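(* Let $\nu$ be a (deterministic) $\sigma$-finite measure on $(0,\infty)$ with $\int_0^\infty(x\wedge1)\nu(dx)<\infty$. For all sequences of initial distributions $\mu_n$ and all sequences $a_n$, $c_n$, $\kappa_n$ and $\theta_n$ with $\kappa_n\in\mathbb N$ and $\kappa_n\le\theta_n\ll a_n$ for which the following five properties hold $\mathbb P$-almost surely, respectively in $\mathbb P$-probability: (i) for all $u>0$, $\lim_{n\to\infty}P_{\mu_n}(Z_{n,1}>u)=0$; (ii) there is a positive decreasing sequence $\rho_n\downarrow0$ such that for all $x,y\in\mathcal V_n$ and all $t\ge0$, $|P_x(Y_n(t+\kappa_n)=y)-\pi_n(y)|\le\rho_n\pi_n(y)$; (iii) for all $t>0$ and all $u>0$, $\nu_n^t(u,\infty)\equiv k_n(t)\sum_{y\in\mathcal V_n}\pi_n(y)Q_n^u(y)\to t\nu(u,\infty)$ as $n\to\infty$; (iv) for all $t>0$ and all $u>0$, $\sigma_n^t(u,\infty)\equiv k_n(t)\sum_{y\in\mathcal V_n}\pi_n(y)[Q_n^u(y)]^2\to0$ as $n\to\infty$; (v) for all $t>0$, $\lim_{\epsilon\downarrow0}\limsup_{n\uparrow\infty}k_n(t)\sum_{y\in\mathcal V_n}\pi_n(y)E_y(Z_{n,1}\mathbf 1_{\{Z_{n,1}\le\epsilon\}})=0$; one has $$S^b_n\Rightarrow_{J_1}S_\nu$$ $\mathbb P$-almost surely, respectively in $\mathbb P$-probability, where $S_\nu$ is the Lévy subordinator with Lévy measure $\nu$ and zero drift, and where convergence holds weakly (for the laws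 of $S_n^b$ under $P_{\mu_n}$) on the space $D([0,\infty))$ equipped with the Skorokhod $J_1$-topology.
   Context: Setting. $G_n(\mathcal V_n,\mathcal E_n)$ is a sequence of finite loop-free graphs. The random environment is a family $(\tau_n(x),x\in\mathcal V_n)$, $n>1$, of possibly dependent positive random variables on a common probability space $(\Omega,\mathcal F,\mathbb P)$. Given the environment, $X_n$ is a Markov jump process on $\mathcal V_n$ with initial distribution $\mu_n$ and jump rates $\lambda_n(x,y)$ with $\lambda_n(x,y)=0$ if $(x,y)\notin\mathcal E_n$ and $\tau_n(x)\lambda_n(x,y)=\tau_n(y)\lambda_n(y,x)$ if $(x,y)\in\mathcal E_n$. The exploration process $Y_n$ is any Markov jump process on $\mathcal V_n$ with initial distribution $\mu_n$ and jump rates $\widetilde\lambda_n(x,y)$ such that $\lambda_n(x,y)/\lambda_n(x)=\widetilde\lambda_n(x,y)/\widetilde\lambda_n(x)$ for all $(x,y)\in\mathcal E_n$, where $\lambda_n(x)=\sum_{y:(x,y)\in\mathcal E_n}\lambda_n(x,y)$ and $\widetilde\lambda_n(x)=\sum_{y:(x,y)\in\mathcal E_n}\widetilde\lambda_n(x,y)$. $P_{\mu_n}$ (resp. $P_y$) is the law of $Y_n$ for a fixed environment, started from $\mu_n$ (resp. from $y$), with expectation $E_{\mu_n}$ (resp. $E_y$). $\pi_n$ denotes the invariant measure of $Y_n$. Blocked clock process. For sequences of positive numbers $a_n,c_n,\theta_n$ ($\theta_n\ll a_n$ means $\theta_n/a_n\to0$) put $k_n(t)=\lfloor a_nt/\theta_n\rfloor$,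 $\ell_n^x(t)=\int_0^t\mathbf 1_{\{Y_n(s)=x\}}ds$, $$Z_{n,i}=c_n^{-1}\sum_{x\in\mathcal V_n}\lambda_n^{-1}(x)\widetilde\lambda_n(x)\,[\ell_n^x(\theta_ni)-\ell_n^x(\theta_n(i-1))],\ i\ge1,\qquad S_n^b(t)=\sum_{i=1}^{k_n(t)}Z_{n,i},$$ and $Q_n^u(y)=P_y(Z_{n,1}>u)$ for $u>0$, $y\in\mathcal V_n$. Convergence modes. Each hypothesis is a property of given sequences $\mu_n,a_n,c_n,\theta_n,\kappa_n$ and a given realization of the environment. A limiting statement as $n\to\infty$ holds $\mathbb P$-almost surely if it holds for $\mathbb P$-almost every realization of the environment; it holds in $\mathbb P$-probability if every subsequence of the integers has a further subsequence along which it holds $\mathbb P$-almost surely. *)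

theory Defs
  imports "HOL-Probability.Probability"
begin

section \<open>Markov jump processes on a finite state space\<close>

definition jump_generator :: "'a set \<Rightarrow> ('a \<Rightarrow> 'a \<Rightarrow> real) \<Rightarrow> 'a \<Rightarrow> 'a \<Rightarrow> real" where
  "jump_generator V r x y = (if x = y then - (\<Sum>z\<in>V - {x}. r x z) else r x y)"

primrec generator_power :: "'a set \<Rightarrow> ('a \<Rightarrow> 'a \<Rightarrow> real) \<Rightarrow> nat \<Rightarrow> 'a \<Rightarrow> 'a \<Rightarrow> real" where
  "generator_power V r 0 x y = of_bool (x = y)"
| "generator_power V r (Suc k) x y = (\<Sum>z\<in>V. jump_generator V r x z * generator_power V r k z y)"

text \<open>The transition function, i.e. the \<open>(x, y)\<close> entry of \<open>exp (t L)\<close> with \<open>L\<close> the generator.\<close>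

definition jump_semigroup :: "'a set \<Rightarrow> ('a \<Rightarrow> 'a \<Rightarrow> real) \<Rightarrow> real \<Rightarrow> 'a \<Rightarrow> 'a \<Rightarrow> real" where
  "jump_semigroup V r t x y = (\<Sum>k. t ^ k / fact k * generator_power V r k x y)"

text \<open>
  \<open>Y\<close> is, under \<open>P\<close>, a Markov jump process on \<open>V\<close> with rates \<open>r\<close> and initial distribution \<open>\<mu>\<close>.
  Only times \<open>t \<ge> 0\<close> matter.  The two filter conditions say that the paths are right-continuous
  with left limits in the discrete topology, so they have finitely many jumps in bounded time.
\<close>

definition markov_jump_process ::
  "'p measure \<Rightarrow> (real \<Rightarrow> 'p \<Rightarrow> 'a) \<Rightarrow> 'a set \<Rightarrow> ('a \<Rightarrow> 'a \<Rightarrow> real) \<Rightarrow> 'a pmf \<Rightarrow> bool" where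
  "markov_jump_process P Y V r \<mu> \<longleftrightarrow>
     prob_space P \<and>
     (\<forall>t\<ge>0. Y t \<in> measurable P (count_space V)) \<and>
     (\<forall>w\<in>space P. \<forall>t\<ge>0. \<forall>\<^sub>F s in at_right t. Y s w = Y t w) \<and>
     (\<forall>w\<in>space P. \<forall>t>0. \<exists>x. \<forall>\<^sub>F s in at_left t. Y s w = x) \<and>
     (\<forall>k (t :: nat \<Rightarrow> real) x.
        t 0 = 0 \<and> (\<forall>i<k. t i \<le> t (Suc i)) \<and> (\<forall>i\<le>k. x i \<in> V) \<longrightarrow>
        measure P {w \<in> space P. \<forall>i\<le>k. Y (t i) w = x i} =
          pmf \<mu> (x 0) * (\<Prod>i<k. jump_semigroup V r (t (Suc i) - t i) (x i) (x (Suc i))))"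

definition invariant_distribution :: "'a set \<Rightarrow> ('a \<Rightarrow> 'a \<Rightarrow> real) \<Rightarrow> 'a pmf \<Rightarrow> bool" where
  "invariant_distribution V r \<pi> \<longleftrightarrow>
     set_pmf \<pi> \<subseteq> V \<and>
     (\<forall>t\<ge>0. \<forall>y\<in>V. (\<Sum>x\<in>V. pmf \<pi> x * jump_semigroup V r t x y) = pmf \<pi> y)"

section \<open>The Skorokhod topology and weak convergence\<close>

text \<open>
  Elements of \<open>D([0,\<infinity>))\<close> are functions on the reals that are \<open>undefined\<close> at negative arguments.
\<close>

definition skorokhod_space :: "(real \<Rightarrow> real) set" where
  "skorokhod_space = {x \<in> extensional {0..}.
     (\<forall>t\<ge>0. continuous (at_right t) x) \<and> (\<forall>t>0. \<exists>l. (x \<longlongrightarrow> l) (at_left t))}"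

definition time_changes :: "(real \<Rightarrow> real) set" where
  "time_changes = {\<phi>. strict_mono_on {0..} \<phi> \<and> continuous_on {0..} \<phi> \<and> bij_betw \<phi> {0..} {0..}}"

definition J1_nbhd :: "(real \<Rightarrow> real) \<Rightarrow> real \<Rightarrow> real \<Rightarrow> (real \<Rightarrow> real) set" where
  "J1_nbhd x m e = {y \<in> skorokhod_space. \<exists>\<phi>\<in>time_changes.
     (\<forall>t\<ge>0. \<bar>\<phi> t - t\<bar> < e) \<and> (\<forall>t\<in>{0..m}. \<bar>y (\<phi> t) - x t\<bar> < e)}"

text \<open>
  The \<open>J\<^sub>1\<close>-topology is the metrizable topology in which \<open>x\<^sub>n\<close> tends to \<open>x\<close> iff there are time
  changes \<open>\<phi>\<^sub>n\<close> such that \<open>\<phi>\<^sub>n(t) - t\<close> tends to 0 uniformly on \<open>[0,\<infinity>)\<close> and \<open>x\<^sub>n(\<phi>\<^sub>n(t)) - x(t)\<close>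
  tends to 0 uniformly on every \<open>[0,m]\<close> (Billingsley, Convergence of Probability Measures,
  Theorem 16.1; Jacod and Shiryaev, Theorem VI.1.14).  Equivalently, \<open>x\<^sub>n\<close> is eventually in
  \<open>J1_nbhd x m e\<close> for all \<open>m\<close> and all \<open>e > 0\<close>; being metrizable, the topology is the following.
\<close>

definition skorokhod_J1 :: "(real \<Rightarrow> real) topology" where
  "skorokhod_J1 = topology (\<lambda>U. U \<subseteq> skorokhod_space \<and>
     (\<forall>x\<in>U. \<exists>m e. 0 < e \<and> J1_nbhd x m e \<subseteq> U))"

lemma J1_nbhd_mono: "m' \<le> m \<Longrightarrow> e \<le> e' \<Longrightarrow> J1_nbhd x m e \<subseteq> J1_nbhd x m' e'"
  unfolding J1_nbhd_def by (auto intro!: bexI elim: order_less_le_trans)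

lemma openin_skorokhod_J1:
  "openin skorokhod_J1 U \<longleftrightarrow>
     U \<subseteq> skorokhod_space \<and> (\<forall>x\<in>U. \<exists>m e. 0 < e \<and> J1_nbhd x m e \<subseteq> U)"
proof -
  let ?P = "\<lambda>U. U \<subseteq> skorokhod_space \<and> (\<forall>x\<in>U. \<exists>m e. 0 < e \<and> J1_nbhd x m e \<subseteq> U)"
  have "?P (S \<inter> T)" if ST: "?P S" "?P T" for S T
  proof (intro conjI ballI)
    show "S \<inter> T \<subseteq> skorokhod_space" using that by blast
    fix x assume "x \<in> S \<inter> T"
    then obtain m e m' e' where *: "0 < e" "J1_nbhd x m e \<subseteq> S" "0 < e'" "J1_nbhd x m' e' \<subseteq> T"
      using ST by (metis IntE)
    have "J1_nbhd x (max m m') (min e e') \<subseteq> S \<inter> T"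
      using J1_nbhd_mono[of m "max m m'" "min e e'" e x]
        J1_nbhd_mono[of m' "max m m'" "min e e'" e' x] *
      by auto
    then show "\<exists>m e. 0 < e \<and> J1_nbhd x m e \<subseteq> S \<inter> T"
      using * by (metis min_less_iff_conj)
  qed
  moreover have "?P (\<Union>K)" if "\<forall>S\<in>K. ?P S" for K
  proof (intro conjI ballI)
    show "\<Union>K \<subseteq> skorokhod_space" using that by blast
    fix x assume "x \<in> \<Union>K"
    then obtain S where "S \<in> K" "x \<in> S" by blast
    then show "\<exists>m e. 0 < e \<and> J1_nbhd x m e \<subseteq> \<Union>K" using that by (meson Sup_upper order_trans)
  qed
  ultimately have "istopology ?P" unfolding istopology_def by blast
  then show ?thesis by (simp add: skorokhod_J1_def topology_inverse')
qed

lemma topspace_skorokhod_J1: "topspace skorokhod_J1 = skorokhod_space"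
proof -
  have "openin skorokhod_J1 skorokhod_space"
    unfolding openin_skorokhod_J1 J1_nbhd_def using zero_less_one by blast
  then show ?thesis
    by (metis openin_skorokhod_J1 openin_subset openin_topspace subset_antisym)
qed

text \<open>
  Convergence in law of random elements \<open>X n\<close> (on \<open>P n\<close>) to \<open>Z\<close> (on \<open>N\<close>).  Measurability is
  required explicitly, since the integral of a non-measurable function is 0 by convention.
\<close>

definition weak_conv_in ::
  "'x topology \<Rightarrow> (nat \<Rightarrow> 'p measure) \<Rightarrow> (nat \<Rightarrow> 'p \<Rightarrow> 'x) \<Rightarrow> 'q measure \<Rightarrow> ('q \<Rightarrow> 'x) \<Rightarrow> bool" where
  "weak_conv_in T P X N Z \<longleftrightarrow>
     (\<forall>n. \<forall>w\<in>space (P n). X n w \<in> topspace T) \<and> (\<forall>w\<in>space N. Z w \<in> topspace T) \<and>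
     (\<forall>f. continuous_map T euclideanreal f \<and> bounded (f ` topspace T) \<longrightarrow>
        (\<forall>n. (\<lambda>w. f (X n w)) \<in> borel_measurable (P n)) \<and>
        (\<lambda>w. f (Z w)) \<in> borel_measurable N \<and>
        (\<lambda>n. \<integral>w. f (X n w) \<partial>P n) \<longlonglongrightarrow> (\<integral>w. f (Z w) \<partial>N))"

section \<open>Subordinators\<close>

text \<open>
  \<open>S\<close> is a subordinator on \<open>N\<close> with Levy measure \<open>\<nu>\<close> and zero drift: the Laplace exponent
  of \<open>S t\<close> has no linear term.
\<close>

definition levy_subordinator :: "'q measure \<Rightarrow> (real \<Rightarrow> 'q \<Rightarrow> real) \<Rightarrow> real measure \<Rightarrow> bool" where
  "levy_subordinator N S \<nu> \<longleftrightarrow>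
     prob_space N \<and>
     (\<forall>t\<ge>0. S t \<in> borel_measurable N) \<and>
     (\<forall>w\<in>space N. S 0 w = 0 \<and> mono_on {0..} (\<lambda>t. S t w) \<and>
        (\<forall>t\<ge>0. continuous (at_right t) (\<lambda>s. S s w))) \<and>
     (\<forall>k (t :: nat \<Rightarrow> real). 0 \<le> t 0 \<and> (\<forall>i<k. t i \<le> t (Suc i)) \<longrightarrow>
        prob_space.indep_vars N (\<lambda>_. borel) (\<lambda>i w. S (t (Suc i)) w - S (t i) w) {..<k}) \<and>
     (\<forall>s t. 0 \<le> s \<and> s \<le> t \<longrightarrow>
        distr N borel (\<lambda>w. S t w - S s w) = distr N borel (S (t - s))) \<and>
     (\<forall>t\<ge>0. \<forall>q\<ge>0.
        (\<integral>w. exp (- q * S t w) \<partial>N) = exp (- t * (\<integral>x. (1 - exp (- q * x)) \<partial>\<nu>)))"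

section \<open>The blocked clock process\<close>

text \<open>
  All data for one index \<open>n\<close> and one realization of the environment: \<open>rate\<close> and \<open>expl_rate\<close> are
  the jump rates of the original and of the exploration process, \<open>expl\<close> is the exploration process,
  and \<open>law \<mu>\<close> is the probability measure under which it has initial distribution \<open>\<mu>\<close>.
\<close>

record ('a, 'p) clock_model =
  verts :: "'a set"
  edges :: "('a \<times> 'a) set"
  rate :: "'a \<Rightarrow> 'a \<Rightarrow> real"
  expl_rate :: "'a \<Rightarrow> 'a \<Rightarrow> real"
  expl :: "real \<Rightarrow> 'p \<Rightarrow> 'a"
  law :: "'a pmf \<Rightarrow> 'p measure"
  init :: "'a pmf"
  invar :: "'a pmf"
  tscale :: real
  cscale :: real
  blocklen :: real
  mixtime :: nat

definition exit_rate :: "('a \<times> 'a) set \<Rightarrow> ('a \<Rightarrow> 'a \<Rightarrow> real) \<Rightarrow> 'a \<Rightarrow> real" where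
  "exit_rate E r x = (\<Sum>y | (x, y) \<in> E. r x y)"

definition local_time :: "(real \<Rightarrow> 'p \<Rightarrow> 'a) \<Rightarrow> 'a \<Rightarrow> real \<Rightarrow> 'p \<Rightarrow> real" where
  "local_time Y x t w = (LINT s:{0..t}|lborel. indicator {s. Y s w = x} s)"

definition block :: "('a, 'p) clock_model \<Rightarrow> nat \<Rightarrow> 'p \<Rightarrow> real" where
  "block X i w = inverse (cscale X) *
     (\<Sum>x\<in>verts X.
        inverse (exit_rate (edges X) (rate X) x) * exit_rate (edges X) (expl_rate X) x *
        (local_time (expl X) x (blocklen X * real i) w
         - local_time (expl X) x (blocklen X * (real i - 1)) w))"

definition nblocks :: "('a, 'p) clock_model \<Rightarrow> real \<Rightarrow> nat" where
  "nblocks X t = nat \<lfloor>tscale X * t / blocklen X\<rfloor>"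

definition blocked_clock :: "('a, 'p) clock_model \<Rightarrow> 'p \<Rightarrow> real \<Rightarrow> real" where
  "blocked_clock X w = restrict (\<lambda>t. \<Sum>i=1..nblocks X t. block X i w) {0..}"

abbreviation law_from :: "('a, 'p) clock_model \<Rightarrow> 'a \<Rightarrow> 'p measure" where
  "law_from X y \<equiv> law X (return_pmf y)"

definition block_tail :: "('a, 'p) clock_model \<Rightarrow> real \<Rightarrow> 'a \<Rightarrow> real" where
  "block_tail X u y = measure (law_from X y) {w \<in> space (law_from X y). block X 1 w > u}"

section \<open>Hypotheses on a sequence of models\<close>

definition initial_block_negligible :: "(nat \<Rightarrow> ('a, 'p) clock_model) \<Rightarrow> bool" where
  "initial_block_negligible X \<longleftrightarrow>
     (\<forall>u>0. (\<lambda>n. measure (law (X n) (init (X n)))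
        {w \<in> space (law (X n) (init (X n))). block (X n) 1 w > u}) \<longlonglongrightarrow> 0)"

definition rapidly_mixing :: "(nat \<Rightarrow> ('a, 'p) clock_model) \<Rightarrow> bool" where
  "rapidly_mixing X \<longleftrightarrow>
     (\<exists>\<rho> :: nat \<Rightarrow> real. (\<forall>n. 0 < \<rho> n) \<and> decseq \<rho> \<and> \<rho> \<longlonglongrightarrow> 0 \<and>
        (\<forall>n. \<forall>x\<in>verts (X n). \<forall>y\<in>verts (X n). \<forall>t\<ge>0.
           \<bar>measure (law_from (X n) x)
               {w \<in> space (law_from (X n) x). expl (X n) (t + real (mixtime (X n))) w = y}
             - pmf (invar (X n)) y\<bar> \<le> \<rho> n * pmf (invar (X n)) y))"

definition tails_converge :: "real measure \<Rightarrow> (nat \<Rightarrow> ('a, 'p) clock_model) \<Rightarrow> bool" where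
  "tails_converge \<nu> X \<longleftrightarrow>
     (\<forall>t>0. \<forall>u>0. (\<lambda>n. real (nblocks (X n) t) *
        (\<Sum>y\<in>verts (X n). pmf (invar (X n)) y * block_tail (X n) u y))
        \<longlonglongrightarrow> t * measure \<nu> {u<..})"

definition squared_tails_vanish :: "(nat \<Rightarrow> ('a, 'p) clock_model) \<Rightarrow> bool" where
  "squared_tails_vanish X \<longleftrightarrow>
     (\<forall>t>0. \<forall>u>0. (\<lambda>n. real (nblocks (X n) t) *
        (\<Sum>y\<in>verts (X n). pmf (invar (X n)) y * (block_tail (X n) u y)\<^sup>2)) \<longlonglongrightarrow> 0)"

definition small_blocks_negligible :: "(nat \<Rightarrow> ('a, 'p) clock_model) \<Rightarrow> bool" where
  "small_blocks_negligible X \<longleftrightarrow>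
     (\<forall>t>0. ((\<lambda>\<epsilon>. limsup (\<lambda>n. ereal (real (nblocks (X n) t) *
        (\<Sum>y\<in>verts (X n). pmf (invar (X n)) y *
           (\<integral>w. block (X n) 1 w * indicator {w. block (X n) 1 w \<le> \<epsilon>} w \<partial>law_from (X n) y)))))
        \<longlongrightarrow> 0) (at_right 0))"

definition blocked_clocks_converge ::
  "'q measure \<Rightarrow> (real \<Rightarrow> 'q \<Rightarrow> real) \<Rightarrow> (nat \<Rightarrow> ('a, 'p) clock_model) \<Rightarrow> bool" where
  "blocked_clocks_converge N S X \<longleftrightarrow>
     weak_conv_in skorokhod_J1 (\<lambda>n. law (X n) (init (X n))) (\<lambda>n. blocked_clock (X n))
       N (\<lambda>w. restrict (\<lambda>t. S t w) {0..})"

section \<open>Modes of convergence in the random environment\<close>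

definition holds_almost_surely ::
  "'w measure \<Rightarrow> (nat \<Rightarrow> 'w \<Rightarrow> 'm) \<Rightarrow> ((nat \<Rightarrow> 'm) \<Rightarrow> bool) \<Rightarrow> bool" where
  "holds_almost_surely M X H \<longleftrightarrow> (AE \<omega> in M. H (\<lambda>n. X n \<omega>))"

definition holds_in_probability ::
  "'w measure \<Rightarrow> (nat \<Rightarrow> 'w \<Rightarrow> 'm) \<Rightarrow> ((nat \<Rightarrow> 'm) \<Rightarrow> bool) \<Rightarrow> bool" where
  "holds_in_probability M X H \<longleftrightarrow>
     (\<forall>s :: nat \<Rightarrow> nat. strict_mono s \<longrightarrow>
        (\<exists>r :: nat \<Rightarrow> nat. strict_mono r \<and> (AE \<omega> in M. H (\<lambda>n. X (s (r n)) \<omega>))))"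

end

theory Submission
  imports Defs "HOL-Probability.Probability"
begin

text \<open>
  At the block times the chain
  forgets its state up to a factor \<open>1 \<plusminus> \<rho>\<^sub>n\<close> within one block, so conditionally on the past
  up to the last block but one, a block has nearly the law obtained by starting from \<open>\<pi>\<^sub>n\<close>.  The
  dependence on the last block costs a term \<open>E[(1 - exp (- q Z\<^sub>i)) G(\<xi>\<^sub>i)]\<close> with
  \<open>G y = E\<^sub>y[1 - exp (- q Z\<^sub>1)]\<close>, which Young's inequality bounds by \<open>\<eta> E[1 - exp (- q Z\<^sub>i)]\<close>
  plus a multiple of \<open>\<pi>\<^sub>n(G\<^sup>2)\<close>; the sum of the latter vanishes by (iv) and (v).  Replacing the
  blocks one after another shows that the joint Laplace transforms of the increments of \<open>S\<^sub>n\<^sup>b\<close>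
  converge to those of \<open>S\<^sub>\<nu>\<close>.

  The paths are increasing, so the \<open>J\<^sub>1\<close>-distance to the path sampled on a grid of mesh \<open>\<delta>\<close> is small
  as soon as every cell of the grid contains at most one large jump; two large blocks in one cell
  have small probability by the same decorrelation.  A bounded \<open>J\<^sub>1\<close>-continuous functional \<open>f\<close> is
  an increasing limit of functionals that are Lipschitz for this distance, and a Lipschitz functional
  of the sampled path is a continuous function of finitely many increments, to which the
  Stone-Weierstrass theorem transfers the convergence of Laplace transforms.  Applying the resulting
  lower bound on \<open>liminf E f(S\<^sub>n\<^sup>b)\<close> to \<open>f\<close> and \<open>- f\<close> gives weak convergence.
\<close>

section \<open>The Skorokhod topology on increasing paths\<close>

text \<open>Mixing acts only across a whole block, and nothing separates a block from the one before
  it. Errors are summed over about \<open>1 / \<gamma>\<close> blocks, where \<open>\<gamma>\<close>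
  is the equilibrium mean of \<open>G\<close>, so each must be small relative to
  \<open>\<gamma>\<close>. Hence the use of mixing bounds relative to the equilibrium weights, and
  of Young's inequality with a free \<open>\<eta>\<close>: its linear terms add up to
  \<open>\<eta>\<close> times a bounded quantity, and \<open>\<eta>\<close> is fixed before
  \<open>n\<close> grows. The process is given through its finite-dimensional laws, but a block is a
  time integral; so the Markov property is proved on grids that refine the blocks and carried over
  by dominated convergence, first for continuous functions of the blocks, then for limits of these
  such as the indicators in (iii) and (iv). (iii) concerns tails, the transforms concern
  \<open>1 - exp (- q * z)\<close>; a staircase of levels links the two. No tightness is proved.
  Regularization and truncation approximate from below, so their errors matter for the limit law
  only; sampling on the grid is the one approximation that needs an estimate along the
  sequence.\<close>

lemma time_changes_bounds:
  assumes "\<phi> \<in> time_changes" "0 \<le> t"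
  shows "0 \<le> \<phi> t"
  using assms by (auto simp: time_changes_def bij_betw_def)

lemma id_time_change: "(\<lambda>t. t) \<in> time_changes"
  unfolding time_changes_def
  by (auto simp: strict_mono_on_def bij_betw_def inj_on_def continuous_on_id)

lemma compose_time_changes:
  assumes "\<phi> \<in> time_changes" "\<psi> \<in> time_changes"
  shows "(\<lambda>t. \<psi> (\<phi> t)) \<in> time_changes"
proof -
  have *: "\<phi> ` {0..} = {0..}" "\<psi> ` {0..} = {0..}"
    using assms by (auto simp: time_changes_def bij_betw_def)
  have "bij_betw (\<psi> \<circ> \<phi>) {0..} {0..}"
    using assms by (intro bij_betw_trans[of _ _ "{0..}"]) (auto simp: time_changes_def)
  moreover have "continuous_on {0..} (\<lambda>t. \<psi> (\<phi> t))"
    using assms *(1) by (intro continuous_on_compose2[of "{0..}" \<psi> "{0..}" \<phi>]) (simp_all add: time_changes_def)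
  moreover have "strict_mono_on {0..} (\<lambda>t. \<psi> (\<phi> t))"
  proof (rule strict_mono_onI)
    fix r s :: real assume rs: "r \<in> {0..}" "s \<in> {0..}" "r < s"
    then have "\<phi> r < \<phi> s"
      using assms(1) by (intro strict_mono_onD[of "{0..}" \<phi>]) (auto simp: time_changes_def)
    then show "\<psi> (\<phi> r) < \<psi> (\<phi> s)"
      using assms(2) rs time_changes_bounds[OF assms(1)]
      by (intro strict_mono_onD[of "{0..}" \<psi>]) (auto simp: time_changes_def)
  qed
  ultimately show ?thesis by (simp add: time_changes_def comp_def)
qed

text \<open>A continuous injection of an interval is a homeomorphism onto its image; this supplies
  the continuity of the inverse.\<close>

lemma inverse_time_change:
  assumes "\<phi> \<in> time_changes"
  obtains \<psi> where "\<psi> \<in> time_changes" "\<And>t. 0 \<le> t \<Longrightarrow> \<phi> (\<psi> t) = t" "\<And>t. 0 \<le> t \<Longrightarrow> \<psi> (\<phi> t) = t"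
proof -
  have *: "strict_mono_on {0..} \<phi>" "continuous_on {0..} \<phi>" "inj_on \<phi> {0..}" "\<phi> ` {0..} = {0..}"
    using assms by (auto simp: time_changes_def bij_betw_def)
  have "path_connected {0::real..}"
    by (simp add: convex_imp_path_connected)
  from homeomorphism_into_1d[OF this *(2) *(4) *(3)]
  obtain \<psi> where h: "homeomorphism {0..} {0..} \<phi> \<psi>" by auto
  have "strict_mono_on {0..} \<psi>"
  proof (rule strict_mono_onI)
    fix r s :: real assume rs: "r \<in> {0..}" "s \<in> {0..}" "r < s"
    have "\<psi> r \<in> {0..}" "\<psi> s \<in> {0..}" "\<phi> (\<psi> r) = r" "\<phi> (\<psi> s) = s"
      using h rs by (auto simp: homeomorphism_def)
    then show "\<psi> r < \<psi> s"
      using *(1) rs by (metis leI order_less_le strict_mono_on_leD not_less)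
  qed
  moreover have "bij_betw \<psi> {0..} {0..}"
    using h by (intro bij_betwI[where g = \<phi>]) (auto simp: homeomorphism_def)
  ultimately have "\<psi> \<in> time_changes" using h by (simp add: time_changes_def homeomorphism_def)
  then show ?thesis using h by (intro that[of \<psi>]) (auto simp: homeomorphism_def)
qed

text \<open>
  \<open>J1_close r x y\<close> bounds by \<open>r\<close> the infimum, over time changes, of the uniform distance between the
  images of the two graphs in space-time under \<open>(t, a) \<mapsto> (t, exp (- t - a))\<close>.  Being built from a metric
  on space-time it satisfies the triangle inequality, and it hardly sees late times.
\<close>

definition J1_close :: "real \<Rightarrow> (real \<Rightarrow> real) \<Rightarrow> (real \<Rightarrow> real) \<Rightarrow> bool" where
  "J1_close r x y \<longleftrightarrow> (\<exists>\<phi>\<in>time_changes. \<forall>t\<ge>0.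
     \<bar>\<phi> t - t\<bar> \<le> r \<and> \<bar>exp (- t - x t) - exp (- \<phi> t - y (\<phi> t))\<bar> \<le> r)"

lemma J1_close_refl: "0 \<le> r \<Longrightarrow> J1_close r x x"
  unfolding J1_close_def using id_time_change by (intro bexI[of _ "\<lambda>t. t"]) auto

lemma J1_close_mono: "J1_close r x y \<Longrightarrow> r \<le> s \<Longrightarrow> J1_close s x y"
  unfolding J1_close_def by (meson order_trans)

text \<open>Substitution of the inverse time change. This works because the closeness condition
  ranges over all \<open>t \<ge> 0\<close>; a condition on \<open>{0..m}\<close>, as in
  \<open>J1_nbhd\<close>, would not be symmetric.\<close>

lemma J1_close_sym:
  assumes "J1_close r x y" shows "J1_close r y x"
proof -
  obtain \<phi> where \<phi>: "\<phi> \<in> time_changes"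
    "\<And>t. 0 \<le> t \<Longrightarrow> \<bar>\<phi> t - t\<bar> \<le> r \<and> \<bar>exp (- t - x t) - exp (- \<phi> t - y (\<phi> t))\<bar> \<le> r"
    using assms unfolding J1_close_def by blast
  obtain \<psi> where \<psi>: "\<psi> \<in> time_changes" "\<And>t. 0 \<le> t \<Longrightarrow> \<phi> (\<psi> t) = t"
    using inverse_time_change[OF \<phi>(1)] by metis
  show ?thesis unfolding J1_close_def
  proof (intro bexI[of _ \<psi>] allI impI \<psi>(1))
    fix t :: real assume t: "0 \<le> t"
    show "\<bar>\<psi> t - t\<bar> \<le> r \<and> \<bar>exp (- t - y t) - exp (- \<psi> t - x (\<psi> t))\<bar> \<le> r"
      using \<phi>(2)[of "\<psi> t"] \<psi>(2)[OF t] time_changes_bounds[OF \<psi>(1) t]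
      by (simp add: abs_minus_commute)
  qed
qed

lemma J1_close_trans:
  assumes "J1_close r x y" "J1_close s y z" shows "J1_close (r + s) x z"
proof -
  obtain \<phi> where \<phi>: "\<phi> \<in> time_changes"
    "\<And>t. 0 \<le> t \<Longrightarrow> \<bar>\<phi> t - t\<bar> \<le> r \<and> \<bar>exp (- t - x t) - exp (- \<phi> t - y (\<phi> t))\<bar> \<le> r"
    using assms unfolding J1_close_def by blast
  obtain \<psi> where \<psi>: "\<psi> \<in> time_changes"
    "\<And>t. 0 \<le> t \<Longrightarrow> \<bar>\<psi> t - t\<bar> \<le> s \<and> \<bar>exp (- t - y t) - exp (- \<psi> t - z (\<psi> t))\<bar> \<le> s"
    using assms unfolding J1_close_def by blast
  show ?thesis unfolding J1_close_def
  proof (rule bexI[OF _ compose_time_changes[OF \<phi>(1) \<psi>(1)]], intro allI impI)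
    fix t :: real assume t: "0 \<le> t"
    show "\<bar>\<psi> (\<phi> t) - t\<bar> \<le> r + s \<and> \<bar>exp (- t - x t) - exp (- \<psi> (\<phi> t) - z (\<psi> (\<phi> t)))\<bar> \<le> r + s"
    proof -
      have *: "\<bar>b - a\<bar> \<le> r \<Longrightarrow> \<bar>c - b\<bar> \<le> s \<Longrightarrow> \<bar>c - a\<bar> \<le> r + s"
        "\<bar>a - b\<bar> \<le> r \<Longrightarrow> \<bar>b - c\<bar> \<le> s \<Longrightarrow> \<bar>a - c\<bar> \<le> r + s" for a b c :: real
        by linarith+
      show ?thesis
        using \<phi>(2)[OF t] \<psi>(2)[OF time_changes_bounds[OF \<phi>(1) t]] by (blast intro: *)
    qed
  qed
qed

text \<open>Where the exponential is at least \<open>c\<close> its slope is too, so it expands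
  distances by the factor \<open>c\<close> there: closeness of transformed values can be undone as
  long as they stay away from 0.\<close>

lemma abs_diff_le_exp_diff:
  fixes p q c :: real
  assumes "c \<le> exp p" "c \<le> exp q" "0 < c"
  shows "\<bar>p - q\<bar> \<le> \<bar>exp p - exp q\<bar> / c"
proof -
  have *: "p - q \<le> (exp p - exp q) / c" if "q \<le> p" "c \<le> exp q" "0 < c" for p q :: real
  proof -
    have "c * (p - q) \<le> exp q * (p - q)" using that by (intro mult_right_mono) auto
    also have "\<dots> \<le> exp q * (exp (p - q) - 1)"
      using exp_ge_add_one_self[of "p - q"] by (intro mult_left_mono) (simp_all del: exp_ge_add_one_self)
    also have "\<dots> = exp p - exp q" by (simp add: algebra_simps flip: exp_add)
    finally show ?thesis using that by (simp add: field_simps)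
  qed
  show ?thesis
  proof (cases "q \<le> p")
    case True then show ?thesis using *[of q p] assms by simp
  next
    case False then show ?thesis using *[of p q] assms by (simp add: abs_if)
  qed
qed

text \<open>The slope of exp is at most 1 on the nonpositive half-line, where all exponents
  \<open>- t - x t\<close> of nonnegative paths lie.\<close>

lemma abs_exp_diff_le:
  fixes p q :: real
  assumes "p \<le> 0" "q \<le> 0"
  shows "\<bar>exp p - exp q\<bar> \<le> \<bar>p - q\<bar>"
proof -
  have *: "exp p - exp q \<le> p - q" if "q \<le> p" "p \<le> 0" for p q :: real
  proof -
    have "exp p - exp q = exp p * (1 - exp (q - p))" by (simp add: algebra_simps flip: exp_add)
    also have "\<dots> \<le> 1 * (1 - exp (q - p))" using that by (intro mult_right_mono) auto
    also have "\<dots> \<le> p - q" using exp_ge_add_one_self[of "q - p"] by (simp del: exp_ge_add_one_self)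
    finally show ?thesis .
  qed
  show ?thesis
  proof (cases "q \<le> p")
    case True then show ?thesis using *[of q p] assms by simp
  next
    case False then show ?thesis using *[of p q] assms by (simp add: abs_if)
  qed
qed

text \<open>The common class of the paths of the blocked clock and of the subordinator. Left limits
  come from monotonicity; the support condition is the convention of
  \<open>skorokhod_space\<close>.\<close>

definition increasing_path :: "(real \<Rightarrow> real) \<Rightarrow> bool" where
  "increasing_path x \<longleftrightarrow> x \<in> extensional {0..} \<and> x 0 = 0 \<and> mono_on {0..} x \<and>
     (\<forall>t\<ge>0. continuous (at_right t) x)"

lemma increasing_path_mono: "increasing_path x \<Longrightarrow> 0 \<le> s \<Longrightarrow> s \<le> t \<Longrightarrow> x s \<le> x t"
  by (auto simp: increasing_path_def mono_on_def)

lemma increasing_path_nonneg: "increasing_path x \<Longrightarrow> 0 \<le> t \<Longrightarrow> 0 \<le> x t"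
  using increasing_path_mono[of x 0 t] by (auto simp: increasing_path_def)

lemma increasing_path_left_limit:
  assumes x: "increasing_path x" and t: "0 < t"
  shows "(x \<longlongrightarrow> Sup (x ` {0..<t})) (at_left t)"
proof (rule order_tendstoI)
  have bdd: "bdd_above (x ` {0..<t})"
    using increasing_path_mono[OF x, of _ t] by (intro bdd_aboveI[of _ "x t"]) auto
  { fix a assume "a < Sup (x ` {0..<t})"
    then obtain s where s: "0 \<le> s" "s < t" "a < x s"
      using t by (subst (asm) less_cSup_iff[OF _ bdd]) auto
    have "\<forall>\<^sub>F u in at_left t. u \<in> {s<..<t}" using s eventually_at_left_real by blast
    then show "\<forall>\<^sub>F u in at_left t. a < x u"
    proof eventually_elim
      case (elim u)
      then show ?case using s increasing_path_mono[OF x, of s u] by simp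
    qed }
  { fix a assume a: "a > Sup (x ` {0..<t})"
    have "\<forall>\<^sub>F u in at_left t. u \<in> {0<..<t}" using t eventually_at_left_real by blast
    then show "\<forall>\<^sub>F u in at_left t. x u < a"
    proof eventually_elim
      case (elim u)
      then have "x u \<le> Sup (x ` {0..<t})" using bdd by (intro cSup_upper) auto
      then show ?case using a by simp
    qed }
qed

lemma increasing_path_skorokhod: "increasing_path x \<Longrightarrow> x \<in> skorokhod_space"
  using increasing_path_left_limit unfolding skorokhod_space_def increasing_path_def by blast

text \<open>On the window up to \<open>m\<close> the increasing path is at most \<open>x M\<close>,
  so its transformed values are at least \<open>c\<close> and the transformation can be inverted
  there with a loss proportional to \<open>1 / c\<close>.\<close>

lemma J1_close_imp_nbhd:
  assumes x: "increasing_path x" and e: "0 < e"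
  obtains r where "0 < r" "\<And>y. y \<in> skorokhod_space \<Longrightarrow> J1_close r x y \<Longrightarrow> y \<in> J1_nbhd x m e"
proof -
  define M where "M = max m 0"
  define c where "c = exp (- M - x M)"
  \<comment> \<open>\<open>r \<le> c / 2\<close> keeps the second transformed value above
    \<open>c / 2\<close>. Inverting the exponential then costs \<open>2 * r / c\<close>, and the
    time shift at most \<open>r \<le> r / c\<close>; together \<open>3 * r / c < e\<close>.\<close>
  define r where "r = min (c / 2) (e * c / 4)"
  have c: "0 < c" "c \<le> 1"
    using increasing_path_nonneg[OF x, of M] by (auto simp: c_def M_def)
  have r: "0 < r" using c e by (simp add: r_def)
  have r3: "3 * r / c < e" using c e by (simp add: r_def field_simps min_def)
  have "r \<le> r / c" using c r by (simp add: field_simps)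
  moreover have "0 < r / c" using r c by simp
  ultimately have "r < e" using r3 by simp
  have "y \<in> J1_nbhd x m e" if y: "y \<in> skorokhod_space" "J1_close r x y" for y
  proof -
    obtain \<phi> where \<phi>: "\<phi> \<in> time_changes"
      "\<And>t. 0 \<le> t \<Longrightarrow> \<bar>\<phi> t - t\<bar> \<le> r \<and> \<bar>exp (- t - x t) - exp (- \<phi> t - y (\<phi> t))\<bar> \<le> r"
      using y(2) unfolding J1_close_def by blast
    have "\<bar>y (\<phi> t) - x t\<bar> < e" if t: "t \<in> {0..m}" for t
    proof -
      have "x t \<le> x M" using increasing_path_mono[OF x, of t M] t by (auto simp: M_def)
      then have 1: "c \<le> exp (- t - x t)" using t by (auto simp: c_def M_def)
      have 2: "\<bar>\<phi> t - t\<bar> \<le> r" "\<bar>exp (- t - x t) - exp (- \<phi> t - y (\<phi> t))\<bar> \<le> r"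
        using \<phi>(2)[of t] t by auto
      have "r \<le> c / 2" by (simp add: r_def)
      then have 3: "c / 2 \<le> exp (- \<phi> t - y (\<phi> t))" using 1 2 by linarith
      have "\<bar>(- t - x t) - (- \<phi> t - y (\<phi> t))\<bar> \<le> \<bar>exp (- t - x t) - exp (- \<phi> t - y (\<phi> t))\<bar> / (c / 2)"
        using 1 3 c by (intro abs_diff_le_exp_diff) auto
      also have "\<dots> \<le> r / (c / 2)" using 2 c by (intro divide_right_mono) auto
      finally have "\<bar>(- t - x t) - (- \<phi> t - y (\<phi> t))\<bar> \<le> 2 * (r / c)" by (simp add: mult.commute)
      then have "\<bar>y (\<phi> t) - x t\<bar> \<le> 3 * (r / c)" using 2 \<open>r \<le> r / c\<close> by linarith
      then show ?thesis using r3 by simp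
    qed
    moreover have "\<forall>t\<ge>0. \<bar>\<phi> t - t\<bar> < e" using \<phi>(2) \<open>r < e\<close> by fastforce
    ultimately show ?thesis unfolding J1_nbhd_def using \<phi>(1) y(1) by blast
  qed
  then show ?thesis using that r by blast
qed

text \<open>Translates the neighbourhood description of open sets into an epsilon condition for
  \<open>J1_close\<close>. Continuity of functionals is exploited below only in this form and only
  at increasing paths.\<close>

lemma J1_continuous_at_increasing_path:
  assumes f: "continuous_map skorokhod_J1 euclideanreal f" and x: "increasing_path x" and e: "0 < e"
  obtains r where "0 < r" "\<And>y. y \<in> skorokhod_space \<Longrightarrow> J1_close r x y \<Longrightarrow> \<bar>f y - f x\<bar> < e"
proof -
  let ?U = "{y \<in> topspace skorokhod_J1. f y \<in> ball (f x) e}"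
  have "openin skorokhod_J1 ?U"
    using f by (auto simp: continuous_map_def)
  moreover have "x \<in> ?U"
    using increasing_path_skorokhod[OF x] e by (simp add: topspace_skorokhod_J1)
  ultimately obtain m d where md: "0 < d" "J1_nbhd x m d \<subseteq> ?U"
    unfolding openin_skorokhod_J1 by blast
  obtain r where r: "0 < r" "\<And>y. y \<in> skorokhod_space \<Longrightarrow> J1_close r x y \<Longrightarrow> y \<in> J1_nbhd x m d"
    using J1_close_imp_nbhd[OF x md(1)] by blast
  show ?thesis
    by (rule that[OF r(1)]) (use r(2) md(2) in \<open>force simp: dist_real_def abs_minus_commute\<close>)
qed

text \<open>The inf-convolution (Pasch-Hausdorff envelope) of \<open>f\<close> with \<open>k\<close>
  times the distance: the largest minorant of \<open>f\<close> that is Lipschitz with constant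
  \<open>k\<close>. The infimum runs over pairs of a path and an admissible bound, since
  \<open>J1_close\<close> is a relation and no distance function is introduced.\<close>

definition J1_regularization :: "((real \<Rightarrow> real) \<Rightarrow> real) \<Rightarrow> real \<Rightarrow> (real \<Rightarrow> real) \<Rightarrow> real" where
  "J1_regularization f k x = Inf {f y + k * r | y r. y \<in> skorokhod_space \<and> 0 \<le> r \<and> J1_close r x y}"

context
  fixes f :: "(real \<Rightarrow> real) \<Rightarrow> real" and k :: real
  assumes f_nonneg: "\<And>y. y \<in> skorokhod_space \<Longrightarrow> 0 \<le> f y" and k_nonneg: "0 \<le> k"
begin

lemma J1_regularization_bdd:
  "bdd_below {f y + k * r | y r. y \<in> skorokhod_space \<and> 0 \<le> r \<and> J1_close r x y}"
  using f_nonneg k_nonneg by (intro bdd_belowI[of _ 0]) auto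

lemma J1_regularization_le: "x \<in> skorokhod_space \<Longrightarrow> J1_regularization f k x \<le> f x"
  unfolding J1_regularization_def
  using J1_close_refl[of 0 x] by (intro cInf_lower J1_regularization_bdd) force

lemma J1_regularization_nonneg: "x \<in> skorokhod_space \<Longrightarrow> 0 \<le> J1_regularization f k x"
  unfolding J1_regularization_def
  using J1_close_refl[of 0 x] f_nonneg k_nonneg by (intro cInf_greatest) auto

text \<open>Triangle inequality: a competitor at distance \<open>r\<close> from \<open>x'\<close> is
  one at distance \<open>s + r\<close> from \<open>x\<close>.\<close>

lemma J1_regularization_lipschitz:
  assumes "x' \<in> skorokhod_space" "0 \<le> s" "J1_close s x x'"
  shows "J1_regularization f k x \<le> J1_regularization f k x' + k * s"
proof -
  have "J1_regularization f k x - k * s \<le> J1_regularization f k x'"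
    unfolding J1_regularization_def[of f k x']
  proof (rule cInf_greatest)
    show "{f y + k * r | y r. y \<in> skorokhod_space \<and> 0 \<le> r \<and> J1_close r x' y} \<noteq> {}"
      using assms J1_close_refl[of 0 x'] by force
    fix z assume "z \<in> {f y + k * r | y r. y \<in> skorokhod_space \<and> 0 \<le> r \<and> J1_close r x' y}"
    then obtain y r where z: "z = f y + k * r" "y \<in> skorokhod_space" "0 \<le> r" "J1_close r x' y"
      by blast
    have "J1_regularization f k x \<le> f y + k * (s + r)"
      unfolding J1_regularization_def using z assms J1_close_trans[OF assms(3) z(4)]
      by (intro cInf_lower J1_regularization_bdd) force
    then show "J1_regularization f k x - k * s \<le> z" using z by (simp add: algebra_simps)
  qed
  then show ?thesis by simp
qed

end

text \<open>Competitors within \<open>r\<close> of \<open>x\<close> have values near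
  \<open>f x\<close> by continuity. For the others the penalty alone is at least \<open>f x\<close>
  as soon as \<open>k \<ge> f x / r\<close>, and \<open>f\<close> is nonnegative.\<close>

lemma J1_regularization_tendsto:
  assumes f: "continuous_map skorokhod_J1 euclideanreal f"
    and nonneg: "\<And>y. y \<in> skorokhod_space \<Longrightarrow> 0 \<le> f y"
    and x: "increasing_path x"
  shows "(\<lambda>k. J1_regularization f (real k) x) \<longlonglongrightarrow> f x"
proof (rule LIMSEQ_I)
  fix e :: real assume e: "0 < e"
  have xs: "x \<in> skorokhod_space" using increasing_path_skorokhod[OF x] .
  obtain r where r: "0 < r" "\<And>y. y \<in> skorokhod_space \<Longrightarrow> J1_close r x y \<Longrightarrow> \<bar>f y - f x\<bar> < e/2"
    using J1_continuous_at_increasing_path[OF f x, of "e/2"] e by auto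
  obtain K :: nat where K: "f x / r \<le> real K" using real_arch_simple by blast
  have "norm (J1_regularization f (real k) x - f x) < e" if "K \<le> k" for k
  proof -
    have "f x \<le> real K * r" using K r(1) by (simp add: field_simps)
    also have "\<dots> \<le> real k * r" using that r(1) by (intro mult_right_mono) auto
    finally have k: "f x \<le> real k * r" .
    have "f x - e/2 \<le> J1_regularization f (real k) x"
      unfolding J1_regularization_def
    proof (rule cInf_greatest)
      show "{f y + real k * r | y r. y \<in> skorokhod_space \<and> 0 \<le> r \<and> J1_close r x y} \<noteq> {}"
        using xs J1_close_refl[of 0 x] by force
      fix z assume "z \<in> {f y + real k * r | y r. y \<in> skorokhod_space \<and> 0 \<le> r \<and> J1_close r x y}"
      then obtain y q where z: "z = f y + real k * q" "y \<in> skorokhod_space" "0 \<le> q" "J1_close q x y"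
        by blast
      show "f x - e/2 \<le> z"
      proof (cases "q \<le> r")
        case True
        then have "\<bar>f y - f x\<bar> < e/2" using r(2) z J1_close_mono by blast
        moreover have "0 \<le> real k * q" using z by simp
        ultimately show ?thesis using z(1) by linarith
      next
        case False
        then have "real k * r \<le> real k * q" by (intro mult_left_mono) auto
        then have "f x \<le> f y + real k * q" using k nonneg[OF z(2)] by simp
        then show ?thesis using z(1) e by simp
      qed
    qed
    moreover have "J1_regularization f (real k) x \<le> f x"
      by (rule J1_regularization_le[OF nonneg _ xs]) simp_all
    ultimately show ?thesis using e by (simp add: abs_if)
  qed
  then show "\<exists>no. \<forall>n\<ge>no. norm (J1_regularization f (real n) x - f x) < e" by blast
qed

section \<open>Grid cells and step paths\<close>

lemma nat_floor_cell:
  fixes t \<delta> :: real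
  assumes "0 < \<delta>" "0 \<le> t"
  shows "real (nat \<lfloor>t / \<delta>\<rfloor>) * \<delta> \<le> t" "t < real (Suc (nat \<lfloor>t / \<delta>\<rfloor>)) * \<delta>"
proof -
  define v where "v = t / \<delta>"
  have "0 \<le> v" using assms by (simp add: v_def)
  then have "real (nat \<lfloor>v\<rfloor>) \<le> v" "v < real (Suc (nat \<lfloor>v\<rfloor>))"
    by linarith+
  moreover have "v * \<delta> = t" using assms by (simp add: v_def)
  ultimately show "real (nat \<lfloor>t / \<delta>\<rfloor>) * \<delta> \<le> t" "t < real (Suc (nat \<lfloor>t / \<delta>\<rfloor>)) * \<delta>"
    using assms mult_right_mono[of "real (nat \<lfloor>v\<rfloor>)" v \<delta>] mult_strict_right_mono[of v "real (Suc (nat \<lfloor>v\<rfloor>))" \<delta>]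
    unfolding v_def[symmetric] by (simp_all del: of_nat_Suc)
qed

lemma nat_floor_eq:
  fixes t \<delta> :: real
  assumes "0 < \<delta>" "real j * \<delta> \<le> t" "t < real (Suc j) * \<delta>"
  shows "nat \<lfloor>t / \<delta>\<rfloor> = j"
proof -
  have "real j \<le> t / \<delta>" "t / \<delta> < real j + 1" using assms by (simp_all add: field_simps)
  then have "\<lfloor>t / \<delta>\<rfloor> = int j" by (intro floor_unique) auto
  then show ?thesis by simp
qed

lemma floor_path_right_continuous:
  fixes \<delta> :: real
  assumes "0 < \<delta>" "0 \<le> t"
  shows "continuous (at_right t) (restrict (\<lambda>t. g (nat \<lfloor>t / \<delta>\<rfloor>) :: real) {0..})"
proof -
  let ?x = "restrict (\<lambda>t. g (nat \<lfloor>t / \<delta>\<rfloor>) :: real) {0..}"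
  define j where "j = nat \<lfloor>t / \<delta>\<rfloor>"
  have j: "real j * \<delta> \<le> t" "t < real (Suc j) * \<delta>"
    using nat_floor_cell[OF assms] by (auto simp: j_def)
  have "\<forall>\<^sub>F s in at_right t. s \<in> {t<..<real (Suc j) * \<delta>}"
    using j eventually_at_right_real by blast
  then have "\<forall>\<^sub>F s in at_right t. ?x s = ?x t"
  proof eventually_elim
    case (elim s)
    then have "nat \<lfloor>s / \<delta>\<rfloor> = j" using assms j by (intro nat_floor_eq) auto
    then show ?case using elim assms by (simp add: j_def)
  qed
  then show ?thesis unfolding continuous_within by (rule tendsto_eventually)
qed

lemma floor_path_skorokhod:
  fixes \<delta> :: real
  assumes \<delta>: "0 < \<delta>"
  shows "restrict (\<lambda>t. g (nat \<lfloor>t / \<delta>\<rfloor>) :: real) {0..} \<in> skorokhod_space"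
proof -
  let ?x = "restrict (\<lambda>t. g (nat \<lfloor>t / \<delta>\<rfloor>) :: real) {0..}"
  have "\<exists>l. (?x \<longlongrightarrow> l) (at_left t)" if t: "0 < t" for t
  proof -
    \<comment> \<open>At a grid point the left limit is the value on the preceding cell, so the cell
      is taken open on the left and closed on the right.\<close>
    obtain j where j: "real j * \<delta> < t" "t \<le> real (Suc j) * \<delta>"
    proof (cases "real (nat \<lfloor>t / \<delta>\<rfloor>) * \<delta> = t")
      case True
      then obtain i where i: "nat \<lfloor>t / \<delta>\<rfloor> = Suc i" using t by (cases "nat \<lfloor>t / \<delta>\<rfloor>") auto
      show ?thesis using True \<delta> by (intro that[of i]) (auto simp: i field_simps)
    next
      case False
      then show ?thesis using nat_floor_cell[OF \<delta>, of t] t by (intro that[of "nat \<lfloor>t / \<delta>\<rfloor>"]) auto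
    qed
    have "\<forall>\<^sub>F s in at_left t. s \<in> {real j * \<delta><..<t}"
      using j eventually_at_left_real by blast
    then have "\<forall>\<^sub>F s in at_left t. ?x s = g j"
    proof eventually_elim
      case (elim s)
      then have "nat \<lfloor>s / \<delta>\<rfloor> = j" using \<delta> j by (intro nat_floor_eq) auto
      moreover have "0 \<le> s" using elim \<delta>
        by (metis greaterThanLessThan_iff less_eq_real_def mult_nonneg_nonneg of_nat_0_le_iff order_trans)
      ultimately show ?case by simp
    qed
    then show ?thesis using tendsto_eventually by blast
  qed
  then show ?thesis
    unfolding skorokhod_space_def using floor_path_right_continuous[OF \<delta>] by auto
qed

text \<open>The increment \<open>d j\<close> is credited at the end of cell \<open>j\<close>, and
  the path is frozen after \<open>m\<close> cells, so it is a function of \<open>m\<close>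
  numbers.\<close>

definition step_path :: "real \<Rightarrow> nat \<Rightarrow> (nat \<Rightarrow> real) \<Rightarrow> real \<Rightarrow> real" where
  "step_path \<delta> m d = restrict (\<lambda>t. \<Sum>j<min m (nat \<lfloor>t / \<delta>\<rfloor>). d j) {0..}"

lemma step_path_skorokhod: "0 < \<delta> \<Longrightarrow> step_path \<delta> m d \<in> skorokhod_space"
  unfolding step_path_def by (rule floor_path_skorokhod)

definition grid_increment :: "real \<Rightarrow> (real \<Rightarrow> real) \<Rightarrow> nat \<Rightarrow> real" where
  "grid_increment \<delta> x j = x (real (Suc j) * \<delta>) - x (real j * \<delta>)"

lemma grid_increment_nonneg:
  "increasing_path x \<Longrightarrow> 0 < \<delta> \<Longrightarrow> 0 \<le> grid_increment \<delta> x j"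
  unfolding grid_increment_def
  by (simp add: increasing_path_mono mult_right_mono)

lemma step_path_grid_increment:
  assumes "increasing_path x" "0 < \<delta>" "0 \<le> t"
  shows "step_path \<delta> m (grid_increment \<delta> x) t = x (real (min m (nat \<lfloor>t / \<delta>\<rfloor>)) * \<delta>)"
proof -
  have "(\<Sum>j<k. grid_increment \<delta> x j) = x (real k * \<delta>)" for k
    using assms(1) by (induction k) (simp_all add: grid_increment_def increasing_path_def)
  then show ?thesis using assms(3) by (simp add: step_path_def)
qed

text \<open>Piecewise linear interpolation that sends \<open>j * \<delta>\<close> to
  \<open>p j\<close>. As \<open>p (Suc j)\<close> lies in cell \<open>j\<close>, the knots move by
  at most \<open>\<delta>\<close>. The last property lets a path that jumps at the points
  \<open>p (Suc j)\<close> be compared with one that jumps at grid times.\<close>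

lemma interpolating_time_change:
  fixes \<delta> :: real and p :: "nat \<Rightarrow> real"
  assumes \<delta>: "0 < \<delta>" and p0: "p 0 = 0"
    and p1: "\<And>j. real j * \<delta> < p (Suc j)" and p2: "\<And>j. p (Suc j) \<le> real (Suc j) * \<delta>"
  obtains \<psi> where "\<psi> \<in> time_changes" "\<And>u. 0 \<le> u \<Longrightarrow> \<bar>\<psi> u - u\<bar> \<le> \<delta>"
    "\<And>j u. real j * \<delta> \<le> u \<Longrightarrow> u < real (Suc j) * \<delta> \<Longrightarrow> p j \<le> \<psi> u \<and> \<psi> u < p (Suc j)"
proof -
  \<comment> \<open>Identity on negative times: \<open>\<psi>\<close> becomes a strictly increasing
    surjection of the real line, and such a map is continuous.\<close>
  define \<psi> where "\<psi> u = (if u < 0 then u else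
    p (nat \<lfloor>u / \<delta>\<rfloor>) + (u / \<delta> - real (nat \<lfloor>u / \<delta>\<rfloor>)) * (p (Suc (nat \<lfloor>u / \<delta>\<rfloor>)) - p (nat \<lfloor>u / \<delta>\<rfloor>)))" for u
  have p3: "p j \<le> real j * \<delta>" for j using p0 p2[of "j - 1"] by (cases j) auto
  have p_less: "p j < p (Suc j)" for j using p3[of j] p1[of j] by simp
  have p_mono: "p i \<le> p j" if "i \<le> j" for i j
    by (rule lift_Suc_mono_le[of p, OF less_imp_le[OF p_less] that])
  have nonneg: "0 \<le> u" if "real j * \<delta> \<le> u" for j u
    using that \<delta> by (meson dual_order.trans less_imp_le mult_nonneg_nonneg of_nat_0_le_iff)
  have \<psi>: "\<psi> u = p j + (u / \<delta> - real j) * (p (Suc j) - p j)"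
    if "real j * \<delta> \<le> u" "u < real (Suc j) * \<delta>" for j u
    using nat_floor_eq[OF \<delta> that] nonneg[OF that(1)] by (simp add: \<psi>_def)
  have frac: "0 \<le> u / \<delta> - real j" "u / \<delta> - real j < 1"
    if "real j * \<delta> \<le> u" "u < real (Suc j) * \<delta>" for j u
    using that \<delta> by (simp_all add: field_simps)
  have cell: "p j \<le> \<psi> u \<and> \<psi> u < p (Suc j)" if u: "real j * \<delta> \<le> u" "u < real (Suc j) * \<delta>" for j u
  proof -
    have "0 \<le> (u / \<delta> - real j) * (p (Suc j) - p j)"
      using frac[OF u] p_less[of j] by simp
    moreover have "(u / \<delta> - real j) * (p (Suc j) - p j) < 1 * (p (Suc j) - p j)"
      using frac[OF u] p_less[of j] by (intro mult_strict_right_mono) auto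
    ultimately show ?thesis using \<psi>[OF u] by simp
  qed
  have less: "\<psi> u < \<psi> v" if uv: "u < v" for u v
  proof (cases "u < 0")
    case True
    show ?thesis
    proof (cases "v < 0")
      case True then show ?thesis using uv by (simp add: \<psi>_def)
    next
      case False
      then have "p 0 \<le> \<psi> v" using cell[OF nat_floor_cell[OF \<delta>], of v] p_mono[of 0] by (meson le0 not_less order_trans)
      then show ?thesis using \<open>u < 0\<close> p0 by (simp add: \<psi>_def)
    qed
  next
    case False
    define i j where "i = nat \<lfloor>u / \<delta>\<rfloor>" and "j = nat \<lfloor>v / \<delta>\<rfloor>"
    have i: "real i * \<delta> \<le> u" "u < real (Suc i) * \<delta>" and j: "real j * \<delta> \<le> v" "v < real (Suc j) * \<delta>"
      using nat_floor_cell[OF \<delta>] False uv by (auto simp: i_def j_def)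
    have "i \<le> j" unfolding i_def j_def using uv \<delta>
      by (intro nat_mono floor_mono divide_right_mono) auto
    show ?thesis
    proof (cases "i = j")
      case True
      have "(u / \<delta> - real i) * (p (Suc i) - p i) < (v / \<delta> - real i) * (p (Suc i) - p i)"
        using uv \<delta> p_less[of i] by (intro mult_strict_right_mono) (auto simp: divide_strict_right_mono)
      then show ?thesis using \<psi>[OF i] \<psi>[OF j] True by simp
    next
      case False
      then have "p (Suc i) \<le> p j" using \<open>i \<le> j\<close> by (intro p_mono) simp
      then show ?thesis using cell[OF i] cell[OF j] by linarith
    qed
  qed
  have surj0: "\<exists>u\<ge>0. \<psi> u = y" if y: "0 \<le> y" for y
  proof -
    obtain n :: nat where "y / \<delta> < real n" using reals_Archimedean2 by blast
    then have "y < p (Suc n)" using p1[of n] \<delta> by (simp add: field_simps)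
    then have ex: "\<exists>k. y < p k" by blast
    \<comment> \<open>The first knot above \<open>y\<close> identifies the linear piece on which
      \<open>y\<close> is attained.\<close>
    define k where "k = (LEAST k. y < p k)"
    have k: "y < p k" unfolding k_def using ex by (rule LeastI_ex)
    then obtain j where j: "k = Suc j" using p0 y by (cases k) auto
    have pj: "p j \<le> y" using not_less_Least[of j "\<lambda>k. y < p k"] j k_def by auto
    define s where "s = (y - p j) / (p (Suc j) - p j)"
    have s: "0 \<le> s" "s < 1" using pj k p_less[of j] by (auto simp: s_def j field_simps)
    define u where "u = (real j + s) * \<delta>"
    have u: "real j * \<delta> \<le> u" "u < real (Suc j) * \<delta>" using s \<delta> by (auto simp: u_def)
    have "u / \<delta> - real j = s" using \<delta> by (simp add: u_def)
    then have "\<psi> u = y" using \<psi>[OF u] p_less[of j] by (simp add: s_def)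
    then show ?thesis using nonneg[OF u(1)] by blast
  qed
  have "range \<psi> = UNIV"
  proof -
    have "\<exists>u. y = \<psi> u" for y
    proof (cases "y < 0")
      case True then show ?thesis by (intro exI[of _ y]) (simp add: \<psi>_def)
    next
      case False then show ?thesis using surj0[of y] by force
    qed
    then show ?thesis by blast
  qed
  then have "continuous_on UNIV \<psi>"
    using less by (intro continuous_onI_mono) (auto simp: le_less)
  then have "continuous_on {0..} \<psi>" using continuous_on_subset by blast
  moreover have "strict_mono_on {0..} \<psi>" using less by (auto intro: strict_mono_onI)
  moreover have "bij_betw \<psi> {0..} {0..}"
  proof (rule bij_betw_imageI)
    show "inj_on \<psi> {0..}" using less by (metis inj_onI linorder_neqE_linordered_idom order_less_irrefl)
    have "0 \<le> \<psi> u" if "0 \<le> u" for u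
      using cell[OF nat_floor_cell[OF \<delta> that]] p_mono[of 0 "nat \<lfloor>u / \<delta>\<rfloor>"] p0 by linarith
    then show "\<psi> ` {0..} = {0..}" using surj0 by force
  qed
  ultimately have "\<psi> \<in> time_changes" by (simp add: time_changes_def)
  moreover have "\<bar>\<psi> u - u\<bar> \<le> \<delta>" if "0 \<le> u" for u
  proof -
    define j where "j = nat \<lfloor>u / \<delta>\<rfloor>"
    have j: "real j * \<delta> \<le> u" "u < real (Suc j) * \<delta>"
      using nat_floor_cell[OF \<delta> that] by (auto simp: j_def)
    define s where "s = u / \<delta> - real j"
    have s: "0 \<le> s" "s < 1" using frac[OF j] by (auto simp: s_def)
    have u: "u = real j * \<delta> + s * \<delta>" using \<delta> by (simp add: s_def field_simps)
    \<comment> \<open>Both \<open>\<psi> u\<close> and \<open>u\<close> are convex combinations with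
      the same weight \<open>s\<close>, of the knots and of the grid points; a knot lags behind its
      grid point by at most \<open>\<delta>\<close>.\<close>
    have "\<psi> u = (1 - s) * p j + s * p (Suc j)" using \<psi>[OF j] by (simp add: s_def algebra_simps)
    moreover have "(1 - s) * p j \<le> (1 - s) * (real j * \<delta>)" "s * p (Suc j) \<le> s * (real (Suc j) * \<delta>)"
      using s p3[of j] p3[of "Suc j"] by (auto intro!: mult_left_mono simp del: of_nat_Suc)
    moreover have "real j * \<delta> - \<delta> \<le> p j"
      using p1[of "j - 1"] p0 \<delta> by (cases j) (auto simp: algebra_simps)
    then have "(1 - s) * (real j * \<delta> - \<delta>) \<le> (1 - s) * p j" using s by (intro mult_left_mono) auto
    moreover have "s * (real j * \<delta>) \<le> s * p (Suc j)"
      using s p1[of j] by (intro mult_left_mono) auto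
    ultimately have "\<psi> u \<le> u" "u - \<delta> \<le> \<psi> u" using \<delta> unfolding u by (auto simp: algebra_simps)
    then show ?thesis using \<delta> by simp
  qed
  ultimately show ?thesis using cell that by blast
qed

text \<open>At most one jump larger than \<open>\<epsilon>\<close> per cell, expressed through
  oscillations: \<open>s\<close> is its time, and the path is unconstrained at \<open>s\<close>
  itself. A cell without large jumps takes its right end as \<open>s\<close>.\<close>

definition single_jump_cells :: "real \<Rightarrow> real \<Rightarrow> nat \<Rightarrow> (real \<Rightarrow> real) \<Rightarrow> bool" where
  "single_jump_cells \<delta> \<epsilon> m x \<longleftrightarrow> (\<forall>j<m. \<exists>s. real j * \<delta> < s \<and> s \<le> real (Suc j) * \<delta> \<and>
     (\<forall>t. real j * \<delta> \<le> t \<and> t < s \<longrightarrow> x t \<le> x (real j * \<delta>) + \<epsilon>) \<and>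
     x (real (Suc j) * \<delta>) \<le> x s + \<epsilon>)"

text \<open>The time change sends the end of cell \<open>j\<close> to the exceptional time of that
  cell, so the step path, which moves at grid times, jumps together with \<open>x\<close>; between
  two exceptional times \<open>x\<close> stays within \<open>\<epsilon>\<close> of its value at the
  grid point in between. From cell \<open>k\<close> on no values are compared: both transformed
  values are at most \<open>exp (\<delta> - real k * \<delta>)\<close>.\<close>

lemma single_jump_cells_imp_J1_close:
  assumes x: "increasing_path x" and \<delta>: "0 < \<delta>" and \<epsilon>: "0 \<le> \<epsilon>"
    and sj: "single_jump_cells \<delta> \<epsilon> k x" and km: "k \<le> m"
  shows "J1_close (max (\<delta> + \<epsilon>) (exp (\<delta> - real k * \<delta>))) (step_path \<delta> m (grid_increment \<delta> x)) x"
proof -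
  obtain s0 where s0: "\<And>j. j < k \<Longrightarrow> real j * \<delta> < s0 j \<and> s0 j \<le> real (Suc j) * \<delta> \<and>
     (\<forall>t. real j * \<delta> \<le> t \<and> t < s0 j \<longrightarrow> x t \<le> x (real j * \<delta>) + \<epsilon>) \<and>
     x (real (Suc j) * \<delta>) \<le> x (s0 j) + \<epsilon>"
    using sj unfolding single_jump_cells_def by metis
  define p where "p i = (case i of 0 \<Rightarrow> 0 | Suc j \<Rightarrow> if j < k then s0 j else real (Suc j) * \<delta>)" for i
  have p: "p 0 = 0" "\<And>j. j < k \<Longrightarrow> p (Suc j) = s0 j" by (auto simp: p_def)
  \<comment> \<open>Past cell \<open>k\<close> the knots are the grid points themselves, which keeps
    the interpolation conditions valid.\<close>
  have "real j * \<delta> < p (Suc j)" "p (Suc j) \<le> real (Suc j) * \<delta>" for j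
    using s0[of j] \<delta> by (auto simp: p_def)
  from interpolating_time_change[of \<delta> p, OF \<delta> p(1) this]
  obtain \<psi> where \<psi>: "\<psi> \<in> time_changes" "\<And>u. 0 \<le> u \<Longrightarrow> \<bar>\<psi> u - u\<bar> \<le> \<delta>"
    "\<And>j u. real j * \<delta> \<le> u \<Longrightarrow> u < real (Suc j) * \<delta> \<Longrightarrow> p j \<le> \<psi> u \<and> \<psi> u < p (Suc j)"
    by auto
  let ?y = "step_path \<delta> m (grid_increment \<delta> x)"
  have "\<bar>exp (- u - ?y u) - exp (- \<psi> u - x (\<psi> u))\<bar> \<le> max (\<delta> + \<epsilon>) (exp (\<delta> - real k * \<delta>))"
    if u: "0 \<le> u" for u
  proof -
    define j where "j = nat \<lfloor>u / \<delta>\<rfloor>"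
    have j: "real j * \<delta> \<le> u" "u < real (Suc j) * \<delta>"
      using nat_floor_cell[OF \<delta> u] by (auto simp: j_def)
    have y: "?y u = x (real (min m j) * \<delta>)"
      using step_path_grid_increment[OF x \<delta> u] by (simp add: j_def)
    have y0: "0 \<le> ?y u" unfolding y using \<delta> by (intro increasing_path_nonneg[OF x]) auto
    have \<psi>0: "0 \<le> \<psi> u" using time_changes_bounds[OF \<psi>(1) u] .
    have x0: "0 \<le> x (\<psi> u)" by (rule increasing_path_nonneg[OF x \<psi>0])
    show ?thesis
    proof (cases "j < k")
      case True
      have y: "?y u = x (real j * \<delta>)" using y km True by (simp add: min_def)
      have pj: "p j \<le> \<psi> u" "\<psi> u < s0 j" using \<psi>(3)[OF j] p(2)[OF True] by auto
      have "x (\<psi> u) \<le> x (real j * \<delta>) + \<epsilon>"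
      proof (cases "real j * \<delta> \<le> \<psi> u")
        case True then show ?thesis using s0[OF \<open>j < k\<close>] pj by blast
      next
        case False
        then have "x (\<psi> u) \<le> x (real j * \<delta>)" using \<psi>0 by (intro increasing_path_mono[OF x]) auto
        then show ?thesis using \<epsilon> by linarith
      qed
      moreover have "x (real j * \<delta>) \<le> x (\<psi> u) + \<epsilon>"
      proof (cases j)
        case 0 then show ?thesis using x x0 \<epsilon> by (simp add: increasing_path_def)
      next
        case (Suc i)
        then have i: "i < k" "p j = s0 i" using True p by auto
        have "0 < s0 i" using s0[OF i(1)] \<delta>
          by (meson le_less_trans less_imp_le mult_nonneg_nonneg of_nat_0_le_iff)
        then have "x (s0 i) \<le> x (\<psi> u)" using pj i by (intro increasing_path_mono[OF x]) auto
        then show ?thesis using s0[OF i(1)] Suc by auto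
      qed
      ultimately have "\<bar>?y u - x (\<psi> u)\<bar> \<le> \<epsilon>" using y by simp
      then have "\<bar>(- u - ?y u) - (- \<psi> u - x (\<psi> u))\<bar> \<le> \<delta> + \<epsilon>" using \<psi>(2)[OF u] by linarith
      then show ?thesis using abs_exp_diff_le[of "- u - ?y u" "- \<psi> u - x (\<psi> u)"] u y0 x0 \<psi>0 by simp
    next
      case False
      then have "real k * \<delta> \<le> real j * \<delta>" using \<delta> by (intro mult_right_mono) auto
      then have uk: "real k * \<delta> \<le> u" using j by simp
      have "\<psi> u \<ge> real k * \<delta> - \<delta>" using \<psi>(2)[OF u] uk by linarith
      then have "exp (- \<psi> u - x (\<psi> u)) \<le> exp (\<delta> - real k * \<delta>)" using x0 by simp
      moreover have "exp (- u - ?y u) \<le> exp (\<delta> - real k * \<delta>)" using uk y0 \<delta> by simp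
      moreover have "0 < exp (- \<psi> u - x (\<psi> u))" "0 < exp (- u - ?y u)" by simp_all
      ultimately have "\<bar>exp (- u - ?y u) - exp (- \<psi> u - x (\<psi> u))\<bar> \<le> exp (\<delta> - real k * \<delta>)" by linarith
      then show ?thesis by simp
    qed
  qed
  moreover have "\<bar>\<psi> u - u\<bar> \<le> max (\<delta> + \<epsilon>) (exp (\<delta> - real k * \<delta>))" if "0 \<le> u" for u
    using \<psi>(2)[OF that] \<epsilon> by linarith
  ultimately show ?thesis unfolding J1_close_def using \<psi>(1) by blast
qed

text \<open>Every time \<open>t\<close> has a neighbourhood on whose right and left parts
  \<open>x\<close> oscillates by at most \<open>\<epsilon>\<close>. A Lebesgue number of this cover
  of \<open>{0..T}\<close> bounds the admissible mesh: each cell then lies in the neighbourhood of a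
  single \<open>t\<close>, the only place where the cell can have a large jump before its right
  end.\<close>

lemma increasing_path_single_jump_cells:
  assumes x: "increasing_path x" and \<epsilon>: "0 < \<epsilon>"
  obtains \<delta>0 where "0 < \<delta>0"
    "\<And>\<delta> m. 0 < \<delta> \<Longrightarrow> \<delta> < \<delta>0 \<Longrightarrow> real m * \<delta> \<le> T \<Longrightarrow> single_jump_cells \<delta> \<epsilon> m x"
proof -
  have "\<exists>\<eta>>0. (\<forall>u. t \<le> u \<and> u < t + \<eta> \<longrightarrow> x u \<le> x t + \<epsilon>) \<and>
      (\<forall>u v. 0 \<le> u \<and> t - \<eta> < u \<and> u \<le> v \<and> v < t \<longrightarrow> x v \<le> x u + \<epsilon>)" if t: "0 \<le> t" for t
  proof -
    have "(x \<longlongrightarrow> x t) (at_right t)"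
      using x t by (simp add: increasing_path_def continuous_within)
    then have "\<forall>\<^sub>F u in at_right t. x u < x t + \<epsilon>" using \<epsilon> by (intro order_tendstoD) auto
    then obtain b where b: "t < b" "\<And>u. t < u \<Longrightarrow> u < b \<Longrightarrow> x u < x t + \<epsilon>"
      by (auto simp: eventually_at_right_field)
    obtain a where a: "a < t" "\<And>u v. 0 \<le> u \<Longrightarrow> a < u \<Longrightarrow> u \<le> v \<Longrightarrow> v < t \<Longrightarrow> x v \<le> x u + \<epsilon>"
    proof (cases "t = 0")
      case True
      then show ?thesis by (intro that[of "-1"]) auto
    next
      case False
      define L where "L = Sup (x ` {0..<t})"
      have bdd: "bdd_above (x ` {0..<t})"
        using increasing_path_mono[OF x, of _ t] by (intro bdd_aboveI[of _ "x t"]) auto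
      have "(x \<longlongrightarrow> L) (at_left t)"
        unfolding L_def using increasing_path_left_limit[OF x] t False by simp
      then have "\<forall>\<^sub>F u in at_left t. L - \<epsilon> < x u" using \<epsilon> by (intro order_tendstoD) auto
      then obtain a where a: "a < t" "\<And>u. a < u \<Longrightarrow> u < t \<Longrightarrow> L - \<epsilon> < x u"
        by (auto simp: eventually_at_left_field)
      have "x v \<le> x u + \<epsilon>" if "0 \<le> u" "a < u" "u \<le> v" "v < t" for u v
      proof -
        have "x v \<le> L" unfolding L_def using that bdd by (intro cSup_upper) auto
        then show ?thesis using a(2)[of u] that by simp
      qed
      then show ?thesis using that a(1) by blast
    qed
    show ?thesis
    proof (intro exI[of _ "min (b - t) (t - a)"] conjI allI impI)
      fix u assume "t \<le> u \<and> u < t + min (b - t) (t - a)"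
      then show "x u \<le> x t + \<epsilon>" using b(2)[of u] \<epsilon> by (cases "u = t") (auto simp: min_def split: if_splits)
    qed (use a b in auto)
  qed
  then obtain \<eta> where \<eta>: "\<And>t. 0 \<le> t \<Longrightarrow> 0 < \<eta> t"
      "\<And>t u. 0 \<le> t \<Longrightarrow> t \<le> u \<Longrightarrow> u < t + \<eta> t \<Longrightarrow> x u \<le> x t + \<epsilon>"
      "\<And>t u v. 0 \<le> t \<Longrightarrow> 0 \<le> u \<Longrightarrow> t - \<eta> t < u \<Longrightarrow> u \<le> v \<Longrightarrow> v < t \<Longrightarrow> x v \<le> x u + \<epsilon>"
    by metis
  have "{0..T} \<subseteq> \<Union> ((\<lambda>t. ball t (\<eta> t)) ` {0..T})" using \<eta>(1) by force
  then obtain \<delta>0 where \<delta>0: "0 < \<delta>0"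
    "\<And>y. y \<in> {0..T} \<Longrightarrow> \<exists>G \<in> (\<lambda>t. ball t (\<eta> t)) ` {0..T}. ball y \<delta>0 \<subseteq> G"
    by (rule Heine_Borel_lemma[OF compact_Icc]) auto
  have "single_jump_cells \<delta> \<epsilon> m x" if \<delta>: "0 < \<delta>" "\<delta> < \<delta>0" "real m * \<delta> \<le> T" for \<delta> m
    unfolding single_jump_cells_def
  proof (intro allI impI)
    fix j assume j: "j < m"
    define l r where "l = real j * \<delta>" and "r = real (Suc j) * \<delta>"
    have lr: "0 \<le> l" "l < r" "r = l + \<delta>" using \<delta> by (auto simp: l_def r_def algebra_simps)
    have "l \<le> real m * \<delta>" unfolding l_def using j \<delta> by (intro mult_right_mono) auto
    then obtain t where t: "0 \<le> t" "ball l \<delta>0 \<subseteq> ball t (\<eta> t)" using \<delta>0(2)[of l] lr \<delta> by auto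
    have in_ball: "t - \<eta> t < u" "u < t + \<eta> t" if "l \<le> u" "u \<le> r" for u
    proof -
      have "u \<in> ball l \<delta>0" using that lr \<delta> by (auto simp: dist_real_def)
      then have "u \<in> ball t (\<eta> t)" using t by blast
      then show "t - \<eta> t < u" "u < t + \<eta> t" by (auto simp: dist_real_def)
    qed
    have "\<exists>s>l. s \<le> r \<and> (\<forall>t. l \<le> t \<and> t < s \<longrightarrow> x t \<le> x l + \<epsilon>) \<and> x r \<le> x s + \<epsilon>"
    \<comment> \<open>If the centre lies in the cell it serves as the exceptional time. Otherwise
      the cell up to its right end lies on one side of \<open>t\<close>, and \<open>r\<close> itself
      serves, since a jump there is allowed.\<close>
    proof (cases "l < t \<and> t \<le> r")
      case True
      show ?thesis
      proof (intro exI[of _ t] conjI allI impI)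
        fix u assume "l \<le> u \<and> u < t"
        then show "x u \<le> x l + \<epsilon>" using \<eta>(3)[OF t(1) lr(1)] in_ball[of l] lr by auto
      next
        show "x r \<le> x t + \<epsilon>" using \<eta>(2)[OF t(1), of r] in_ball[of r] True lr by auto
      qed (use True in auto)
    next
      case False
      have "x u \<le> x l + \<epsilon>" if u: "l \<le> u" "u < r" for u
      proof (cases "t \<le> l")
        case True
        then have "x u \<le> x t + \<epsilon>" using \<eta>(2)[OF t(1), of u] in_ball[of u] u by auto
        also have "x t \<le> x l" using True t by (intro increasing_path_mono[OF x]) auto
        finally show ?thesis by simp
      next
        case 2: False
        then show ?thesis using False u \<eta>(3)[OF t(1) lr(1), of u] in_ball[of l] by auto
      qed
      then show ?thesis using lr \<epsilon> by (intro exI[of _ r]) auto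
    qed
    then show "\<exists>s. real j * \<delta> < s \<and> s \<le> real (Suc j) * \<delta> \<and>
     (\<forall>t. real j * \<delta> \<le> t \<and> t < s \<longrightarrow> x t \<le> x (real j * \<delta>) + \<epsilon>) \<and>
     x (real (Suc j) * \<delta>) \<le> x s + \<epsilon>" by (simp only: l_def r_def)
  qed
  then show ?thesis using that \<delta>0(1) by blast
qed

text \<open>One index refines both scales: \<open>(Suc l)\<^sup>2\<close> cells of width
  \<open>1 / real (Suc l)\<close> reach the time \<open>Suc l\<close>.\<close>

definition skeleton :: "nat \<Rightarrow> (real \<Rightarrow> real) \<Rightarrow> real \<Rightarrow> real" where
  "skeleton l x = step_path (1 / real (Suc l)) ((Suc l)\<^sup>2) (grid_increment (1 / real (Suc l)) x)"

lemma skeleton_skorokhod: "skeleton l x \<in> skorokhod_space"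
  unfolding skeleton_def by (rule step_path_skorokhod) simp

text \<open>The factor \<open>T\<close> is the time horizon, beyond which the weight \<open>exp (- t)\<close> is negligible.\<close>

lemma skeleton_J1_close:
  assumes x: "increasing_path x" and "0 < s" "1 / real (Suc l) \<le> s / 2" "exp (1 - real T) \<le> s"
    "T \<le> Suc l" "single_jump_cells (1 / real (Suc l)) (s / 2) (T * Suc l) x"
  shows "J1_close s (skeleton l x) x"
proof -
  let ?\<delta> = "1 / real (Suc l)"
  have "T * Suc l \<le> Suc l * Suc l" using assms(5) by (intro mult_right_mono) auto
  then have "T * Suc l \<le> (Suc l)\<^sup>2" by (simp only: power2_eq_square)
  then have *: "J1_close (max (?\<delta> + s / 2) (exp (?\<delta> - real (T * Suc l) * ?\<delta>))) (skeleton l x) x"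
    unfolding skeleton_def using assms by (intro single_jump_cells_imp_J1_close) auto
  have "?\<delta> \<le> 1" by simp
  moreover have "real (T * Suc l) * ?\<delta> = real T" by (simp del: of_nat_Suc mult_Suc_right)
  ultimately have "exp (?\<delta> - real (T * Suc l) * ?\<delta>) \<le> exp (1 - real T)" by simp
  then have "exp (?\<delta> - real (T * Suc l) * ?\<delta>) \<le> s" using assms(4) by (rule order_trans)
  moreover have "?\<delta> + s / 2 \<le> s" using assms(3) by linarith
  ultimately have "max (?\<delta> + s / 2) (exp (?\<delta> - real (T * Suc l) * ?\<delta>)) \<le> s" by (rule max.boundedI[rotated])
  then show ?thesis using * J1_close_mono by blast
qed

lemma exp_horizon:
  fixes s :: real assumes "0 < s" obtains T :: nat where "exp (1 - real T) \<le> s"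
proof -
  obtain T :: nat where "1 - ln s \<le> real T" using real_arch_simple by blast
  then have "exp (1 - real T) \<le> exp (ln s)" by (subst exp_le_cancel_iff) linarith
  then show ?thesis using that assms by simp
qed

lemma eventually_inverse_Suc_le:
  fixes s :: real assumes "0 < s" shows "\<forall>\<^sub>F l in sequentially. 1 / real (Suc l) \<le> s"
  using order_tendstoD(2)[OF LIMSEQ_inverse_real_of_nat assms]
  by eventually_elim (simp add: inverse_eq_divide)

lemma skeleton_eventually_J1_close:
  assumes x: "increasing_path x" and s: "0 < s"
  shows "\<forall>\<^sub>F l in sequentially. J1_close s (skeleton l x) x"
proof -
  obtain T where T: "exp (1 - real T) \<le> s" using exp_horizon[OF s] .
  obtain \<delta>0 where \<delta>0: "0 < \<delta>0"
    "\<And>\<delta> m. 0 < \<delta> \<Longrightarrow> \<delta> < \<delta>0 \<Longrightarrow> real m * \<delta> \<le> real T \<Longrightarrow> single_jump_cells \<delta> (s / 2) m x"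
    using increasing_path_single_jump_cells[OF x, of "s/2" "real T"] s by auto
  have "\<forall>\<^sub>F l in sequentially. 1 / real (Suc l) \<le> \<delta>0 / 2"
    "\<forall>\<^sub>F l in sequentially. 1 / real (Suc l) \<le> s / 2" "\<forall>\<^sub>F l in sequentially. T \<le> l"
    using \<delta>0 s by (intro eventually_inverse_Suc_le eventually_ge_at_top; simp)+
  then show ?thesis
  proof eventually_elim
    case (elim l)
    then have "1 / real (Suc l) < \<delta>0" using \<delta>0(1) by linarith
    then have "single_jump_cells (1 / real (Suc l)) (s / 2) (T * Suc l) x"
      by (intro \<delta>0(2)) (simp_all del: of_nat_Suc mult_Suc_right)
    then show ?case using elim T s x by (intro skeleton_J1_close[of x s l T]) auto
  qed
qed

section \<open>Weak convergence of increasing processes\<close>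

text \<open>Weak enough to cover both the functionals continuous for the topology and their
  regularizations, which are Lipschitz for \<open>J1_close\<close>. Continuity is asked at
  increasing paths only, because these are the paths that the processes take.\<close>

definition path_continuous :: "((real \<Rightarrow> real) \<Rightarrow> real) \<Rightarrow> bool" where
  "path_continuous h \<longleftrightarrow> (\<forall>x. increasing_path x \<longrightarrow> (\<forall>e>0. \<exists>r>0. \<forall>y\<in>skorokhod_space.
     J1_close r x y \<longrightarrow> \<bar>h y - h x\<bar> < e))"

lemma path_continuous_J1:
  assumes "continuous_map skorokhod_J1 euclideanreal f" shows "path_continuous f"
  unfolding path_continuous_def
proof (intro allI impI)
  fix x and e :: real assume "increasing_path x" "0 < e"
  then obtain r where "0 < r" "\<And>y. y \<in> skorokhod_space \<Longrightarrow> J1_close r x y \<Longrightarrow> \<bar>f y - f x\<bar> < e"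
    using J1_continuous_at_increasing_path[OF assms, of x e] by auto
  then show "\<exists>r>0. \<forall>y\<in>skorokhod_space. J1_close r x y \<longrightarrow> \<bar>f y - f x\<bar> < e"
    by (intro exI[of _ r]) simp
qed

lemma path_continuous_J1_regularization:
  assumes "\<And>y. y \<in> skorokhod_space \<Longrightarrow> 0 \<le> f y" "0 \<le> k"
  shows "path_continuous (J1_regularization f k)"
  unfolding path_continuous_def
proof (intro allI impI)
  fix x and e :: real assume x: "increasing_path x" and e: "0 < e"
  define r where "r = e / (k + 1)"
  have r: "0 < r" "k * r < e" using e assms(2) by (auto simp: r_def field_simps)
  have "\<bar>J1_regularization f k y - J1_regularization f k x\<bar> < e"
    if y: "y \<in> skorokhod_space" "J1_close r x y" for y
  proof -
    have "J1_regularization f k x \<le> J1_regularization f k y + k * r"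
      using J1_regularization_lipschitz[OF assms y(1) _ y(2)] r by simp
    moreover have "J1_regularization f k y \<le> J1_regularization f k x + k * r"
      using J1_regularization_lipschitz[OF assms increasing_path_skorokhod[OF x] _ J1_close_sym[OF y(2)]] r by simp
    ultimately show ?thesis using r(2) by linarith
  qed
  then show "\<exists>r>0. \<forall>y\<in>skorokhod_space. J1_close r x y \<longrightarrow>
      \<bar>J1_regularization f k y - J1_regularization f k x\<bar> < e" using r(1) by blast
qed

lemma step_path_increasing:
  assumes "0 < \<delta>" "\<And>j. j < m \<Longrightarrow> 0 \<le> d j" shows "increasing_path (step_path \<delta> m d)"
proof -
  have "(\<Sum>j<min m (nat \<lfloor>s / \<delta>\<rfloor>). d j) \<le> (\<Sum>j<min m (nat \<lfloor>t / \<delta>\<rfloor>). d j)" if "0 \<le> s" "s \<le> t" for s t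
  proof (rule sum_mono2)
    have "nat \<lfloor>s / \<delta>\<rfloor> \<le> nat \<lfloor>t / \<delta>\<rfloor>" using that assms(1)
      by (intro nat_mono floor_mono divide_right_mono) auto
    then show "{..<min m (nat \<lfloor>s / \<delta>\<rfloor>)} \<subseteq> {..<min m (nat \<lfloor>t / \<delta>\<rfloor>)}" by auto
  qed (use assms(2) in auto)
  then have "mono_on {0..} (step_path \<delta> m d)"
    by (auto simp: step_path_def mono_on_def)
  moreover have "\<forall>t\<ge>0. continuous (at_right t) (step_path \<delta> m d)"
    unfolding step_path_def by (intro allI impI floor_path_right_continuous[OF assms(1)])
  ultimately show ?thesis by (auto simp: increasing_path_def step_path_def)
qed

lemma step_path_cong: "(\<And>j. j < m \<Longrightarrow> d j = d' j) \<Longrightarrow> step_path \<delta> m d = step_path \<delta> m d'"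
  unfolding step_path_def by (intro restrict_ext sum.cong) auto

text \<open>The two paths share their jump times, so the identity serves as time change and only the
  partial sums differ.\<close>

lemma step_path_J1_close:
  assumes "\<And>j. j < m \<Longrightarrow> 0 \<le> d j" "\<And>j. j < m \<Longrightarrow> 0 \<le> d' j"
  shows "J1_close (\<Sum>j<m. \<bar>d j - d' j\<bar>) (step_path \<delta> m d) (step_path \<delta> m d')"
  unfolding J1_close_def
proof (rule bexI[OF _ id_time_change], intro allI impI conjI)
  fix t :: real assume t: "0 \<le> t"
  let ?k = "min m (nat \<lfloor>t / \<delta>\<rfloor>)"
  show "\<bar>t - t\<bar> \<le> (\<Sum>j<m. \<bar>d j - d' j\<bar>)" by (simp add: sum_nonneg)
  have "\<bar>exp (- t - (\<Sum>j<?k. d j)) - exp (- t - (\<Sum>j<?k. d' j))\<bar>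
      \<le> \<bar>(- t - (\<Sum>j<?k. d j)) - (- t - (\<Sum>j<?k. d' j))\<bar>"
  proof (rule abs_exp_diff_le)
    have "0 \<le> (\<Sum>j<?k. d j)" "0 \<le> (\<Sum>j<?k. d' j)" using assms by (auto intro!: sum_nonneg)
    then show "- t - (\<Sum>j<?k. d j) \<le> 0" "- t - (\<Sum>j<?k. d' j) \<le> 0" using t by linarith+
  qed
  also have "\<dots> = \<bar>\<Sum>j<?k. d' j - d j\<bar>" by (simp add: sum_subtractf)
  also have "\<dots> \<le> (\<Sum>j<?k. \<bar>d j - d' j\<bar>)"
    by (rule order_trans[OF sum_abs]) (simp add: abs_minus_commute)
  also have "\<dots> \<le> (\<Sum>j<m. \<bar>d j - d' j\<bar>)" by (rule sum_mono2) auto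
  finally show "\<bar>exp (- t - step_path \<delta> m d t) - exp (- t - step_path \<delta> m d' t)\<bar> \<le> (\<Sum>j<m. \<bar>d j - d' j\<bar>)"
    using t by (simp add: step_path_def)
qed

lemma tendsto_coordinate:
  fixes x :: "nat \<Rightarrow> nat \<Rightarrow> real"
  assumes "x \<longlonglongrightarrow> l" shows "(\<lambda>n. x n j) \<longlonglongrightarrow> l j"
  using continuous_on_tendsto_compose[OF continuous_on_product_coordinates[of j] assms] by simp

text \<open>The absolute values make every sequence a legitimate list of increments. Without effect
  on the nonnegative increments of increasing paths, they let continuity be stated on the whole
  product space.\<close>

lemma continuous_on_step_path_functional:
  assumes h: "path_continuous h" and \<delta>: "0 < \<delta>"
  shows "continuous_on UNIV (\<lambda>d. h (step_path \<delta> m (\<lambda>j. \<bar>d j\<bar>)))"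
proof (rule continuous_on_sequentiallyI)
  fix u :: "nat \<Rightarrow> nat \<Rightarrow> real" and a assume u: "u \<longlonglongrightarrow> a"
  let ?y = "\<lambda>d :: nat \<Rightarrow> real. step_path \<delta> m (\<lambda>j. \<bar>d j\<bar>)"
  show "(\<lambda>n. h (?y (u n))) \<longlonglongrightarrow> h (?y a)"
  proof (rule tendstoI)
    fix e :: real assume "0 < e"
    have "increasing_path (?y a)" using \<delta> by (intro step_path_increasing) auto
    then obtain r where r: "0 < r" "\<And>y. y \<in> skorokhod_space \<Longrightarrow> J1_close r (?y a) y \<Longrightarrow> \<bar>h y - h (?y a)\<bar> < e"
      using h \<open>0 < e\<close> unfolding path_continuous_def by meson
    have "(\<lambda>n. \<Sum>j<m. \<bar>\<bar>a j\<bar> - \<bar>u n j\<bar>\<bar>) \<longlonglongrightarrow> (\<Sum>j<m. \<bar>\<bar>a j\<bar> - \<bar>a j\<bar>\<bar>)"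
      by (intro tendsto_intros tendsto_coordinate u)
    then have "\<forall>\<^sub>F n in sequentially. (\<Sum>j<m. \<bar>\<bar>a j\<bar> - \<bar>u n j\<bar>\<bar>) < r"
      using r(1) by (intro order_tendstoD(2)) auto
    then show "\<forall>\<^sub>F n in sequentially. dist (h (?y (u n))) (h (?y a)) < e"
    proof eventually_elim
      case (elim n)
      have "J1_close (\<Sum>j<m. \<bar>\<bar>a j\<bar> - \<bar>u n j\<bar>\<bar>) (?y a) (?y (u n))" by (rule step_path_J1_close) auto
      then have "J1_close r (?y a) (?y (u n))" using elim by (intro J1_close_mono[of _ _ _ r]) auto
      then show ?case using r(2) step_path_skorokhod[OF \<delta>] by (simp add: dist_real_def)
    qed
  qed
qed

section \<open>Measurability of functionals of increasing processes\<close>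

definition increasing_process :: "'p measure \<Rightarrow> ('p \<Rightarrow> real \<Rightarrow> real) \<Rightarrow> bool" where
  "increasing_process P A \<longleftrightarrow> prob_space P \<and> (\<forall>w\<in>space P. increasing_path (A w)) \<and>
     (\<forall>t\<ge>0. (\<lambda>w. A w t) \<in> borel_measurable P)"

lemma grid_increment_measurable:
  assumes "increasing_process P A" "0 < \<delta>"
  shows "(\<lambda>w. grid_increment \<delta> (A w) j) \<in> borel_measurable P"
proof -
  have "(\<lambda>w. A w t) \<in> borel_measurable P" if "0 \<le> t" for t
    using assms(1) that by (simp add: increasing_process_def)
  then show ?thesis unfolding grid_increment_def using assms(2) by (intro borel_measurable_diff) simp_all
qed

lemma step_path_functional_measurable:
  assumes h: "path_continuous h" and A: "increasing_process P A" and \<delta>: "0 < \<delta>"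
  shows "(\<lambda>w. h (step_path \<delta> m (grid_increment \<delta> (A w)))) \<in> borel_measurable P"
proof -
  have 1: "(\<lambda>w. grid_increment \<delta> (A w)) \<in> borel_measurable P"
    by (rule measurable_coordinatewise_then_product) (rule grid_increment_measurable[OF A \<delta>])
  have "(\<lambda>d. h (step_path \<delta> m (\<lambda>j. \<bar>d j\<bar>))) \<in> borel_measurable borel"
    by (rule borel_measurable_continuous_onI[OF continuous_on_step_path_functional[OF h \<delta>]])
  then have "(\<lambda>w. h (step_path \<delta> m (\<lambda>j. \<bar>grid_increment \<delta> (A w) j\<bar>))) \<in> borel_measurable P"
    using measurable_compose[OF 1] by blast
  then show ?thesis
    using A grid_increment_nonneg[OF _ \<delta>]
    by (subst measurable_cong[where g = "\<lambda>w. h (step_path \<delta> m (\<lambda>j. \<bar>grid_increment \<delta> (A w) j\<bar>))"])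
       (simp_all add: increasing_process_def)
qed

lemma skeleton_functional_measurable:
  assumes "path_continuous h" "increasing_process P A"
  shows "(\<lambda>w. h (skeleton l (A w))) \<in> borel_measurable P"
  unfolding skeleton_def using assms by (intro step_path_functional_measurable) auto

lemma skeleton_functional_tendsto:
  assumes h: "path_continuous h" and x: "increasing_path x"
  shows "(\<lambda>l. h (skeleton l x)) \<longlonglongrightarrow> h x"
proof (rule tendstoI)
  fix e :: real assume "0 < e"
  then obtain r where r: "0 < r" "\<And>y. y \<in> skorokhod_space \<Longrightarrow> J1_close r x y \<Longrightarrow> \<bar>h y - h x\<bar> < e"
    using h x unfolding path_continuous_def by meson
  show "\<forall>\<^sub>F l in sequentially. dist (h (skeleton l x)) (h x) < e"
    using skeleton_eventually_J1_close[OF x r(1)]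
    by eventually_elim (use r(2) skeleton_skorokhod J1_close_sym in \<open>auto simp: dist_real_def\<close>)
qed

text \<open>A pointwise limit of functions of finitely many increments; no sigma-algebra on the path
  space enters.\<close>

lemma path_functional_measurable:
  assumes h: "path_continuous h" and A: "increasing_process P A"
  shows "(\<lambda>w. h (A w)) \<in> borel_measurable P"
proof (rule borel_measurable_LIMSEQ_real)
  show "(\<lambda>w. h (skeleton l (A w))) \<in> borel_measurable P" for l
    by (rule skeleton_functional_measurable[OF h A])
  show "(\<lambda>l. h (skeleton l (A w))) \<longlonglongrightarrow> h (A w)" if "w \<in> space P" for w
    using A that by (intro skeleton_functional_tendsto[OF h]) (simp add: increasing_process_def)
qed

section \<open>Polynomials in the exponentials of the increments\<close>

definition unit_cube :: "nat \<Rightarrow> (nat \<Rightarrow> real) set" where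
  "unit_cube m = {u. \<forall>j. u j \<in> (if j < m then {0..1} else {0})}"

lemma compact_unit_cube: "compact (unit_cube m)"
proof -
  have "unit_cube m = PiE UNIV (\<lambda>j. if j < m then {0..1} else {0})"
    by (auto simp: unit_cube_def PiE_def Pi_def)
  moreover have "compactin (product_topology (\<lambda>j. euclidean) UNIV) (PiE UNIV (\<lambda>j::nat. if j < m then {0..1::real} else {0}))"
    by (auto simp: compactin_PiE)
  ultimately show ?thesis by (simp add: euclidean_product_topology)
qed

text \<open>Polynomials in the first \<open>m\<close> coordinates, generated from monomials because
  monomials in the exponentials of the increments are the integrands of Laplace transforms.\<close>

inductive_set monomial_sums :: "nat \<Rightarrow> ((nat \<Rightarrow> real) \<Rightarrow> real) set" for m where
  monomial: "(\<lambda>u. c * (\<Prod>j<m. u j ^ e j)) \<in> monomial_sums m"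
| add: "f \<in> monomial_sums m \<Longrightarrow> g \<in> monomial_sums m \<Longrightarrow> (\<lambda>u. f u + g u) \<in> monomial_sums m"

lemma monomial_sums_mult:
  assumes "f \<in> monomial_sums m" "g \<in> monomial_sums m"
  shows "(\<lambda>u. f u * g u) \<in> monomial_sums m"
proof -
  have *: "(\<lambda>u. f u * (c * (\<Prod>j<m. u j ^ e j))) \<in> monomial_sums m"
    if "f \<in> monomial_sums m" for f c e
    using that
  proof induction
    case (monomial c' e')
    have "(\<lambda>u. c' * (\<Prod>j<m. u j ^ e' j) * (c * (\<Prod>j<m. u j ^ e j)))
        = (\<lambda>u. (c' * c) * (\<Prod>j<m. u j ^ (e' j + e j)))"
      by (simp add: power_add prod.distrib mult_ac)
    then show ?case by (simp only: monomial_sums.monomial)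
  next
    case (add f g)
    then show ?case by (simp add: distrib_right monomial_sums.add)
  qed
  show ?thesis using assms(2)
  proof induction
    case (monomial c e)
    then show ?case using *[OF assms(1)] .
  next
    case (add f' g')
    then show ?case by (simp add: distrib_left monomial_sums.add)
  qed
qed

lemma monomial_sums_continuous: "f \<in> monomial_sums m \<Longrightarrow> continuous_on S f"
proof (induction rule: monomial_sums.induct)
  case (monomial c e)
  have "continuous_on S (\<lambda>u. u j)" for j :: nat
    by (rule continuous_on_subset[OF continuous_on_product_coordinates]) simp
  then show ?case by (intro continuous_intros)
next
  case (add f g)
  then show ?case by (intro continuous_intros)
qed

text \<open>Stone-Weierstrass. The coordinates from \<open>m\<close> on are pinned to 0 in the cube,
  so the first \<open>m\<close> coordinates separate its points although it sits in a space of
  sequences.\<close>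

lemma monomial_sums_dense:
  fixes G :: "(nat \<Rightarrow> real) \<Rightarrow> real"
  assumes G: "continuous_on (unit_cube m) G" and e: "0 < e"
  shows "\<exists>g\<in>monomial_sums m. \<forall>u\<in>unit_cube m. \<bar>G u - g u\<bar> < e"
proof -
  have coord: "(\<lambda>u. u i) \<in> monomial_sums m" if "i < m" for i
  proof -
    have "(\<Prod>j<m. u j ^ (if j = i then 1 else 0)) = u i" for u :: "nat \<Rightarrow> real"
      using that by (subst prod.remove[of _ i]) auto
    then show ?thesis using monomial_sums.monomial[where m = m and c = 1 and e = "\<lambda>j. if j = i then 1 else 0"] by simp
  qed
  interpret function_ring_on "monomial_sums m" "unit_cube m"
  proof
    show "(\<lambda>_. c) \<in> monomial_sums m" for c
      using monomial_sums.monomial[where m = m and c = c and e = "\<lambda>_. 0"] by simp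
    fix x y assume xy: "x \<in> unit_cube m" "y \<in> unit_cube m" "x \<noteq> y"
    then obtain i where i: "x i \<noteq> y i" by auto
    have "i < m"
    proof (rule ccontr)
      assume "\<not> i < m"
      then have "x i \<in> {0}" "y i \<in> {0}" using xy(1,2) unfolding unit_cube_def by (auto dest!: spec[of _ i])
      then show False using i by simp
    qed
    then show "\<exists>f\<in>monomial_sums m. f x \<noteq> f y" using i by (intro bexI[OF _ coord[OF \<open>i < m\<close>]])
  qed (auto intro: compact_unit_cube monomial_sums_continuous monomial_sums.add monomial_sums_mult)
  show ?thesis by (rule Stone_Weierstrass_basic[OF G e])
qed

text \<open>Maps the noncompact range of the increments into the compact cube; increments escaping
  to infinity approach the faces where a coordinate is 0.\<close>

definition exp_vector :: "nat \<Rightarrow> (nat \<Rightarrow> real) \<Rightarrow> nat \<Rightarrow> real" where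
  "exp_vector m d j = (if j < m then exp (- d j) else 0)"

lemma exp_vector_unit_cube: "(\<And>j. j < m \<Longrightarrow> 0 \<le> d j) \<Longrightarrow> exp_vector m d \<in> unit_cube m"
  by (auto simp: unit_cube_def exp_vector_def)

text \<open>Only natural multipliers occur, so convergence of Laplace transforms at natural
  arguments is enough for all polynomials.\<close>

lemma monomial_exp_vector:
  "(\<Prod>j<m. exp_vector m d j ^ e j) = exp (- (\<Sum>j<m. real (e j) * d j))"
proof -
  have "(\<Prod>j<m. exp_vector m d j ^ e j) = (\<Prod>j<m. exp (- (real (e j) * d j)))"
    by (intro prod.cong) (auto simp: exp_vector_def simp flip: exp_of_nat_mult)
  also have "\<dots> = exp (\<Sum>j<m. - (real (e j) * d j))" by (simp only: exp_sum finite_lessThan)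
  finally show ?thesis by (simp only: sum_negf)
qed

lemma monomial_sums_integrable:
  assumes "prob_space P" "\<And>j. j < m \<Longrightarrow> (\<lambda>w. D w j) \<in> borel_measurable P"
    and "\<And>j w. w \<in> space P \<Longrightarrow> j < m \<Longrightarrow> 0 \<le> D w j" and "g \<in> monomial_sums m"
  shows "integrable P (\<lambda>w. g (exp_vector m (D w)))"
  using assms(4)
proof induction
  case (monomial c e)
  interpret prob_space P by fact
  have "integrable P (\<lambda>w. exp (- (\<Sum>j<m. real (e j) * D w j)))"
  proof (rule integrable_const_bound[where B = 1])
    show "AE w in P. norm (exp (- (\<Sum>j<m. real (e j) * D w j))) \<le> 1"
      using assms(3) by (intro AE_I2) (auto intro!: sum_nonneg)
    show "(\<lambda>w. exp (- (\<Sum>j<m. real (e j) * D w j))) \<in> borel_measurable P"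
      using assms(2) by (intro measurable_compose[OF _ borel_measurable_exp] borel_measurable_uminus borel_measurable_sum borel_measurable_times) auto
  qed
  then show ?case by (simp add: monomial_exp_vector)
next
  case (add f g)
  then show ?case by simp
qed

text \<open>\<open>G\<close> is continuous on the cube only, hence the detour through polynomials,
  which give measurable functions of the increments and approximate \<open>G\<close>
  uniformly.\<close>

lemma exp_vector_functional_measurable:
  fixes G :: "(nat \<Rightarrow> real) \<Rightarrow> real"
  assumes P: "prob_space P" "\<And>j. j < m \<Longrightarrow> (\<lambda>w. D w j) \<in> borel_measurable P"
    and nn: "\<And>j w. w \<in> space P \<Longrightarrow> j < m \<Longrightarrow> 0 \<le> D w j" and G: "continuous_on (unit_cube m) G"
  shows "(\<lambda>w. G (exp_vector m (D w))) \<in> borel_measurable P"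
proof -
  have "\<exists>g\<in>monomial_sums m. \<forall>u\<in>unit_cube m. \<bar>G u - g u\<bar> < 1 / real (Suc i)" for i
    by (rule monomial_sums_dense[OF G]) simp
  then obtain g where g: "\<And>i. g i \<in> monomial_sums m"
    "\<And>i u. u \<in> unit_cube m \<Longrightarrow> \<bar>G u - g i u\<bar> < 1 / real (Suc i)" by metis
  show ?thesis
  proof (rule borel_measurable_LIMSEQ_real)
    fix i show "(\<lambda>w. g i (exp_vector m (D w))) \<in> borel_measurable P"
      using monomial_sums_integrable[OF P nn g(1)] by (rule borel_measurable_integrable)
  next
    fix w assume "w \<in> space P"
    then have u: "exp_vector m (D w) \<in> unit_cube m" using nn exp_vector_unit_cube by blast
    have "(\<lambda>i. g i (exp_vector m (D w)) - G (exp_vector m (D w))) \<longlonglongrightarrow> 0"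
      using g(2)[OF u] by (intro Lim_null_comparison[OF _ LIMSEQ_inverse_real_of_nat] always_eventually)
        (auto simp: abs_minus_commute inverse_eq_divide less_imp_le)
    then show "(\<lambda>i. g i (exp_vector m (D w))) \<longlonglongrightarrow> G (exp_vector m (D w))"
      by (simp add: LIM_zero_iff)
  qed
qed

lemma (in prob_space) integral_abs_diff_le:
  fixes f g :: "'a \<Rightarrow> real"
  assumes "integrable M f" "integrable M g" "\<And>w. w \<in> space M \<Longrightarrow> \<bar>f w - g w\<bar> \<le> e"
  shows "\<bar>(\<integral>w. f w \<partial>M) - (\<integral>w. g w \<partial>M)\<bar> \<le> e"
proof -
  have "\<bar>(\<integral>w. f w \<partial>M) - (\<integral>w. g w \<partial>M)\<bar> = \<bar>\<integral>w. f w - g w \<partial>M\<bar>" using assms by simp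
  also have "\<dots> \<le> (\<integral>w. \<bar>f w - g w\<bar> \<partial>M)" by (rule integral_abs_bound)
  also have "\<dots> \<le> (\<integral>w. e \<partial>M)" using assms by (intro integral_mono) auto
  finally show ?thesis by (simp add: prob_space)
qed

lemma exp_vector_functional_integrable:
  fixes G :: "(nat \<Rightarrow> real) \<Rightarrow> real"
  assumes P: "prob_space P" "\<And>j. j < m \<Longrightarrow> (\<lambda>w. D w j) \<in> borel_measurable P"
    and nn: "\<And>j w. w \<in> space P \<Longrightarrow> j < m \<Longrightarrow> 0 \<le> D w j" and G: "continuous_on (unit_cube m) G"
  shows "integrable P (\<lambda>w. G (exp_vector m (D w)))"
proof -
  interpret prob_space P by fact
  obtain B where B: "\<And>u. u \<in> unit_cube m \<Longrightarrow> \<bar>G u\<bar> \<le> B"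
    using compact_imp_bounded[OF compact_continuous_image[OF G compact_unit_cube]]
    by (auto simp: bounded_iff)
  show ?thesis
  proof (rule integrable_const_bound[where B = B])
    show "AE w in P. norm (G (exp_vector m (D w))) \<le> B"
      using B nn exp_vector_unit_cube by (intro AE_I2) auto
  qed (rule exp_vector_functional_measurable[OF assms])
qed

lemma exp_vector_functional_approx:
  fixes G :: "(nat \<Rightarrow> real) \<Rightarrow> real"
  assumes P: "prob_space P" "\<And>j. j < m \<Longrightarrow> (\<lambda>w. D w j) \<in> borel_measurable P"
      "\<And>j w. w \<in> space P \<Longrightarrow> j < m \<Longrightarrow> 0 \<le> D w j"
    and G: "continuous_on (unit_cube m) G"
    and g: "g \<in> monomial_sums m" "\<And>u. u \<in> unit_cube m \<Longrightarrow> \<bar>G u - g u\<bar> \<le> e"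
  shows "\<bar>(\<integral>w. G (exp_vector m (D w)) \<partial>P) - (\<integral>w. g (exp_vector m (D w)) \<partial>P)\<bar> \<le> e"
proof (rule prob_space.integral_abs_diff_le[OF P(1)])
  show "integrable P (\<lambda>w. G (exp_vector m (D w)))" by (rule exp_vector_functional_integrable[OF P G])
  show "integrable P (\<lambda>w. g (exp_vector m (D w)))" by (rule monomial_sums_integrable[OF P g(1)])
  show "\<bar>G (exp_vector m (D w)) - g (exp_vector m (D w))\<bar> \<le> e" if "w \<in> space P" for w
    using P(3)[OF that] by (intro g(2) exp_vector_unit_cube)
qed

text \<open>For polynomials convergence follows from \<open>lap\<close> by linearity. Replacing
  \<open>G\<close> by a polynomial costs at most \<open>e / 3\<close> under each of the laws,
  whatever \<open>n\<close> is.\<close>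

lemma exp_vector_functional_tendsto:
  fixes D :: "nat \<Rightarrow> 'p \<Rightarrow> nat \<Rightarrow> real" and D' :: "'q \<Rightarrow> nat \<Rightarrow> real"
    and G :: "(nat \<Rightarrow> real) \<Rightarrow> real"
  assumes P: "\<And>n. prob_space (P n)" "\<And>n j. j < m \<Longrightarrow> (\<lambda>w. D n w j) \<in> borel_measurable (P n)"
      "\<And>n j w. w \<in> space (P n) \<Longrightarrow> j < m \<Longrightarrow> 0 \<le> D n w j"
    and N: "prob_space N" "\<And>j. j < m \<Longrightarrow> (\<lambda>w. D' w j) \<in> borel_measurable N"
      "\<And>j w. w \<in> space N \<Longrightarrow> j < m \<Longrightarrow> 0 \<le> D' w j"
    and lap: "\<And>q :: nat \<Rightarrow> nat. (\<lambda>n. \<integral>w. exp (- (\<Sum>j<m. real (q j) * D n w j)) \<partial>P n)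
      \<longlonglongrightarrow> (\<integral>w. exp (- (\<Sum>j<m. real (q j) * D' w j)) \<partial>N)"
    and G: "continuous_on (unit_cube m) G"
  shows "(\<lambda>n. \<integral>w. G (exp_vector m (D n w)) \<partial>P n) \<longlonglongrightarrow> (\<integral>w. G (exp_vector m (D' w)) \<partial>N)"
proof (rule LIMSEQ_I)
  fix e :: real assume e: "0 < e"
  obtain g where g: "g \<in> monomial_sums m" "\<And>u. u \<in> unit_cube m \<Longrightarrow> \<bar>G u - g u\<bar> < e / 3"
    using monomial_sums_dense[OF G, of "e / 3"] e by auto
  have gP: "integrable (P n) (\<lambda>w. g (exp_vector m (D n w)))" for n
    using g(1) P by (intro monomial_sums_integrable) auto
  have gN: "integrable N (\<lambda>w. g (exp_vector m (D' w)))"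
    using g(1) N by (intro monomial_sums_integrable) auto
  have "(\<lambda>n. \<integral>w. g (exp_vector m (D n w)) \<partial>P n) \<longlonglongrightarrow> (\<integral>w. g (exp_vector m (D' w)) \<partial>N)"
    using g(1)
  proof induction
    case (monomial c q)
    then show ?case using tendsto_mult[OF tendsto_const lap] by (simp add: monomial_exp_vector)
  next
    case (add f1 f2)
    have "integrable (P n) (\<lambda>w. f (exp_vector m (D n w)))" "integrable N (\<lambda>w. f (exp_vector m (D' w)))"
      if "f \<in> monomial_sums m" for f n
      using that P N by (intro monomial_sums_integrable; auto)+
    then show ?case using tendsto_add[OF add.IH] add.hyps by simp
  qed
  from LIMSEQ_D[OF this, of "e / 3"] obtain n0 where n0: "\<And>n. n \<ge> n0 \<Longrightarrow>
      \<bar>(\<integral>w. g (exp_vector m (D n w)) \<partial>P n) - (\<integral>w. g (exp_vector m (D' w)) \<partial>N)\<bar> < e / 3"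
    using e by auto
  have close: "\<bar>(\<integral>w. G (exp_vector m (D n w)) \<partial>P n) - (\<integral>w. g (exp_vector m (D n w)) \<partial>P n)\<bar> \<le> e / 3"
      "\<bar>(\<integral>w. G (exp_vector m (D' w)) \<partial>N) - (\<integral>w. g (exp_vector m (D' w)) \<partial>N)\<bar> \<le> e / 3" for n
    by (rule exp_vector_functional_approx[OF P G g(1) less_imp_le[OF g(2)]]; assumption)
       (rule exp_vector_functional_approx[OF N G g(1) less_imp_le[OF g(2)]]; assumption)
  have "norm ((\<integral>w. G (exp_vector m (D n w)) \<partial>P n) - (\<integral>w. G (exp_vector m (D' w)) \<partial>N)) < e" if "n \<ge> n0" for n
    using close(1)[of n] close(2) n0[OF that] by (simp only: real_norm_def)
  then show "\<exists>no. \<forall>n\<ge>no. norm ((\<integral>w. G (exp_vector m (D n w)) \<partial>P n) - (\<integral>w. G (exp_vector m (D' w)) \<partial>N)) < e"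
    by blast
qed

text \<open>Vanishes for \<open>v \<le> exp (- real K)\<close> and equals 1 from
  \<open>2 * exp (- real K)\<close> on. For \<open>v = exp (- d)\<close> this says that increments
  from \<open>K\<close> on are discarded and those up to \<open>K - ln 2\<close> are kept with full
  weight.\<close>

definition cutoff :: "nat \<Rightarrow> real \<Rightarrow> real" where
  "cutoff K v = min 1 (max 0 (exp (real K) * v - 1))"

text \<open>
  In the coordinates \<open>u\<^sub>j = exp (- d\<^sub>j)\<close> a functional of the increments \<open>d\<^sub>j\<close> need not extend
  continuously to the faces \<open>u\<^sub>j = 0\<close> of the cube, hence the cutoff.
\<close>

definition cut_functional ::
  "((real \<Rightarrow> real) \<Rightarrow> real) \<Rightarrow> real \<Rightarrow> nat \<Rightarrow> nat \<Rightarrow> (nat \<Rightarrow> real) \<Rightarrow> real" where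
  "cut_functional h \<delta> m K u =
     h (step_path \<delta> m (\<lambda>j. \<bar>ln (max (u j) (exp (- real K)))\<bar>)) * (\<Prod>j<m. cutoff K (u j))"

text \<open>The maximum with \<open>exp (- real K)\<close> keeps the logarithm continuous, and it
  alters the first \<open>m\<close> coordinates only where the product of cutoffs is 0.\<close>

lemma cut_functional_continuous:
  assumes h: "path_continuous h" and \<delta>: "0 < \<delta>"
  shows "continuous_on S (cut_functional h \<delta> m K)"
proof -
  have c: "continuous_on S (\<lambda>u. u j)" for j :: nat
    by (rule continuous_on_subset[OF continuous_on_product_coordinates]) simp
  have "continuous_on S (\<lambda>u j. ln (max (u j) (exp (- real K))))"
  proof (rule continuous_on_coordinatewise_then_product)
    fix j :: nat
    have "0 < max (u j) (exp (- real K))" for u :: "nat \<Rightarrow> real"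
      by (simp add: less_max_iff_disj)
    then have "max (u j) (exp (- real K)) \<noteq> 0" for u :: "nat \<Rightarrow> real"
      by (metis less_irrefl)
    then show "continuous_on S (\<lambda>u. ln (max (u j) (exp (- real K))))"
      by (intro continuous_on_ln continuous_on_max c continuous_on_const ballI)
  qed
  from continuous_on_compose2[OF continuous_on_step_path_functional[OF h \<delta>] this subset_UNIV]
  have "continuous_on S (\<lambda>u. h (step_path \<delta> m (\<lambda>j. \<bar>ln (max (u j) (exp (- real K)))\<bar>)))" .
  moreover have "continuous_on S (\<lambda>u. \<Prod>j<m. cutoff K (u j))"
    unfolding cutoff_def
    by (intro continuous_on_prod continuous_on_min continuous_on_max continuous_on_diff
        continuous_on_mult continuous_on_const c)
  ultimately show ?thesis
    unfolding cut_functional_def by (rule continuous_on_mult)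
qed

lemma cutoff_bounds: "0 \<le> cutoff K v" "cutoff K v \<le> 1"
  by (auto simp: cutoff_def)

lemma cutoff_prod_bounds: "0 \<le> (\<Prod>j<m. cutoff K (u j))" "(\<Prod>j<m. cutoff K (u j)) \<le> 1"
  by (simp_all add: prod_nonneg prod_le_1 cutoff_bounds)

lemma cut_functional_eq:
  assumes d: "\<And>j. j < m \<Longrightarrow> 0 \<le> d j" and nz: "\<And>j. j < m \<Longrightarrow> cutoff K (exp (- d j)) \<noteq> 0"
  shows "cut_functional h \<delta> m K (exp_vector m d) = h (step_path \<delta> m d) * (\<Prod>j<m. cutoff K (exp (- d j)))"
proof -
  have "\<bar>ln (max (exp_vector m d j) (exp (- real K)))\<bar> = d j" if j: "j < m" for j
  proof -
    have "1 < exp (real K) * exp (- d j)" using nz[OF j] by (auto simp: cutoff_def)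
    then have "exp (- real K) < exp (- d j)"
      by (simp add: exp_minus field_simps)
    then have "max (exp_vector m d j) (exp (- real K)) = exp (- d j)"
      using j by (simp add: exp_vector_def)
    then show ?thesis using d[OF j] by simp
  qed
  then have "step_path \<delta> m (\<lambda>j. \<bar>ln (max (exp_vector m d j) (exp (- real K)))\<bar>) = step_path \<delta> m d"
    by (rule step_path_cong)
  moreover have "(\<Prod>j<m. cutoff K (exp_vector m d j)) = (\<Prod>j<m. cutoff K (exp (- d j)))"
    by (intro prod.cong) (auto simp: exp_vector_def)
  ultimately show ?thesis by (simp add: cut_functional_def)
qed

lemma cut_functional_le:
  assumes d: "\<And>j. j < m \<Longrightarrow> 0 \<le> d j" and h: "0 \<le> h (step_path \<delta> m d)"
  shows "cut_functional h \<delta> m K (exp_vector m d) \<le> h (step_path \<delta> m d)"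
proof (cases "\<exists>j<m. cutoff K (exp (- d j)) = 0")
  case True
  then obtain j where j: "j < m" "cutoff K (exp (- d j)) = 0" by auto
  then have "\<exists>j\<in>{..<m}. cutoff K (exp_vector m d j) = 0"
    by (intro bexI[of _ j]) (auto simp: exp_vector_def)
  then have "(\<Prod>j<m. cutoff K (exp_vector m d j)) = 0"
    by (intro prod_zero) auto
  then have "cut_functional h \<delta> m K (exp_vector m d) = 0" by (simp only: cut_functional_def mult_zero_right)
  then show ?thesis using h by simp
next
  case False
  then have "cut_functional h \<delta> m K (exp_vector m d) = h (step_path \<delta> m d) * (\<Prod>j<m. cutoff K (exp (- d j)))"
    using d by (intro cut_functional_eq) auto
  also have "\<dots> \<le> h (step_path \<delta> m d) * 1"
    using h cutoff_prod_bounds(2)[of K "\<lambda>j. exp (- d j)" m] by (intro mult_left_mono) auto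
  finally show ?thesis by simp
qed

lemma cut_functional_tendsto:
  assumes d: "\<And>j. j < m \<Longrightarrow> 0 \<le> d j"
  shows "(\<lambda>K. cut_functional h \<delta> m K (exp_vector m d)) \<longlonglongrightarrow> h (step_path \<delta> m d)"
proof -
  \<comment> \<open>The sum dominates each increment, and \<open>ln 2\<close> is the margin between
    the points where the cutoff is 0 and where it is 1.\<close>
  obtain K0 :: nat where K0: "(\<Sum>j<m. d j) + ln 2 \<le> real K0" using real_arch_simple by blast
  have "cut_functional h \<delta> m K (exp_vector m d) = h (step_path \<delta> m d)" if K: "K0 \<le> K" for K
  proof -
    have 1: "cutoff K (exp (- d j)) = 1" if j: "j < m" for j
    proof -
      have "d j \<le> (\<Sum>j<m. d j)" using d j by (intro member_le_sum) auto
      moreover have "real K0 \<le> real K" using K by simp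
      ultimately have "ln 2 \<le> real K - d j" using K0 by linarith
      then have "exp (ln 2) \<le> exp (real K - d j)" by (simp only: exp_le_cancel_iff)
      then have "2 \<le> exp (real K) * exp (- d j)" by (simp add: exp_diff exp_minus divide_inverse)
      then show ?thesis by (simp add: cutoff_def)
    qed
    have "cut_functional h \<delta> m K (exp_vector m d) = h (step_path \<delta> m d) * (\<Prod>j<m. cutoff K (exp (- d j)))"
      using d 1 by (intro cut_functional_eq) auto
    also have "(\<Prod>j<m. cutoff K (exp (- d j))) = 1" using 1 by (intro prod.neutral) auto
    finally show ?thesis by simp
  qed
  then have "\<forall>\<^sub>F K in sequentially. cut_functional h \<delta> m K (exp_vector m d) = h (step_path \<delta> m d)"
    using eventually_sequentially by blast
  then show ?thesis by (rule tendsto_eventually)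
qed

text \<open>Along the sequence the cut functional serves only as a minorant, so increments escaping
  to infinity do no harm and no tightness is asked. How well it approximates matters for the limit
  law alone, where dominated convergence applies. This is why the claim is a lower bound.\<close>

lemma step_path_functional_liminf:
  assumes A: "\<And>n. increasing_process (P n) (A n)" and Z: "increasing_process N Z"
    and \<delta>: "0 < \<delta>"
    and lap: "\<And>q :: nat \<Rightarrow> nat.
      (\<lambda>n. \<integral>w. exp (- (\<Sum>j<m. real (q j) * grid_increment \<delta> (A n w) j)) \<partial>P n)
      \<longlonglongrightarrow> (\<integral>w. exp (- (\<Sum>j<m. real (q j) * grid_increment \<delta> (Z w) j)) \<partial>N)"
    and h: "path_continuous h" "\<And>y. y \<in> skorokhod_space \<Longrightarrow> 0 \<le> h y" "\<And>y. y \<in> skorokhod_space \<Longrightarrow> h y \<le> B"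
    and e: "0 < e"
  shows "\<forall>\<^sub>F n in sequentially. (\<integral>w. h (step_path \<delta> m (grid_increment \<delta> (Z w))) \<partial>N) - e
    \<le> (\<integral>w. h (step_path \<delta> m (grid_increment \<delta> (A n w))) \<partial>P n)"
proof -
  let ?g = "\<lambda>x. h (step_path \<delta> m (grid_increment \<delta> x))"
  let ?c = "\<lambda>K x. cut_functional h \<delta> m K (exp_vector m (grid_increment \<delta> x))"
  interpret N: prob_space N using Z by (simp add: increasing_process_def)
  have P: "prob_space (P n)" for n using A by (simp add: increasing_process_def)
  note sk = step_path_skorokhod[OF \<delta>]
  have bd: "0 \<le> ?g x" "\<bar>?g x\<bar> \<le> B" for x using h(2,3)[OF sk] by (auto simp: abs_le_iff intro: order_trans[of _ 0])
  have incZ: "0 \<le> grid_increment \<delta> (Z w) j" if "w \<in> space N" for w j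
    using Z that by (intro grid_increment_nonneg \<delta>) (simp add: increasing_process_def)
  have incA: "0 \<le> grid_increment \<delta> (A n w) j" if "w \<in> space (P n)" for n w j
    using A that by (intro grid_increment_nonneg \<delta>) (simp add: increasing_process_def)
  note cont = cut_functional_continuous[OF h(1) \<delta>]
  have cbd: "\<bar>?c K x\<bar> \<le> B" for K x
  proof -
    let ?p = "\<Prod>j<m. cutoff K (exp_vector m (grid_increment \<delta> x) j)"
    have p: "0 \<le> ?p" "?p \<le> 1" by (rule cutoff_prod_bounds)+
    show ?thesis
      using h(2)[OF sk] h(3)[OF sk] p mult_mono[OF h(3)[OF sk] p(2)]
      unfolding cut_functional_def abs_mult by (simp add: order_trans[OF h(2)[OF sk] h(3)[OF sk]])
  qed
  have "(\<lambda>K. \<integral>w. ?c K (Z w) \<partial>N) \<longlonglongrightarrow> (\<integral>w. ?g (Z w) \<partial>N)"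
  proof (rule integral_dominated_convergence[where w = "\<lambda>_. B"])
    show "(\<lambda>w. ?g (Z w)) \<in> borel_measurable N" by (rule step_path_functional_measurable[OF h(1) Z \<delta>])
    show "(\<lambda>w. ?c K (Z w)) \<in> borel_measurable N" for K
      using incZ by (intro exp_vector_functional_measurable N.prob_space_axioms cont grid_increment_measurable[OF Z \<delta>])
    show "AE w in N. (\<lambda>K. ?c K (Z w)) \<longlonglongrightarrow> ?g (Z w)"
      using incZ by (intro AE_I2 cut_functional_tendsto)
    show "AE w in N. norm (?c K (Z w)) \<le> B" for K
      using cbd by (intro AE_I2) simp
  qed simp
  from LIMSEQ_D[OF this, of "e / 2"] obtain K where
    "\<bar>(\<integral>w. ?c K (Z w) \<partial>N) - (\<integral>w. ?g (Z w) \<partial>N)\<bar> < e / 2" using e by auto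
  then have K: "(\<integral>w. ?g (Z w) \<partial>N) - e / 2 \<le> (\<integral>w. ?c K (Z w) \<partial>N)" by linarith
  have "(\<lambda>n. \<integral>w. ?c K (A n w) \<partial>P n) \<longlonglongrightarrow> (\<integral>w. ?c K (Z w) \<partial>N)"
  proof (rule exp_vector_functional_tendsto[OF P _ _ N.prob_space_axioms])
    show "(\<lambda>w. grid_increment \<delta> (A n w) j) \<in> borel_measurable (P n)" for n j
      by (rule grid_increment_measurable[OF A \<delta>])
    show "(\<lambda>w. grid_increment \<delta> (Z w) j) \<in> borel_measurable N" for j
      by (rule grid_increment_measurable[OF Z \<delta>])
  qed (use incA incZ lap cont in simp_all)
  then have "\<forall>\<^sub>F n in sequentially. (\<integral>w. ?c K (Z w) \<partial>N) - e / 2 < (\<integral>w. ?c K (A n w) \<partial>P n)"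
    using e by (intro order_tendstoD(1)) auto
  then show ?thesis
  proof eventually_elim
    case (elim n)
    interpret P: prob_space "P n" by (rule P)
    have "(\<integral>w. ?c K (A n w) \<partial>P n) \<le> (\<integral>w. ?g (A n w) \<partial>P n)"
    proof (rule integral_mono)
      show "integrable (P n) (\<lambda>w. ?g (A n w))"
        using bd by (intro P.integrable_const_bound[where B = B] AE_I2 step_path_functional_measurable[OF h(1) A \<delta>]) simp
      show "integrable (P n) (\<lambda>w. ?c K (A n w))"
        using incA by (intro exp_vector_functional_integrable P cont grid_increment_measurable[OF A \<delta>])
      show "?c K (A n w) \<le> ?g (A n w)" if "w \<in> space (P n)" for w
        using incA[OF that] bd(1) by (intro cut_functional_le)
    qed
    then show ?case using elim K by linarith
  qed
qed

text \<open>Along the sequence regularizations enter through their Lipschitz bound and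
  \<open>J1_regularization f k x \<le> f x\<close>, never through their speed of convergence.
  Sampling on the grid is the one step that needs an estimate there, and \<open>cells\<close>
  provides it. The parameters are fixed in the order \<open>k\<close>, then \<open>s\<close> and
  \<open>T\<close>, then \<open>l\<close>; \<open>n\<close> varies last.\<close>

lemma increasing_process_liminf:
  assumes A: "\<And>n. increasing_process (P n) (A n)" and Z: "increasing_process N Z"
    and lap: "\<And>l m (q :: nat \<Rightarrow> nat).
      (\<lambda>n. \<integral>w. exp (- (\<Sum>j<m. real (q j) * grid_increment (1 / real (Suc l)) (A n w) j)) \<partial>P n)
      \<longlonglongrightarrow> (\<integral>w. exp (- (\<Sum>j<m. real (q j) * grid_increment (1 / real (Suc l)) (Z w) j)) \<partial>N)"
    and cells: "\<And>\<epsilon> \<eta> T. 0 < \<epsilon> \<Longrightarrow> 0 < \<eta> \<Longrightarrow> \<forall>\<^sub>F l in sequentially. \<forall>\<^sub>F n in sequentially.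
      \<exists>C\<in>sets (P n). measure (P n) C \<le> \<eta> \<and>
        (\<forall>w\<in>space (P n) - C. single_jump_cells (1 / real (Suc l)) \<epsilon> (T * Suc l) (A n w))"
    and f: "continuous_map skorokhod_J1 euclideanreal f"
      "\<And>y. y \<in> skorokhod_space \<Longrightarrow> 0 \<le> f y" "\<And>y. y \<in> skorokhod_space \<Longrightarrow> f y \<le> B"
    and e: "0 < e"
  shows "\<forall>\<^sub>F n in sequentially. (\<integral>w. f (Z w) \<partial>N) - e \<le> (\<integral>w. f (A n w) \<partial>P n)"
proof -
  interpret N: prob_space N using Z by (simp add: increasing_process_def)
  \<comment> \<open>Five losses: regularizing and sampling under the limit law, the lower bound for
    step paths, the Lipschitz error \<open>real k * s\<close> on the good event, and
    \<open>B\<close> times the probability of the exceptional event.\<close>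
  define d where "d = e / 5"
  have d: "0 < d" "e = 5 * d" using e by (auto simp: d_def)
  let ?R = "\<lambda>k. J1_regularization f (real k)"
  have ZI: "increasing_path (Z w)" if "w \<in> space N" for w
    using Z that by (simp add: increasing_process_def)
  have AI: "increasing_path (A n w)" if "w \<in> space (P n)" for n w
    using A that by (simp add: increasing_process_def)
  have "skeleton 0 (\<lambda>_. 0) \<in> skorokhod_space" by (rule skeleton_skorokhod)
  then have B: "0 \<le> B" using f(2,3) order_trans by blast
  have R0: "0 \<le> ?R k y" if "y \<in> skorokhod_space" for k y
    using f(2) that by (intro J1_regularization_nonneg) auto
  have Rf: "?R k y \<le> f y" if "y \<in> skorokhod_space" for k y
    using f(2) that by (intro J1_regularization_le) auto
  have RB: "?R k y \<le> B" if "y \<in> skorokhod_space" for k y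
    using Rf[OF that] f(3)[OF that] by (rule order_trans)
  have Rabs: "\<bar>?R k y\<bar> \<le> B" if "y \<in> skorokhod_space" for k y
    using R0[OF that] RB[OF that] by simp
  have Rc: "path_continuous (?R k)" for k
    using f(2) by (intro path_continuous_J1_regularization) auto
  note fc = path_continuous_J1[OF f(1)]
  have "(\<lambda>k. \<integral>w. ?R k (Z w) \<partial>N) \<longlonglongrightarrow> (\<integral>w. f (Z w) \<partial>N)"
  proof (rule integral_dominated_convergence[where w = "\<lambda>_. B"])
    show "AE w in N. (\<lambda>k. ?R k (Z w)) \<longlonglongrightarrow> f (Z w)"
      using ZI by (intro AE_I2 J1_regularization_tendsto f)
    show "AE w in N. norm (?R k (Z w)) \<le> B" for k
      using Rabs[OF increasing_path_skorokhod[OF ZI]] by (intro AE_I2) simp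
  qed (simp_all add: path_functional_measurable[OF Rc Z] path_functional_measurable[OF fc Z])
  from LIMSEQ_D[OF this d(1)] obtain k where
    "\<bar>(\<integral>w. ?R k (Z w) \<partial>N) - (\<integral>w. f (Z w) \<partial>N)\<bar> < d" by auto
  then have k: "(\<integral>w. f (Z w) \<partial>N) - d \<le> (\<integral>w. ?R k (Z w) \<partial>N)" by linarith
  define s where "s = d / (real k + 1)"
  have s: "0 < s" "real k * s \<le> d" using d by (auto simp: s_def field_simps)
  obtain T where T: "exp (1 - real T) \<le> s" using exp_horizon[OF s(1)] .
  have "(\<lambda>l. \<integral>w. ?R k (skeleton l (Z w)) \<partial>N) \<longlonglongrightarrow> (\<integral>w. ?R k (Z w) \<partial>N)"
  proof (rule integral_dominated_convergence[where w = "\<lambda>_. B"])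
    show "AE w in N. (\<lambda>l. ?R k (skeleton l (Z w))) \<longlonglongrightarrow> ?R k (Z w)"
      using ZI by (intro AE_I2 skeleton_functional_tendsto[OF Rc])
    show "AE w in N. norm (?R k (skeleton l (Z w))) \<le> B" for l
      using Rabs[OF skeleton_skorokhod] by (intro AE_I2) simp
  qed (simp_all add: path_functional_measurable[OF Rc Z] skeleton_functional_measurable[OF Rc Z])
  then have ev1: "\<forall>\<^sub>F l in sequentially. (\<integral>w. ?R k (Z w) \<partial>N) - d < (\<integral>w. ?R k (skeleton l (Z w)) \<partial>N)"
    using d by (intro order_tendstoD(1)) auto
  have ev2: "\<forall>\<^sub>F l in sequentially. 1 / real (Suc l) \<le> s / 2"
    by (rule eventually_inverse_Suc_le) (use s in simp)
  have ev3: "\<forall>\<^sub>F l in sequentially. \<forall>\<^sub>F n in sequentially.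
      \<exists>C\<in>sets (P n). measure (P n) C \<le> d / (B + 1) \<and>
        (\<forall>w\<in>space (P n) - C. single_jump_cells (1 / real (Suc l)) (s / 2) (T * Suc l) (A n w))"
    by (rule cells) (use s d B in auto)
  have "\<forall>\<^sub>F l in sequentially. (\<integral>w. ?R k (Z w) \<partial>N) - d < (\<integral>w. ?R k (skeleton l (Z w)) \<partial>N) \<and>
     1 / real (Suc l) \<le> s / 2 \<and> T \<le> l \<and> (\<forall>\<^sub>F n in sequentially.
      \<exists>C\<in>sets (P n). measure (P n) C \<le> d / (B + 1) \<and>
        (\<forall>w\<in>space (P n) - C. single_jump_cells (1 / real (Suc l)) (s / 2) (T * Suc l) (A n w)))"
    by (intro eventually_conj ev1 ev2 ev3 eventually_ge_at_top)
  from eventually_happens'[OF sequentially_bot this]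
  obtain l where l: "(\<integral>w. ?R k (Z w) \<partial>N) - d < (\<integral>w. ?R k (skeleton l (Z w)) \<partial>N)"
     "1 / real (Suc l) \<le> s / 2" "T \<le> l" "\<forall>\<^sub>F n in sequentially.
      \<exists>C\<in>sets (P n). measure (P n) C \<le> d / (B + 1) \<and>
        (\<forall>w\<in>space (P n) - C. single_jump_cells (1 / real (Suc l)) (s / 2) (T * Suc l) (A n w))"
    by (elim exE conjE)
  have "\<forall>\<^sub>F n in sequentially. (\<integral>w. ?R k (skeleton l (Z w)) \<partial>N) - d \<le> (\<integral>w. ?R k (skeleton l (A n w)) \<partial>P n)"
    unfolding skeleton_def
    by (rule step_path_functional_liminf[OF A Z _ lap Rc R0 RB d(1)]) auto
  with l(4) show ?thesis
  proof eventually_elim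
    case (elim n)
    interpret P: prob_space "P n" using A[of n] by (simp add: increasing_process_def)
    obtain C where C: "C \<in> sets (P n)" "measure (P n) C \<le> d / (B + 1)"
      "\<And>w. w \<in> space (P n) - C \<Longrightarrow> single_jump_cells (1 / real (Suc l)) (s / 2) (T * Suc l) (A n w)"
      using elim(1) by auto
    have RI: "integrable (P n) (\<lambda>w. ?R k (skeleton l (A n w)))"
      using Rabs[OF skeleton_skorokhod]
      by (intro P.integrable_const_bound[where B = B] AE_I2 skeleton_functional_measurable[OF Rc A]) simp
    have fI: "integrable (P n) (\<lambda>w. f (A n w))"
      using f(2,3)[OF increasing_path_skorokhod[OF AI]]
      by (intro P.integrable_const_bound[where B = B] AE_I2 path_functional_measurable[OF fc A]) simp
    have CI: "integrable (P n) (\<lambda>w. real k * s + B * indicator C w)"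
      using C(1) by (intro Bochner_Integration.integrable_add integrable_mult_right P.integrable_const)
        (simp add: P.emeasure_eq_measure)
    have "(\<integral>w. ?R k (skeleton l (A n w)) \<partial>P n)
      \<le> (\<integral>w. f (A n w) + (real k * s + B * indicator C w) \<partial>P n)"
    proof (rule integral_mono[OF RI Bochner_Integration.integrable_add[OF fI CI]])
      fix w assume w: "w \<in> space (P n)"
      note As = increasing_path_skorokhod[OF AI[OF w]]
      have ks: "0 \<le> real k * s" using s by simp
      show "?R k (skeleton l (A n w)) \<le> f (A n w) + (real k * s + B * indicator C w)"
      proof (cases "w \<in> C")
        case True
        then show ?thesis using RB[OF skeleton_skorokhod, of k l "A n w"] f(2)[OF As] ks by simp
      next
        case False
        then have "J1_close s (skeleton l (A n w)) (A n w)"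
          using w l T s by (intro skeleton_J1_close[OF AI[OF w] s(1) l(2) T _ C(3)]) auto
        then have "?R k (skeleton l (A n w)) \<le> ?R k (A n w) + real k * s"
          using f(2) s As by (intro J1_regularization_lipschitz) auto
        then show ?thesis using Rf[OF As, of k] False by simp
      qed
    qed
    also have "\<dots> = (\<integral>w. f (A n w) \<partial>P n) + (\<integral>w. real k * s + B * indicator C w \<partial>P n)"
      by (rule Bochner_Integration.integral_add[OF fI CI])
    also have "(\<integral>w. real k * s + B * indicator C w \<partial>P n) = real k * s + B * measure (P n) C"
      using C(1) by (subst Bochner_Integration.integral_add) (auto simp: P.prob_space P.emeasure_eq_measure)
    also have "B * measure (P n) C \<le> d"
    proof -
      have "B * measure (P n) C \<le> B * (d / (B + 1))" using B C(2) by (intro mult_left_mono) auto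
      also have "\<dots> \<le> d" using B d by (simp add: field_simps)
      finally show ?thesis .
    qed
    finally show ?case using elim(2) l(1) k s(2) d(2) by linarith
  qed
qed

theorem increasing_process_weak_conv:
  assumes A: "\<And>n. increasing_process (P n) (A n)" and Z: "increasing_process N Z"
    and lap: "\<And>l m (q :: nat \<Rightarrow> nat).
      (\<lambda>n. \<integral>w. exp (- (\<Sum>j<m. real (q j) * grid_increment (1 / real (Suc l)) (A n w) j)) \<partial>P n)
      \<longlonglongrightarrow> (\<integral>w. exp (- (\<Sum>j<m. real (q j) * grid_increment (1 / real (Suc l)) (Z w) j)) \<partial>N)"
    and cells: "\<And>\<epsilon> \<eta> T. 0 < \<epsilon> \<Longrightarrow> 0 < \<eta> \<Longrightarrow> \<forall>\<^sub>F l in sequentially. \<forall>\<^sub>F n in sequentially.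
      \<exists>C\<in>sets (P n). measure (P n) C \<le> \<eta> \<and>
        (\<forall>w\<in>space (P n) - C. single_jump_cells (1 / real (Suc l)) \<epsilon> (T * Suc l) (A n w))"
  shows "weak_conv_in skorokhod_J1 P A N Z"
  unfolding weak_conv_in_def topspace_skorokhod_J1
proof (intro conjI allI ballI impI)
  show As: "A n w \<in> skorokhod_space" if "w \<in> space (P n)" for n w
    using A that by (intro increasing_path_skorokhod) (simp add: increasing_process_def)
  show Zs: "Z w \<in> skorokhod_space" if "w \<in> space N" for w
    using Z that by (intro increasing_path_skorokhod) (simp add: increasing_process_def)
  fix f assume "continuous_map skorokhod_J1 euclideanreal f \<and> bounded (f ` skorokhod_space)"
  then have f: "continuous_map skorokhod_J1 euclideanreal f" and "bounded (f ` skorokhod_space)" by auto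
  then obtain B where B: "\<And>y. y \<in> skorokhod_space \<Longrightarrow> \<bar>f y\<bar> \<le> B"
    by (auto simp: bounded_iff)
  note fc = path_continuous_J1[OF f]
  show mA: "(\<lambda>w. f (A n w)) \<in> borel_measurable (P n)" for n by (rule path_functional_measurable[OF fc A])
  show mZ: "(\<lambda>w. f (Z w)) \<in> borel_measurable N" by (rule path_functional_measurable[OF fc Z])
  interpret N: prob_space N using Z by (simp add: increasing_process_def)
  have P: "prob_space (P n)" for n using A by (simp add: increasing_process_def)
  have intA: "integrable (P n) (\<lambda>w. f (A n w))" for n
    using B As by (intro finite_measure.integrable_const_bound[OF prob_space.finite_measure[OF P], where B = B] AE_I2 mA) simp
  have intZ: "integrable N (\<lambda>w. f (Z w))"
    using B Zs by (intro N.integrable_const_bound[where B = B] AE_I2 mZ) simp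
  show "(\<lambda>n. \<integral>w. f (A n w) \<partial>P n) \<longlonglongrightarrow> (\<integral>w. f (Z w) \<partial>N)"
  proof (rule tendstoI)
    fix e :: real assume e: "0 < e"
    \<comment> \<open>Shifting by the bound makes both \<open>f\<close> and its negative
      nonnegative, which keeps the infimum in the regularization bounded below; the two lower bounds
      combine into a two-sided estimate.\<close>
    have bds: "0 \<le> f y + B" "f y + B \<le> 2 * B" "0 \<le> B - f y" "B - f y \<le> 2 * B" if "y \<in> skorokhod_space" for y
      using B[OF that] by (auto simp: abs_le_iff)
    have c1: "continuous_map skorokhod_J1 euclideanreal (\<lambda>y. f y + B)"
      by (intro continuous_map_add f) simp
    have c2: "continuous_map skorokhod_J1 euclideanreal (\<lambda>y. B - f y)"
      by (intro continuous_map_diff f) simp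
    have "\<forall>\<^sub>F n in sequentially. (\<integral>w. f (Z w) + B \<partial>N) - e / 2 \<le> (\<integral>w. f (A n w) + B \<partial>P n)"
      by (rule increasing_process_liminf[OF A Z lap cells c1 bds(1,2)]) (use e in auto)
    moreover have "\<forall>\<^sub>F n in sequentially. (\<integral>w. B - f (Z w) \<partial>N) - e / 2 \<le> (\<integral>w. B - f (A n w) \<partial>P n)"
      by (rule increasing_process_liminf[OF A Z lap cells c2 bds(3,4)]) (use e in auto)
    ultimately show "\<forall>\<^sub>F n in sequentially. dist (\<integral>w. f (A n w) \<partial>P n) (\<integral>w. f (Z w) \<partial>N) < e"
    proof eventually_elim
      case (elim n)
      interpret P: prob_space "P n" by (rule P)
      show ?case using elim e intA[of n] intZ
        by (simp add: dist_real_def P.prob_space N.prob_space)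
    qed
  qed
qed

section \<open>The Markov property of the blocks\<close>

text \<open>Each \<open>s\<close> is paired with the next grid point strictly to its right, which
  approaches \<open>s\<close> from above; right continuity in the discrete topology makes the
  indicator there eventually equal to the one at \<open>s\<close>. The same limit shows that the
  integrand is measurable in time.\<close>

lemma right_continuous_riemann_sum:
  fixes y :: "real \<Rightarrow> 'a"
  assumes y: "\<And>t. 0 \<le> t \<Longrightarrow> \<forall>\<^sub>F s in at_right t. y s = y t" and \<theta>: "0 < \<theta>"
  shows "(\<lambda>l. \<Sum>r<k * Suc l. \<theta> / real (Suc l) * of_bool (y (real (Suc r) * (\<theta> / real (Suc l))) = x))
    \<longlonglongrightarrow> (LINT s:{0..\<theta> * real k}|lborel. indicator {s. y s = x} s)"
proof -
  define \<tau> where "\<tau> l = \<theta> / real (Suc l)" for l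
  have \<tau>: "0 < \<tau> l" "real (Suc l) * \<tau> l = \<theta>" for l using \<theta> by (auto simp: \<tau>_def simp del: of_nat_Suc)
  have end_point: "real (k * Suc l) * \<tau> l = \<theta> * real k" for l
    using \<tau>(2)[of l] by (simp only: of_nat_mult mult.assoc) (simp only: mult.commute)
  define b where "b l r = (of_bool (y (real (Suc r) * \<tau> l) = x) :: real)" for l r
  define st where "st l s = (\<Sum>r<k * Suc l. indicator {real r * \<tau> l..<real (Suc r) * \<tau> l} s * b l r)" for l s
  have int_st: "(\<integral>s. st l s \<partial>lborel) = (\<Sum>r<k * Suc l. \<tau> l * b l r)" for l
  proof -
    have "(\<integral>s. st l s \<partial>lborel) = (\<Sum>r<k * Suc l. \<integral>s. indicator {real r * \<tau> l..<real (Suc r) * \<tau> l} s * b l r \<partial>lborel)"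
      unfolding st_def using \<tau>(1)
      by (intro Bochner_Integration.integral_sum integrable_mult_left integrable_real_indicator) (auto simp: ennreal_less_top)
    also have "\<dots> = (\<Sum>r<k * Suc l. \<tau> l * b l r)"
    proof (intro sum.cong refl)
      fix r
      have "real r * \<tau> l \<le> real (Suc r) * \<tau> l" using \<tau>(1)[of l] by (intro mult_right_mono) auto
      then show "(\<integral>s. indicator {real r * \<tau> l..<real (Suc r) * \<tau> l} s * b l r \<partial>lborel) = \<tau> l * b l r"
        by (simp add: measure_def algebra_simps)
    qed
    finally show ?thesis .
  qed
  have st_eq: "st l s = (if 0 \<le> s \<and> s < \<theta> * real k then b l (nat \<lfloor>s / \<tau> l\<rfloor>) else 0)" for l s
  proof -
    have cell: "s \<in> {real r * \<tau> l..<real (Suc r) * \<tau> l} \<longleftrightarrow> 0 \<le> s \<and> r = nat \<lfloor>s / \<tau> l\<rfloor>" for r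
    proof
      assume s: "s \<in> {real r * \<tau> l..<real (Suc r) * \<tau> l}"
      have "0 \<le> real r * \<tau> l" using \<tau>(1)[of l] by simp
      then show "0 \<le> s \<and> r = nat \<lfloor>s / \<tau> l\<rfloor>" using s nat_floor_eq[OF \<tau>(1), of r l s] by auto
    next
      assume "0 \<le> s \<and> r = nat \<lfloor>s / \<tau> l\<rfloor>"
      then show "s \<in> {real r * \<tau> l..<real (Suc r) * \<tau> l}" using nat_floor_cell[OF \<tau>(1), of s l] by auto
    qed
    have "st l s = (\<Sum>r<k * Suc l. if r = nat \<lfloor>s / \<tau> l\<rfloor> then (if 0 \<le> s then b l r else 0) else 0)"
      unfolding st_def by (intro sum.cong refl) (simp add: indicator_def cell del: of_nat_Suc atLeastLessThan_iff)
    also have "\<dots> = (if nat \<lfloor>s / \<tau> l\<rfloor> < k * Suc l then (if 0 \<le> s then b l (nat \<lfloor>s / \<tau> l\<rfloor>) else 0) else 0)"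
      by (subst sum.delta) (auto simp del: mult_Suc_right)
    also have "\<dots> = (if 0 \<le> s \<and> s < \<theta> * real k then b l (nat \<lfloor>s / \<tau> l\<rfloor>) else 0)"
    proof (cases "0 \<le> s")
      case True
      have "nat \<lfloor>s / \<tau> l\<rfloor> < k * Suc l \<longleftrightarrow> s < \<theta> * real k"
      proof
        assume "nat \<lfloor>s / \<tau> l\<rfloor> < k * Suc l"
        then have "real (Suc (nat \<lfloor>s / \<tau> l\<rfloor>)) \<le> real (k * Suc l)" by (simp only: of_nat_le_iff Suc_le_eq)
        then have "real (Suc (nat \<lfloor>s / \<tau> l\<rfloor>)) * \<tau> l \<le> real (k * Suc l) * \<tau> l"
          using \<tau>(1)[of l] by (intro mult_right_mono) auto
        then show "s < \<theta> * real k" using nat_floor_cell(2)[OF \<tau>(1) True, of l] unfolding end_point by linarith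
      next
        assume "s < \<theta> * real k"
        then have "real (nat \<lfloor>s / \<tau> l\<rfloor>) * \<tau> l < real (k * Suc l) * \<tau> l"
          using nat_floor_cell(1)[OF \<tau>(1) True, of l] unfolding end_point by linarith
        then have "real (nat \<lfloor>s / \<tau> l\<rfloor>) < real (k * Suc l)"
          using \<tau>(1)[of l] by (simp only: mult_less_cancel_right_pos)
        then show "nat \<lfloor>s / \<tau> l\<rfloor> < k * Suc l" by (simp only: of_nat_less_iff)
      qed
      then show ?thesis using True by (simp del: mult_Suc_right)
    qed simp
    finally show ?thesis .
  qed
  define f where "f s = indicator {0..<\<theta> * real k} s * (indicator {s. y s = x} s :: real)" for s :: real
  have \<tau>0: "(\<lambda>l. \<tau> l) \<longlonglongrightarrow> 0"
    using tendsto_mult[OF tendsto_const[of \<theta>] LIMSEQ_inverse_real_of_nat]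
    by (simp add: \<tau>_def divide_inverse)
  have st_lim: "(\<lambda>l. st l s) \<longlonglongrightarrow> f s" for s
  proof (cases "0 \<le> s \<and> s < \<theta> * real k")
    case True
    obtain c where c: "s < c" "\<And>u. s < u \<Longrightarrow> u < c \<Longrightarrow> y u = y s"
      using y[of s] True by (auto simp: eventually_at_right_field)
    have "\<forall>\<^sub>F l in sequentially. \<tau> l < c - s" using c \<tau>0 by (intro order_tendstoD(2)) auto
    then have "\<forall>\<^sub>F l in sequentially. st l s = f s"
    proof eventually_elim
      case (elim l)
      let ?u = "real (Suc (nat \<lfloor>s / \<tau> l\<rfloor>)) * \<tau> l"
      have "s < ?u" using nat_floor_cell(2)[OF \<tau>(1)] True by blast
      moreover have "?u \<le> s + \<tau> l" using nat_floor_cell(1)[OF \<tau>(1), of s l] True by (simp add: algebra_simps)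
      ultimately have "y ?u = y s" using elim by (intro c(2)) auto
      then show ?case using True by (simp add: st_eq f_def b_def indicator_def del: of_nat_Suc)
    qed
    then show ?thesis by (rule tendsto_eventually)
  next
    case False
    then have "st l s = f s" for l by (auto simp: st_eq f_def)
    then show ?thesis by simp
  qed
  have st_meas: "st l \<in> borel_measurable lborel" for l unfolding st_def by measurable
  have f_meas: "f \<in> borel_measurable lborel"
    by (rule borel_measurable_LIMSEQ_real[OF st_lim st_meas])
  have "(\<lambda>l. \<integral>s. st l s \<partial>lborel) \<longlonglongrightarrow> (\<integral>s. f s \<partial>lborel)"
  proof (rule integral_dominated_convergence[where w = "indicator {0..<\<theta> * real k}"])
    show "integrable lborel (indicator {0..<\<theta> * real k} :: real \<Rightarrow> real)"
      using \<theta> by (intro integrable_real_indicator) (auto simp: ennreal_less_top)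
    show "AE s in lborel. norm (st l s) \<le> indicator {0..<\<theta> * real k} s" for l
      by (auto simp: st_eq b_def)
  qed (use f_meas st_meas st_lim in auto)
  also have "(\<integral>s. f s \<partial>lborel) = (LINT s:{0..\<theta> * real k}|lborel. indicator {s. y s = x} s)"
    unfolding set_lebesgue_integral_def
  proof (rule integral_cong_AE)
    have "AE s in lborel. s \<noteq> \<theta> * real k" by (rule AE_lborel_singleton)
    then show ae: "AE s in lborel. f s = indicator {0..\<theta> * real k} s *\<^sub>R indicator {s. y s = x} s"
      by eventually_elim (auto simp: f_def indicator_def)
    \<comment> \<open>The closed interval differs from the half-open one by its right end. One point
      does not change the integral, but measurability of the integrand is obtained by adding that
      point explicitly.\<close>
    let ?e = "\<theta> * real k"
    have "(\<lambda>s. indicator {0..?e} s *\<^sub>R indicator {s. y s = x} s :: real)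
       = (\<lambda>s. f s + indicator {?e} s * (if 0 \<le> ?e \<and> y ?e = x then 1 else 0))"
      by (rule ext) (auto simp: f_def indicator_def)
    then show "(\<lambda>s. indicator {0..?e} s *\<^sub>R indicator {s. y s = x} s :: real) \<in> borel_measurable lborel"
      using f_meas by simp
  qed (rule f_meas)
  finally show ?thesis by (simp add: int_st b_def \<tau>_def del: of_nat_Suc)
qed

section \<open>The Markov property at the points of a grid\<close>

lemma integral_finite_valued:
  fixes g :: "'b \<Rightarrow> real"
  assumes P: "prob_space P" and A: "finite A" and R: "\<And>w. w \<in> space P \<Longrightarrow> R w \<in> A"
    and sets: "\<And>r. r \<in> A \<Longrightarrow> {w \<in> space P. R w = r} \<in> sets P"
  shows "(\<integral>w. g (R w) \<partial>P) = (\<Sum>r\<in>A. g r * measure P {w \<in> space P. R w = r})"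
proof -
  interpret prob_space P by fact
  have "(\<integral>w. g (R w) \<partial>P) = (\<integral>w. (\<Sum>r\<in>A. g r * indicator {w \<in> space P. R w = r} w) \<partial>P)"
  proof (rule Bochner_Integration.integral_cong[OF refl])
    fix w assume w: "w \<in> space P"
    have "(\<Sum>r\<in>A. g r * indicator {w \<in> space P. R w = r} w) = (\<Sum>r\<in>A. if r = R w then g r else 0)"
      using w by (intro sum.cong) (auto simp: indicator_def)
    then show "g (R w) = (\<Sum>r\<in>A. g r * indicator {w \<in> space P. R w = r} w)"
      using R[OF w] A by simp
  qed
  also have "\<dots> = (\<Sum>r\<in>A. \<integral>w. g r * indicator {w \<in> space P. R w = r} w \<partial>P)"
    using sets by (intro Bochner_Integration.integral_sum integrable_mult_right integrable_real_indicator)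
      (auto simp: emeasure_eq_measure)
  also have "\<dots> = (\<Sum>r\<in>A. g r * measure P {w \<in> space P. R w = r})"
    using sets by (intro sum.cong) (auto simp: Int_absorb1)
  finally show ?thesis .
qed

lemma prod_lessThan_add:
  fixes f :: "nat \<Rightarrow> 'b :: comm_monoid_mult"
  shows "(\<Prod>i<m + n. f i) = (\<Prod>i<m. f i) * (\<Prod>i<n. f (m + i))"
  by (induction n) (simp_all add: mult.assoc)

lemma markov_jump_process_cylinder:
  assumes Y: "markov_jump_process P Y V r \<mu>" and \<tau>: "0 \<le> \<tau>" and x: "\<And>i. i \<le> J \<Longrightarrow> x i \<in> V"
  shows "measure P {w \<in> space P. \<forall>i\<le>J. Y (real i * \<tau>) w = x i}
    = pmf \<mu> (x 0) * (\<Prod>i<J. jump_semigroup V r \<tau> (x i) (x (Suc i)))"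
proof -
  have fd: "\<forall>k (t :: nat \<Rightarrow> real) x.
        t 0 = 0 \<and> (\<forall>i<k. t i \<le> t (Suc i)) \<and> (\<forall>i\<le>k. x i \<in> V) \<longrightarrow>
        measure P {w \<in> space P. \<forall>i\<le>k. Y (t i) w = x i} =
          pmf \<mu> (x 0) * (\<Prod>i<k. jump_semigroup V r (t (Suc i) - t i) (x i) (x (Suc i)))"
    using Y by (simp add: markov_jump_process_def)
  have step: "real (Suc i) * \<tau> - real i * \<tau> = \<tau>" for i by (simp add: algebra_simps)
  have "measure P {w \<in> space P. \<forall>i\<le>J. Y (real i * \<tau>) w = x i}
    = pmf \<mu> (x 0) * (\<Prod>i<J. jump_semigroup V r (real (Suc i) * \<tau> - real i * \<tau>) (x i) (x (Suc i)))"
    using \<tau> x by (intro fd[rule_format, of "\<lambda>i. real i * \<tau>" J x]) (auto intro!: mult_right_mono)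
  then show ?thesis by (simp only: step)
qed

text \<open>Restriction to \<open>{..J}\<close> makes the sample take finitely many values when the
  state space is finite, so that integrals become finite sums. Consecutive samples share their
  boundary point.\<close>

definition sample :: "(real \<Rightarrow> 'p \<Rightarrow> 'a) \<Rightarrow> real \<Rightarrow> nat \<Rightarrow> nat \<Rightarrow> 'p \<Rightarrow> nat \<Rightarrow> 'a" where
  "sample Y \<tau> j J w = restrict (\<lambda>i. Y (real (j + i) * \<tau>) w) {..J}"

lemma markov_jump_process_sets:
  assumes Y: "markov_jump_process P Y V r \<mu>" and t: "0 \<le> t"
  shows "{w \<in> space P. Y t w = x} \<in> sets P"
proof -
  have m: "Y t \<in> measurable P (count_space V)" using Y t by (simp add: markov_jump_process_def)
  have "Y t -` ({x} \<inter> V) \<inter> space P \<in> sets P" by (rule measurable_sets[OF m]) simp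
  also have "Y t -` ({x} \<inter> V) \<inter> space P = {w \<in> space P. Y t w = x}"
    using measurable_space[OF m] by auto
  finally show ?thesis .
qed

lemma markov_jump_process_in:
  assumes Y: "markov_jump_process P Y V r \<mu>" and t: "0 \<le> t" and w: "w \<in> space P"
  shows "Y t w \<in> V"
proof -
  have "Y t \<in> measurable P (count_space V)" using Y t by (simp add: markov_jump_process_def)
  from measurable_space[OF this w] show ?thesis by simp
qed

lemma sample_sets:
  assumes Y: "markov_jump_process P Y V r \<mu>" and \<tau>: "0 \<le> \<tau>"
  shows "{w \<in> space P. sample Y \<tau> j J w = x} \<in> sets P"
proof (cases "x \<in> extensional {..J}")
  case True
  have "{w \<in> space P. sample Y \<tau> j J w = x} = {w \<in> space P. \<forall>i\<in>{..J}. Y (real (j + i) * \<tau>) w = x i}"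
    using True by (auto simp: sample_def extensional_def fun_eq_iff restrict_def split: if_splits)
  also have "\<dots> \<in> sets P"
  proof (rule sets.sets_Collect_finite_All)
    show "{w \<in> space P. Y (real (j + i) * \<tau>) w = x i} \<in> sets P" for i
      using \<tau> by (intro markov_jump_process_sets[OF Y]) simp
  qed simp
  finally show ?thesis .
next
  case False
  then have "sample Y \<tau> j J w \<noteq> x" for w
    unfolding sample_def using restrict_extensional by metis
  then show ?thesis by simp
qed

text \<open>Cylinder probabilities are products of transition functions, which split at index
  \<open>J\<close>: the factors beyond \<open>J\<close> form the cylinder probability of the process
  restarted at the state occupied there. Summing over the finitely many samples gives the identity
  for functions, without conditional expectations.\<close>

lemma sampled_markov_property:
  fixes Y :: "real \<Rightarrow> 'p \<Rightarrow> 'a" and P :: "'a pmf \<Rightarrow> 'p measure" and F H :: "(nat \<Rightarrow> 'a) \<Rightarrow> real"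
  assumes V: "finite V"
    and Y: "\<And>\<mu>. set_pmf \<mu> \<subseteq> V \<Longrightarrow> markov_jump_process (P \<mu>) Y V r \<mu>"
    and \<mu>: "set_pmf \<mu> \<subseteq> V" and \<tau>: "0 \<le> \<tau>"
  shows "(\<integral>w. F (sample Y \<tau> 0 J w) * H (sample Y \<tau> J K w) \<partial>P \<mu>)
    = (\<integral>w. F (sample Y \<tau> 0 J w) * (\<integral>w'. H (sample Y \<tau> 0 K w') \<partial>P (return_pmf (Y (real J * \<tau>) w))) \<partial>P \<mu>)"
proof -
  note mj = Y[OF \<mu>]
  have Yx: "markov_jump_process (P (return_pmf x)) Y V r (return_pmf x)" if "x \<in> V" for x
    using that by (intro Y) simp
  have P: "prob_space (P \<mu>)" using mj by (simp add: markov_jump_process_def)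
  have Px: "prob_space (P (return_pmf x))" if "x \<in> V" for x
    using Yx[OF that] by (simp add: markov_jump_process_def)
  define A where "A n = PiE {..n::nat} (\<lambda>_. V)" for n
  have fin: "finite (A n)" for n unfolding A_def using V by (intro finite_PiE) auto
  have inA: "sample Y \<tau> j n w \<in> A n" if "markov_jump_process Q Y V r \<rho>" "w \<in> space Q" for j n w Q \<rho>
    unfolding A_def sample_def using markov_jump_process_in[OF that(1) _ that(2)] \<tau> by auto
  let ?p = "\<lambda>x n. measure (P (return_pmf x)) {w \<in> space (P (return_pmf x)). sample Y \<tau> 0 K w = n}"
  have cyl: "{w \<in> space Q. sample Y \<tau> 0 n w = x} = {w \<in> space Q. \<forall>i\<le>n. Y (real i * \<tau>) w = x i}"
    if "x \<in> A n" for Q n x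
    using that by (auto simp: A_def sample_def PiE_def extensional_def fun_eq_iff restrict_def split: if_splits)
  have joint: "measure (P \<mu>) {w \<in> space (P \<mu>). (sample Y \<tau> 0 J w, sample Y \<tau> J K w) = (x, y)}
      = measure (P \<mu>) {w \<in> space (P \<mu>). sample Y \<tau> 0 J w = x} * ?p (x J) y"
    if x: "x \<in> A J" and y: "y \<in> A K" for x y
  proof -
    have xV: "x i \<in> V" if "i \<le> J" for i using x that by (auto simp: A_def PiE_def Pi_def)
    have yV: "y i \<in> V" if "i \<le> K" for i using y that by (auto simp: A_def PiE_def Pi_def)
    have py: "?p (x J) y = pmf (return_pmf (x J)) (y 0) * (\<Prod>i<K. jump_semigroup V r \<tau> (y i) (y (Suc i)))"
      unfolding cyl[OF y] by (rule markov_jump_process_cylinder[OF Yx[OF xV[OF order_refl]] \<tau> yV])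
    show ?thesis
    \<comment> \<open>The two samples overlap in index \<open>J\<close>. Incompatible values give an
      empty event on the left, and on the right the point mass at \<open>x J\<close> does not charge
      \<open>y 0\<close>.\<close>
    proof (cases "x J = y 0")
      case False
      have "(sample Y \<tau> 0 J w, sample Y \<tau> J K w) \<noteq> (x, y)" for w
      proof
        assume a: "(sample Y \<tau> 0 J w, sample Y \<tau> J K w) = (x, y)"
        have "sample Y \<tau> 0 J w J = sample Y \<tau> J K w 0" by (simp add: sample_def)
        then show False using a False by simp
      qed
      then have "{w \<in> space (P \<mu>). (sample Y \<tau> 0 J w, sample Y \<tau> J K w) = (x, y)} = {}" by blast
      then show ?thesis using py False by (simp only: measure_empty) (simp add: pmf_return)
    next
      case True
      define z where "z i = (if i \<le> J then x i else y (i - J))" for i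
      have split_range: "(\<forall>i\<le>J. Q i) \<and> (\<forall>i. J \<le> i \<and> i \<le> J + K \<longrightarrow> Q i) \<longleftrightarrow> (\<forall>i\<le>J + K. Q i)" for Q
      proof
        assume a: "(\<forall>i\<le>J. Q i) \<and> (\<forall>i. J \<le> i \<and> i \<le> J + K \<longrightarrow> Q i)"
        have "Q i" if "i \<le> J + K" for i using a that by (cases "i \<le> J") auto
        then show "\<forall>i\<le>J + K. Q i" by simp
      qed simp
      have zy: "z (J + i) = y i" for i using True by (cases i) (auto simp: z_def)
      have "{w \<in> space (P \<mu>). (sample Y \<tau> 0 J w, sample Y \<tau> J K w) = (x, y)}
          = {w \<in> space (P \<mu>). \<forall>i\<le>J + K. Y (real i * \<tau>) w = z i}"
      proof (intro Collect_cong conj_cong refl)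
        fix w assume "w \<in> space (P \<mu>)"
        have 1: "sample Y \<tau> 0 J w = x \<longleftrightarrow> (\<forall>i\<le>J. Y (real i * \<tau>) w = z i)"
          using x by (auto simp: z_def A_def sample_def PiE_def extensional_def fun_eq_iff restrict_def)
        have "sample Y \<tau> J K w = y \<longleftrightarrow> (\<forall>i\<le>K. Y (real (J + i) * \<tau>) w = z (J + i))"
          using y unfolding zy by (auto simp: A_def sample_def PiE_def extensional_def fun_eq_iff restrict_def)
        also have "\<dots> \<longleftrightarrow> (\<forall>i. J \<le> i \<and> i \<le> J + K \<longrightarrow> Y (real i * \<tau>) w = z i)"
          by (metis add_le_cancel_left le_add1 le_add_diff_inverse)
        finally show "(sample Y \<tau> 0 J w, sample Y \<tau> J K w) = (x, y) \<longleftrightarrow> (\<forall>i\<le>J + K. Y (real i * \<tau>) w = z i)"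
          unfolding Pair_inject prod.inject 1 using split_range[of "\<lambda>i. Y (real i * \<tau>) w = z i"] by (simp only:)
      qed
      then have "measure (P \<mu>) {w \<in> space (P \<mu>). (sample Y \<tau> 0 J w, sample Y \<tau> J K w) = (x, y)}
          = pmf \<mu> (z 0) * (\<Prod>i<J + K. jump_semigroup V r \<tau> (z i) (z (Suc i)))"
        using xV yV by (simp only:) (intro markov_jump_process_cylinder[OF mj \<tau>], auto simp: z_def)
      also have "\<dots> = (pmf \<mu> (z 0) * (\<Prod>i<J. jump_semigroup V r \<tau> (z i) (z (Suc i))))
          * (\<Prod>i<K. jump_semigroup V r \<tau> (z (J + i)) (z (J + Suc i)))"
        by (simp add: prod_lessThan_add mult.assoc)
      also have "pmf \<mu> (z 0) * (\<Prod>i<J. jump_semigroup V r \<tau> (z i) (z (Suc i)))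
          = measure (P \<mu>) {w \<in> space (P \<mu>). sample Y \<tau> 0 J w = x}"
        unfolding cyl[OF x]
        by (subst markov_jump_process_cylinder[OF mj \<tau> xV]) (auto simp: z_def intro!: prod.cong)
      also have "(\<Prod>i<K. jump_semigroup V r \<tau> (z (J + i)) (z (J + Suc i))) = ?p (x J) y"
        unfolding py zy using True by simp
      finally show ?thesis .
    qed
  qed
  have "(\<integral>w. F (sample Y \<tau> 0 J w) * H (sample Y \<tau> J K w) \<partial>P \<mu>)
      = (\<integral>w. (\<lambda>(x, y). F x * H y) (sample Y \<tau> 0 J w, sample Y \<tau> J K w) \<partial>P \<mu>)" by simp
  also have "\<dots> = (\<Sum>z\<in>A J \<times> A K. (\<lambda>(x, y). F x * H y) z *
      measure (P \<mu>) {w \<in> space (P \<mu>). (sample Y \<tau> 0 J w, sample Y \<tau> J K w) = z})"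
  proof (rule integral_finite_valued[OF P])
    fix z :: "(nat \<Rightarrow> 'a) \<times> (nat \<Rightarrow> 'a)"
    have "{w \<in> space (P \<mu>). (sample Y \<tau> 0 J w, sample Y \<tau> J K w) = z}
        = {w \<in> space (P \<mu>). sample Y \<tau> 0 J w = fst z} \<inter> {w \<in> space (P \<mu>). sample Y \<tau> J K w = snd z}"
      by auto
    also have "\<dots> \<in> sets (P \<mu>)"
      by (intro sets.Int sample_sets[OF mj \<tau>])
    finally show "{w \<in> space (P \<mu>). (sample Y \<tau> 0 J w, sample Y \<tau> J K w) = z} \<in> sets (P \<mu>)" .
  qed (use fin inA[OF mj] in auto)
  also have "\<dots> = (\<Sum>x\<in>A J. \<Sum>y\<in>A K. F x * H y *
      measure (P \<mu>) {w \<in> space (P \<mu>). (sample Y \<tau> 0 J w, sample Y \<tau> J K w) = (x, y)})"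
    by (subst sum.cartesian_product) (auto intro!: sum.cong)
  also have "\<dots> = (\<Sum>x\<in>A J. \<Sum>y\<in>A K. F x * H y *
      (measure (P \<mu>) {w \<in> space (P \<mu>). sample Y \<tau> 0 J w = x} * ?p (x J) y))"
    by (intro sum.cong refl) (simp only: joint)
  also have "\<dots> = (\<Sum>x\<in>A J. (F x * (\<Sum>y\<in>A K. H y * ?p (x J) y)) *
      measure (P \<mu>) {w \<in> space (P \<mu>). sample Y \<tau> 0 J w = x})"
    by (simp add: sum_distrib_left sum_distrib_right mult_ac)
  also have "\<dots> = (\<Sum>x\<in>A J. (F x * (\<integral>w'. H (sample Y \<tau> 0 K w') \<partial>P (return_pmf (x J)))) *
      measure (P \<mu>) {w \<in> space (P \<mu>). sample Y \<tau> 0 J w = x})"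
  proof (intro sum.cong refl)
    fix x assume "x \<in> A J"
    then have xJ: "x J \<in> V" by (auto simp: A_def PiE_def Pi_def)
    have "(\<integral>w'. H (sample Y \<tau> 0 K w') \<partial>P (return_pmf (x J))) = (\<Sum>y\<in>A K. H y * ?p (x J) y)"
      by (rule integral_finite_valued[OF Px[OF xJ] fin inA[OF Yx[OF xJ]] sample_sets[OF Yx[OF xJ] \<tau>]])
    then show "(F x * (\<Sum>y\<in>A K. H y * ?p (x J) y)) * measure (P \<mu>) {w \<in> space (P \<mu>). sample Y \<tau> 0 J w = x}
      = (F x * (\<integral>w'. H (sample Y \<tau> 0 K w') \<partial>P (return_pmf (x J)))) *
          measure (P \<mu>) {w \<in> space (P \<mu>). sample Y \<tau> 0 J w = x}" by simp
  qed
  also have "\<dots> = (\<integral>w. (\<lambda>x. F x * (\<integral>w'. H (sample Y \<tau> 0 K w') \<partial>P (return_pmf (x J)))) (sample Y \<tau> 0 J w) \<partial>P \<mu>)"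
    by (rule integral_finite_valued[OF P fin inA[OF mj] sample_sets[OF mj \<tau>], symmetric])
  also have "\<dots> = (\<integral>w. F (sample Y \<tau> 0 J w) * (\<integral>w'. H (sample Y \<tau> 0 K w') \<partial>P (return_pmf (Y (real J * \<tau>) w))) \<partial>P \<mu>)"
    by (simp add: sample_def)
  finally show ?thesis .
qed

text \<open>Limits of continuous functions under a common bound, on the half-line where blocks take
  their values. The class contains the indicators and truncations of the hypotheses, while integral
  identities still pass to it from continuous functions by dominated convergence.\<close>

definition bounded_baire :: "(real \<Rightarrow> real) \<Rightarrow> bool" where
  "bounded_baire g \<longleftrightarrow> (\<exists>B (\<phi> :: nat \<Rightarrow> real \<Rightarrow> real).
     (\<forall>m. continuous_on UNIV (\<phi> m)) \<and> (\<forall>m. \<forall>z\<ge>0. \<bar>\<phi> m z\<bar> \<le> B) \<and> (\<forall>z\<ge>0. (\<lambda>m. \<phi> m z) \<longlonglongrightarrow> g z))"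

lemma bounded_baire_continuous:
  assumes "continuous_on UNIV g" "\<And>z. 0 \<le> z \<Longrightarrow> \<bar>g z\<bar> \<le> B"
  shows "bounded_baire g"
  unfolding bounded_baire_def using assms by (intro exI[of _ B] exI[of _ "\<lambda>_. g"]) auto

lemma ramp_tendsto:
  fixes u z :: real
  shows "(\<lambda>m. min 1 (max 0 (real (Suc m) * (z - u)))) \<longlonglongrightarrow> indicator {u<..} z"
proof (cases "u < z")
  case True
  then have "0 < z - u" by simp
  from eventually_inverse_Suc_le[OF this]
  have "\<forall>\<^sub>F m in sequentially. min 1 (max 0 (real (Suc m) * (z - u))) = indicator {u<..} z"
  proof eventually_elim
    case (elim m)
    have "1 \<le> real (Suc m) * (z - u)" using elim by (simp only: pos_divide_le_eq of_nat_0_less_iff zero_less_Suc mult.commute)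
    then show ?case using True by (simp add: indicator_def del: of_nat_Suc)
  qed
  then show ?thesis by (rule tendsto_eventually)
next
  case False
  then have "real (Suc m) * (z - u) \<le> 0" for m by (intro mult_nonneg_nonpos) auto
  then have "min 1 (max 0 (real (Suc m) * (z - u))) = indicator {u<..} z" for m
    using False by (simp add: indicator_def del: of_nat_Suc)
  then show ?thesis by (simp only: tendsto_const)
qed

lemma bounded_baire_indicator: "bounded_baire (indicator {u<..})"
  unfolding bounded_baire_def
proof (intro exI[of _ 1] exI[of _ "\<lambda>m z. min 1 (max 0 (real (Suc m) * (z - u)))"] conjI allI impI)
  show "continuous_on UNIV (\<lambda>z. min 1 (max 0 (real (Suc m) * (z - u))))" for m
    by (intro continuous_intros)
  show "(\<lambda>m. min 1 (max 0 (real (Suc m) * (z - u)))) \<longlonglongrightarrow> indicator {u<..} z" for z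
    by (rule ramp_tendsto)
qed (simp del: of_nat_Suc)

lemma bounded_baire_truncation:
  assumes "0 \<le> u" shows "bounded_baire (\<lambda>z. z * indicator {..u} z)"
  unfolding bounded_baire_def
\<comment> \<open>The ramps have slope at least 1, so they equal 1 beyond \<open>u + 1\<close> and
  the approximants vanish there; this gives the common bound.\<close>
proof (intro exI[of _ "u + 1"] exI[of _ "\<lambda>m z. z * (1 - min 1 (max 0 (real (Suc m) * (z - u))))"] conjI allI impI)
  show "continuous_on UNIV (\<lambda>z. z * (1 - min 1 (max 0 (real (Suc m) * (z - u)))))" for m
    by (intro continuous_intros)
  fix z :: real assume z: "0 \<le> z"
  have "(\<lambda>m. z * (1 - min 1 (max 0 (real (Suc m) * (z - u))))) \<longlonglongrightarrow> z * (1 - indicator {u<..} z)"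
    by (intro tendsto_intros ramp_tendsto)
  also have "z * (1 - indicator {u<..} z) = z * indicator {..u} z" by (simp add: indicator_def)
  finally show "(\<lambda>m. z * (1 - min 1 (max 0 (real (Suc m) * (z - u))))) \<longlonglongrightarrow> z * indicator {..u} z" .
  fix m
  show "\<bar>z * (1 - min 1 (max 0 (real (Suc m) * (z - u))))\<bar> \<le> u + 1"
  proof (cases "z \<le> u + 1")
    case True
    have "\<bar>z\<bar> * \<bar>1 - min 1 (max 0 (real (Suc m) * (z - u)))\<bar> \<le> (u + 1) * 1"
      using z True assms by (intro mult_mono) auto
    then show ?thesis by (simp only: abs_mult mult_1_right)
  next
    case False
    then have "1 * 1 \<le> real (Suc m) * (z - u)" by (intro mult_mono) auto
    then show ?thesis using assms by (simp del: of_nat_Suc)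
  qed
qed

section \<open>Blocks as limits of grid sums\<close>

lemma sum_lessThan_add:
  fixes f :: "nat \<Rightarrow> 'b :: comm_monoid_add"
  shows "(\<Sum>i<m + n. f i) = (\<Sum>i<m. f i) + (\<Sum>i<n. f (m + i))"
  by (induction n) (simp_all add: add.assoc)

locale exploration_clock =
  fixes X :: "('a, 'p) clock_model"
  assumes finite_verts: "finite (verts X)"
    and process: "\<And>\<mu>. set_pmf \<mu> \<subseteq> verts X \<Longrightarrow>
      markov_jump_process (law X \<mu>) (expl X) (verts X) (expl_rate X) \<mu>"
    and rate_pos: "\<And>x. x \<in> verts X \<Longrightarrow> 0 < exit_rate (edges X) (rate X) x"
      "\<And>x. x \<in> verts X \<Longrightarrow> 0 < exit_rate (edges X) (expl_rate X) x"
    and init_verts: "set_pmf (init X) \<subseteq> verts X"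
    and invar_verts: "set_pmf (invar X) \<subseteq> verts X"
    and scale_pos: "0 < tscale X" "0 < cscale X" "0 < blocklen X"
    and mixtime_le: "real (mixtime X) \<le> blocklen X"
begin

text \<open>\<open>block\<close> is stated with local times; equivalently it is the time integral of
  this function along the path over the block.\<close>

definition speed :: "'a \<Rightarrow> real" where
  "speed x = inverse (cscale X) *
     (inverse (exit_rate (edges X) (rate X) x) * exit_rate (edges X) (expl_rate X) x)"

lemma speed_nonneg: "x \<in> verts X \<Longrightarrow> 0 \<le> speed x"
  unfolding speed_def using rate_pos[of x] scale_pos by simp

text \<open>\<open>block X (Suc k)\<close> is the block that starts at time \<open>k * blocklen X\<close>.\<close>

definition riemann :: "nat \<Rightarrow> nat \<Rightarrow> 'p \<Rightarrow> real" where
  "riemann l k w = (\<Sum>r<Suc l. blocklen X / real (Suc l) *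
     speed (expl X (real (k * Suc l + Suc r) * (blocklen X / real (Suc l))) w))"

context
  fixes \<mu> :: "'a pmf" assumes \<mu>: "set_pmf \<mu> \<subseteq> verts X"
begin

lemma prob_space_law: "prob_space (law X \<mu>)"
  using process[OF \<mu>] by (simp add: markov_jump_process_def)

lemma expl_in_verts: "w \<in> space (law X \<mu>) \<Longrightarrow> 0 \<le> t \<Longrightarrow> expl X t w \<in> verts X"
  using markov_jump_process_in[OF process[OF \<mu>]] by blast

lemma expl_functional_measurable:
  fixes u :: "'a \<Rightarrow> real"
  assumes "0 \<le> t" shows "(\<lambda>w. u (expl X t w)) \<in> borel_measurable (law X \<mu>)"
proof -
  have "expl X t \<in> measurable (law X \<mu>) (count_space (verts X))"
    using process[OF \<mu>] assms by (simp add: markov_jump_process_def)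
  moreover have "u \<in> measurable (count_space (verts X)) borel" by simp
  ultimately show ?thesis by (rule measurable_compose)
qed

text \<open>Local times are counted from time 0, and the grid divides the blocks evenly, so the sums
  up to the ends of blocks \<open>k\<close> and \<open>Suc k\<close> agree in their common part and
  the difference runs over the grid points of one block.\<close>

lemma riemann_tendsto:
  assumes w: "w \<in> space (law X \<mu>)"
  shows "(\<lambda>l. riemann l k w) \<longlonglongrightarrow> block X (Suc k) w"
proof -
  let ?\<tau> = "\<lambda>l. blocklen X / real (Suc l)"
  let ?a = "\<lambda>x. inverse (exit_rate (edges X) (rate X) x) * exit_rate (edges X) (expl_rate X) x"
  define L where "L k l x = (\<Sum>r<k * Suc l. ?\<tau> l * of_bool (expl X (real (Suc r) * ?\<tau> l) w = x))" for k l x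
  have "\<forall>\<^sub>F s in at_right t. expl X s w = expl X t w" if "0 \<le> t" for t
    using process[OF \<mu>] w that by (simp add: markov_jump_process_def)
  from right_continuous_riemann_sum[of "\<lambda>t. expl X t w", OF this scale_pos(3)]
  have L: "(\<lambda>l. L k l x) \<longlonglongrightarrow> local_time (expl X) x (blocklen X * real k) w" for k x
    unfolding L_def local_time_def by blast
  have lim: "(\<lambda>l. inverse (cscale X) * (\<Sum>x\<in>verts X. ?a x * (L (Suc k) l x - L k l x)))
    \<longlonglongrightarrow> inverse (cscale X) * (\<Sum>x\<in>verts X. ?a x * (local_time (expl X) x (blocklen X * real (Suc k)) w
      - local_time (expl X) x (blocklen X * real k) w))"
    by (intro tendsto_intros L)
  have block: "inverse (cscale X) * (\<Sum>x\<in>verts X. ?a x * (local_time (expl X) x (blocklen X * real (Suc k)) w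
      - local_time (expl X) x (blocklen X * real k) w)) = block X (Suc k) w" by (simp add: block_def)
  have "(\<lambda>l. inverse (cscale X) * (\<Sum>x\<in>verts X. ?a x * (L (Suc k) l x - L k l x))) = (\<lambda>l. riemann l k w)"
  proof
    fix l
    let ?Y = "\<lambda>r. expl X (real (k * Suc l + Suc r) * ?\<tau> l) w"
    have e: "Suc k * Suc l = k * Suc l + Suc l" by simp
    have d: "L (Suc k) l x - L k l x = (\<Sum>r<Suc l. ?\<tau> l * of_bool (?Y r = x))" for x
      unfolding L_def e sum_lessThan_add by (simp only: add_diff_cancel_left' add_Suc_right)
    have "(\<Sum>x\<in>verts X. ?a x * (L (Suc k) l x - L k l x))
        = (\<Sum>r<Suc l. \<Sum>x\<in>verts X. ?a x * (?\<tau> l * of_bool (?Y r = x)))"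
      unfolding d sum_distrib_left by (rule sum.swap)
    also have "\<dots> = (\<Sum>r<Suc l. ?\<tau> l * ?a (?Y r))"
    proof (intro sum.cong refl)
      fix r
      have V: "?Y r \<in> verts X" using scale_pos(3) by (intro expl_in_verts w) simp
      have "(\<Sum>x\<in>verts X. ?a x * (?\<tau> l * of_bool (?Y r = x)))
          = (\<Sum>x\<in>verts X. if x = ?Y r then ?\<tau> l * ?a (?Y r) else 0)"
        by (intro sum.cong) (auto simp del: of_nat_Suc)
      also have "\<dots> = ?\<tau> l * ?a (?Y r)" by (subst sum.delta[OF finite_verts]) (simp only: V if_True)
      finally show "(\<Sum>x\<in>verts X. ?a x * (?\<tau> l * of_bool (?Y r = x))) = ?\<tau> l * ?a (?Y r)" .
    qed
    finally show "inverse (cscale X) * (\<Sum>x\<in>verts X. ?a x * (L (Suc k) l x - L k l x)) = riemann l k w"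
      unfolding riemann_def speed_def by (simp only: sum_distrib_left mult_ac)
  qed
  then show ?thesis using lim unfolding block by (simp only:)
qed

lemma riemann_nonneg: "w \<in> space (law X \<mu>) \<Longrightarrow> 0 \<le> riemann l k w"
  unfolding riemann_def using scale_pos(3)
  by (intro sum_nonneg mult_nonneg_nonneg speed_nonneg expl_in_verts) (simp_all del: of_nat_Suc)

lemma riemann_measurable: "riemann l k \<in> borel_measurable (law X \<mu>)"
proof -
  have "(\<lambda>w. speed (expl X (real (k * Suc l + Suc r) * (blocklen X / real (Suc l))) w)) \<in> borel_measurable (law X \<mu>)" for r
    using scale_pos(3) by (intro expl_functional_measurable) simp
  then show ?thesis unfolding riemann_def[abs_def]
    by (intro borel_measurable_sum borel_measurable_times borel_measurable_const)
qed

lemma block_nonneg: "w \<in> space (law X \<mu>) \<Longrightarrow> 0 \<le> block X (Suc k) w"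
  using LIMSEQ_le_const[OF riemann_tendsto] riemann_nonneg by blast

lemma block_measurable: "(\<lambda>w. block X (Suc k) w) \<in> borel_measurable (law X \<mu>)"
  by (rule borel_measurable_LIMSEQ_real[OF riemann_tendsto riemann_measurable])

lemma baire_block_measurable:
  assumes "bounded_baire g"
  shows "(\<lambda>w. g (block X (Suc k) w)) \<in> borel_measurable (law X \<mu>)"
proof -
  obtain \<phi> :: "nat \<Rightarrow> real \<Rightarrow> real" where \<phi>: "\<And>m. continuous_on UNIV (\<phi> m)" "\<And>z. 0 \<le> z \<Longrightarrow> (\<lambda>m. \<phi> m z) \<longlonglongrightarrow> g z"
    using assms unfolding bounded_baire_def by blast
  show ?thesis
  proof (rule borel_measurable_LIMSEQ_real)
    show "(\<lambda>m. \<phi> m (block X (Suc k) w)) \<longlonglongrightarrow> g (block X (Suc k) w)" if "w \<in> space (law X \<mu>)" for w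
      using block_nonneg[OF that] by (rule \<phi>(2))
    show "(\<lambda>w. \<phi> m (block X (Suc k) w)) \<in> borel_measurable (law X \<mu>)" for m
      by (rule measurable_compose[OF block_measurable borel_measurable_continuous_onI[OF \<phi>(1)]])
  qed
qed

end

lemma return_verts: "x \<in> verts X \<Longrightarrow> set_pmf (return_pmf x) \<subseteq> verts X"
  by simp

text \<open>Passage to the limit in an identity of Markov type, also inside the integral over the
  restarted process; the bound \<open>c\<close>, uniform over starting points, dominates the inner
  integrals. It serves two passages: from grid sums to blocks, and from continuous functions to
  their limits.\<close>

lemma markov_dominated_limit:
  fixes A C D :: "nat \<Rightarrow> 'p \<Rightarrow> real"
  assumes \<mu>: "set_pmf \<mu> \<subseteq> verts X" and t: "0 \<le> t"
    and meas: "\<And>l. A l \<in> borel_measurable (law X \<mu>)" "\<And>l. C l \<in> borel_measurable (law X \<mu>)"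
      "\<And>l x. x \<in> verts X \<Longrightarrow> D l \<in> borel_measurable (law_from X x)"
    and lim: "\<And>w. w \<in> space (law X \<mu>) \<Longrightarrow> (\<lambda>l. A l w) \<longlonglongrightarrow> A' w"
      "\<And>w. w \<in> space (law X \<mu>) \<Longrightarrow> (\<lambda>l. C l w) \<longlonglongrightarrow> C' w"
      "\<And>x w. x \<in> verts X \<Longrightarrow> w \<in> space (law_from X x) \<Longrightarrow> (\<lambda>l. D l w) \<longlonglongrightarrow> D' w"
    and bd: "\<And>l w. w \<in> space (law X \<mu>) \<Longrightarrow> \<bar>A l w\<bar> \<le> a" "\<And>l w. w \<in> space (law X \<mu>) \<Longrightarrow> \<bar>C l w\<bar> \<le> c"
      "\<And>l x w. x \<in> verts X \<Longrightarrow> w \<in> space (law_from X x) \<Longrightarrow> \<bar>D l w\<bar> \<le> c"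
    and eq: "\<And>l. (\<integral>w. A l w * C l w \<partial>law X \<mu>)
      = (\<integral>w. A l w * (\<integral>w'. D l w' \<partial>law_from X (expl X t w)) \<partial>law X \<mu>)"
  shows "(\<integral>w. A' w * C' w \<partial>law X \<mu>) = (\<integral>w. A' w * (\<integral>w'. D' w' \<partial>law_from X (expl X t w)) \<partial>law X \<mu>)"
proof -
  interpret P: prob_space "law X \<mu>" by (rule prob_space_law[OF \<mu>])
  have mA': "A' \<in> borel_measurable (law X \<mu>)" by (rule borel_measurable_LIMSEQ_real[OF lim(1) meas(1)])
  have mC': "C' \<in> borel_measurable (law X \<mu>)" by (rule borel_measurable_LIMSEQ_real[OF lim(2) meas(2)])
  obtain w0 where w0: "w0 \<in> space (law X \<mu>)" using P.not_empty by blast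
  have a: "0 \<le> a" using bd(1)[OF w0, of 0] by linarith
  have DV: "(\<lambda>l. \<integral>w'. D l w' \<partial>law_from X x) \<longlonglongrightarrow> (\<integral>w'. D' w' \<partial>law_from X x)"
    and DB: "\<bar>\<integral>w'. D l w' \<partial>law_from X x\<bar> \<le> c" if x: "x \<in> verts X" for x l
  proof -
    interpret Q: prob_space "law_from X x" by (rule prob_space_law[OF return_verts[OF x]])
    have mD': "D' \<in> borel_measurable (law_from X x)"
      by (rule borel_measurable_LIMSEQ_real[OF lim(3)[OF x] meas(3)[OF x]])
    show "(\<lambda>l. \<integral>w'. D l w' \<partial>law_from X x) \<longlonglongrightarrow> (\<integral>w'. D' w' \<partial>law_from X x)"
      using lim(3)[OF x] bd(3)[OF x]
      by (intro integral_dominated_convergence[where w = "\<lambda>_. c"] mD' meas(3)[OF x] AE_I2) simp_all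
    have i: "integrable (law_from X x) (D l)"
      using bd(3)[OF x] by (intro Q.integrable_const_bound[where B = c] meas(3)[OF x] AE_I2) simp
    have "\<bar>(\<integral>w'. D l w' \<partial>law_from X x) - (\<integral>w'. 0 \<partial>law_from X x)\<bar> \<le> c"
      using bd(3)[OF x] by (intro Q.integral_abs_diff_le i) auto
    then show "\<bar>\<integral>w'. D l w' \<partial>law_from X x\<bar> \<le> c" by simp
  qed
  have V: "expl X t w \<in> verts X" if "w \<in> space (law X \<mu>)" for w by (rule expl_in_verts[OF \<mu> that t])
  have "(\<lambda>l. \<integral>w. A l w * C l w \<partial>law X \<mu>) \<longlonglongrightarrow> (\<integral>w. A' w * C' w \<partial>law X \<mu>)"
  proof (rule integral_dominated_convergence[where w = "\<lambda>_. a * c"])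
    show "AE w in law X \<mu>. norm (A l w * C l w) \<le> a * c" for l
      using bd(1,2) a unfolding real_norm_def abs_mult by (intro AE_I2 mult_mono) auto
    show "AE w in law X \<mu>. (\<lambda>l. A l w * C l w) \<longlonglongrightarrow> A' w * C' w"
      using lim by (intro AE_I2 tendsto_mult)
  qed (auto intro!: borel_measurable_times mA' mC' meas)
  moreover have "(\<lambda>l. \<integral>w. A l w * (\<integral>w'. D l w' \<partial>law_from X (expl X t w)) \<partial>law X \<mu>)
      \<longlonglongrightarrow> (\<integral>w. A' w * (\<integral>w'. D' w' \<partial>law_from X (expl X t w)) \<partial>law X \<mu>)"
  proof (rule integral_dominated_convergence[where w = "\<lambda>_. a * c"])
    show "(\<lambda>w. A' w * (\<integral>w'. D' w' \<partial>law_from X (expl X t w))) \<in> borel_measurable (law X \<mu>)"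
      by (intro borel_measurable_times mA' expl_functional_measurable[OF \<mu> t])
    show "(\<lambda>w. A l w * (\<integral>w'. D l w' \<partial>law_from X (expl X t w))) \<in> borel_measurable (law X \<mu>)" for l
      by (intro borel_measurable_times meas expl_functional_measurable[OF \<mu> t])
    show "AE w in law X \<mu>. norm (A l w * (\<integral>w'. D l w' \<partial>law_from X (expl X t w))) \<le> a * c" for l
      using bd(1) a unfolding real_norm_def abs_mult by (intro AE_I2 mult_mono DB V) auto
    show "AE w in law X \<mu>. (\<lambda>l. A l w * (\<integral>w'. D l w' \<partial>law_from X (expl X t w)))
        \<longlonglongrightarrow> A' w * (\<integral>w'. D' w' \<partial>law_from X (expl X t w))"
      using lim(1) by (intro AE_I2 tendsto_mult DV V)
  qed simp
  ultimately show ?thesis unfolding eq by (rule LIMSEQ_unique)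
qed

lemma grid_time: "real (k * Suc l) * (blocklen X / real (Suc l)) = real k * blocklen X"
  by (simp only: of_nat_mult) simp

lemma verts_functional_bound:
  fixes h :: "'a \<Rightarrow> real"
  shows "\<exists>b\<ge>0. \<forall>x\<in>verts X. \<bar>h x\<bar> \<le> b"
proof (intro exI[of _ "\<Sum>x\<in>verts X. \<bar>h x\<bar>"] conjI ballI)
  show "\<bar>h x\<bar> \<le> (\<Sum>x\<in>verts X. \<bar>h x\<bar>)" if "x \<in> verts X" for x
    using that finite_verts by (intro member_le_sum) auto
qed (simp add: sum_nonneg)

lemma riemann_sample:
  assumes "i < k"
  shows "riemann l i w = (\<Sum>r<Suc l. blocklen X / real (Suc l) *
     speed (sample (expl X) (blocklen X / real (Suc l)) 0 (k * Suc l) w (i * Suc l + Suc r)))"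
  unfolding riemann_def
proof (intro sum.cong refl)
  fix r assume "r \<in> {..<Suc l}"
  then have "i * Suc l + Suc r \<le> Suc i * Suc l" by simp
  also have "\<dots> \<le> k * Suc l" using assms by (intro mult_right_mono) auto
  finally show "blocklen X / real (Suc l) * speed (expl X (real (i * Suc l + Suc r) * (blocklen X / real (Suc l))) w)
    = blocklen X / real (Suc l) * speed (sample (expl X) (blocklen X / real (Suc l)) 0 (k * Suc l) w (i * Suc l + Suc r))"
    by (simp add: sample_def del: of_nat_Suc mult_Suc_right of_nat_add of_nat_mult)
qed

lemma riemann_last_sample:
  "riemann l k w = (\<Sum>r<Suc l. blocklen X / real (Suc l) *
     speed (sample (expl X) (blocklen X / real (Suc l)) (k * Suc l) (Suc l) w (Suc r)))"
  unfolding riemann_def by (intro sum.cong refl) (simp add: sample_def del: of_nat_Suc mult_Suc_right of_nat_add of_nat_mult)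

text \<open>The mesh divides the block length, so block boundaries are grid points and the Markov
  property applies exactly there; \<open>h\<close> reads the state at the end of the last
  block.\<close>

lemma riemann_markov:
  fixes G :: "real \<Rightarrow> real" and h :: "'a \<Rightarrow> real"
  assumes \<mu>: "set_pmf \<mu> \<subseteq> verts X"
  shows "(\<integral>w. (\<Prod>i<k. \<phi> i (riemann l i w)) * (G (riemann l k w) * h (expl X (real (Suc k) * blocklen X) w)) \<partial>law X \<mu>)
    = (\<integral>w. (\<Prod>i<k. \<phi> i (riemann l i w)) *
        (\<integral>w'. G (riemann l 0 w') * h (expl X (blocklen X) w') \<partial>law_from X (expl X (real k * blocklen X) w)) \<partial>law X \<mu>)"
proof -
  let ?\<tau> = "blocklen X / real (Suc l)"
  define F where "F s = (\<Prod>i<k. \<phi> i (\<Sum>r<Suc l. ?\<tau> * speed (s (i * Suc l + Suc r))))" for s :: "nat \<Rightarrow> 'a"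
  define H where "H s = G (\<Sum>r<Suc l. ?\<tau> * speed (s (Suc r))) * h (s (Suc l))" for s :: "nat \<Rightarrow> 'a"
  have \<tau>: "0 \<le> ?\<tau>" using scale_pos(3) by simp
  have F: "F (sample (expl X) ?\<tau> 0 (k * Suc l) w) = (\<Prod>i<k. \<phi> i (riemann l i w))" for w
    unfolding F_def by (intro prod.cong refl) (simp only: riemann_sample lessThan_iff)
  have H: "H (sample (expl X) ?\<tau> (j * Suc l) (Suc l) w) = G (riemann l j w) * h (expl X (real (Suc j) * blocklen X) w)" for j w
  proof -
    have "real (j * Suc l + Suc l) * ?\<tau> = real (Suc j) * blocklen X"
      using grid_time[of "Suc j" l] by (simp only: mult_Suc add.commute)
    then show ?thesis unfolding H_def riemann_last_sample
      by (simp add: sample_def del: of_nat_Suc mult_Suc_right of_nat_add of_nat_mult)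
  qed
  have "(\<integral>w. F (sample (expl X) ?\<tau> 0 (k * Suc l) w) * H (sample (expl X) ?\<tau> (k * Suc l) (Suc l) w) \<partial>law X \<mu>)
    = (\<integral>w. F (sample (expl X) ?\<tau> 0 (k * Suc l) w) *
      (\<integral>w'. H (sample (expl X) ?\<tau> 0 (Suc l) w') \<partial>law_from X (expl X (real (k * Suc l) * ?\<tau>) w)) \<partial>law X \<mu>)"
    by (rule sampled_markov_property[OF finite_verts process \<mu> \<tau>])
  moreover have "H (sample (expl X) ?\<tau> 0 (Suc l) w) = G (riemann l 0 w) * h (expl X (blocklen X) w)" for w
    using H[of 0 w] by (simp only: mult_0 of_nat_1 One_nat_def[symmetric] mult_1_left)
  ultimately show ?thesis by (simp only: F H grid_time)
qed

text \<open>One frame for both limit passages: either \<open>\<zeta>\<close> is the grid sum and the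
  functions are fixed, or \<open>\<zeta>\<close> is the block itself and the functions vary.\<close>

lemma block_markov_limit:
  fixes \<zeta> :: "nat \<Rightarrow> nat \<Rightarrow> 'p \<Rightarrow> real" and \<psi> :: "nat \<Rightarrow> nat \<Rightarrow> real \<Rightarrow> real" and g :: "nat \<Rightarrow> real \<Rightarrow> real"
    and h :: "'a \<Rightarrow> real"
  assumes \<mu>: "set_pmf \<mu> \<subseteq> verts X"
    and \<zeta>: "\<And>\<mu> l i. set_pmf \<mu> \<subseteq> verts X \<Longrightarrow> \<zeta> l i \<in> borel_measurable (law X \<mu>)"
      "\<And>\<mu> l i w. set_pmf \<mu> \<subseteq> verts X \<Longrightarrow> w \<in> space (law X \<mu>) \<Longrightarrow> 0 \<le> \<zeta> l i w"
    and \<psi>: "\<And>i l. continuous_on UNIV (\<psi> i l)" "\<And>i l z. 0 \<le> z \<Longrightarrow> \<bar>\<psi> i l z\<bar> \<le> B i"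
    and g: "\<And>l. continuous_on UNIV (g l)" "\<And>l z. 0 \<le> z \<Longrightarrow> \<bar>g l z\<bar> \<le> b"
    and lim: "\<And>\<mu> i w. set_pmf \<mu> \<subseteq> verts X \<Longrightarrow> w \<in> space (law X \<mu>) \<Longrightarrow>
        (\<lambda>l. \<psi> i l (\<zeta> l i w)) \<longlonglongrightarrow> \<phi> i (block X (Suc i) w)"
      "\<And>\<mu> i w. set_pmf \<mu> \<subseteq> verts X \<Longrightarrow> w \<in> space (law X \<mu>) \<Longrightarrow>
        (\<lambda>l. g l (\<zeta> l i w)) \<longlonglongrightarrow> G (block X (Suc i) w)"
    and eq: "\<And>l. (\<integral>w. (\<Prod>i<k. \<psi> i l (\<zeta> l i w)) * (g l (\<zeta> l k w) * h (expl X (real (Suc k) * blocklen X) w)) \<partial>law X \<mu>)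
      = (\<integral>w. (\<Prod>i<k. \<psi> i l (\<zeta> l i w)) *
        (\<integral>w'. g l (\<zeta> l 0 w') * h (expl X (blocklen X) w') \<partial>law_from X (expl X (real k * blocklen X) w)) \<partial>law X \<mu>)"
  shows "(\<integral>w. (\<Prod>i<k. \<phi> i (block X (Suc i) w)) * (G (block X (Suc k) w) * h (expl X (real (Suc k) * blocklen X) w)) \<partial>law X \<mu>)
    = (\<integral>w. (\<Prod>i<k. \<phi> i (block X (Suc i) w)) *
        (\<integral>w'. G (block X (Suc 0) w') * h (expl X (blocklen X) w') \<partial>law_from X (expl X (real k * blocklen X) w)) \<partial>law X \<mu>)"
proof -
  obtain bh where bh: "0 \<le> bh" "\<And>x. x \<in> verts X \<Longrightarrow> \<bar>h x\<bar> \<le> bh" using verts_functional_bound[of h] by blast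
  have b: "0 \<le> b" using g(2)[of 0 0] by simp
  have comp: "(\<lambda>w. f (\<zeta> l i w)) \<in> borel_measurable (law X \<nu>)"
    if "continuous_on UNIV f" "set_pmf \<nu> \<subseteq> verts X" for f :: "real \<Rightarrow> real" and l i \<nu>
    by (rule measurable_compose[OF \<zeta>(1)[OF that(2)] borel_measurable_continuous_onI[OF that(1)]])
  have \<theta>: "0 \<le> blocklen X" "0 \<le> real k * blocklen X" "0 \<le> real (Suc k) * blocklen X" for k
    using scale_pos(3) by (simp_all del: of_nat_Suc)
  have gh: "\<bar>g l (\<zeta> l i w) * h (expl X t w)\<bar> \<le> b * bh"
    if "set_pmf \<nu> \<subseteq> verts X" "w \<in> space (law X \<nu>)" "0 \<le> t" for \<nu> w l i t
    unfolding abs_mult using b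
    by (intro mult_mono g(2) \<zeta>(2)[OF that(1,2)] bh(2) expl_in_verts[OF that] abs_ge_zero)
  show ?thesis
  proof (rule markov_dominated_limit[OF \<mu> \<theta>(2), where A = "\<lambda>l w. \<Prod>i<k. \<psi> i l (\<zeta> l i w)"
      and C = "\<lambda>l w. g l (\<zeta> l k w) * h (expl X (real (Suc k) * blocklen X) w)"
      and D = "\<lambda>l w. g l (\<zeta> l 0 w) * h (expl X (blocklen X) w)" and a = "\<Prod>i<k. B i" and c = "b * bh"])
    show "(\<lambda>w. \<Prod>i<k. \<psi> i l (\<zeta> l i w)) \<in> borel_measurable (law X \<mu>)" for l
      by (intro borel_measurable_prod comp \<psi>(1) \<mu>)
    show "(\<lambda>w. g l (\<zeta> l k w) * h (expl X (real (Suc k) * blocklen X) w)) \<in> borel_measurable (law X \<mu>)" for l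
      by (intro borel_measurable_times comp g(1) \<mu> expl_functional_measurable \<theta>)
    show "(\<lambda>w. g l (\<zeta> l 0 w) * h (expl X (blocklen X) w)) \<in> borel_measurable (law_from X x)" if "x \<in> verts X" for l x
      by (intro borel_measurable_times comp g(1) return_verts that expl_functional_measurable \<theta>)
    fix l
    show "(\<lambda>l. \<Prod>i<k. \<psi> i l (\<zeta> l i w)) \<longlonglongrightarrow> (\<Prod>i<k. \<phi> i (block X (Suc i) w))" if "w \<in> space (law X \<mu>)" for w
      by (intro tendsto_prod lim(1)[OF \<mu> that])
    show "(\<lambda>l. g l (\<zeta> l k w) * h (expl X (real (Suc k) * blocklen X) w))
      \<longlonglongrightarrow> G (block X (Suc k) w) * h (expl X (real (Suc k) * blocklen X) w)" if "w \<in> space (law X \<mu>)" for w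
      by (intro tendsto_mult tendsto_const lim(2)[OF \<mu> that])
    show "(\<lambda>l. g l (\<zeta> l 0 w) * h (expl X (blocklen X) w))
      \<longlonglongrightarrow> G (block X (Suc 0) w) * h (expl X (blocklen X) w)" if "x \<in> verts X" "w \<in> space (law_from X x)" for x w
      by (intro tendsto_mult tendsto_const lim(2)[OF return_verts[OF that(1)] that(2)])
    show "\<bar>\<Prod>i<k. \<psi> i l (\<zeta> l i w)\<bar> \<le> (\<Prod>i<k. B i)" if "w \<in> space (law X \<mu>)" for w
      unfolding abs_prod using \<psi>(2)[OF \<zeta>(2)[OF \<mu> that]] by (intro prod_mono conjI abs_ge_zero)
    show "\<bar>g l (\<zeta> l k w) * h (expl X (real (Suc k) * blocklen X) w)\<bar> \<le> b * bh" if "w \<in> space (law X \<mu>)" for w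
      by (rule gh[OF \<mu> that \<theta>(3)])
    show "\<bar>g l (\<zeta> l 0 w) * h (expl X (blocklen X) w)\<bar> \<le> b * bh" if "x \<in> verts X" "w \<in> space (law_from X x)" for x w
      by (rule gh[OF return_verts[OF that(1)] that(2) \<theta>(1)])
  qed (rule eq)
qed

lemma block_markov_continuous:
  fixes G :: "real \<Rightarrow> real" and h :: "'a \<Rightarrow> real"
  assumes \<mu>: "set_pmf \<mu> \<subseteq> verts X"
    and \<phi>: "\<And>i. continuous_on UNIV (\<phi> i)" "\<And>i z. 0 \<le> z \<Longrightarrow> \<bar>\<phi> i z\<bar> \<le> B i"
    and G: "continuous_on UNIV G" "\<And>z. 0 \<le> z \<Longrightarrow> \<bar>G z\<bar> \<le> b"
  shows "(\<integral>w. (\<Prod>i<k. \<phi> i (block X (Suc i) w)) * (G (block X (Suc k) w) * h (expl X (real (Suc k) * blocklen X) w)) \<partial>law X \<mu>)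
    = (\<integral>w. (\<Prod>i<k. \<phi> i (block X (Suc i) w)) *
        (\<integral>w'. G (block X (Suc 0) w') * h (expl X (blocklen X) w') \<partial>law_from X (expl X (real k * blocklen X) w)) \<partial>law X \<mu>)"
proof (rule block_markov_limit[OF \<mu>, where \<zeta> = riemann and \<psi> = "\<lambda>i _. \<phi> i" and g = "\<lambda>_. G" and B = B and b = b])
  have "(\<lambda>l. f (riemann l i w)) \<longlonglongrightarrow> f (block X (Suc i) w)"
    if "continuous_on UNIV f" "set_pmf \<nu> \<subseteq> verts X" "w \<in> space (law X \<nu>)" for f :: "real \<Rightarrow> real" and i \<nu> w
    by (rule continuous_on_tendsto_compose[OF that(1) riemann_tendsto[OF that(2,3)]]) auto
  then show "(\<lambda>l. \<phi> i (riemann l i w)) \<longlonglongrightarrow> \<phi> i (block X (Suc i) w)"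
    "(\<lambda>l. G (riemann l i w)) \<longlonglongrightarrow> G (block X (Suc i) w)"
    if "set_pmf \<nu> \<subseteq> verts X" "w \<in> space (law X \<nu>)" for i \<nu> w
    using that \<phi>(1) G(1) by blast+
qed (use \<phi> G in \<open>auto intro: riemann_measurable riemann_nonneg riemann_markov[OF \<mu>] simp del: of_nat_Suc\<close>)

text \<open>Testing against products of functions of the earlier blocks replaces conditional
  expectations. With \<open>h\<close> constant it exposes one block, with \<open>G\<close> constant
  one step of the chain at block times.\<close>

lemma block_markov:
  fixes G :: "real \<Rightarrow> real" and h :: "'a \<Rightarrow> real"
  assumes \<mu>: "set_pmf \<mu> \<subseteq> verts X" and \<phi>: "\<And>i. bounded_baire (\<phi> i)" and G: "bounded_baire G"
  shows "(\<integral>w. (\<Prod>i<k. \<phi> i (block X (Suc i) w)) * (G (block X (Suc k) w) * h (expl X (real (Suc k) * blocklen X) w)) \<partial>law X \<mu>)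
    = (\<integral>w. (\<Prod>i<k. \<phi> i (block X (Suc i) w)) *
        (\<integral>w'. G (block X (Suc 0) w') * h (expl X (blocklen X) w') \<partial>law_from X (expl X (real k * blocklen X) w)) \<partial>law X \<mu>)"
proof -
  obtain B and \<psi> :: "nat \<Rightarrow> nat \<Rightarrow> real \<Rightarrow> real" where
    \<psi>: "\<And>i l. continuous_on UNIV (\<psi> i l)" "\<And>i l z. 0 \<le> z \<Longrightarrow> \<bar>\<psi> i l z\<bar> \<le> B i"
      "\<And>i z. 0 \<le> z \<Longrightarrow> (\<lambda>l. \<psi> i l z) \<longlonglongrightarrow> \<phi> i z"
    using \<phi> unfolding bounded_baire_def by metis
  obtain b and g :: "nat \<Rightarrow> real \<Rightarrow> real" where
    g: "\<And>l. continuous_on UNIV (g l)" "\<And>l z. 0 \<le> z \<Longrightarrow> \<bar>g l z\<bar> \<le> b" "\<And>z. 0 \<le> z \<Longrightarrow> (\<lambda>l. g l z) \<longlonglongrightarrow> G z"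
    using G unfolding bounded_baire_def by metis
  show ?thesis
  proof (rule block_markov_limit[OF \<mu>, where \<zeta> = "\<lambda>_ i. block X (Suc i)" and \<psi> = \<psi> and g = g and B = B and b = b])
    show "(\<lambda>l. \<psi> i l (block X (Suc i) w)) \<longlonglongrightarrow> \<phi> i (block X (Suc i) w)"
      "(\<lambda>l. g l (block X (Suc i) w)) \<longlonglongrightarrow> G (block X (Suc i) w)"
      if "set_pmf \<nu> \<subseteq> verts X" "w \<in> space (law X \<nu>)" for i \<nu> w
      by (rule \<psi>(3) g(3), rule block_nonneg[OF that])+
  qed (fact \<psi>(1,2) g(1,2) | rule block_measurable block_nonneg block_markov_continuous[OF \<mu> \<psi>(1,2) g(1,2)] | assumption)+
qed

end

section \<open>Mixing estimates for one model\<close>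

text \<open>Weighted so that the first term stays linear in \<open>x\<close>: below, the
  expectations of \<open>x\<close> summed over the blocks are bounded but not small, whereas those
  of \<open>y\<^sup>2\<close> vanish in the limit. Linearity comes from
  \<open>x\<^sup>2 \<le> x\<close>.\<close>

lemma young_product:
  fixes x y \<eta> :: real
  assumes "0 < \<eta>" "0 \<le> x" "x \<le> 1"
  shows "x * y \<le> \<eta> * x + y\<^sup>2 / \<eta>"
proof -
  have "0 \<le> (\<eta> * x - y)\<^sup>2 + (\<eta> * x)\<^sup>2 + y\<^sup>2" by simp
  then have "\<eta> * x * y \<le> (\<eta> * x)\<^sup>2 + y\<^sup>2" by (simp add: power2_diff)
  also have "\<dots> \<le> \<eta>\<^sup>2 * x + y\<^sup>2"
  proof -
    have "x\<^sup>2 \<le> x" using assms(2,3) by (simp add: power2_eq_square mult_left_le)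
    then show ?thesis by (simp add: power_mult_distrib mult_left_mono)
  qed
  finally have "(\<eta> * (x * y)) / \<eta> \<le> (\<eta>\<^sup>2 * x + y\<^sup>2) / \<eta>"
    using assms(1) by (intro divide_right_mono) (auto simp: mult_ac)
  then show ?thesis using assms(1) by (simp add: add_divide_distrib power2_eq_square)
qed

context exploration_clock
begin

section \<open>Averages in equilibrium\<close>

definition mean :: "('a \<Rightarrow> real) \<Rightarrow> real" where
  "mean h = (\<Sum>y\<in>verts X. pmf (invar X) y * h y)"

definition block_mean :: "(real \<Rightarrow> real) \<Rightarrow> 'a \<Rightarrow> real" where
  "block_mean g y = (\<integral>w. g (block X (Suc 0) w) \<partial>law_from X y)"

lemma mean_mono: "(\<And>y. y \<in> verts X \<Longrightarrow> g y \<le> h y) \<Longrightarrow> mean g \<le> mean h"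
  unfolding mean_def by (intro sum_mono mult_left_mono) auto

lemma mean_nonneg: "(\<And>y. y \<in> verts X \<Longrightarrow> 0 \<le> h y) \<Longrightarrow> 0 \<le> mean h"
  unfolding mean_def by (intro sum_nonneg mult_nonneg_nonneg) auto

lemma mean_const: "mean (\<lambda>_. c) = c"
  unfolding mean_def using sum_pmf_eq_1[OF finite_verts invar_verts]
  by (simp flip: sum_distrib_right)

lemma mean_add: "mean (\<lambda>y. g y + h y) = mean g + mean h"
  by (simp add: mean_def distrib_left sum.distrib)

lemma mean_cmult: "mean (\<lambda>y. c * h y) = c * mean h"
  by (simp add: mean_def sum_distrib_left mult_ac)

lemma mean_sum: "mean (\<lambda>y. \<Sum>i\<in>I. h i y) = (\<Sum>i\<in>I. mean (h i))"
  unfolding mean_def sum_distrib_left by (rule sum.swap)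

context
  fixes \<mu> :: "'a pmf" assumes \<mu>: "set_pmf \<mu> \<subseteq> verts X"
begin

lemma integrable_bounded:
  fixes f :: "'p \<Rightarrow> real"
  assumes "f \<in> borel_measurable (law X \<mu>)" "\<And>w. w \<in> space (law X \<mu>) \<Longrightarrow> \<bar>f w\<bar> \<le> B"
  shows "integrable (law X \<mu>) f"
proof -
  interpret prob_space "law X \<mu>" by (rule prob_space_law[OF \<mu>])
  show ?thesis using assms by (intro integrable_const_bound[where B = B] AE_I2) auto
qed

lemma integrable_expl_functional:
  fixes h :: "'a \<Rightarrow> real"
  assumes "0 \<le> t" shows "integrable (law X \<mu>) (\<lambda>w. h (expl X t w))"
proof -
  obtain b where "\<forall>x\<in>verts X. \<bar>h x\<bar> \<le> b" using verts_functional_bound by blast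
  then show ?thesis
    using expl_in_verts[OF \<mu> _ assms]
    by (intro integrable_bounded[where B = b] expl_functional_measurable[OF \<mu> assms]) auto
qed

lemma bounded_baire_bound:
  assumes "bounded_baire g" obtains B where "\<And>z. 0 \<le> z \<Longrightarrow> \<bar>g z\<bar> \<le> B"
proof -
  obtain B and \<phi> :: "nat \<Rightarrow> real \<Rightarrow> real" where
    \<phi>: "\<And>m z. 0 \<le> z \<Longrightarrow> \<bar>\<phi> m z\<bar> \<le> B" "\<And>z. 0 \<le> z \<Longrightarrow> (\<lambda>m. \<phi> m z) \<longlonglongrightarrow> g z"
    using assms unfolding bounded_baire_def by blast
  have "\<bar>g z\<bar> \<le> B" if "0 \<le> z" for z
    by (rule LIMSEQ_le_const2[OF tendsto_rabs[OF \<phi>(2)[OF that]]]) (use \<phi>(1)[OF that] in blast)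
  then show ?thesis by (rule that)
qed

lemma integrable_baire_block:
  assumes "bounded_baire g" shows "integrable (law X \<mu>) (\<lambda>w. g (block X (Suc k) w))"
proof -
  obtain B where "\<And>z. 0 \<le> z \<Longrightarrow> \<bar>g z\<bar> \<le> B" using bounded_baire_bound[OF assms] by blast
  then show ?thesis
    using block_nonneg[OF \<mu>] by (intro integrable_bounded[where B = B] baire_block_measurable[OF \<mu> assms]) auto
qed

end

lemma block_mean_mono:
  assumes "y \<in> verts X" "bounded_baire f" "bounded_baire g" "\<And>z. 0 \<le> z \<Longrightarrow> f z \<le> g z"
  shows "block_mean f y \<le> block_mean g y"
  unfolding block_mean_def using assms(4) block_nonneg[OF return_verts[OF assms(1)]]
  by (intro integral_mono integrable_baire_block[OF return_verts[OF assms(1)]] assms(2,3)) auto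

lemma block_mean_const: "y \<in> verts X \<Longrightarrow> block_mean (\<lambda>_. c) y = c"
  unfolding block_mean_def using prob_space.prob_space[OF prob_space_law[OF return_verts]] by simp

lemma bounded_baire_const: "bounded_baire (\<lambda>_. c)"
  by (rule bounded_baire_continuous[where B = "\<bar>c\<bar>"]) auto

lemma block_mean_nonneg:
  assumes "y \<in> verts X" "bounded_baire g" "\<And>z. 0 \<le> z \<Longrightarrow> 0 \<le> g z"
  shows "0 \<le> block_mean g y"
  using block_mean_mono[OF assms(1) bounded_baire_const assms(2,3)] block_mean_const[OF assms(1)] by simp

lemma block_tail_block_mean:
  assumes "y \<in> verts X" shows "block_tail X u y = block_mean (indicator {u<..}) y"
proof -
  have "block_mean (indicator {u<..}) y = (\<integral>w. indicator {w \<in> space (law_from X y). block X 1 w > u} w \<partial>law_from X y)"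
    unfolding block_mean_def by (intro Bochner_Integration.integral_cong refl) (simp add: indicator_def)
  then show ?thesis unfolding block_tail_def by (simp add: Int_absorb2 subset_eq)
qed

definition mixing :: "real \<Rightarrow> bool" where
  "mixing \<rho> \<longleftrightarrow> (\<forall>x\<in>verts X. \<forall>y\<in>verts X. \<forall>t\<ge>0.
     \<bar>measure (law_from X x) {w \<in> space (law_from X x). expl X (t + real (mixtime X)) w = y}
       - pmf (invar X) y\<bar> \<le> \<rho> * pmf (invar X) y)"

context
  fixes \<rho> :: real assumes mixing: "mixing \<rho>" and \<rho>: "0 \<le> \<rho>"
begin

text \<open>The mixing bound is relative to the equilibrium weights, so for nonnegative
  \<open>h\<close> the error is relative to \<open>mean h\<close>. That matters because averages of
  the order of one over the number of blocks are later summed over all blocks.\<close>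

lemma mixing_step:
  fixes h :: "'a \<Rightarrow> real"
  assumes x: "x \<in> verts X" and h: "\<And>y. y \<in> verts X \<Longrightarrow> 0 \<le> h y"
  shows "\<bar>(\<integral>w. h (expl X (blocklen X) w) \<partial>law_from X x) - mean h\<bar> \<le> \<rho> * mean h"
proof -
  note rv = return_verts[OF x]
  let ?p = "\<lambda>y. measure (law_from X x) {w \<in> space (law_from X x). expl X (blocklen X) w = y}"
  have \<theta>: "0 \<le> blocklen X" using scale_pos(3) by simp
  have "(\<integral>w. h (expl X (blocklen X) w) \<partial>law_from X x) = (\<Sum>y\<in>verts X. h y * ?p y)"
    by (rule integral_finite_valued[OF prob_space_law[OF rv] finite_verts expl_in_verts[OF rv _ \<theta>]
          markov_jump_process_sets[OF process[OF rv] \<theta>]])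
  then have "(\<integral>w. h (expl X (blocklen X) w) \<partial>law_from X x) - mean h
      = (\<Sum>y\<in>verts X. h y * (?p y - pmf (invar X) y))"
    by (simp add: mean_def sum_subtractf right_diff_distrib mult.commute)
  also have "\<bar>\<dots>\<bar> \<le> (\<Sum>y\<in>verts X. \<bar>h y * (?p y - pmf (invar X) y)\<bar>)" by (rule sum_abs)
  also have "\<dots> \<le> (\<Sum>y\<in>verts X. h y * (\<rho> * pmf (invar X) y))"
  proof (rule sum_mono)
    fix y assume y: "y \<in> verts X"
    \<comment> \<open>One block is long enough to mix: the time left after \<open>mixtime X\<close>
      is the free parameter of the mixing condition.\<close>
    have "\<bar>?p y - pmf (invar X) y\<bar> \<le> \<rho> * pmf (invar X) y"
      using mixing[unfolded mixing_def, rule_format, OF x y, of "blocklen X - real (mixtime X)"] mixtime_le by simp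
    then show "\<bar>h y * (?p y - pmf (invar X) y)\<bar> \<le> h y * (\<rho> * pmf (invar X) y)"
      unfolding abs_mult using h[OF y] by (intro mult_mono) auto
  qed
  also have "\<dots> = \<rho> * mean h" by (simp add: mean_def sum_distrib_left mult_ac)
  finally show ?thesis .
qed

context
  fixes \<mu> :: "'a pmf" assumes \<mu>: "set_pmf \<mu> \<subseteq> verts X"
begin

abbreviation (input) state :: "nat \<Rightarrow> 'p \<Rightarrow> 'a" where
  "state k w \<equiv> expl X (real k * blocklen X) w"

lemma state_in: "w \<in> space (law X \<mu>) \<Longrightarrow> state k w \<in> verts X"
  using expl_in_verts[OF \<mu>] scale_pos(3) by simp

lemma markov_block:
  assumes "\<And>i. bounded_baire (\<phi> i)" "bounded_baire G"
  shows "(\<integral>w. (\<Prod>i<k. \<phi> i (block X (Suc i) w)) * G (block X (Suc k) w) \<partial>law X \<mu>)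
    = (\<integral>w. (\<Prod>i<k. \<phi> i (block X (Suc i) w)) * block_mean G (state k w) \<partial>law X \<mu>)"
  using block_markov[OF \<mu> assms, where k = k and h = "\<lambda>_. 1"] by (simp add: block_mean_def)

lemma markov_state:
  fixes h :: "'a \<Rightarrow> real"
  assumes "\<And>i. bounded_baire (\<phi> i)"
  shows "(\<integral>w. (\<Prod>i<k. \<phi> i (block X (Suc i) w)) * h (state (Suc k) w) \<partial>law X \<mu>)
    = (\<integral>w. (\<Prod>i<k. \<phi> i (block X (Suc i) w)) *
        (\<integral>w'. h (expl X (blocklen X) w') \<partial>law_from X (state k w)) \<partial>law X \<mu>)"
  using block_markov[OF \<mu> assms bounded_baire_const[of 1], where k = k and h = h] by (simp del: of_nat_Suc)

context
  fixes \<phi> :: "nat \<Rightarrow> real \<Rightarrow> real"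
  assumes \<phi>: "\<And>i. bounded_baire (\<phi> i)" and \<phi>01: "\<And>i z. 0 \<le> z \<Longrightarrow> 0 \<le> \<phi> i z" "\<And>i z. 0 \<le> z \<Longrightarrow> \<phi> i z \<le> 1"
begin

abbreviation (input) past :: "nat \<Rightarrow> 'p \<Rightarrow> real" where
  "past k w \<equiv> \<Prod>i<k. \<phi> i (block X (Suc i) w)"

lemma past_bounds: "w \<in> space (law X \<mu>) \<Longrightarrow> 0 \<le> past k w" "w \<in> space (law X \<mu>) \<Longrightarrow> past k w \<le> 1"
  using \<phi>01 block_nonneg[OF \<mu>] by (auto intro!: prod_nonneg prod_le_1)

lemma past_measurable: "(\<lambda>w. past k w) \<in> borel_measurable (law X \<mu>)"
  by (intro borel_measurable_prod baire_block_measurable[OF \<mu> \<phi>])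

lemma past_times_integrable:
  fixes f :: "'p \<Rightarrow> real"
  assumes "integrable (law X \<mu>) f" shows "integrable (law X \<mu>) (\<lambda>w. past k w * f w)"
proof (rule Bochner_Integration.integrable_bound[OF assms])
  show "(\<lambda>w. past k w * f w) \<in> borel_measurable (law X \<mu>)"
    by (intro borel_measurable_times past_measurable borel_measurable_integrable[OF assms])
  have "\<bar>past k w\<bar> * \<bar>f w\<bar> \<le> 1 * \<bar>f w\<bar>" if "w \<in> space (law X \<mu>)" for w
    using past_bounds[OF that, of k] by (intro mult_right_mono) auto
  then show "AE w in law X \<mu>. norm (past k w * f w) \<le> norm (f w)"
    by (intro AE_I2) (simp only: real_norm_def abs_mult mult_1_left)
qed

text \<open>\<open>past k\<close> depends on the path up to time \<open>real k * blocklen X\<close>,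
  one full block before the state numbered \<open>Suc k\<close>; the Markov property at the earlier
  time leaves exactly one block over which to mix.\<close>

lemma past_state:
  fixes h :: "'a \<Rightarrow> real"
  assumes h: "\<And>y. y \<in> verts X \<Longrightarrow> 0 \<le> h y"
  shows "\<bar>(\<integral>w. past k w * h (state (Suc k) w) \<partial>law X \<mu>) - mean h * (\<integral>w. past k w \<partial>law X \<mu>)\<bar>
    \<le> \<rho> * mean h * (\<integral>w. past k w \<partial>law X \<mu>)"
proof -
  interpret P: prob_space "law X \<mu>" by (rule prob_space_law[OF \<mu>])
  let ?f = "\<lambda>x. \<integral>w'. h (expl X (blocklen X) w') \<partial>law_from X x"
  have t: "0 \<le> real k * blocklen X" using scale_pos(3) by simp
  have i1: "integrable (law X \<mu>) (\<lambda>w. past k w * ?f (state k w))"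
    by (rule past_times_integrable[OF integrable_expl_functional[OF \<mu> t]])
  have i2: "integrable (law X \<mu>) (\<lambda>w. past k w)"
    using past_times_integrable[of "\<lambda>_. 1" k] by simp
  have "(\<integral>w. past k w * h (state (Suc k) w) \<partial>law X \<mu>) - mean h * (\<integral>w. past k w \<partial>law X \<mu>)
      = (\<integral>w. past k w * ?f (state k w) - mean h * past k w \<partial>law X \<mu>)"
    unfolding markov_state[OF \<phi>, where k = k and h = h] using i1 i2 by simp
  also have "\<bar>\<dots>\<bar> \<le> (\<integral>w. \<bar>past k w * ?f (state k w) - mean h * past k w\<bar> \<partial>law X \<mu>)"
    by (rule integral_abs_bound)
  also have "\<dots> \<le> (\<integral>w. \<rho> * mean h * past k w \<partial>law X \<mu>)"
  proof (rule integral_mono)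
    show "integrable (law X \<mu>) (\<lambda>w. \<bar>past k w * ?f (state k w) - mean h * past k w\<bar>)" using i1 i2 by simp
    show "integrable (law X \<mu>) (\<lambda>w. \<rho> * mean h * past k w)" using i2 by simp
    fix w assume w: "w \<in> space (law X \<mu>)"
    have "\<bar>past k w * ?f (state k w) - mean h * past k w\<bar> = past k w * \<bar>?f (state k w) - mean h\<bar>"
      using past_bounds(1)[OF w, of k] by (simp add: abs_mult right_diff_distrib[symmetric] mult.commute[of "mean h"])
    also have "\<dots> \<le> past k w * (\<rho> * mean h)"
      using past_bounds(1)[OF w, of k] by (intro mult_left_mono mixing_step state_in w h)
    finally show "\<bar>past k w * ?f (state k w) - mean h * past k w\<bar> \<le> \<rho> * mean h * past k w"
      by (simp only: mult_ac)
  qed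
  also have "\<dots> = \<rho> * mean h * (\<integral>w. past k w \<partial>law X \<mu>)" by simp
  finally show ?thesis .
qed

lemma past_mean_bounds: "0 \<le> (\<integral>w. past k w \<partial>law X \<mu>)" "(\<integral>w. past k w \<partial>law X \<mu>) \<le> 1"
proof -
  interpret P: prob_space "law X \<mu>" by (rule prob_space_law[OF \<mu>])
  show "0 \<le> (\<integral>w. past k w \<partial>law X \<mu>)"
    using past_bounds(1)[of _ k] by (intro Bochner_Integration.integral_nonneg_AE AE_I2)
  have i2: "integrable (law X \<mu>) (\<lambda>w. past k w)"
    using past_times_integrable[of "\<lambda>_. 1" k] by simp
  have "(\<integral>w. past k w \<partial>law X \<mu>) \<le> (\<integral>w. 1 \<partial>law X \<mu>)"
    using past_bounds(2)[of _ k] by (intro integral_mono i2) auto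
  then show "(\<integral>w. past k w \<partial>law X \<mu>) \<le> 1" by (simp add: P.prob_space)
qed

lemma past_state_le:
  fixes h :: "'a \<Rightarrow> real"
  assumes h: "\<And>y. y \<in> verts X \<Longrightarrow> 0 \<le> h y"
  shows "(\<integral>w. past k w * h (state (Suc k) w) \<partial>law X \<mu>) \<le> (1 + \<rho>) * mean h * (\<integral>w. past k w \<partial>law X \<mu>)"
  using past_state[where h = h and k = k, OF h] by (simp add: algebra_simps abs_le_iff del: of_nat_Suc)

end

lemma state_le:
  fixes h :: "'a \<Rightarrow> real"
  assumes h: "\<And>y. y \<in> verts X \<Longrightarrow> 0 \<le> h y"
  shows "(\<integral>w. h (state (Suc k) w) \<partial>law X \<mu>) \<le> (1 + \<rho>) * mean h"
  using past_state_le[where \<phi> = "\<lambda>_ _. 1" and h = h and k = k, OF bounded_baire_const _ _ h]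
    prob_space.prob_space[OF prob_space_law[OF \<mu>]] by simp

text \<open>A block that is not the first starts at least one block length after time 0, hence
  nearly in equilibrium whatever \<open>\<mu>\<close> is. The first block is out of reach of this
  argument, which is where hypothesis (i) comes in.\<close>

lemma block_le:
  assumes g: "bounded_baire g" "\<And>z. 0 \<le> z \<Longrightarrow> 0 \<le> g z"
  shows "(\<integral>w. g (block X (Suc (Suc k)) w) \<partial>law X \<mu>) \<le> (1 + \<rho>) * mean (block_mean g)"
  using markov_block[of "\<lambda>_ _. 1" g "Suc k", OF bounded_baire_const g(1)]
    state_le[of "block_mean g" k, OF block_mean_nonneg[OF _ g]] by simp

text \<open>With \<open>U k\<close> the expectation of the product over the first \<open>k\<close>
  blocks and \<open>c k\<close> the equilibrium value of the next factor, \<open>U (Suc k)\<close>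
  is compared with \<open>c k * U k\<close>; since all \<open>c i\<close> lie between 0 and 1, the
  one-step errors just add up. \<open>\<gamma>\<close> bounds the mean weight,
  \<open>\<gamma>2\<close> the mean squared conditional weight, and \<open>\<beta>\<close> takes
  care of the first block, which need not be near equilibrium.\<close>

lemma product_laplace_estimate:
  fixes u :: "nat \<Rightarrow> real \<Rightarrow> real" and \<gamma> \<gamma>2 \<eta> :: real
  assumes u: "\<And>i. bounded_baire (u i)" "\<And>i z. 0 \<le> z \<Longrightarrow> 0 \<le> u i z" "\<And>i z. 0 \<le> z \<Longrightarrow> u i z \<le> 1"
    and u': "\<And>i. bounded_baire (\<lambda>z. 1 - u i z)"
    and \<gamma>: "\<And>i. mean (block_mean (\<lambda>z. 1 - u i z)) \<le> \<gamma>" "\<And>i. mean (\<lambda>y. (block_mean (\<lambda>z. 1 - u i z) y)\<^sup>2) \<le> \<gamma>2"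
    and \<eta>: "0 < \<eta>"
    and \<beta>: "(\<integral>w. 1 - u 0 (block X (Suc 0) w) \<partial>law X \<mu>) \<le> \<beta>"
  shows "\<bar>(\<integral>w. (\<Prod>i<k. u i (block X (Suc i) w)) \<partial>law X \<mu>) - (\<Prod>i<k. 1 - mean (block_mean (\<lambda>z. 1 - u i z)))\<bar>
    \<le> (1 + \<gamma> + \<eta>) * \<beta> + \<gamma> + real k * (\<rho> * \<gamma> + (\<gamma> + \<eta>) * (1 + \<rho>) * \<gamma> + (1 + \<rho>) * \<gamma>2 / \<eta>)"
proof -
  interpret P: prob_space "law X \<mu>" by (rule prob_space_law[OF \<mu>])
  define U where "U k = (\<integral>w. (\<Prod>i<k. u i (block X (Suc i) w)) \<partial>law X \<mu>)" for k
  define g where "g i y = block_mean (\<lambda>z. 1 - u i z) y" for i y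
  define c where "c i = 1 - mean (g i)" for i
  define b where "b i = (\<integral>w. 1 - u i (block X (Suc i) w) \<partial>law X \<mu>)" for i
  have g0: "0 \<le> g i y" and g1: "g i y \<le> 1" if "y \<in> verts X" for i y
  proof -
    show "0 \<le> g i y" unfolding g_def using u(3) by (intro block_mean_nonneg that u') auto
    have "g i y \<le> block_mean (\<lambda>_. 1) y" unfolding g_def
      using u(2) by (intro block_mean_mono that u' bounded_baire_const) auto
    then show "g i y \<le> 1" using block_mean_const[OF that] by simp
  qed
  have m0: "0 \<le> mean (g i)" for i using g0 by (intro mean_nonneg)
  have m1: "mean (g i) \<le> 1" for i using mean_mono[of "g i" "\<lambda>_. 1"] g1 mean_const by simp
  have m\<gamma>: "mean (g i) \<le> \<gamma>" for i using \<gamma>(1)[of i] by (simp add: g_def[abs_def])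
  have \<gamma>0: "0 \<le> \<gamma>" using m0[of 0] m\<gamma>[of 0] by simp
  have m\<gamma>2: "mean (\<lambda>y. (g i y)\<^sup>2) \<le> \<gamma>2" for i using \<gamma>(2)[of i] by (simp add: g_def[abs_def])
  have \<gamma>20: "0 \<le> \<gamma>2" using mean_nonneg[of "\<lambda>y. (g 0 y)\<^sup>2"] m\<gamma>2[of 0] by simp
  have c01: "0 \<le> c i" "c i \<le> 1" for i using m0[of i] m1[of i] by (auto simp: c_def)
  have ublock: "block_mean (u i) y = 1 - g i y" if "y \<in> verts X" for i y
  proof -
    interpret Q: prob_space "law_from X y" by (rule prob_space_law[OF return_verts[OF that]])
    show ?thesis unfolding g_def block_mean_def
      using integrable_baire_block[OF return_verts[OF that] u(1)[of i], of 0] by (simp add: Q.prob_space)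
  qed
  note past = past_bounds[where \<phi> = u, OF u, simplified]
    and past_int = past_times_integrable[where \<phi> = u, OF u, simplified]
  note bI = integrable_baire_block[OF \<mu> u(1)]
  have t: "0 \<le> real k * blocklen X" for k using scale_pos(3) by simp
  have b0: "0 \<le> b i" for i
    unfolding b_def using u(3) block_nonneg[OF \<mu>] by (intro Bochner_Integration.integral_nonneg_AE AE_I2) auto
  have b_bound: "b i \<le> (1 + \<rho>) * \<gamma> + (if i = 0 then \<beta> else 0)" for i
  proof (cases i)
    case 0 then show ?thesis using \<beta> \<rho> \<gamma>0 by (simp add: b_def add_increasing)
  next
    case (Suc j)
    have "b i \<le> (1 + \<rho>) * mean (g i)" unfolding b_def Suc g_def[abs_def]
      using u(3) by (intro block_le u') auto
    also have "\<dots> \<le> (1 + \<rho>) * \<gamma>" using \<rho> m\<gamma> by (intro mult_left_mono) auto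
    finally show ?thesis using Suc by simp
  qed
  have \<beta>0: "0 \<le> \<beta>" using b0[of 0] \<beta> by (simp add: b_def)
  \<comment> \<open>The state from which the new block starts is one block later than the blocks in
    \<open>?p j\<close>, but it is the end of the block just before it. The factor of that block is
    therefore split off as \<open>1 - ?v\<close>: the 1 gives a decorrelated term, and the remainder
    carries the small factor \<open>?v\<close>.\<close>
  have step: "\<bar>U (Suc (Suc j)) - c (Suc j) * U (Suc j)\<bar> \<le> \<rho> * \<gamma> + (\<gamma> + \<eta>) * b j + (1 + \<rho>) * \<gamma>2 / \<eta>" for j
  proof -
    let ?p = "\<lambda>k w. \<Prod>i<k. u i (block X (Suc i) w)"
    let ?h = "\<lambda>w. g (Suc j) (state (Suc j) w)"
    let ?m = "mean (g (Suc j))"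
    let ?v = "\<lambda>w. 1 - u j (block X (Suc j) w)"
    have hI: "integrable (law X \<mu>) ?h" by (rule integrable_expl_functional[OF \<mu> t])
    have pI: "integrable (law X \<mu>) (?p k)" for k using past_int[of "\<lambda>_. 1" k] by simp
    have U2: "U (Suc (Suc j)) = (\<integral>w. ?p (Suc j) w * (1 - ?h w) \<partial>law X \<mu>)"
    proof -
      have "U (Suc (Suc j)) = (\<integral>w. ?p (Suc j) w * u (Suc j) (block X (Suc (Suc j)) w) \<partial>law X \<mu>)"
        unfolding U_def by simp
      also have "\<dots> = (\<integral>w. ?p (Suc j) w * block_mean (u (Suc j)) (state (Suc j) w) \<partial>law X \<mu>)"
        by (rule markov_block[OF u(1) u(1)])
      also have "\<dots> = (\<integral>w. ?p (Suc j) w * (1 - ?h w) \<partial>law X \<mu>)"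
        by (intro Bochner_Integration.integral_cong refl) (simp only: ublock state_in)
      finally show ?thesis .
    qed
    have hmI: "integrable (law X \<mu>) (\<lambda>w. ?m - ?h w)" using hI by simp
    have vI: "integrable (law X \<mu>) ?v" using bI by simp
    have vhI: "integrable (law X \<mu>) (\<lambda>w. ?v w * (?m - ?h w))"
    proof (rule Bochner_Integration.integrable_bound[OF hmI])
      show "(\<lambda>w. ?v w * (?m - ?h w)) \<in> borel_measurable (law X \<mu>)"
        by (intro borel_measurable_times borel_measurable_integrable vI hmI)
      have "\<bar>?v w\<bar> * \<bar>?m - ?h w\<bar> \<le> 1 * \<bar>?m - ?h w\<bar>" if "w \<in> space (law X \<mu>)" for w
        using u(2,3)[OF block_nonneg[OF \<mu> that]] by (intro mult_right_mono) auto
      then show "AE w in law X \<mu>. norm (?v w * (?m - ?h w)) \<le> norm (?m - ?h w)"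
        by (intro AE_I2) (simp only: real_norm_def abs_mult mult_1_left)
    qed
    have pvI: "integrable (law X \<mu>) (\<lambda>w. ?p j w * (?v w * (?m - ?h w)))"
      by (rule past_int[OF vhI])
    have "U (Suc (Suc j)) - c (Suc j) * U (Suc j)
        = (\<integral>w. ?p (Suc j) w * (1 - ?h w) \<partial>law X \<mu>) - (\<integral>w. c (Suc j) * ?p (Suc j) w \<partial>law X \<mu>)"
      unfolding U2 unfolding U_def by (simp del: of_nat_Suc prod.lessThan_Suc)
    also have "\<dots> = (\<integral>w. ?p (Suc j) w * (1 - ?h w) - c (Suc j) * ?p (Suc j) w \<partial>law X \<mu>)"
      using hI by (intro Bochner_Integration.integral_diff[symmetric] past_int integrable_mult_right pI) simp
    also have "\<dots> = (\<integral>w. ?p j w * (?m - ?h w) - ?p j w * (?v w * (?m - ?h w)) \<partial>law X \<mu>)"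
      by (intro Bochner_Integration.integral_cong refl) (simp add: c_def algebra_simps)
    also have "\<dots> = (\<integral>w. ?p j w * (?m - ?h w) \<partial>law X \<mu>) - (\<integral>w. ?p j w * (?v w * (?m - ?h w)) \<partial>law X \<mu>)"
      by (rule Bochner_Integration.integral_diff[OF past_int[OF hmI] pvI])
    finally have eq: "U (Suc (Suc j)) - c (Suc j) * U (Suc j) = \<dots>" .
    have 1: "\<bar>\<integral>w. ?p j w * (?m - ?h w) \<partial>law X \<mu>\<bar> \<le> \<rho> * \<gamma>"
    proof -
      have "(\<integral>w. ?p j w * (?m - ?h w) \<partial>law X \<mu>) = ?m * (\<integral>w. ?p j w \<partial>law X \<mu>) - (\<integral>w. ?p j w * ?h w \<partial>law X \<mu>)"
        using pI[of j] past_int[OF hI, of j] by (simp add: right_diff_distrib mult.commute[of _ ?m])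
      also have "\<bar>\<dots>\<bar> \<le> \<rho> * ?m * (\<integral>w. ?p j w \<partial>law X \<mu>)"
        using past_state[where \<phi> = u and h = "g (Suc j)" and k = j, OF u g0]
        by (simp add: abs_minus_commute del: of_nat_Suc)
      also have "\<dots> \<le> \<rho> * ?m * 1"
        using past_mean_bounds[where \<phi> = u and k = j, OF u, simplified] \<rho> m0 by (intro mult_left_mono) auto
      also have "\<dots> \<le> \<rho> * \<gamma>" using \<rho> m\<gamma> by (simp add: mult_left_mono)
      finally show ?thesis .
    qed
    have h2I: "integrable (law X \<mu>) (\<lambda>w. (?h w)\<^sup>2 / \<eta>)"
      using integrable_expl_functional[OF \<mu> t, of "\<lambda>y. (g (Suc j) y)\<^sup>2" "Suc j"] by simp
    have 2: "\<bar>\<integral>w. ?p j w * (?v w * (?m - ?h w)) \<partial>law X \<mu>\<bar> \<le> (\<gamma> + \<eta>) * b j + (1 + \<rho>) * \<gamma>2 / \<eta>"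
    proof -
      have "\<bar>\<integral>w. ?p j w * (?v w * (?m - ?h w)) \<partial>law X \<mu>\<bar> \<le> (\<integral>w. \<bar>?p j w * (?v w * (?m - ?h w))\<bar> \<partial>law X \<mu>)"
        by (rule integral_abs_bound)
      also have "\<dots> \<le> (\<integral>w. (\<gamma> + \<eta>) * ?v w + (?h w)\<^sup>2 / \<eta> \<partial>law X \<mu>)"
      proof (rule integral_mono)
        show "integrable (law X \<mu>) (\<lambda>w. \<bar>?p j w * (?v w * (?m - ?h w))\<bar>)" using pvI by (rule integrable_abs)
        show "integrable (law X \<mu>) (\<lambda>w. (\<gamma> + \<eta>) * ?v w + (?h w)\<^sup>2 / \<eta>)"
          by (intro Bochner_Integration.integrable_add integrable_mult_right vI h2I)
        fix w assume w: "w \<in> space (law X \<mu>)"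
        have v: "0 \<le> ?v w" "?v w \<le> 1" using u(2,3)[OF block_nonneg[OF \<mu> w]] by auto
        have h: "0 \<le> ?h w" using g0[OF state_in[OF w]] .
        have "\<bar>?p j w * (?v w * (?m - ?h w))\<bar> = ?p j w * (?v w * \<bar>?m - ?h w\<bar>)"
          using past(1)[OF w] v by (simp add: abs_mult)
        also have "\<dots> \<le> 1 * (?v w * \<bar>?m - ?h w\<bar>)" using past(2)[OF w] v by (intro mult_right_mono) auto
        also have "\<dots> \<le> ?v w * (\<gamma> + ?h w)"
        proof -
          have "\<bar>?m - ?h w\<bar> \<le> \<gamma> + ?h w" using m0[of "Suc j"] m\<gamma>[of "Suc j"] h by linarith
          then show ?thesis using v by (simp add: mult_left_mono)
        qed
        \<comment> \<open>\<open>\<gamma> * ?v\<close> is already a product of two small quantities;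
          only \<open>?v * ?h\<close> couples a block with the state it leads to, and Young's
          inequality is spent on it.\<close>
        also have "\<dots> \<le> (\<gamma> + \<eta>) * ?v w + (?h w)\<^sup>2 / \<eta>"
          using young_product[OF \<eta> v, of "?h w"] by (simp add: algebra_simps)
        finally show "\<bar>?p j w * (?v w * (?m - ?h w))\<bar> \<le> (\<gamma> + \<eta>) * ?v w + (?h w)\<^sup>2 / \<eta>" .
      qed
      also have "\<dots> = (\<gamma> + \<eta>) * b j + (\<integral>w. (?h w)\<^sup>2 \<partial>law X \<mu>) / \<eta>"
        unfolding b_def using vI h2I by (subst Bochner_Integration.integral_add) auto
      also have "(\<integral>w. (?h w)\<^sup>2 \<partial>law X \<mu>) / \<eta> \<le> (1 + \<rho>) * \<gamma>2 / \<eta>"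
      proof (rule divide_right_mono)
        have "(\<integral>w. (?h w)\<^sup>2 \<partial>law X \<mu>) \<le> (1 + \<rho>) * mean (\<lambda>y. (g (Suc j) y)\<^sup>2)"
          by (rule state_le) simp
        also have "\<dots> \<le> (1 + \<rho>) * \<gamma>2" using \<rho> m\<gamma>2 by (intro mult_left_mono) auto
        finally show "(\<integral>w. (?h w)\<^sup>2 \<partial>law X \<mu>) \<le> (1 + \<rho>) * \<gamma>2" .
      qed (use \<eta> in simp)
      finally show ?thesis by simp
    qed
    show ?thesis unfolding eq using 1 2 by linarith
  qed
  have U1: "\<bar>U 1 - c 0 * U 0\<bar> \<le> \<beta> + \<gamma>"
  proof -
    have "U 0 = 1" by (simp add: U_def P.prob_space)
    moreover have "U 1 = 1 - b 0" unfolding U_def b_def using bI[of 0 0] by (simp add: P.prob_space)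
    ultimately show ?thesis using b0[of 0] \<beta> m0[of 0] m\<gamma>[of 0] by (simp add: c_def b_def)
  qed
  define K where "K = \<rho> * \<gamma> + (\<gamma> + \<eta>) * ((1 + \<rho>) * \<gamma>) + (1 + \<rho>) * \<gamma>2 / \<eta>"
  have K0: "0 \<le> K" unfolding K_def using \<rho> \<gamma>0 \<gamma>20 \<eta> by simp
  have ge: "(\<gamma> + \<eta>) * \<beta> \<ge> 0" using \<gamma>0 \<eta> \<beta>0 by simp
  \<comment> \<open>\<open>j = 0\<close> is the initial comparison, with \<open>U 0 = 1\<close>. For
    \<open>j = 1\<close> the remainder involves the mean weight of the first block, which adds the
    multiple of \<open>\<beta>\<close>.\<close>
  have stepK: "\<bar>U (Suc j) - c j * U j\<bar> \<le> (if j = 0 then \<beta> + \<gamma> else if j = 1 then K + (\<gamma> + \<eta>) * \<beta> else K)" for j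
  proof (cases j)
    case 0 then show ?thesis using U1 by simp
  next
    case (Suc i)
    have "(\<gamma> + \<eta>) * b i \<le> (\<gamma> + \<eta>) * ((1 + \<rho>) * \<gamma> + (if i = 0 then \<beta> else 0))"
      using \<gamma>0 \<eta> by (intro mult_left_mono b_bound) auto
    then show ?thesis using step[of i] Suc by (auto simp: K_def algebra_simps split: if_splits)
  qed
  have tele: "\<bar>U k - (\<Prod>i<k. c i)\<bar> \<le> (\<Sum>j<k. if j = 0 then \<beta> + \<gamma> else if j = 1 then K + (\<gamma> + \<eta>) * \<beta> else K)" for k
  proof (induction k)
    case 0 show ?case by (simp add: U_def P.prob_space)
  next
    case (Suc k)
    have "\<bar>U (Suc k) - (\<Prod>i<Suc k. c i)\<bar> = \<bar>(U (Suc k) - c k * U k) + c k * (U k - (\<Prod>i<k. c i))\<bar>"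
      by (simp add: algebra_simps)
    also have "\<dots> \<le> \<bar>U (Suc k) - c k * U k\<bar> + \<bar>c k * (U k - (\<Prod>i<k. c i))\<bar>" by (rule abs_triangle_ineq)
    also have "\<dots> \<le> \<bar>U (Suc k) - c k * U k\<bar> + 1 * \<bar>U k - (\<Prod>i<k. c i)\<bar>"
      unfolding abs_mult using c01[of k] by (intro add_left_mono mult_right_mono) auto
    also have "\<dots> \<le> (if k = 0 then \<beta> + \<gamma> else if k = 1 then K + (\<gamma> + \<eta>) * \<beta> else K)
        + (\<Sum>j<k. if j = 0 then \<beta> + \<gamma> else if j = 1 then K + (\<gamma> + \<eta>) * \<beta> else K)"
      using Suc stepK[of k] by (intro add_mono) simp_all
    finally show ?case by (simp only: sum.lessThan_Suc add.commute)
  qed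
  have sum: "(\<Sum>j<k. if j = 0 then \<beta> + \<gamma> else if j = 1 then K + (\<gamma> + \<eta>) * \<beta> else K)
      \<le> \<beta> + \<gamma> + (\<gamma> + \<eta>) * \<beta> + real k * K"
  proof -
    have "(\<Sum>j<k. if j = 0 then \<beta> + \<gamma> else if j = 1 then K + (\<gamma> + \<eta>) * \<beta> else K)
      \<le> (\<Sum>j<k. (if j = 0 then \<beta> + \<gamma> else 0) + (if j = 1 then (\<gamma> + \<eta>) * \<beta> else 0) + K)"
      using K0 by (intro sum_mono) auto
    also have "\<dots> = (if 0 < k then \<beta> + \<gamma> else 0) + (if 1 < k then (\<gamma> + \<eta>) * \<beta> else 0) + real k * K"
      by (simp add: sum.distrib)
    also have "\<dots> \<le> \<beta> + \<gamma> + (\<gamma> + \<eta>) * \<beta> + real k * K" using \<beta>0 \<gamma>0 ge by auto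
    finally show ?thesis .
  qed
  have "\<bar>U k - (\<Prod>i<k. c i)\<bar> \<le> (1 + \<gamma> + \<eta>) * \<beta> + \<gamma> + real k * K"
    using tele[of k] sum by (simp add: algebra_simps)
  then show ?thesis unfolding U_def c_def g_def[abs_def] K_def by (simp only: mult.assoc)
qed

text \<open>Constant factors 1 away from index \<open>i\<close> make the statements about products
  available for a single earlier block.\<close>

lemma past_single:
  assumes "i < k"
  shows "(\<Prod>j<k. (if j = i then g else (\<lambda>_. 1)) (block X (Suc j) w)) = (g (block X (Suc i) w) :: real)"
proof -
  have "(\<Prod>j<k. (if j = i then g else (\<lambda>_. 1)) (block X (Suc j) w))
      = (\<Prod>j<k. if j = i then g (block X (Suc i) w) else 1)"
    by (intro prod.cong) auto
  also have "\<dots> = g (block X (Suc i) w)" using assms by simp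
  finally show ?thesis .
qed

section \<open>Pairs of large blocks\<close>

context
  fixes u :: real
begin

abbreviation (input) tail :: "'a \<Rightarrow> real" where
  "tail y \<equiv> block_tail X u y"

lemma large_block_sets: "{w \<in> space (law X \<mu>). u < block X (Suc k) w} \<in> sets (law X \<mu>)"
  using block_measurable[OF \<mu>, of k] by measurable

lemma two_large_blocks:
  assumes "i < k"
  shows "measure (law X \<mu>) {w \<in> space (law X \<mu>). u < block X (Suc i) w \<and> u < block X (Suc k) w}
    = (\<integral>w. indicator {u<..} (block X (Suc i) w) * tail (state k w) \<partial>law X \<mu>)"
proof -
  let ?\<phi> = "\<lambda>j. if j = i then indicator {u<..} else (\<lambda>_. 1::real)"
  have "{w \<in> space (law X \<mu>). u < block X (Suc i) w \<and> u < block X (Suc k) w}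
      = {w \<in> space (law X \<mu>). u < block X (Suc i) w} \<inter> {w \<in> space (law X \<mu>). u < block X (Suc k) w}" by auto
  then have s: "{w \<in> space (law X \<mu>). u < block X (Suc i) w \<and> u < block X (Suc k) w} \<in> sets (law X \<mu>)"
    using sets.Int[OF large_block_sets large_block_sets] by simp
  have "measure (law X \<mu>) {w \<in> space (law X \<mu>). u < block X (Suc i) w \<and> u < block X (Suc k) w}
      = (\<integral>w. indicator {w \<in> space (law X \<mu>). u < block X (Suc i) w \<and> u < block X (Suc k) w} w \<partial>law X \<mu>)"
    using sets.sets_into_space[OF s] by (simp add: Int_absorb2)
  also have "\<dots> = (\<integral>w. (\<Prod>j<k. ?\<phi> j (block X (Suc j) w)) * indicator {u<..} (block X (Suc k) w) \<partial>law X \<mu>)"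
    unfolding past_single[OF assms] by (intro Bochner_Integration.integral_cong refl) (simp add: indicator_def)
  also have "\<dots> = (\<integral>w. (\<Prod>j<k. ?\<phi> j (block X (Suc j) w)) * block_mean (indicator {u<..}) (state k w) \<partial>law X \<mu>)"
    by (rule markov_block) (auto intro: bounded_baire_indicator bounded_baire_const)
  also have "\<dots> = (\<integral>w. indicator {u<..} (block X (Suc i) w) * tail (state k w) \<partial>law X \<mu>)"
    unfolding past_single[OF assms]
    by (intro Bochner_Integration.integral_cong refl) (simp only: block_tail_block_mean state_in)
  finally show ?thesis .
qed

lemma tail_bounds: "y \<in> verts X \<Longrightarrow> 0 \<le> tail y" by (simp add: block_tail_def)

lemma large_block_le:
  "(\<integral>w. indicator {u<..} (block X (Suc (Suc k)) w) \<partial>law X \<mu>) \<le> (1 + \<rho>) * mean tail"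
proof -
  have "mean (block_mean (indicator {u<..})) = mean tail"
    unfolding mean_def by (intro sum.cong refl) (simp only: block_tail_block_mean)
  then show ?thesis using block_le[OF bounded_baire_indicator[of u], of k] by simp
qed

text \<open>No mixing time lies between neighbouring blocks, so the second one is bounded through
  the state between them by Young's inequality, with \<open>\<eta>\<close> free. The first block is
  left out so that both resulting averages are near equilibrium.\<close>

lemma adjacent_large_blocks:
  assumes "0 < \<eta>"
  shows "measure (law X \<mu>) {w \<in> space (law X \<mu>). u < block X (Suc (Suc i)) w \<and> u < block X (Suc (Suc (Suc i))) w}
    \<le> (1 + \<rho>) * (\<eta> * mean tail + mean (\<lambda>y. (tail y)\<^sup>2) / \<eta>)"
proof -
  let ?I = "\<lambda>w. indicator {u<..} (block X (Suc (Suc i)) w) :: real" and ?h = "\<lambda>w. tail (state (Suc (Suc i)) w)"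
  have t: "0 \<le> real (Suc (Suc i)) * blocklen X" using scale_pos(3) by simp
  have I: "integrable (law X \<mu>) ?I" by (rule integrable_baire_block[OF \<mu> bounded_baire_indicator])
  have h: "integrable (law X \<mu>) ?h" by (rule integrable_expl_functional[OF \<mu> t])
  have h2: "integrable (law X \<mu>) (\<lambda>w. (?h w)\<^sup>2 / \<eta>)"
    using integrable_expl_functional[OF \<mu> t, of "\<lambda>y. (tail y)\<^sup>2"] by simp
  have "measure (law X \<mu>) {w \<in> space (law X \<mu>). u < block X (Suc (Suc i)) w \<and> u < block X (Suc (Suc (Suc i))) w}
      = (\<integral>w. ?I w * ?h w \<partial>law X \<mu>)" by (rule two_large_blocks) simp
  also have "\<dots> \<le> (\<integral>w. \<eta> * ?I w + (?h w)\<^sup>2 / \<eta> \<partial>law X \<mu>)"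
  proof (rule integral_mono)
    show "integrable (law X \<mu>) (\<lambda>w. ?I w * ?h w)"
    proof (rule Bochner_Integration.integrable_bound[OF h])
      show "(\<lambda>w. ?I w * ?h w) \<in> borel_measurable (law X \<mu>)"
        by (intro borel_measurable_times borel_measurable_integrable I h)
    qed (auto simp: indicator_def)
    show "integrable (law X \<mu>) (\<lambda>w. \<eta> * ?I w + (?h w)\<^sup>2 / \<eta>)"
      by (intro Bochner_Integration.integrable_add integrable_mult_right I h2)
    show "?I w * ?h w \<le> \<eta> * ?I w + (?h w)\<^sup>2 / \<eta>" for w
      by (rule young_product[OF assms]) (auto simp: indicator_def)
  qed
  also have "\<dots> = \<eta> * (\<integral>w. ?I w \<partial>law X \<mu>) + (\<integral>w. (?h w)\<^sup>2 \<partial>law X \<mu>) / \<eta>"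
    using I h2 by (subst Bochner_Integration.integral_add) auto
  also have "\<dots> \<le> \<eta> * ((1 + \<rho>) * mean tail) + ((1 + \<rho>) * mean (\<lambda>y. (tail y)\<^sup>2)) / \<eta>"
    using assms by (intro add_mono mult_left_mono divide_right_mono large_block_le state_le) auto
  finally show ?thesis by (simp add: algebra_simps)
qed

text \<open>With one whole block in between, the state at which the later block starts has nearly
  the equilibrium law even on the event that the earlier block is large, so the two tail
  probabilities multiply.\<close>

lemma distant_large_blocks:
  assumes "Suc i < k"
  shows "measure (law X \<mu>) {w \<in> space (law X \<mu>). u < block X (Suc (Suc i)) w \<and> u < block X (Suc (Suc k)) w}
    \<le> ((1 + \<rho>) * mean tail)\<^sup>2"
proof -
  let ?\<phi> = "\<lambda>j. if j = Suc i then indicator {u<..} else (\<lambda>_. 1::real)"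
  have m0: "0 \<le> mean tail" by (rule mean_nonneg[OF tail_bounds])
  have "measure (law X \<mu>) {w \<in> space (law X \<mu>). u < block X (Suc (Suc i)) w \<and> u < block X (Suc (Suc k)) w}
      = (\<integral>w. (\<Prod>j<k. ?\<phi> j (block X (Suc j) w)) * tail (state (Suc k) w) \<partial>law X \<mu>)"
    using assms by (subst two_large_blocks) (simp_all only: past_single)
  also have "\<dots> \<le> (1 + \<rho>) * mean tail * (\<integral>w. (\<Prod>j<k. ?\<phi> j (block X (Suc j) w)) \<partial>law X \<mu>)"
    by (rule past_state_le[where h = tail]) (auto intro: bounded_baire_indicator bounded_baire_const tail_bounds)
  also have "\<dots> \<le> (1 + \<rho>) * mean tail * ((1 + \<rho>) * mean tail)"
    unfolding past_single[OF assms] using \<rho> m0 by (intro mult_left_mono large_block_le) auto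
  finally show ?thesis by (simp add: power2_eq_square)
qed

end

end

end

end

section \<open>Asymptotics along a sequence of models\<close>

text \<open>Counting the multiples of \<open>1 / R\<close> strictly below \<open>y\<close> recovers
  \<open>y\<close> from below with error at most \<open>1 / R\<close>; this is the quantization
  behind the staircase.\<close>

lemma count_scaled:
  fixes y :: real
  assumes "0 \<le> y" "y < 1" "0 < R"
  shows "(\<Sum>r\<in>{1..<R}. of_bool (real r < real R * y)) \<le> real R * y"
    and "real R * y \<le> (\<Sum>r\<in>{1..<R}. of_bool (real r < real R * y)) + 1"
proof -
  \<comment> \<open>The largest natural number strictly below \<open>R * y\<close>; for
    \<open>y = 0\<close> the conversion to \<open>nat\<close> turns \<open>- 1\<close> into
    0.\<close>
  define m where "m = nat (\<lceil>real R * y\<rceil> - 1)"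
  have "real R * y < real R" using assms by simp
  then have "\<lceil>real R * y\<rceil> \<le> int R" by (simp add: ceiling_le_iff less_imp_le)
  then have mR: "m < R" using assms(3) by (auto simp: m_def)
  have iff: "real r < real R * y \<longleftrightarrow> r \<le> m" if "1 \<le> r" for r
  proof -
    have "real r < real R * y \<longleftrightarrow> int r < \<lceil>real R * y\<rceil>" by (simp add: less_ceiling_iff)
    then show ?thesis using that by (auto simp: m_def)
  qed
  have "(\<Sum>r\<in>{1..<R}. of_bool (real r < real R * y)) = (\<Sum>r\<in>{1..<R}. if r \<in> {1..m} then 1 else 0 :: real)"
    using iff by (intro sum.cong) auto
  also have "\<dots> = (\<Sum>r\<in>{1..<R} \<inter> {1..m}. 1)" by (rule sum.inter_restrict[symmetric]) simp
  also have "\<dots> = real (card ({1..<R} \<inter> {1..m}))" by simp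
  also have "{1..<R} \<inter> {1..m} = {1..m}" using mR by auto
  finally have s: "(\<Sum>r\<in>{1..<R}. of_bool (real r < real R * y)) = real m" by simp
  show "(\<Sum>r\<in>{1..<R}. of_bool (real r < real R * y)) \<le> real R * y"
    unfolding s using assms iff[of m] by (cases "m = 0") auto
  have "real R * y \<le> of_int \<lceil>real R * y\<rceil>" by (rule le_of_int_ceiling)
  then show "real R * y \<le> (\<Sum>r\<in>{1..<R}. of_bool (real r < real R * y)) + 1"
    unfolding s m_def using assms by linarith
qed

definition laplace_weight :: "real \<Rightarrow> real \<Rightarrow> real" where
  "laplace_weight q z = 1 - exp (- q * z)"

text \<open>The levels at which \<open>laplace_weight q\<close> passes the values \<open>r / R\<close>, cut off from below at \<open>\<epsilon>\<close>.\<close>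

definition level :: "real \<Rightarrow> real \<Rightarrow> nat \<Rightarrow> nat \<Rightarrow> real" where
  "level q \<epsilon> R r = max \<epsilon> (- ln (1 - real r / real R) / q)"

text \<open>A finite combination of indicators of half-lines, since (iii) speaks about such
  indicators only. It does so for positive levels, and \<open>\<epsilon>\<close> keeps all levels
  away from 0.\<close>

definition staircase :: "real \<Rightarrow> real \<Rightarrow> nat \<Rightarrow> real \<Rightarrow> real" where
  "staircase q \<epsilon> R z = (\<Sum>r\<in>{1..<R}. indicator {level q \<epsilon> R r<..} z / real R)"

lemma laplace_weight_bounds:
  assumes "0 \<le> q" "0 \<le> z"
  shows "0 \<le> laplace_weight q z" "laplace_weight q z < 1" "laplace_weight q z \<le> q * z"
  using assms exp_ge_add_one_self[of "- q * z"] by (auto simp: laplace_weight_def simp del: exp_ge_add_one_self)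

text \<open>Above \<open>\<epsilon>\<close> the levels passed by \<open>z\<close> are exactly those
  \<open>r\<close> with \<open>r < R * laplace_weight q z\<close>, so quantization costs
  \<open>1 / R\<close>; up to \<open>\<epsilon>\<close> the staircase is 0 and the weight at most
  \<open>q * z\<close>.\<close>

lemma staircase_bounds:
  assumes q: "0 < q" and z: "0 \<le> z" and R: "0 < R" and \<epsilon>: "0 < \<epsilon>"
  shows "staircase q \<epsilon> R z \<le> laplace_weight q z"
    and "laplace_weight q z \<le> staircase q \<epsilon> R z + indicator {\<epsilon><..} z / real R + q * (z * indicator {..\<epsilon>} z)"
proof -
  let ?y = "laplace_weight q z"
  note y = laplace_weight_bounds[OF less_imp_le[OF q] z]
  have lev: "indicator {level q \<epsilon> R r<..} z = (indicator {\<epsilon><..} z * of_bool (real r < real R * ?y) :: real)"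
    if r: "r \<in> {1..<R}" for r
  proof -
    have pos: "0 < 1 - real r / real R" using r by simp
    have "- ln (1 - real r / real R) / q < z \<longleftrightarrow> - q * z < ln (1 - real r / real R)"
      using pos_divide_less_eq[OF q, of "- ln (1 - real r / real R)" z]
        minus_less_iff[of "ln (1 - real r / real R)" "z * q"] by (simp add: mult.commute)
    also have "\<dots> \<longleftrightarrow> exp (- q * z) < 1 - real r / real R"
      using pos by (metis exp_less_cancel_iff exp_ln)
    also have "\<dots> \<longleftrightarrow> real r < real R * ?y"
      using R by (auto simp: laplace_weight_def field_simps)
    finally show ?thesis by (auto simp: level_def indicator_def)
  qed
  have s: "staircase q \<epsilon> R z = indicator {\<epsilon><..} z * ((\<Sum>r\<in>{1..<R}. of_bool (real r < real R * ?y)) / real R)"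
    unfolding staircase_def sum_divide_distrib sum_distrib_left
    by (intro sum.cong refl) (simp add: lev)
  have c: "(\<Sum>r\<in>{1..<R}. of_bool (real r < real R * ?y)) / real R \<le> ?y"
    "?y \<le> (\<Sum>r\<in>{1..<R}. of_bool (real r < real R * ?y)) / real R + 1 / real R"
    using count_scaled[OF y(1,2) R] R by (auto simp: field_simps)
  show "staircase q \<epsilon> R z \<le> ?y" unfolding s using c(1) y(1) by (auto simp: indicator_def)
  show "?y \<le> staircase q \<epsilon> R z + indicator {\<epsilon><..} z / real R + q * (z * indicator {..\<epsilon>} z)"
    unfolding s using c(2) y(3) by (cases "\<epsilon> < z") (auto simp: indicator_def)
qed

section \<open>Exponentials and staircases as test functions\<close>

lemma bounded_baire_laplace_weight:
  assumes "0 \<le> q" shows "bounded_baire (laplace_weight q)"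
proof (rule bounded_baire_continuous[where B = 1])
  show "continuous_on UNIV (laplace_weight q)" unfolding laplace_weight_def[abs_def] by (intro continuous_intros)
  show "\<bar>laplace_weight q z\<bar> \<le> 1" if "0 \<le> z" for z using laplace_weight_bounds[OF assms that] by auto
qed

lemma bounded_baire_exp:
  fixes q :: real
  assumes "0 \<le> q" shows "bounded_baire (\<lambda>z. exp (- q * z))"
proof (rule bounded_baire_continuous[where B = 1])
  show "continuous_on UNIV (\<lambda>z. exp (- q * z))" by (intro continuous_intros)
qed (use assms in simp)

lemma bounded_baire_cmult:
  assumes "bounded_baire g" shows "bounded_baire (\<lambda>z. c * g z)"
proof -
  obtain B and \<phi> :: "nat \<Rightarrow> real \<Rightarrow> real" where
    \<phi>: "\<And>m. continuous_on UNIV (\<phi> m)" "\<And>m z. 0 \<le> z \<Longrightarrow> \<bar>\<phi> m z\<bar> \<le> B" "\<And>z. 0 \<le> z \<Longrightarrow> (\<lambda>m. \<phi> m z) \<longlonglongrightarrow> g z"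
    using assms unfolding bounded_baire_def by blast
  show ?thesis unfolding bounded_baire_def
  proof (intro exI[of _ "\<bar>c\<bar> * B"] exI[of _ "\<lambda>m z. c * \<phi> m z"] conjI allI impI)
    show "continuous_on UNIV (\<lambda>z. c * \<phi> m z)" for m by (intro continuous_on_mult continuous_on_const \<phi>(1))
    show "\<bar>c * \<phi> m z\<bar> \<le> \<bar>c\<bar> * B" if "0 \<le> z" for m z
      unfolding abs_mult by (rule mult_left_mono[OF \<phi>(2)[OF that]]) simp
    show "(\<lambda>m. c * \<phi> m z) \<longlonglongrightarrow> c * g z" if "0 \<le> z" for z
      by (intro tendsto_mult tendsto_const \<phi>(3) that)
  qed
qed

lemma bounded_baire_add:
  assumes "bounded_baire f" "bounded_baire g" shows "bounded_baire (\<lambda>z. f z + g z)"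
proof -
  obtain B and \<phi> :: "nat \<Rightarrow> real \<Rightarrow> real" where
    \<phi>: "\<And>m. continuous_on UNIV (\<phi> m)" "\<And>m z. 0 \<le> z \<Longrightarrow> \<bar>\<phi> m z\<bar> \<le> B" "\<And>z. 0 \<le> z \<Longrightarrow> (\<lambda>m. \<phi> m z) \<longlonglongrightarrow> f z"
    using assms(1) unfolding bounded_baire_def by blast
  obtain C and \<psi> :: "nat \<Rightarrow> real \<Rightarrow> real" where
    \<psi>: "\<And>m. continuous_on UNIV (\<psi> m)" "\<And>m z. 0 \<le> z \<Longrightarrow> \<bar>\<psi> m z\<bar> \<le> C" "\<And>z. 0 \<le> z \<Longrightarrow> (\<lambda>m. \<psi> m z) \<longlonglongrightarrow> g z"
    using assms(2) unfolding bounded_baire_def by blast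
  show ?thesis unfolding bounded_baire_def
  proof (intro exI[of _ "B + C"] exI[of _ "\<lambda>m z. \<phi> m z + \<psi> m z"] conjI allI impI)
    show "continuous_on UNIV (\<lambda>z. \<phi> m z + \<psi> m z)" for m by (intro continuous_on_add \<phi>(1) \<psi>(1))
    show "\<bar>\<phi> m z + \<psi> m z\<bar> \<le> B + C" if "0 \<le> z" for m z
      using \<phi>(2)[OF that, of m] \<psi>(2)[OF that, of m] by linarith
    show "(\<lambda>m. \<phi> m z + \<psi> m z) \<longlonglongrightarrow> f z + g z" if "0 \<le> z" for z
      by (intro tendsto_add \<phi>(3) \<psi>(3) that)
  qed
qed

lemma bounded_baire_sum: "(\<And>i. i \<in> I \<Longrightarrow> bounded_baire (f i)) \<Longrightarrow> bounded_baire (\<lambda>z. \<Sum>i\<in>I. f i z)"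
proof (induction I rule: infinite_finite_induct)
  case (insert x F)
  have "bounded_baire (\<lambda>z. f x z + (\<Sum>i\<in>F. f i z))"
    by (rule bounded_baire_add) (auto intro: insert)
  then show ?case using insert.hyps by simp
qed (auto intro: bounded_baire_continuous[where B = 0])

lemma bounded_baire_staircase: "bounded_baire (staircase q \<epsilon> R)"
  unfolding staircase_def[abs_def] divide_inverse mult.commute[of _ "inverse (real R)"]
  by (intro bounded_baire_sum bounded_baire_cmult bounded_baire_indicator)

context exploration_clock
begin

lemma block_mean_cmult: "block_mean (\<lambda>z. c * g z) y = c * block_mean g y"
  by (simp add: block_mean_def)

lemma block_mean_add:
  assumes "y \<in> verts X" "bounded_baire f" "bounded_baire g"
  shows "block_mean (\<lambda>z. f z + g z) y = block_mean f y + block_mean g y"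
  unfolding block_mean_def
  by (intro Bochner_Integration.integral_add integrable_baire_block return_verts assms)

lemma block_mean_sum:
  assumes "y \<in> verts X" "\<And>i. i \<in> I \<Longrightarrow> bounded_baire (f i)"
  shows "block_mean (\<lambda>z. \<Sum>i\<in>I. f i z) y = (\<Sum>i\<in>I. block_mean (f i) y)"
  unfolding block_mean_def
  by (intro Bochner_Integration.integral_sum integrable_baire_block return_verts assms)

text \<open>The mean of \<open>g\<close> over a block started in equilibrium; hypotheses (iii) and
  (v) are both about the number of blocks times such a quantity.\<close>

definition block_intensity :: "(real \<Rightarrow> real) \<Rightarrow> real" where
  "block_intensity g = mean (block_mean g)"

lemma block_intensity_mono:
  assumes "bounded_baire f" "bounded_baire g" "\<And>z. 0 \<le> z \<Longrightarrow> f z \<le> g z"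
  shows "block_intensity f \<le> block_intensity g"
  unfolding block_intensity_def by (intro mean_mono block_mean_mono assms)

lemma block_intensity_nonneg:
  assumes "bounded_baire g" "\<And>z. 0 \<le> z \<Longrightarrow> 0 \<le> g z" shows "0 \<le> block_intensity g"
  unfolding block_intensity_def by (intro mean_nonneg block_mean_nonneg assms)

lemma mean_cong: "(\<And>y. y \<in> verts X \<Longrightarrow> g y = h y) \<Longrightarrow> mean g = mean h"
  by (simp add: mean_def)

lemma block_intensity_cmult: "block_intensity (\<lambda>z. c * g z) = c * block_intensity g"
  unfolding block_intensity_def block_mean_cmult by (rule mean_cmult)

lemma block_intensity_add:
  assumes "bounded_baire f" "bounded_baire g"
  shows "block_intensity (\<lambda>z. f z + g z) = block_intensity f + block_intensity g"
  unfolding block_intensity_def mean_add[symmetric] by (intro mean_cong block_mean_add assms)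

lemma block_intensity_sum:
  assumes "\<And>i. i \<in> I \<Longrightarrow> bounded_baire (f i)"
  shows "block_intensity (\<lambda>z. \<Sum>i\<in>I. f i z) = (\<Sum>i\<in>I. block_intensity (f i))"
  unfolding block_intensity_def mean_sum[symmetric] by (intro mean_cong block_mean_sum assms)

lemma block_intensity_tail: "block_intensity (indicator {u<..}) = mean (block_tail X u)"
  unfolding block_intensity_def by (rule mean_cong) (rule block_tail_block_mean[symmetric])

lemma block_intensity_staircase:
  "block_intensity (staircase q \<epsilon> R) = (\<Sum>r\<in>{1..<R}. mean (block_tail X (level q \<epsilon> R r)) / real R)"
proof -
  have "block_intensity (staircase q \<epsilon> R) = block_intensity (\<lambda>z. \<Sum>r\<in>{1..<R}. inverse (real R) * indicator {level q \<epsilon> R r<..} z)"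
    unfolding staircase_def[abs_def] by (simp add: divide_inverse mult.commute)
  also have "\<dots> = (\<Sum>r\<in>{1..<R}. block_intensity (\<lambda>z. inverse (real R) * indicator {level q \<epsilon> R r<..} z))"
    by (intro block_intensity_sum bounded_baire_cmult bounded_baire_indicator)
  also have "\<dots> = (\<Sum>r\<in>{1..<R}. mean (block_tail X (level q \<epsilon> R r)) / real R)"
    unfolding block_intensity_cmult block_intensity_tail by (simp add: divide_inverse mult.commute)
  finally show ?thesis .
qed

lemma laplace_intensity_bounds:
  assumes q: "0 < q" and R: "0 < R" and \<epsilon>: "0 < \<epsilon>"
  shows "block_intensity (staircase q \<epsilon> R) \<le> block_intensity (laplace_weight q)"
    and "block_intensity (laplace_weight q) \<le> block_intensity (staircase q \<epsilon> R)
      + mean (block_tail X \<epsilon>) / real R + q * block_intensity (\<lambda>z. z * indicator {..\<epsilon>} z)"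
proof -
  note [intro] = bounded_baire_staircase bounded_baire_laplace_weight[OF less_imp_le[OF q]]
  show "block_intensity (staircase q \<epsilon> R) \<le> block_intensity (laplace_weight q)"
    using staircase_bounds[OF q _ R \<epsilon>] by (intro block_intensity_mono) auto
  have t: "bounded_baire (\<lambda>z. q * (z * indicator {..\<epsilon>} z))"
    using \<epsilon> by (intro bounded_baire_cmult bounded_baire_truncation) simp
  have i: "bounded_baire (\<lambda>z. inverse (real R) * indicator {\<epsilon><..} z)"
    by (intro bounded_baire_cmult bounded_baire_indicator)
  have si: "bounded_baire (\<lambda>z. staircase q \<epsilon> R z + inverse (real R) * indicator {\<epsilon><..} z)"
    by (intro bounded_baire_add bounded_baire_staircase i)
  have "block_intensity (laplace_weight q)
      \<le> block_intensity (\<lambda>z. staircase q \<epsilon> R z + inverse (real R) * indicator {\<epsilon><..} z + q * (z * indicator {..\<epsilon>} z))"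
  proof (rule block_intensity_mono)
    show "bounded_baire (\<lambda>z. staircase q \<epsilon> R z + inverse (real R) * indicator {\<epsilon><..} z + q * (z * indicator {..\<epsilon>} z))"
      by (rule bounded_baire_add[OF si t])
    show "laplace_weight q z \<le> staircase q \<epsilon> R z + inverse (real R) * indicator {\<epsilon><..} z + q * (z * indicator {..\<epsilon>} z)"
      if "0 \<le> z" for z
      using staircase_bounds(2)[OF q that R \<epsilon>] by (simp add: divide_inverse mult.commute)
  qed auto
  also have "\<dots> = block_intensity (staircase q \<epsilon> R) + mean (block_tail X \<epsilon>) / real R
      + q * block_intensity (\<lambda>z. z * indicator {..\<epsilon>} z)"
    unfolding block_intensity_add[OF si t] block_intensity_add[OF bounded_baire_staircase i]
      block_intensity_cmult block_intensity_tail by (simp add: divide_inverse mult.commute)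
  finally show "block_intensity (laplace_weight q) \<le> block_intensity (staircase q \<epsilon> R)
      + mean (block_tail X \<epsilon>) / real R + q * block_intensity (\<lambda>z. z * indicator {..\<epsilon>} z)" .
qed

text \<open>The weight is at most the indicator of a block above \<open>\<epsilon>\<close> plus
  \<open>q\<close> times the truncated block. After squaring, the first part is what (iv) controls,
  and the mean \<open>a\<close> of the truncated block from a given state satisfies
  \<open>a\<^sup>2 \<le> \<epsilon> * a\<close>, which reduces it to the first-order quantity of
  (v).\<close>

lemma laplace_intensity_square:
  assumes q: "0 \<le> q" and \<epsilon>: "0 < \<epsilon>"
  shows "mean (\<lambda>y. (block_mean (laplace_weight q) y)\<^sup>2)
    \<le> 2 * mean (\<lambda>y. (block_tail X \<epsilon> y)\<^sup>2) + 2 * q\<^sup>2 * \<epsilon> * block_intensity (\<lambda>z. z * indicator {..\<epsilon>} z)"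
proof -
  let ?s = "\<lambda>z. z * indicator {..\<epsilon>} z :: real"
  have s: "bounded_baire ?s" using \<epsilon> by (intro bounded_baire_truncation) simp
  have "mean (\<lambda>y. (block_mean (laplace_weight q) y)\<^sup>2)
      \<le> mean (\<lambda>y. 2 * (block_tail X \<epsilon> y)\<^sup>2 + (2 * q\<^sup>2 * \<epsilon>) * block_mean ?s y)"
  proof (rule mean_mono)
    fix y assume y: "y \<in> verts X"
    note tail = block_tail_block_mean[OF y, symmetric]
    define a where "a = block_mean ?s y"
    have a0: "0 \<le> a" unfolding a_def by (rule block_mean_nonneg[OF y s]) simp
    have "a \<le> block_mean (\<lambda>_. \<epsilon>) y" unfolding a_def
      using \<epsilon> by (intro block_mean_mono[OF y s] bounded_baire_const) (simp add: indicator_def)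
    then have a1: "a \<le> \<epsilon>" by (simp add: block_mean_const[OF y])
    have g0: "0 \<le> block_mean (laplace_weight q) y"
      by (intro block_mean_nonneg y bounded_baire_laplace_weight q laplace_weight_bounds(1))
    have "block_mean (laplace_weight q) y \<le> block_mean (\<lambda>z. indicator {\<epsilon><..} z + q * ?s z) y"
    proof (rule block_mean_mono[OF y])
      show "laplace_weight q z \<le> indicator {\<epsilon><..} z + q * ?s z" if "0 \<le> z" for z
        using laplace_weight_bounds[OF q that] by (cases "z \<le> \<epsilon>") (auto simp: indicator_def)
    qed (intro bounded_baire_laplace_weight q bounded_baire_add bounded_baire_indicator bounded_baire_cmult s)+
    also have "\<dots> = block_tail X \<epsilon> y + q * a"
      by (subst block_mean_add[OF y]) (auto intro: bounded_baire_indicator bounded_baire_cmult s simp only: block_mean_cmult tail a_def)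
    finally have "(block_mean (laplace_weight q) y)\<^sup>2 \<le> (block_tail X \<epsilon> y + q * a)\<^sup>2"
      using g0 by (intro power_mono)
    also have "\<dots> \<le> 2 * (block_tail X \<epsilon> y)\<^sup>2 + 2 * (q * a)\<^sup>2"
      using sum_squares_bound[of "block_tail X \<epsilon> y" "q * a"] by (simp add: power2_sum)
    also have "2 * (q * a)\<^sup>2 \<le> (2 * q\<^sup>2 * \<epsilon>) * a"
    proof -
      have "a * a \<le> \<epsilon> * a" using a0 a1 by (intro mult_right_mono)
      then have "(2 * q\<^sup>2) * (a * a) \<le> (2 * q\<^sup>2) * (\<epsilon> * a)" by (intro mult_left_mono) auto
      then show ?thesis by (simp add: power2_eq_square mult_ac)
    qed
    finally show "(block_mean (laplace_weight q) y)\<^sup>2 \<le> 2 * (block_tail X \<epsilon> y)\<^sup>2 + (2 * q\<^sup>2 * \<epsilon>) * block_mean ?s y"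
      by (simp add: a_def)
  qed
  then show ?thesis unfolding mean_add mean_cmult block_intensity_def .
qed

end

locale clock_sequence =
  fixes X :: "nat \<Rightarrow> ('a, 'p) clock_model" and \<nu> :: "real measure" and \<rho> :: "nat \<Rightarrow> real"
  assumes clock: "\<And>n. exploration_clock (X n)"
    and time_scales: "(\<lambda>n. blocklen (X n) / tscale (X n)) \<longlonglongrightarrow> 0"
    and levy_sets: "sets \<nu> = sets (restrict_space borel {0<..})"
    and levy_integral: "(\<integral>\<^sup>+x. ennreal (min x 1) \<partial>\<nu>) < \<infinity>"
    and first_block: "initial_block_negligible X"
    and mix: "\<And>n. exploration_clock.mixing (X n) (\<rho> n)" "\<And>n. 0 \<le> \<rho> n" "\<rho> \<longlonglongrightarrow> 0"
    and tails: "tails_converge \<nu> X" "squared_tails_vanish X"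
    and small_blocks: "small_blocks_negligible X"
begin

sublocale C: exploration_clock "X n" for n by (rule clock)

section \<open>Integrals against the Levy measure\<close>

lemma levy_space: "space \<nu> = {0<..}"
  using sets_eq_imp_space_eq[OF levy_sets] by (simp add: space_restrict_space)

lemma levy_measurable: "f \<in> borel_measurable borel \<Longrightarrow> f \<in> borel_measurable \<nu>"
  using measurable_restrict_space1[of f borel borel "{0<..}"] measurable_cong_sets[OF levy_sets refl] by blast

lemma min_integrable: "integrable \<nu> (\<lambda>x. min x 1)"
proof (rule integrableI_bounded)
  show "(\<lambda>x. min x 1) \<in> borel_measurable \<nu>" by (intro levy_measurable) simp
  have "(\<integral>\<^sup>+x. ennreal (norm (min x 1)) \<partial>\<nu>) = (\<integral>\<^sup>+x. ennreal (min x 1) \<partial>\<nu>)"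
    by (intro nn_integral_cong) (auto simp: levy_space)
  then show "(\<integral>\<^sup>+x. ennreal (norm (min x 1)) \<partial>\<nu>) < \<infinity>" using levy_integral by simp
qed

lemma levy_integrable_bound:
  fixes f :: "real \<Rightarrow> real"
  assumes "f \<in> borel_measurable borel" "\<And>x. 0 < x \<Longrightarrow> \<bar>f x\<bar> \<le> c * min x 1"
  shows "integrable \<nu> f"
proof (rule Bochner_Integration.integrable_bound[OF integrable_mult_right[OF min_integrable, of c] levy_measurable[OF assms(1)]])
  show "AE x in \<nu>. norm (f x) \<le> norm (c * min x 1)"
    using assms(2) by (intro AE_I2) (auto simp: levy_space intro: order_trans[OF _ abs_ge_self])
qed

lemma tail_integrable: assumes u: "0 < u" shows "integrable \<nu> (indicator {u<..} :: real \<Rightarrow> real)"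
proof (rule levy_integrable_bound[where c = "max 1 (1 / u)"])
  fix x :: real assume x: "0 < x"
  show "\<bar>indicator {u<..} x\<bar> \<le> max 1 (1 / u) * min x 1"
  proof (cases "u < x")
    case True
    have "1 \<le> max 1 (1 / u) * min x 1"
    proof (cases "x \<le> 1")
      case True
      have "1 \<le> (1 / u) * x" using \<open>u < x\<close> u by simp
      also have "\<dots> \<le> max 1 (1 / u) * x" using x by (intro mult_right_mono) auto
      finally show ?thesis using True by (simp add: min_def)
    qed auto
    then show ?thesis using True by simp
  next
    case False
    have "0 \<le> max 1 (1 / u) * min x 1" using x by (intro mult_nonneg_nonneg) auto
    then show ?thesis using False by simp
  qed
qed simp

lemma tail_integral: assumes "0 < u" shows "(\<integral>x. indicator {u<..} x \<partial>\<nu>) = measure \<nu> {u<..}"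
proof -
  have "{u<..} \<inter> space \<nu> = {u<..}" using assms by (auto simp: levy_space)
  then show ?thesis by simp
qed

lemma laplace_integrable: assumes q: "0 \<le> q" shows "integrable \<nu> (laplace_weight q)"
proof (rule levy_integrable_bound[where c = "max 1 q"])
  show "laplace_weight q \<in> borel_measurable borel" unfolding laplace_weight_def[abs_def] by measurable
  fix x :: real assume x: "0 < x"
  note b = laplace_weight_bounds[OF q less_imp_le[OF x]]
  have "laplace_weight q x \<le> max 1 q * min x 1"
  proof (cases "x \<le> 1")
    case True
    have "q * x \<le> max 1 q * x" using x by (intro mult_right_mono) auto
    then show ?thesis using b True by (simp add: min_def)
  next
    case False then show ?thesis using b(2) by (simp add: min_def)
  qed
  then show "\<bar>laplace_weight q x\<bar> \<le> max 1 q * min x 1" using b(1) by simp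
qed

lemma truncation_integrable: assumes "0 < \<epsilon>" "\<epsilon> \<le> 1" shows "integrable \<nu> (\<lambda>x. x * indicator {..\<epsilon>} x)"
proof (rule levy_integrable_bound[where c = 1])
  show "(\<lambda>x::real. x * indicator {..\<epsilon>} x) \<in> borel_measurable borel" by measurable
qed (use assms in \<open>auto simp: indicator_def\<close>)

text \<open>Dominated convergence under \<open>min x 1\<close>: the Levy measure may have infinite
  mass near 0, but its first moment there is finite.\<close>

lemma truncation_vanishes:
  assumes e: "0 < e"
  obtains \<epsilon>0 where "0 < \<epsilon>0" "\<epsilon>0 \<le> 1"
    "\<And>\<epsilon>. 0 < \<epsilon> \<Longrightarrow> \<epsilon> \<le> \<epsilon>0 \<Longrightarrow> (\<integral>x. x * indicator {..\<epsilon>} x \<partial>\<nu>) < e"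
proof -
  have "(\<lambda>l. \<integral>x. x * indicator {..1 / real (Suc l)} x \<partial>\<nu>) \<longlonglongrightarrow> (\<integral>x. 0 \<partial>\<nu>)"
  proof (rule integral_dominated_convergence[OF _ _ min_integrable])
    show "(\<lambda>x. x * indicator {..1 / real (Suc l)} x) \<in> borel_measurable \<nu>" for l
      by (intro levy_measurable) measurable
    show "AE x in \<nu>. (\<lambda>l. x * indicator {..1 / real (Suc l)} x) \<longlonglongrightarrow> 0"
    proof (intro AE_I2)
      fix x assume "x \<in> space \<nu>"
      then have x: "0 < x / 2" by (simp add: levy_space)
      have "\<forall>\<^sub>F l in sequentially. x * indicator {..1 / real (Suc l)} x = 0"
        using eventually_inverse_Suc_le[OF x] by eventually_elim (use x in \<open>auto simp: indicator_def\<close>)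
      then show "(\<lambda>l. x * indicator {..1 / real (Suc l)} x) \<longlonglongrightarrow> 0" by (rule tendsto_eventually)
    qed
    show "AE x in \<nu>. norm (x * indicator {..1 / real (Suc l)} x) \<le> min x 1" for l
    proof (intro AE_I2)
      fix x assume "x \<in> space \<nu>"
      then have x: "0 < x" by (simp add: levy_space)
      have le1: "1 / real (Suc l) \<le> 1" by simp
      have "x \<le> 1" if "x \<le> 1 / real (Suc l)" using that le1 by (rule order_trans)
      then show "norm (x * indicator {..1 / real (Suc l)} x) \<le> min x 1"
        using x by (auto simp: indicator_def simp del: of_nat_Suc)
    qed
  qed simp
  then have "\<forall>\<^sub>F l in sequentially. (\<integral>x. x * indicator {..1 / real (Suc l)} x \<partial>\<nu>) < e"
    using e by (intro order_tendstoD(2)) auto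
  then obtain l where l: "(\<integral>x. x * indicator {..1 / real (Suc l)} x \<partial>\<nu>) < e"
    by (auto simp: eventually_sequentially)
  show ?thesis
  proof (rule that[of "1 / real (Suc l)"])
    fix \<epsilon> :: real assume \<epsilon>: "0 < \<epsilon>" "\<epsilon> \<le> 1 / real (Suc l)"
    have le1: "1 / real (Suc l) \<le> 1" by simp
    with \<epsilon>(2) have \<epsilon>1: "\<epsilon> \<le> 1" by (rule order_trans)
    have l0: "0 < 1 / real (Suc l)" by simp
    have "(\<integral>x. x * indicator {..\<epsilon>} x \<partial>\<nu>) \<le> (\<integral>x. x * indicator {..1 / real (Suc l)} x \<partial>\<nu>)"
      using \<epsilon> by (intro integral_mono truncation_integrable[OF \<epsilon>(1) \<epsilon>1] truncation_integrable[OF l0 le1]) (auto simp: levy_space indicator_def simp del: of_nat_Suc)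
    then show "(\<integral>x. x * indicator {..\<epsilon>} x \<partial>\<nu>) < e" using l by simp
  qed simp_all
qed

definition exponent :: "real \<Rightarrow> real" where
  "exponent q = (\<integral>x. laplace_weight q x \<partial>\<nu>)"

lemma exponent_nonneg: "0 \<le> q \<Longrightarrow> 0 \<le> exponent q"
  unfolding exponent_def
  by (intro Bochner_Integration.integral_nonneg_AE AE_I2) (auto simp: levy_space laplace_weight_bounds)

text \<open>The same sandwich as \<open>laplace_intensity_bounds\<close>, with the Levy measure in
  place of the block law; the two are compared level by level.\<close>

lemma exponent_bounds:
  assumes q: "0 < q" and R: "0 < R" and \<epsilon>: "0 < \<epsilon>" "\<epsilon> \<le> 1"
  defines "s \<equiv> \<Sum>r\<in>{1..<R}. measure \<nu> {level q \<epsilon> R r<..} / real R"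
  shows "s \<le> exponent q" and "exponent q \<le> s + measure \<nu> {\<epsilon><..} / real R + q * (\<integral>x. x * indicator {..\<epsilon>} x \<partial>\<nu>)"
proof -
  have lev: "0 < level q \<epsilon> R r" for r using \<epsilon> by (auto simp: level_def)
  have si: "integrable \<nu> (staircase q \<epsilon> R)" unfolding staircase_def[abs_def]
    by (intro Bochner_Integration.integrable_sum integrable_divide_zero tail_integrable lev)
  have s: "(\<integral>x. staircase q \<epsilon> R x \<partial>\<nu>) = s"
    unfolding staircase_def s_def using tail_integrable[OF lev] tail_integral[OF lev]
    by (subst Bochner_Integration.integral_sum) auto
  note ei = tail_integrable[OF \<epsilon>(1)] and ti = truncation_integrable[OF \<epsilon>] and li = laplace_integrable[OF less_imp_le[OF q]]
  show "s \<le> exponent q" unfolding s[symmetric] exponent_def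
    using staircase_bounds(1)[OF q _ R \<epsilon>(1)] by (intro integral_mono si li) (auto simp: levy_space)
  have "exponent q \<le> (\<integral>x. staircase q \<epsilon> R x + indicator {\<epsilon><..} x / real R + q * (x * indicator {..\<epsilon>} x) \<partial>\<nu>)"
    unfolding exponent_def
    using staircase_bounds(2)[OF q _ R \<epsilon>(1)]
    by (intro integral_mono li Bochner_Integration.integrable_add si integrable_divide_zero ei integrable_mult_right ti)
      (auto simp: levy_space)
  also have "\<dots> = (\<integral>x. staircase q \<epsilon> R x + indicator {\<epsilon><..} x / real R \<partial>\<nu>) + (\<integral>x. q * (x * indicator {..\<epsilon>} x) \<partial>\<nu>)"
    by (intro Bochner_Integration.integral_add Bochner_Integration.integrable_add si integrable_divide_zero ei integrable_mult_right ti)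
  also have "(\<integral>x. staircase q \<epsilon> R x + indicator {\<epsilon><..} x / real R \<partial>\<nu>) = s + (\<integral>x. indicator {\<epsilon><..} x / real R \<partial>\<nu>)"
    unfolding s[symmetric] by (intro Bochner_Integration.integral_add si integrable_divide_zero ei)
  also have "(\<integral>x. indicator {\<epsilon><..} x / real R \<partial>\<nu>) = measure \<nu> {\<epsilon><..} / real R"
    using tail_integral[OF \<epsilon>(1)] by simp
  also have "(\<integral>x. q * (x * indicator {..\<epsilon>} x) \<partial>\<nu>) = q * (\<integral>x. x * indicator {..\<epsilon>} x \<partial>\<nu>)" by simp
  finally show "exponent q \<le> s + measure \<nu> {\<epsilon><..} / real R + q * (\<integral>x. x * indicator {..\<epsilon>} x \<partial>\<nu>)" .
qed

section \<open>Limits of block averages\<close>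

abbreviation blocks :: "nat \<Rightarrow> real \<Rightarrow> nat" where
  "blocks n t \<equiv> nblocks (X n) t"

text \<open>This is the use of block lengths that are negligible on the time scale: the number of
  blocks diverges, so averages with a convergent multiple vanish individually.\<close>

lemma blocks_at_top: assumes t: "0 < t" shows "filterlim (\<lambda>n. real (blocks n t)) at_top sequentially"
proof -
  have "filterlim (\<lambda>n. inverse (blocklen (X n) / tscale (X n))) at_top sequentially"
    by (rule filterlim_inverse_at_top[OF time_scales])
      (use C.scale_pos in \<open>auto intro!: always_eventually divide_pos_pos\<close>)
  then have "filterlim (\<lambda>n. t * inverse (blocklen (X n) / tscale (X n))) at_top sequentially"
    using t by (intro filterlim_tendsto_pos_mult_at_top[OF tendsto_const])
  then have *: "filterlim (\<lambda>n. (-1) + t * inverse (blocklen (X n) / tscale (X n))) at_top sequentially"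
    by (rule filterlim_tendsto_add_at_top[OF tendsto_const])
  show ?thesis
  proof (rule filterlim_at_top_mono[OF *], intro always_eventually allI)
    fix n
    have "t * inverse (blocklen (X n) / tscale (X n)) = tscale (X n) * t / blocklen (X n)"
      by (simp add: field_simps)
    moreover have "v - 1 \<le> real (nat \<lfloor>v\<rfloor>)" for v :: real by linarith
    ultimately show "(-1) + t * inverse (blocklen (X n) / tscale (X n)) \<le> real (blocks n t)"
      unfolding nblocks_def by (metis add.commute diff_conv_add_uminus)
  qed
qed

lemma tendsto_0_of_blocks:
  assumes t: "0 < t" and a: "(\<lambda>n. real (blocks n t) * a n) \<longlonglongrightarrow> c"
  shows "a \<longlonglongrightarrow> 0"
proof -
  have "(\<lambda>n. inverse (real (blocks n t)) * (real (blocks n t) * a n)) \<longlonglongrightarrow> 0 * c"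
    by (intro tendsto_mult a tendsto_inverse_0_at_top blocks_at_top t)
  moreover have "\<forall>\<^sub>F n in sequentially. inverse (real (blocks n t)) * (real (blocks n t) * a n) = a n"
    using filterlim_at_top_dense[THEN iffD1, OF blocks_at_top[OF t], rule_format, of 0]
    by eventually_elim simp
  ultimately show ?thesis by (simp add: tendsto_cong)
qed

lemma tail_intensity_tendsto:
  "0 < t \<Longrightarrow> 0 < u \<Longrightarrow> (\<lambda>n. real (blocks n t) * C.mean n (block_tail (X n) u)) \<longlonglongrightarrow> t * measure \<nu> {u<..}"
  using tails(1) unfolding tails_converge_def C.mean_def by blast

lemma squared_tail_intensity_tendsto:
  "0 < t \<Longrightarrow> 0 < u \<Longrightarrow> (\<lambda>n. real (blocks n t) * C.mean n (\<lambda>y. (block_tail (X n) u y)\<^sup>2)) \<longlonglongrightarrow> 0"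
  using tails(2) unfolding squared_tails_vanish_def C.mean_def by blast

lemma small_intensity:
  assumes t: "0 < t" and e: "0 < e"
  obtains \<epsilon>0 where "0 < \<epsilon>0" "\<And>\<epsilon>. 0 < \<epsilon> \<Longrightarrow> \<epsilon> < \<epsilon>0 \<Longrightarrow>
    \<forall>\<^sub>F n in sequentially. real (blocks n t) * C.block_intensity n (\<lambda>z. z * indicator {..\<epsilon>} z) < e"
proof -
  have eq: "(\<Sum>y\<in>verts (X n). pmf (invar (X n)) y *
       (\<integral>w. block (X n) 1 w * indicator {w. block (X n) 1 w \<le> \<epsilon>} w \<partial>law_from (X n) y))
    = C.block_intensity n (\<lambda>z. z * indicator {..\<epsilon>} z)" for n \<epsilon>
    unfolding C.block_intensity_def C.mean_def C.block_mean_def by (simp add: indicator_def)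
  have "((\<lambda>\<epsilon>. limsup (\<lambda>n. ereal (real (blocks n t) * C.block_intensity n (\<lambda>z. z * indicator {..\<epsilon>} z)))) \<longlongrightarrow> 0) (at_right 0)"
    using small_blocks t unfolding small_blocks_negligible_def eq by blast
  then have "\<forall>\<^sub>F \<epsilon> in at_right 0. limsup (\<lambda>n. ereal (real (blocks n t) * C.block_intensity n (\<lambda>z. z * indicator {..\<epsilon>} z))) < ereal e"
    using e by (intro order_tendstoD(2)) auto
  then obtain \<epsilon>0 where \<epsilon>0: "0 < \<epsilon>0" "\<And>\<epsilon>. 0 < \<epsilon> \<Longrightarrow> \<epsilon> < \<epsilon>0 \<Longrightarrow>
      limsup (\<lambda>n. ereal (real (blocks n t) * C.block_intensity n (\<lambda>z. z * indicator {..\<epsilon>} z))) < ereal e"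
    by (auto simp: eventually_at_right_field)
  have "\<forall>\<^sub>F n in sequentially. real (blocks n t) * C.block_intensity n (\<lambda>z. z * indicator {..\<epsilon>} z) < e"
    if "0 < \<epsilon>" "\<epsilon> < \<epsilon>0" for \<epsilon>
    using Limsup_lessD[OF \<epsilon>0(2)[OF that]] by simp
  then show ?thesis using that \<epsilon>0(1) by blast
qed

text \<open>Both sides are squeezed with staircases of the same levels, and (iii) makes finitely
  many tails converge. \<open>\<epsilon>\<close> is chosen first, so that the small parts are
  negligible on both sides; \<open>R\<close> follows, since the quantization error involves the tail
  above \<open>\<epsilon>\<close>, which may grow as \<open>\<epsilon>\<close> decreases. Zero
  \<open>q\<close> is separate because the levels divide by \<open>q\<close>.\<close>

lemma laplace_intensity_tendsto:
  assumes t: "0 < t" and q: "0 \<le> q"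
  shows "(\<lambda>n. real (blocks n t) * C.block_intensity n (laplace_weight q)) \<longlonglongrightarrow> t * exponent q"
proof (cases "q = 0")
  case True
  have "laplace_weight 0 = (\<lambda>_. 0)" by (simp add: laplace_weight_def fun_eq_iff)
  moreover have "C.block_intensity n (\<lambda>_. 0) = 0" for n using C.block_intensity_cmult[of n 0 "\<lambda>_. 0"] by simp
  ultimately show ?thesis using True by (simp add: exponent_def)
next
  case False
  then have q: "0 < q" using q by simp
  show ?thesis
  proof (rule tendstoI)
    fix e :: real assume e: "0 < e"
    obtain \<epsilon>1 where \<epsilon>1: "0 < \<epsilon>1" "\<And>\<epsilon>. 0 < \<epsilon> \<Longrightarrow> \<epsilon> < \<epsilon>1 \<Longrightarrow>
      \<forall>\<^sub>F n in sequentially. real (blocks n t) * C.block_intensity n (\<lambda>z. z * indicator {..\<epsilon>} z) < e / (4 * q)"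
      using small_intensity[OF t, of "e / (4 * q)"] e q by auto
    obtain \<epsilon>2 where \<epsilon>2: "0 < \<epsilon>2" "\<epsilon>2 \<le> 1"
      "\<And>\<epsilon>. 0 < \<epsilon> \<Longrightarrow> \<epsilon> \<le> \<epsilon>2 \<Longrightarrow> (\<integral>x. x * indicator {..\<epsilon>} x \<partial>\<nu>) < e / (4 * q * t)"
      using truncation_vanishes[of "e / (4 * q * t)"] e q t by auto
    define \<epsilon> where "\<epsilon> = min (\<epsilon>1 / 2) \<epsilon>2"
    have \<epsilon>: "0 < \<epsilon>" "\<epsilon> < \<epsilon>1" "\<epsilon> \<le> \<epsilon>2" "\<epsilon> \<le> 1" using \<epsilon>1(1) \<epsilon>2(1,2) by (auto simp: \<epsilon>_def)
    define m where "m = t * measure \<nu> {\<epsilon><..}"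
    have m: "0 \<le> m" using t by (simp add: m_def)
    \<comment> \<open>The \<open>+ 1\<close> leaves room for \<open>D n\<close>, which only tends to
      \<open>m\<close>.\<close>
    obtain R :: nat where R1: "4 * (m + 1) / e < real R" using reals_Archimedean2 by blast
    have "0 < 4 * (m + 1) / e" using m e by simp
    then have R0: "0 < real R" using R1 by linarith
    moreover have "4 * (m + 1) < real R * e" using R1 e by (simp only: pos_divide_less_eq)
    ultimately have R: "0 < R" "(m + 1) / real R < e / 4"
      by (simp_all add: pos_divide_less_eq mult.commute)
    have lev: "0 < level q \<epsilon> R r" for r using \<epsilon> by (auto simp: level_def)
    define s where "s = (\<Sum>r\<in>{1..<R}. measure \<nu> {level q \<epsilon> R r<..} / real R)"
    define A where "A n = real (blocks n t) * C.block_intensity n (laplace_weight q)" for n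
    define B where "B n = real (blocks n t) * C.block_intensity n (staircase q \<epsilon> R)" for n
    define D where "D n = real (blocks n t) * C.mean n (block_tail (X n) \<epsilon>)" for n
    define E where "E n = real (blocks n t) * C.block_intensity n (\<lambda>z. z * indicator {..\<epsilon>} z)" for n
    have "(\<lambda>n. \<Sum>r\<in>{1..<R}. real (blocks n t) * C.mean n (block_tail (X n) (level q \<epsilon> R r)) / real R)
        \<longlonglongrightarrow> (\<Sum>r\<in>{1..<R}. t * measure \<nu> {level q \<epsilon> R r<..} / real R)"
      using R(1) by (intro tendsto_sum tendsto_divide tail_intensity_tendsto t lev tendsto_const) simp
    then have Blim: "B \<longlonglongrightarrow> t * s"
      unfolding B_def[abs_def] C.block_intensity_staircase s_def by (simp add: sum_distrib_left)
    have Dlim: "D \<longlonglongrightarrow> m" unfolding D_def m_def by (rule tail_intensity_tendsto[OF t \<epsilon>(1)])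
    have AB: "B n \<le> A n" "A n \<le> B n + D n / real R + q * E n" for n
    proof -
      note b = C.laplace_intensity_bounds[OF q R(1) \<epsilon>(1), of n]
      show "B n \<le> A n" unfolding A_def B_def using b(1) by (rule mult_left_mono) simp
      have "A n \<le> real (blocks n t) * (C.block_intensity n (staircase q \<epsilon> R)
          + C.mean n (block_tail (X n) \<epsilon>) / real R + q * C.block_intensity n (\<lambda>z. z * indicator {..\<epsilon>} z))"
        unfolding A_def using b(2) by (rule mult_left_mono) simp
      then show "A n \<le> B n + D n / real R + q * E n"
        unfolding B_def D_def E_def by (simp add: algebra_simps)
    qed
    have nu: "t * s \<le> t * exponent q" "t * exponent q \<le> t * s + m / real R + e / 4"
    proof -
      note b = exponent_bounds[OF q R(1) \<epsilon>(1,4), folded s_def]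
      show "t * s \<le> t * exponent q" using b(1) t by (intro mult_left_mono) auto
      have "t * exponent q \<le> t * (s + measure \<nu> {\<epsilon><..} / real R + q * (\<integral>x. x * indicator {..\<epsilon>} x \<partial>\<nu>))"
        using b(2) t by (intro mult_left_mono) auto
      also have "\<dots> = t * s + m / real R + (q * t) * (\<integral>x. x * indicator {..\<epsilon>} x \<partial>\<nu>)"
        by (simp add: m_def algebra_simps)
      also have "(q * t) * (\<integral>x. x * indicator {..\<epsilon>} x \<partial>\<nu>) \<le> (q * t) * (e / (4 * q * t))"
        using \<epsilon>2(3)[OF \<epsilon>(1,3)] q t by (intro mult_left_mono) auto
      also have "(q * t) * (e / (4 * q * t)) = e / 4" using q t by simp
      finally show "t * exponent q \<le> t * s + m / real R + e / 4" by simp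
    qed
    have "m / real R \<le> (m + 1) / real R" using R(1) by (intro divide_right_mono) auto
    then have mR: "m / real R < e / 4" using R(2) by (rule le_less_trans)
    have ev1: "\<forall>\<^sub>F n in sequentially. dist (B n) (t * s) < e / 4" using tendstoD[OF Blim, of "e / 4"] e by simp
    have ev2: "\<forall>\<^sub>F n in sequentially. D n < m + 1" using Dlim by (intro order_tendstoD(2)) auto
    have ev3: "\<forall>\<^sub>F n in sequentially. E n < e / (4 * q)" unfolding E_def by (rule \<epsilon>1(2)[OF \<epsilon>(1,2)])
    show "\<forall>\<^sub>F n in sequentially. dist (real (blocks n t) * C.block_intensity n (laplace_weight q)) (t * exponent q) < e"
      using ev1 ev2 ev3
    proof eventually_elim
      case (elim n)
      have "D n / real R \<le> (m + 1) / real R" using elim(2) R(1) by (intro divide_right_mono) auto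
      moreover have "q * E n \<le> q * (e / (4 * q))" using elim(3) q by (intro mult_left_mono) auto
      moreover have "q * (e / (4 * q)) = e / 4" using q by simp
      ultimately have "A n < B n + e / 4 + e / 4" using AB(2)[of n] R(2) by linarith
      moreover have "\<bar>B n - t * s\<bar> < e / 4" using elim(1) by (simp add: dist_real_def)
      ultimately have "\<bar>A n - t * exponent q\<bar> < e" using AB(1)[of n] nu mR e by linarith
      then show ?case by (simp add: A_def dist_real_def)
    qed
  qed
qed

lemma laplace_square_tendsto:
  assumes t: "0 < t" and q: "0 \<le> q"
  shows "(\<lambda>n. real (blocks n t) * C.mean n (\<lambda>y. (C.block_mean n (laplace_weight q) y)\<^sup>2)) \<longlonglongrightarrow> 0"
proof (rule tendstoI)
  fix e :: real assume e: "0 < e"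
  \<comment> \<open>Half of \<open>e\<close> is kept for the squared tails; the \<open>+ 1\<close>
    covers \<open>q = 0\<close>.\<close>
  define d where "d = e / (2 * (2 * q\<^sup>2 + 1))"
  have q1: "0 < 2 * q\<^sup>2 + 1" by (simp add: add_nonneg_pos)
  have d: "0 < d" "2 * q\<^sup>2 * d \<le> e / 2"
    using e q1 by (auto simp: d_def field_simps)
  obtain \<epsilon>1 where \<epsilon>1: "0 < \<epsilon>1" "\<And>\<epsilon>. 0 < \<epsilon> \<Longrightarrow> \<epsilon> < \<epsilon>1 \<Longrightarrow>
      \<forall>\<^sub>F n in sequentially. real (blocks n t) * C.block_intensity n (\<lambda>z. z * indicator {..\<epsilon>} z) < d"
    using small_intensity[OF t d(1)] by auto
  define \<epsilon> where "\<epsilon> = min 1 (\<epsilon>1 / 2)"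
  have \<epsilon>: "0 < \<epsilon>" "\<epsilon> < \<epsilon>1" "\<epsilon> \<le> 1" using \<epsilon>1(1) by (auto simp: \<epsilon>_def)
  have ev1: "\<forall>\<^sub>F n in sequentially. real (blocks n t) * C.mean n (\<lambda>y. (block_tail (X n) \<epsilon> y)\<^sup>2) < e / 4"
    using squared_tail_intensity_tendsto[OF t \<epsilon>(1)] e by (intro order_tendstoD(2)) auto
  show "\<forall>\<^sub>F n in sequentially. dist (real (blocks n t) * C.mean n (\<lambda>y. (C.block_mean n (laplace_weight q) y)\<^sup>2)) 0 < e"
    using ev1 \<epsilon>1(2)[OF \<epsilon>(1,2)]
  proof eventually_elim
    case (elim n)
    let ?s = "real (blocks n t) * C.block_intensity n (\<lambda>z. z * indicator {..\<epsilon>} z)"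
    have s0: "0 \<le> C.block_intensity n (\<lambda>z. z * indicator {..\<epsilon>} z)"
      using \<epsilon>(1) by (intro C.block_intensity_nonneg bounded_baire_truncation) auto
    have "real (blocks n t) * C.mean n (\<lambda>y. (C.block_mean n (laplace_weight q) y)\<^sup>2)
        \<le> real (blocks n t) * (2 * C.mean n (\<lambda>y. (block_tail (X n) \<epsilon> y)\<^sup>2)
          + 2 * q\<^sup>2 * \<epsilon> * C.block_intensity n (\<lambda>z. z * indicator {..\<epsilon>} z))"
      by (intro mult_left_mono C.laplace_intensity_square q \<epsilon>(1)) simp
    also have "\<dots> = 2 * (real (blocks n t) * C.mean n (\<lambda>y. (block_tail (X n) \<epsilon> y)\<^sup>2)) + 2 * q\<^sup>2 * (\<epsilon> * ?s)"
      by (simp add: algebra_simps)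
    also have "2 * q\<^sup>2 * (\<epsilon> * ?s) \<le> 2 * q\<^sup>2 * (1 * d)"
      using \<epsilon> s0 elim(2) by (intro mult_left_mono mult_mono) auto
    also have "2 * (real (blocks n t) * C.mean n (\<lambda>y. (block_tail (X n) \<epsilon> y)\<^sup>2)) + 2 * q\<^sup>2 * (1 * d) < e"
      using elim(1) d(2) by simp
    finally have "real (blocks n t) * C.mean n (\<lambda>y. (C.block_mean n (laplace_weight q) y)\<^sup>2) < e" by simp
    moreover have "0 \<le> real (blocks n t) * C.mean n (\<lambda>y. (C.block_mean n (laplace_weight q) y)\<^sup>2)"
      by (intro mult_nonneg_nonneg C.mean_nonneg) auto
    ultimately show ?case by simp
  qed
qed

text \<open>(i) gives smallness in probability, which suffices because the weight is at most 1, and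
  at most \<open>q * u\<close> on blocks up to \<open>u\<close>.\<close>

lemma first_block_tendsto:
  assumes q: "0 \<le> q"
  shows "(\<lambda>n. \<integral>w. laplace_weight q (block (X n) (Suc 0) w) \<partial>law (X n) (init (X n))) \<longlonglongrightarrow> 0"
proof (rule tendstoI)
  fix e :: real assume e: "0 < e"
  define u where "u = e / (2 * (q + 1))"
  have u: "0 < u" "q * u \<le> e / 2" using e q by (auto simp: u_def field_simps)
  have "(\<lambda>n. measure (law (X n) (init (X n))) {w \<in> space (law (X n) (init (X n))). block (X n) 1 w > u}) \<longlonglongrightarrow> 0"
    using first_block u unfolding initial_block_negligible_def by blast
  then have "\<forall>\<^sub>F n in sequentially. measure (law (X n) (init (X n))) {w \<in> space (law (X n) (init (X n))). block (X n) 1 w > u} < e / 2"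
    using e by (intro order_tendstoD(2)) auto
  then show "\<forall>\<^sub>F n in sequentially. dist (\<integral>w. laplace_weight q (block (X n) (Suc 0) w) \<partial>law (X n) (init (X n))) 0 < e"
  proof eventually_elim
    case (elim n)
    let ?P = "law (X n) (init (X n))"
    interpret P: prob_space ?P by (rule C.prob_space_law[OF C.init_verts])
    note nn = C.block_nonneg[OF C.init_verts]
    note I = C.integrable_baire_block[OF C.init_verts]
    have "(\<integral>w. laplace_weight q (block (X n) (Suc 0) w) \<partial>?P)
        \<le> (\<integral>w. indicator {u<..} (block (X n) (Suc 0) w) + q * u \<partial>?P)"
    proof (rule integral_mono)
      show "integrable ?P (\<lambda>w. indicator {u<..} (block (X n) (Suc 0) w) + q * u)"
        by (intro Bochner_Integration.integrable_add I bounded_baire_indicator P.integrable_const)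
      fix w assume w: "w \<in> space ?P"
      show "laplace_weight q (block (X n) (Suc 0) w) \<le> indicator {u<..} (block (X n) (Suc 0) w) + q * u"
      proof (cases "u < block (X n) (Suc 0) w")
        case True
        have "0 \<le> q * u" using q u by simp
        then show ?thesis using laplace_weight_bounds(2)[OF q nn[OF w]] True by (simp add: less_imp_le add_increasing2)
      next
        case False
        then have "q * block (X n) (Suc 0) w \<le> q * u" using q by (intro mult_left_mono) auto
        with laplace_weight_bounds(3)[OF q nn[OF w]]
        have "laplace_weight q (block (X n) (Suc 0) w) \<le> q * u" by (rule order_trans)
        then show ?thesis using False by simp
      qed
    qed (intro I bounded_baire_laplace_weight q)
    also have "\<dots> = (\<integral>w. indicator {u<..} (block (X n) (Suc 0) w) \<partial>?P) + q * u"
      using I[OF bounded_baire_indicator] by (subst Bochner_Integration.integral_add) (auto simp: P.prob_space)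
    also have "(\<integral>w. indicator {u<..} (block (X n) (Suc 0) w) \<partial>?P)
        = (\<integral>w. indicator {w \<in> space ?P. block (X n) 1 w > u} w \<partial>?P)"
      by (intro Bochner_Integration.integral_cong refl) (simp add: indicator_def)
    also have "\<dots> = measure ?P {w \<in> space ?P. block (X n) 1 w > u}" by (simp add: Int_absorb2 subset_eq)
    finally have "(\<integral>w. laplace_weight q (block (X n) (Suc 0) w) \<partial>?P) < e" using elim u(2) by simp
    moreover have "0 \<le> (\<integral>w. laplace_weight q (block (X n) (Suc 0) w) \<partial>?P)"
      using laplace_weight_bounds(1)[OF q nn] by (intro Bochner_Integration.integral_nonneg_AE AE_I2)
    ultimately show ?case by simp
  qed
qed

end

text \<open>The power is squeezed between exponentials by
  \<open>exp (- (y / (1 - y))) \<le> 1 - y \<le> exp (- y)\<close>, so base and exponent may vary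
  separately as long as their product converges.\<close>

lemma power_one_minus_tendsto:
  fixes x :: "nat \<Rightarrow> real" and k :: "nat \<Rightarrow> nat"
  assumes x0: "\<And>n. 0 \<le> x n" and xl: "x \<longlonglongrightarrow> 0" and kx: "(\<lambda>n. real (k n) * x n) \<longlonglongrightarrow> c"
  shows "(\<lambda>n. (1 - x n) ^ k n) \<longlonglongrightarrow> exp (- c)"
proof -
  have x1: "\<forall>\<^sub>F n in sequentially. x n < 1" using xl by (intro order_tendstoD(2)) auto
  have lower: "(\<lambda>n. exp (- (real (k n) * x n / (1 - x n)))) \<longlonglongrightarrow> exp (- (c / (1 - 0)))"
    by (intro tendsto_intros kx xl) simp
  have upper: "(\<lambda>n. exp (- (real (k n) * x n))) \<longlonglongrightarrow> exp (- c)"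
    by (intro tendsto_intros kx)
  have bound: "exp (- (y / (1 - y))) \<le> 1 - y \<and> 1 - y \<le> exp (- y)" if y: "0 \<le> y" "y < 1" for y :: real
  proof
    have "1 + y / (1 - y) \<le> exp (y / (1 - y))" by (rule exp_ge_add_one_self)
    moreover have "1 + y / (1 - y) = 1 / (1 - y)" using y by (simp add: field_simps)
    ultimately have "inverse (exp (y / (1 - y))) \<le> inverse (1 / (1 - y))"
      using y by (intro le_imp_inverse_le) auto
    then show "exp (- (y / (1 - y))) \<le> 1 - y" by (simp add: exp_minus)
    show "1 - y \<le> exp (- y)" using exp_ge_add_one_self[of "- y"] by simp
  qed
  show ?thesis
  proof (rule tendsto_sandwich)
    show "\<forall>\<^sub>F n in sequentially. exp (- (real (k n) * x n / (1 - x n))) \<le> (1 - x n) ^ k n"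
      using x1
    proof eventually_elim
      case (elim n)
      have "exp (- (real (k n) * x n / (1 - x n))) = exp (- (x n / (1 - x n))) ^ k n"
        by (simp flip: exp_of_nat_mult)
      then show ?case using bound[OF x0 elim] by (simp add: power_mono)
    qed
    show "\<forall>\<^sub>F n in sequentially. (1 - x n) ^ k n \<le> exp (- (real (k n) * x n))"
      using x1
    proof eventually_elim
      case (elim n)
      have "exp (- (real (k n) * x n)) = exp (- x n) ^ k n"
        by (simp flip: exp_of_nat_mult)
      then show ?case using bound[OF x0 elim] elim by (simp add: power_mono)
    qed
  qed (use lower upper in simp_all)
qed

section \<open>Grouping blocks into grid cells\<close>

lemma prod_cells:
  fixes f :: "nat \<Rightarrow> real" and K :: "nat \<Rightarrow> nat"
  assumes "K 0 = 0" "\<And>j. K j \<le> K (Suc j)"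
  shows "(\<Prod>i<K m. f i) = (\<Prod>j<m. \<Prod>i\<in>{K j..<K (Suc j)}. f i)"
proof (induction m)
  case (Suc m)
  have "(\<Prod>i<K (Suc m). f i) = (\<Prod>i\<in>{0..<K m}. f i) * (\<Prod>i\<in>{K m..<K (Suc m)}. f i)"
    using assms(2)[of m] by (simp add: lessThan_atLeast0 prod.atLeastLessThan_concat)
  then show ?case using Suc by (simp add: lessThan_atLeast0)
qed (simp add: assms)

lemma sum_cells:
  fixes f :: "nat \<Rightarrow> real" and K :: "nat \<Rightarrow> nat"
  assumes "K 0 = 0" "\<And>j. K j \<le> K (Suc j)"
  shows "(\<Sum>i<K m. f i) = (\<Sum>j<m. \<Sum>i\<in>{K j..<K (Suc j)}. f i)"
proof (induction m)
  case (Suc m)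
  have "(\<Sum>i<K (Suc m). f i) = (\<Sum>i\<in>{0..<K m}. f i) + (\<Sum>i\<in>{K m..<K (Suc m)}. f i)"
    using assms(2)[of m] by (simp add: lessThan_atLeast0 sum.atLeastLessThan_concat)
  then show ?case using Suc by (simp add: lessThan_atLeast0)
qed (simp add: assms)

text \<open>A multiplier constant on the blocks of each cell. It turns the joint transform of
  several increments into one product over blocks, to which the product estimate applies.\<close>

definition cell_weight :: "(nat \<Rightarrow> nat) \<Rightarrow> nat \<Rightarrow> (nat \<Rightarrow> real) \<Rightarrow> nat \<Rightarrow> real" where
  "cell_weight K m q i = (\<Sum>j<m. if i \<in> {K j..<K (Suc j)} then q j else 0)"

lemma cell_weight_eq:
  assumes K: "\<And>j. K j \<le> K (Suc j)" and i: "i \<in> {K j..<K (Suc j)}" and j: "j < m"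
  shows "cell_weight K m q i = q j"
proof -
  have mono: "K a \<le> K b" if "a \<le> b" for a b by (rule lift_Suc_mono_le[of K, OF K that])
  have "i \<in> {K l..<K (Suc l)} \<longleftrightarrow> l = j" for l
  proof (cases l j rule: linorder_cases)
    case less
    then have "K (Suc l) \<le> K j" by (intro mono) simp
    then show ?thesis using i less by auto
  next
    case greater
    then have "K (Suc j) \<le> K l" by (intro mono) simp
    then show ?thesis using i greater by auto
  qed (use i in auto)
  then show ?thesis unfolding cell_weight_def using j by simp
qed

lemma cell_weight_bounds:
  assumes "\<And>j. 0 \<le> q j"
  shows "0 \<le> cell_weight K m q i" "cell_weight K m q i \<le> (\<Sum>j<m. q j)"
  unfolding cell_weight_def using assms by (auto intro!: sum_nonneg sum_mono)

text \<open>If a cell contains a large block with index \<open>i > 0\<close>, the time at which the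
  path jumps by it is the exceptional time, and all other increments in the cell are sums of small
  blocks. Index 0 is exempt from \<open>unique\<close>, because the first block is controlled
  through \<open>small\<close> instead.\<close>

lemma block_path_single_jump_cells:
  fixes z :: "nat \<Rightarrow> real" and \<tau> \<delta> :: real
  assumes \<tau>: "0 < \<tau>" and \<delta>: "0 < \<delta>" and \<epsilon>: "0 \<le> \<epsilon>"
    and x: "\<And>t. 0 \<le> t \<Longrightarrow> x t = (\<Sum>i<nat \<lfloor>t / \<tau>\<rfloor>. z i)"
  defines "K \<equiv> \<lambda>j. nat \<lfloor>real j * \<delta> / \<tau>\<rfloor>"
  assumes small: "\<And>J. J \<subseteq> {..<K m} \<Longrightarrow> (\<And>i. i \<in> J \<Longrightarrow> 0 < i \<Longrightarrow> z i \<le> u) \<Longrightarrow> sum z J \<le> \<epsilon>"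
    and unique: "\<And>j i i'. j < m \<Longrightarrow> 0 < i \<Longrightarrow> i < i' \<Longrightarrow> i \<in> {K j..<K (Suc j)} \<Longrightarrow> i' \<in> {K j..<K (Suc j)} \<Longrightarrow>
      u < z i \<Longrightarrow> u < z i' \<Longrightarrow> False"
  shows "single_jump_cells \<delta> \<epsilon> m x"
  unfolding single_jump_cells_def
proof (intro allI impI)
  fix j assume j: "j < m"
  define l r where "l = real j * \<delta>" and "r = real (Suc j) * \<delta>"
  have lr: "0 \<le> l" "l < r" using \<delta> by (auto simp: l_def r_def algebra_simps)
  define N where "N t = nat \<lfloor>t / \<tau>\<rfloor>" for t
  have mono: "N s \<le> N t" if "s \<le> t" for s t
    unfolding N_def using that \<tau> by (intro nat_mono floor_mono divide_right_mono) auto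
  have Kl: "K j = N l" "K (Suc j) = N r" by (simp_all add: K_def N_def l_def r_def)
  have "real (Suc j) * \<delta> \<le> real m * \<delta>" using j \<delta> by (intro mult_right_mono) auto
  then have Km: "N r \<le> K m" using mono[of r "real m * \<delta>"] by (simp add: K_def N_def r_def)
  have inc: "x t - x s = (\<Sum>i\<in>{N s..<N t}. z i)" if "0 \<le> s" "s \<le> t" for s t
  proof -
    have "(\<Sum>i\<in>{0..<N s}. z i) + (\<Sum>i\<in>{N s..<N t}. z i) = (\<Sum>i\<in>{0..<N t}. z i)"
      using mono[OF that(2)] by (intro sum.atLeastLessThan_concat) auto
    then show ?thesis using x[of s] x[of t] that by (simp add: N_def lessThan_atLeast0)
  qed
  have less_iff: "N t < k \<longleftrightarrow> t < real k * \<tau>" if "0 \<le> t" for t k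
  proof -
    have v: "0 \<le> t / \<tau>" using that \<tau> by simp
    have "N t < k \<longleftrightarrow> t / \<tau> < real k" unfolding N_def using v by linarith
    also have "\<dots> \<longleftrightarrow> t < real k * \<tau>" using \<tau> by (simp add: pos_divide_less_eq)
    finally show ?thesis .
  qed
  have "\<exists>s>l. s \<le> r \<and> (\<forall>t. l \<le> t \<and> t < s \<longrightarrow> x t \<le> x l + \<epsilon>) \<and> x r \<le> x s + \<epsilon>"
  proof (cases "\<exists>i. 0 < i \<and> i \<in> {N l..<N r} \<and> u < z i")
    case True
    then obtain i where i: "0 < i" "N l \<le> i" "i < N r" "u < z i" by auto
    have other: "z a \<le> u" if "0 < a" "a \<in> {N l..<N r}" "a \<noteq> i" for a
    proof (rule ccontr)
      assume "\<not> z a \<le> u"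
      then have "u < z a" by simp
      then show False
        using unique[OF j, of a i] unique[OF j, of i a] that i unfolding Kl
        by (cases "a < i") auto
    qed
    \<comment> \<open>Block \<open>i\<close> is credited when it is complete, hence the
      successor.\<close>
    define s where "s = real (Suc i) * \<tau>"
    have s0: "0 \<le> s" using \<tau> by (simp add: s_def)
    have "l < s" using less_iff[OF lr(1), of "Suc i"] i by (simp add: s_def)
    moreover have "s \<le> r" using less_iff[of r "Suc i"] lr i by (simp add: s_def not_less[symmetric])
    moreover have Ns: "N s = Suc i"
      unfolding N_def s_def by (rule nat_floor_eq[OF \<tau>]) (use \<tau> in auto)
    have "x t \<le> x l + \<epsilon>" if t: "l \<le> t" "t < s" for t
    proof -
      have "N t < Suc i" using less_iff[of t "Suc i"] t lr by (simp add: s_def)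
      then have "sum z {N l..<N t} \<le> \<epsilon>"
        using i Km other by (intro small) auto
      then show ?thesis using inc[OF lr(1) t(1)] by simp
    qed
    moreover have "x r \<le> x s + \<epsilon>"
    proof -
      have "sum z {N s..<N r} \<le> \<epsilon>"
        using i Km other Ns by (intro small) auto
      then show ?thesis using inc[OF s0 \<open>s \<le> r\<close>] by simp
    qed
    ultimately show ?thesis by blast
  next
    case False
    then have no: "z a \<le> u" if "0 < a" "a \<in> {N l..<N r}" for a using that by (auto simp: not_less)
    have "x t \<le> x l + \<epsilon>" if t: "l \<le> t" "t < r" for t
    proof -
      have "sum z {N l..<N t} \<le> \<epsilon>"
        using Km no mono[of t r] t by (intro small) auto
      then show ?thesis using inc[OF lr(1) t(1)] by simp
    qed
    then show ?thesis using lr \<epsilon> by (intro exI[of _ r]) auto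
  qed
  then show "\<exists>s. real j * \<delta> < s \<and> s \<le> real (Suc j) * \<delta> \<and>
     (\<forall>t. real j * \<delta> \<le> t \<and> t < s \<longrightarrow> x t \<le> x (real j * \<delta>) + \<epsilon>) \<and>
     x (real (Suc j) * \<delta>) \<le> x s + \<epsilon>" by (simp only: l_def r_def)
qed

section \<open>Paths of the blocked clock\<close>

context exploration_clock
begin

lemma nblocks_eq: "nblocks X t = nat \<lfloor>t / (blocklen X / tscale X)\<rfloor>"
  unfolding nblocks_def by (simp add: mult.commute)

lemma nblocks_0: "nblocks X 0 = 0" by (simp add: nblocks_def)

lemma nblocks_mono: "s \<le> t \<Longrightarrow> nblocks X s \<le> nblocks X t"
  unfolding nblocks_def using scale_pos
  by (intro nat_mono floor_mono divide_right_mono mult_left_mono) auto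

lemma blocked_clock_eq: "0 \<le> t \<Longrightarrow> blocked_clock X w t = (\<Sum>i<nblocks X t. block X (Suc i) w)"
  unfolding blocked_clock_def by (simp add: sum.atLeast1_atMost_eq)

lemma blocked_clock_increasing_process:
  assumes \<mu>: "set_pmf \<mu> \<subseteq> verts X" shows "increasing_process (law X \<mu>) (blocked_clock X)"
  unfolding increasing_process_def
proof (intro conjI ballI allI impI)
  show "prob_space (law X \<mu>)" by (rule prob_space_law[OF \<mu>])
  show "(\<lambda>w. blocked_clock X w t) \<in> borel_measurable (law X \<mu>)" if "0 \<le> t" for t
    unfolding blocked_clock_eq[OF that] by (intro borel_measurable_sum block_measurable[OF \<mu>])
  fix w assume w: "w \<in> space (law X \<mu>)"
  have eq: "blocked_clock X w = restrict (\<lambda>t. (\<lambda>n. \<Sum>i=1..n. block X i w) (nat \<lfloor>t / (blocklen X / tscale X)\<rfloor>)) {0..}"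
    unfolding blocked_clock_def nblocks_eq by simp
  have "0 < blocklen X / tscale X" using scale_pos by simp
  note rc = floor_path_right_continuous[OF this]
  show "increasing_path (blocked_clock X w)"
    unfolding increasing_path_def
  proof (intro conjI allI impI)
    show "blocked_clock X w \<in> extensional {0..}" by (simp add: blocked_clock_def)
    show "blocked_clock X w 0 = 0" by (simp add: blocked_clock_eq nblocks_0)
    show "mono_on {0..} (blocked_clock X w)"
    proof (rule mono_onI)
      fix s t :: real assume st: "s \<in> {0..}" "t \<in> {0..}" "s \<le> t"
      then show "blocked_clock X w s \<le> blocked_clock X w t"
        using nblocks_mono[OF st(3)] block_nonneg[OF \<mu> w]
        by (simp add: blocked_clock_eq sum_mono2)
    qed
    show "continuous (at_right t) (blocked_clock X w)" if "0 \<le> t" for t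
      unfolding eq by (rule rc[OF that])
  qed
qed

lemma grid_increment_blocked_clock:
  assumes "0 < \<delta>"
  shows "grid_increment \<delta> (blocked_clock X w) j
    = (\<Sum>i\<in>{nblocks X (real j * \<delta>)..<nblocks X (real (Suc j) * \<delta>)}. block X (Suc i) w)"
proof -
  have "nblocks X (real j * \<delta>) \<le> nblocks X (real (Suc j) * \<delta>)"
    using assms by (intro nblocks_mono mult_right_mono) auto
  then have "(\<Sum>i\<in>{0..<nblocks X (real j * \<delta>)}. block X (Suc i) w)
      + (\<Sum>i\<in>{nblocks X (real j * \<delta>)..<nblocks X (real (Suc j) * \<delta>)}. block X (Suc i) w)
      = (\<Sum>i\<in>{0..<nblocks X (real (Suc j) * \<delta>)}. block X (Suc i) w)"
    by (intro sum.atLeastLessThan_concat) auto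
  then show ?thesis unfolding grid_increment_def using assms
    by (subst (1 2) blocked_clock_eq) (auto simp: lessThan_atLeast0)
qed

end

context clock_sequence
begin

text \<open>The multipliers may depend on \<open>n\<close> and \<open>i\<close>, since the cells
  contain different blocks for each \<open>n\<close>; \<open>qb\<close> dominates them, so the
  weights at \<open>qb\<close> bound all means. Of the error bound only the Young term survives in
  the limit, with value \<open>\<eta> * (t * exponent qb)\<close>.\<close>

lemma laplace_product_tendsto:
  assumes t: "0 < t" and qb: "0 \<le> qb" and q: "\<And>n i. 0 \<le> q n i" "\<And>n i. q n i \<le> qb"
  shows "(\<lambda>n. (\<integral>w. exp (- (\<Sum>i<blocks n t. q n i * block (X n) (Suc i) w)) \<partial>law (X n) (init (X n)))
    - (\<Prod>i<blocks n t. 1 - C.block_intensity n (laplace_weight (q n i)))) \<longlonglongrightarrow> 0"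
proof (rule tendstoI)
  fix e :: real assume e: "0 < e"
  \<comment> \<open>Chosen before \<open>n\<close> tends to infinity so that the surviving term is
    less than \<open>e\<close>; the \<open>+ 1\<close> covers a vanishing exponent.\<close>
  define \<eta> where "\<eta> = e / (2 * (t * exponent qb + 1))"
  have te: "0 \<le> t * exponent qb" using t exponent_nonneg[OF qb] by simp
  have \<eta>: "0 < \<eta>" "\<eta> * (t * exponent qb) < e"
  proof -
    have p: "0 < 2 * (t * exponent qb + 1)" using te by simp
    then show "0 < \<eta>" using e by (simp add: \<eta>_def)
    then have "\<eta> * (t * exponent qb) < \<eta> * (2 * (t * exponent qb + 1))"
      using te by (intro mult_strict_left_mono) auto
    also have "\<dots> = e" using p by (simp add: \<eta>_def)
    finally show "\<eta> * (t * exponent qb) < e" .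
  qed
  define \<gamma> where "\<gamma> n = C.block_intensity n (laplace_weight qb)" for n
  define \<gamma>2 where "\<gamma>2 n = C.mean n (\<lambda>y. (C.block_mean n (laplace_weight qb) y)\<^sup>2)" for n
  define \<beta> where "\<beta> n = (\<integral>w. laplace_weight qb (block (X n) (Suc 0) w) \<partial>law (X n) (init (X n)))" for n
  define k where "k n = real (blocks n t)" for n
  define b where "b n = (1 + \<gamma> n + \<eta>) * \<beta> n + \<gamma> n
    + k n * (\<rho> n * \<gamma> n + (\<gamma> n + \<eta>) * (1 + \<rho> n) * \<gamma> n + (1 + \<rho> n) * \<gamma>2 n / \<eta>)" for n
  have k\<gamma>: "(\<lambda>n. k n * \<gamma> n) \<longlonglongrightarrow> t * exponent qb" unfolding k_def \<gamma>_def by (rule laplace_intensity_tendsto[OF t qb])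
  have k\<gamma>2: "(\<lambda>n. k n * \<gamma>2 n) \<longlonglongrightarrow> 0" unfolding k_def \<gamma>2_def by (rule laplace_square_tendsto[OF t qb])
  have \<gamma>0: "\<gamma> \<longlonglongrightarrow> 0" using tendsto_0_of_blocks[OF t k\<gamma>[unfolded k_def]] .
  have \<beta>0: "\<beta> \<longlonglongrightarrow> 0" unfolding \<beta>_def[abs_def] by (rule first_block_tendsto[OF qb])
  \<comment> \<open>The number of blocks is attached to \<open>\<gamma> n\<close> and
    \<open>\<gamma>2 n\<close>, for which the product converges, while the free factors
    \<open>\<rho> n\<close>, \<open>\<gamma> n\<close> and \<open>\<beta> n\<close> tend to
    0.\<close>
  have "(\<lambda>n. (1 + \<gamma> n + \<eta>) * \<beta> n + \<gamma> n
    + (\<rho> n * (k n * \<gamma> n) + (\<gamma> n + \<eta>) * (1 + \<rho> n) * (k n * \<gamma> n) + (1 + \<rho> n) * (k n * \<gamma>2 n) / \<eta>))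
    \<longlonglongrightarrow> (1 + 0 + \<eta>) * 0 + 0 + (0 * (t * exponent qb) + (0 + \<eta>) * (1 + 0) * (t * exponent qb) + (1 + 0) * 0 / \<eta>)"
    using \<eta>(1) by (intro tendsto_intros k\<gamma> k\<gamma>2 \<gamma>0 \<beta>0 mix(3)) auto
  moreover have "b n = (1 + \<gamma> n + \<eta>) * \<beta> n + \<gamma> n
    + (\<rho> n * (k n * \<gamma> n) + (\<gamma> n + \<eta>) * (1 + \<rho> n) * (k n * \<gamma> n) + (1 + \<rho> n) * (k n * \<gamma>2 n) / \<eta>)" for n
    unfolding b_def by (simp add: algebra_simps add_divide_distrib)
  ultimately have "(\<lambda>n. b n) \<longlonglongrightarrow> (1 + 0 + \<eta>) * 0 + 0 + (0 * (t * exponent qb) + (0 + \<eta>) * (1 + 0) * (t * exponent qb) + (1 + 0) * 0 / \<eta>)"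
    by (simp only:)
  then have "b \<longlonglongrightarrow> \<eta> * (t * exponent qb)" by simp
  then have "\<forall>\<^sub>F n in sequentially. b n < e" using \<eta>(2) by (intro order_tendstoD(2))
  then show "\<forall>\<^sub>F n in sequentially. dist ((\<integral>w. exp (- (\<Sum>i<blocks n t. q n i * block (X n) (Suc i) w)) \<partial>law (X n) (init (X n)))
    - (\<Prod>i<blocks n t. 1 - C.block_intensity n (laplace_weight (q n i)))) 0 < e"
  proof eventually_elim
    case (elim n)
    let ?P = "law (X n) (init (X n))"
    let ?u = "\<lambda>i z. exp (- q n i * z)"
    have u': "(\<lambda>z. 1 - ?u i z) = laplace_weight (q n i)" for i by (simp add: laplace_weight_def fun_eq_iff)
    have le: "laplace_weight (q n i) z \<le> laplace_weight qb z" if "0 \<le> z" for i z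
      unfolding laplace_weight_def using q(2)[of n i] that by (simp add: mult_right_mono)
    note lb = bounded_baire_laplace_weight
    have "\<bar>(\<integral>w. (\<Prod>i<blocks n t. ?u i (block (X n) (Suc i) w)) \<partial>?P)
        - (\<Prod>i<blocks n t. 1 - C.mean n (C.block_mean n (\<lambda>z. 1 - ?u i z)))\<bar>
      \<le> (1 + \<gamma> n + \<eta>) * \<beta> n + \<gamma> n
        + real (blocks n t) * (\<rho> n * \<gamma> n + (\<gamma> n + \<eta>) * (1 + \<rho> n) * \<gamma> n + (1 + \<rho> n) * \<gamma>2 n / \<eta>)"
    proof (rule C.product_laplace_estimate[OF mix(1,2) C.init_verts])
      show "bounded_baire (?u i)" for i by (rule bounded_baire_exp[OF q(1)])
      show "bounded_baire (\<lambda>z. 1 - ?u i z)" for i unfolding u' by (rule lb[OF q(1)])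
      show "?u i z \<le> 1" if "0 \<le> z" for i z using q(1)[of n i] that by simp
      show "C.mean n (C.block_mean n (\<lambda>z. 1 - ?u i z)) \<le> \<gamma> n" for i
        unfolding u' \<gamma>_def C.block_intensity_def[symmetric]
        by (intro C.block_intensity_mono lb q(1) qb le)
      show "C.mean n (\<lambda>y. (C.block_mean n (\<lambda>z. 1 - ?u i z) y)\<^sup>2) \<le> \<gamma>2 n" for i
        unfolding u' \<gamma>2_def
        by (intro C.mean_mono power_mono C.block_mean_mono C.block_mean_nonneg lb q(1) qb le laplace_weight_bounds(1))
      show "(\<integral>w. 1 - ?u 0 (block (X n) (Suc 0) w) \<partial>?P) \<le> \<beta> n"
      proof -
        have "(\<integral>w. laplace_weight (q n 0) (block (X n) (Suc 0) w) \<partial>?P) \<le> \<beta> n" unfolding \<beta>_def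
          by (intro integral_mono C.integrable_baire_block C.init_verts lb q(1) qb le C.block_nonneg[OF C.init_verts])
        then show ?thesis by (simp add: laplace_weight_def)
      qed
    qed (use \<eta> in simp_all)
    also have "\<dots> = b n" by (simp add: b_def k_def)
    also have "(\<lambda>w. \<Prod>i<blocks n t. ?u i (block (X n) (Suc i) w))
        = (\<lambda>w. exp (- (\<Sum>i<blocks n t. q n i * block (X n) (Suc i) w)))"
      by (rule ext) (simp add: exp_sum flip: sum_negf)
    finally show ?case using elim unfolding u' C.block_intensity_def by (simp add: dist_real_def)
  qed
qed

text \<open>Once the product over blocks is replaced by equilibrium factors, the factor is constant
  on each cell. The cell contributes a power of \<open>1 - x\<close> with \<open>x\<close> the block
  intensity, and the number of its blocks times \<open>x\<close> tends to
  \<open>\<delta> * exponent (q j)\<close>.\<close>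

lemma blocked_clock_laplace_tendsto:
  fixes q :: "nat \<Rightarrow> real"
  assumes \<delta>: "0 < \<delta>" and q: "\<And>j. 0 \<le> q j"
  shows "(\<lambda>n. \<integral>w. exp (- (\<Sum>j<m. q j * grid_increment \<delta> (blocked_clock (X n) w) j)) \<partial>law (X n) (init (X n)))
    \<longlonglongrightarrow> (\<Prod>j<m. exp (- (\<delta> * exponent (q j))))"
proof (cases "m = 0")
  case True
  then show ?thesis using prob_space.prob_space[OF C.prob_space_law[OF C.init_verts]] by simp
next
  case False
  define K where "K n j = blocks n (real j * \<delta>)" for n j
  have K0: "K n 0 = 0" for n by (simp add: K_def C.nblocks_0)
  have KS: "K n j \<le> K n (Suc j)" for n j
    unfolding K_def using \<delta> by (intro C.nblocks_mono mult_right_mono) auto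
  let ?q = "\<lambda>n. cell_weight (K n) m q"
  have md: "0 < real m * \<delta>" using False \<delta> by simp
  have diff: "(\<lambda>n. (\<integral>w. exp (- (\<Sum>i<K n m. ?q n i * block (X n) (Suc i) w)) \<partial>law (X n) (init (X n)))
      - (\<Prod>i<K n m. 1 - C.block_intensity n (laplace_weight (?q n i)))) \<longlonglongrightarrow> 0"
    unfolding K_def[of _ m]
    by (rule laplace_product_tendsto[OF md, where qb = "\<Sum>j<m. q j"]) (auto intro: cell_weight_bounds q sum_nonneg)
  have prod: "(\<lambda>n. \<Prod>i<K n m. 1 - C.block_intensity n (laplace_weight (?q n i)))
      \<longlonglongrightarrow> (\<Prod>j<m. exp (- (\<delta> * exponent (q j))))"
  proof -
    have "(\<Prod>i<K n m. 1 - C.block_intensity n (laplace_weight (?q n i)))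
        = (\<Prod>j<m. (1 - C.block_intensity n (laplace_weight (q j))) ^ (K n (Suc j) - K n j))" for n
    proof -
      have "(\<Prod>i<K n m. 1 - C.block_intensity n (laplace_weight (?q n i)))
          = (\<Prod>j<m. \<Prod>i\<in>{K n j..<K n (Suc j)}. 1 - C.block_intensity n (laplace_weight (?q n i)))"
        by (rule prod_cells[of "K n", OF K0 KS])
      also have "\<dots> = (\<Prod>j<m. \<Prod>i\<in>{K n j..<K n (Suc j)}. 1 - C.block_intensity n (laplace_weight (q j)))"
        by (intro prod.cong refl) (simp add: cell_weight_eq[of "K n", OF KS])
      finally show ?thesis by simp
    qed
    moreover have "(\<lambda>n. \<Prod>j<m. (1 - C.block_intensity n (laplace_weight (q j))) ^ (K n (Suc j) - K n j))
        \<longlonglongrightarrow> (\<Prod>j<m. exp (- (\<delta> * exponent (q j))))"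
    proof (intro tendsto_prod power_one_minus_tendsto)
      fix j
      show "0 \<le> C.block_intensity n (laplace_weight (q j))" for n
        by (intro C.block_intensity_nonneg bounded_baire_laplace_weight q laplace_weight_bounds(1))
      have lim: "(\<lambda>n. real (K n i) * C.block_intensity n (laplace_weight (q j))) \<longlonglongrightarrow> real i * \<delta> * exponent (q j)" for i
      proof (cases "i = 0")
        case True then show ?thesis by (simp add: K0)
      next
        case False
        then have "0 < real i * \<delta>" using \<delta> by simp
        then show ?thesis unfolding K_def by (rule laplace_intensity_tendsto) (rule q)
      qed
      show "(\<lambda>n. C.block_intensity n (laplace_weight (q j))) \<longlonglongrightarrow> 0"
        by (rule tendsto_0_of_blocks[of 1, OF _ laplace_intensity_tendsto[of 1, OF _ q]]) simp_all
      show "(\<lambda>n. real (K n (Suc j) - K n j) * C.block_intensity n (laplace_weight (q j))) \<longlonglongrightarrow> \<delta> * exponent (q j)"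
        using tendsto_diff[OF lim[of "Suc j"] lim[of j]] by (simp add: of_nat_diff[OF KS] algebra_simps)
    qed
    ultimately show ?thesis by simp
  qed
  from tendsto_add[OF diff prod]
  have "(\<lambda>n. \<integral>w. exp (- (\<Sum>i<K n m. ?q n i * block (X n) (Suc i) w)) \<partial>law (X n) (init (X n)))
      \<longlonglongrightarrow> 0 + (\<Prod>j<m. exp (- (\<delta> * exponent (q j))))"
    by (simp only: diff_add_cancel)
  moreover have "(\<Sum>i<K n m. ?q n i * block (X n) (Suc i) w)
      = (\<Sum>j<m. q j * grid_increment \<delta> (blocked_clock (X n) w) j)" for n w
  proof -
    have "(\<Sum>i<K n m. ?q n i * block (X n) (Suc i) w)
        = (\<Sum>j<m. \<Sum>i\<in>{K n j..<K n (Suc j)}. ?q n i * block (X n) (Suc i) w)"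
      by (rule sum_cells[of "K n", OF K0 KS])
    also have "\<dots> = (\<Sum>j<m. \<Sum>i\<in>{K n j..<K n (Suc j)}. q j * block (X n) (Suc i) w)"
      by (intro sum.cong refl) (simp add: cell_weight_eq[of "K n", OF KS])
    also have "\<dots> = (\<Sum>j<m. q j * grid_increment \<delta> (blocked_clock (X n) w) j)"
      unfolding C.grid_increment_blocked_clock[OF \<delta>] K_def by (simp only: sum_distrib_left)
    finally show ?thesis .
  qed
  ultimately show ?thesis by simp
qed

end

text \<open>Pairs of blocks in a common cell with at least one block between them, so that mixing
  separates them. Index 0 is the first block, which need not be near equilibrium.\<close>

definition distant_pairs :: "(nat \<Rightarrow> nat) \<Rightarrow> nat \<Rightarrow> (nat \<times> nat) set" where
  "distant_pairs K m = {(i, i') \<in> (\<Union>j<m. {K j..<K (Suc j)} \<times> {K j..<K (Suc j)}). 0 < i \<and> Suc i < i'}"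

context exploration_clock
begin

context
  fixes \<rho> :: real and \<mu> :: "'a pmf"
  assumes mixing: "mixing \<rho>" and \<rho>: "0 \<le> \<rho>" and \<mu>: "set_pmf \<mu> \<subseteq> verts X"
begin

text \<open>Markov's inequality; the sum starts at index 1, from where on every block is nearly in
  equilibrium.\<close>

lemma small_blocks_sum_prob:
  fixes k :: nat and u c :: real
  assumes u: "0 \<le> u" and c: "0 < c"
  defines "B \<equiv> {w \<in> space (law X \<mu>). c \<le> (\<Sum>i\<in>{1..<k}. block X (Suc i) w * indicator {..u} (block X (Suc i) w))}"
  shows "B \<in> sets (law X \<mu>)"
    and "measure (law X \<mu>) B \<le> (1 + \<rho>) * (real k * block_intensity (\<lambda>z. z * indicator {..u} z)) / c"
proof -
  let ?s = "\<lambda>z. z * indicator {..u} z :: real"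
  interpret P: prob_space "law X \<mu>" by (rule prob_space_law[OF \<mu>])
  have s: "bounded_baire ?s" by (rule bounded_baire_truncation[OF u])
  have s0: "0 \<le> block_intensity ?s" by (intro block_intensity_nonneg s) simp
  have I: "integrable (law X \<mu>) (\<lambda>w. ?s (block X (Suc i) w))" for i by (rule integrable_baire_block[OF \<mu> s])
  have SI: "integrable (law X \<mu>) (\<lambda>w. \<Sum>i\<in>{1..<k}. ?s (block X (Suc i) w))"
    by (intro Bochner_Integration.integrable_sum I)
  have [measurable]: "(\<lambda>w. \<Sum>i\<in>{1..<k}. ?s (block X (Suc i) w)) \<in> borel_measurable (law X \<mu>)"
    by (rule borel_measurable_integrable[OF SI])
  show Bs: "B \<in> sets (law X \<mu>)" unfolding B_def by measurable
  have "measure (law X \<mu>) B = (\<integral>w. indicator B w \<partial>law X \<mu>)"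
    using sets.sets_into_space[OF Bs] by (simp add: Int_absorb2)
  also have "\<dots> \<le> (\<integral>w. (\<Sum>i\<in>{1..<k}. ?s (block X (Suc i) w)) / c \<partial>law X \<mu>)"
  proof (rule integral_mono)
    show "integrable (law X \<mu>) (indicator B :: 'p \<Rightarrow> real)" using Bs by (simp add: P.emeasure_eq_measure)
    show "integrable (law X \<mu>) (\<lambda>w. (\<Sum>i\<in>{1..<k}. ?s (block X (Suc i) w)) / c)" using SI by simp
    fix w assume w: "w \<in> space (law X \<mu>)"
    have "0 \<le> (\<Sum>i\<in>{1..<k}. ?s (block X (Suc i) w)) / c"
      using c block_nonneg[OF \<mu> w] by (intro divide_nonneg_pos sum_nonneg) auto
    then show "indicator B w \<le> (\<Sum>i\<in>{1..<k}. ?s (block X (Suc i) w)) / c"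
      using c by (simp add: indicator_def B_def)
  qed
  also have "\<dots> = (\<Sum>i\<in>{1..<k}. \<integral>w. ?s (block X (Suc i) w) \<partial>law X \<mu>) / c"
    by (simp only: integral_divide_zero Bochner_Integration.integral_sum[OF I])
  also have "\<dots> \<le> (\<Sum>i\<in>{1..<k}. (1 + \<rho>) * block_intensity ?s) / c"
  proof (intro divide_right_mono sum_mono)
    fix i assume "i \<in> {1..<k}"
    then obtain a where a: "i = Suc a" by (cases i) auto
    show "(\<integral>w. ?s (block X (Suc i) w) \<partial>law X \<mu>) \<le> (1 + \<rho>) * block_intensity ?s"
      unfolding a block_intensity_def by (rule block_le[OF mixing \<rho> \<mu> s]) simp
  qed (use c in simp)
  also have "\<dots> \<le> (1 + \<rho>) * (real k * block_intensity ?s) / c"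
  proof (rule divide_right_mono)
    have "(\<Sum>i\<in>{1..<k}. (1 + \<rho>) * block_intensity ?s) \<le> real k * ((1 + \<rho>) * block_intensity ?s)"
      using s0 \<rho> by (simp add: mult_right_mono)
    then show "(\<Sum>i\<in>{1..<k}. (1 + \<rho>) * block_intensity ?s) \<le> (1 + \<rho>) * (real k * block_intensity ?s)"
      by (simp add: mult_ac)
  qed (use c in simp)
  finally show "measure (law X \<mu>) B \<le> (1 + \<rho>) * (real k * block_intensity ?s) / c" .
qed

definition large_pair :: "real \<Rightarrow> nat \<Rightarrow> nat \<Rightarrow> 'p set" where
  "large_pair u i i' = {w \<in> space (law X \<mu>). u < block X (Suc i) w \<and> u < block X (Suc i') w}"

lemma large_pair_sets: "large_pair u i i' \<in> sets (law X \<mu>)"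
proof -
  have [measurable]: "(\<lambda>w. block X (Suc i) w) \<in> borel_measurable (law X \<mu>)" for i by (rule block_measurable[OF \<mu>])
  show ?thesis unfolding large_pair_def by measurable
qed

lemma adjacent_pairs_prob:
  assumes "0 < \<eta>"
  shows "measure (law X \<mu>) (\<Union>i<k. large_pair u (Suc i) (Suc (Suc i)))
    \<le> (1 + \<rho>) * (\<eta> * (real k * mean (block_tail X u)) + real k * mean (\<lambda>y. (block_tail X u y)\<^sup>2) / \<eta>)"
proof -
  interpret P: prob_space "law X \<mu>" by (rule prob_space_law[OF \<mu>])
  have "measure (law X \<mu>) (\<Union>i<k. large_pair u (Suc i) (Suc (Suc i)))
      \<le> (\<Sum>i<k. measure (law X \<mu>) (large_pair u (Suc i) (Suc (Suc i))))"
    using large_pair_sets by (intro P.finite_measure_subadditive_finite) auto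
  also have "\<dots> \<le> (\<Sum>i<k. (1 + \<rho>) * (\<eta> * mean (block_tail X u) + mean (\<lambda>y. (block_tail X u y)\<^sup>2) / \<eta>))"
    unfolding large_pair_def by (intro sum_mono adjacent_large_blocks mixing \<rho> \<mu> assms)
  also have "\<dots> = (1 + \<rho>) * (\<eta> * (real k * mean (block_tail X u)) + real k * mean (\<lambda>y. (block_tail X u y)\<^sup>2) / \<eta>)"
    by (simp add: algebra_simps)
  finally show ?thesis .
qed

text \<open>The pairs in a cell number at most the square of its block count, and each has
  probability at most the squared tail, up to mixing factors. Per cell this is the square of the
  equilibrium number of large blocks, so the sum over cells is small when the mesh is.\<close>

lemma distant_pairs_prob:
  "measure (law X \<mu>) (\<Union>(i, i')\<in>distant_pairs K m. large_pair u i i')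
    \<le> (1 + \<rho>)\<^sup>2 * (\<Sum>j<m. (real (K (Suc j) - K j) * mean (block_tail X u))\<^sup>2)"
proof -
  interpret P: prob_space "law X \<mu>" by (rule prob_space_law[OF \<mu>])
  let ?U = "\<Union>j<m. {K j..<K (Suc j)} \<times> {K j..<K (Suc j)}"
  have fin: "finite ?U" by auto
  have sub: "distant_pairs K m \<subseteq> ?U" unfolding distant_pairs_def by auto
  have card: "real (card (distant_pairs K m)) \<le> (\<Sum>j<m. (real (K (Suc j) - K j))\<^sup>2)"
  proof -
    have "card (distant_pairs K m) \<le> card ?U" by (rule card_mono[OF fin sub])
    also have "\<dots> \<le> (\<Sum>j<m. card ({K j..<K (Suc j)} \<times> {K j..<K (Suc j)}))" by (rule card_UN_le) simp
    also have "\<dots> = (\<Sum>j<m. (K (Suc j) - K j)\<^sup>2)" by (simp add: card_cartesian_product power2_eq_square)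
    finally have "real (card (distant_pairs K m)) \<le> real (\<Sum>j<m. (K (Suc j) - K j)\<^sup>2)" by (simp only: of_nat_le_iff)
    then show ?thesis by (simp only: of_nat_sum of_nat_power)
  qed
  have "measure (law X \<mu>) (\<Union>(i, i')\<in>distant_pairs K m. large_pair u i i')
      \<le> (\<Sum>p\<in>distant_pairs K m. measure (law X \<mu>) (case p of (i, i') \<Rightarrow> large_pair u i i'))"
    using large_pair_sets finite_subset[OF sub fin]
    by (intro P.finite_measure_subadditive_finite) auto
  also have "\<dots> \<le> (\<Sum>p\<in>distant_pairs K m. ((1 + \<rho>) * mean (block_tail X u))\<^sup>2)"
  proof (rule sum_mono)
    fix p assume p: "p \<in> distant_pairs K m"
    obtain i i' where ii: "p = (i, i')" "0 < i" "Suc i < i'" using p by (auto simp: distant_pairs_def)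
    obtain a where a: "i = Suc a" using ii(2) by (cases i) auto
    obtain b where b: "i' = Suc b" using ii(3) by (cases i') auto
    have "Suc a < b" using ii(3) a b by simp
    then show "measure (law X \<mu>) (case p of (i, i') \<Rightarrow> large_pair u i i') \<le> ((1 + \<rho>) * mean (block_tail X u))\<^sup>2"
      unfolding ii(1) a b large_pair_def prod.case by (rule distant_large_blocks[OF mixing \<rho> \<mu>])
  qed
  also have "\<dots> = real (card (distant_pairs K m)) * ((1 + \<rho>) * mean (block_tail X u))\<^sup>2" by simp
  also have "\<dots> \<le> (\<Sum>j<m. (real (K (Suc j) - K j))\<^sup>2) * ((1 + \<rho>) * mean (block_tail X u))\<^sup>2"
    using card by (rule mult_right_mono) simp
  also have "\<dots> = (1 + \<rho>)\<^sup>2 * (\<Sum>j<m. (real (K (Suc j) - K j) * mean (block_tail X u))\<^sup>2)"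
    by (simp add: power_mult_distrib sum_distrib_left sum_distrib_right mult_ac)
  finally show ?thesis .
qed

text \<open>Four exceptional events are excluded: a large first block, a large total of small
  blocks, two large neighbours, and two large blocks further apart in one cell. Neighbours are
  excluded over the whole horizon, whether or not they share a cell. The first block and the small
  ones are allowed \<open>\<epsilon> / 2\<close> each.\<close>

lemma blocked_clock_single_jump_cells:
  assumes \<delta>: "0 < \<delta>" and \<epsilon>: "0 < \<epsilon>" and w: "w \<in> space (law X \<mu>)"
  defines "K \<equiv> \<lambda>j. nblocks X (real j * \<delta>)"
  assumes A1: "\<not> \<epsilon> / 2 < block X (Suc 0) w"
    and A2: "\<not> \<epsilon> / 2 \<le> (\<Sum>i\<in>{1..<K m}. block X (Suc i) w * indicator {..u} (block X (Suc i) w))"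
    and A3: "w \<notin> (\<Union>i<K m. large_pair u (Suc i) (Suc (Suc i)))"
    and A4: "w \<notin> (\<Union>(i, i')\<in>distant_pairs K m. large_pair u i i')"
  shows "single_jump_cells \<delta> \<epsilon> m (blocked_clock X w)"
proof -
  let ?z = "\<lambda>i. block X (Suc i) w"
  let ?\<tau> = "blocklen X / tscale X"
  note z0 = block_nonneg[OF \<mu> w]
  have \<tau>: "0 < ?\<tau>" using scale_pos by simp
  have K: "K j = nat \<lfloor>real j * \<delta> / ?\<tau>\<rfloor>" for j by (simp add: K_def nblocks_eq)
  have Kmono: "K a \<le> K b" if "a \<le> b" for a b
    unfolding K_def using that \<delta> by (intro nblocks_mono mult_right_mono) auto
  show ?thesis
  proof (rule block_path_single_jump_cells[OF \<tau> \<delta> less_imp_le[OF \<epsilon>], where z = ?z and u = u])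
    show "blocked_clock X w t = (\<Sum>i<nat \<lfloor>t / ?\<tau>\<rfloor>. ?z i)" if "0 \<le> t" for t
      using blocked_clock_eq[OF that] by (simp add: nblocks_eq)
    fix J assume J: "J \<subseteq> {..<nat \<lfloor>real m * \<delta> / ?\<tau>\<rfloor>}" and sm: "\<And>i. i \<in> J \<Longrightarrow> 0 < i \<Longrightarrow> ?z i \<le> u"
    have J: "J \<subseteq> {..<K m}" using J by (simp add: K)
    have fin: "finite J" using J finite_subset by blast
    \<comment> \<open>Index 0 is added if absent, so that its block can be split off and bounded by
      \<open>A1\<close>; the others are at most \<open>u\<close> and fall under
      \<open>A2\<close>.\<close>
    have "sum ?z J \<le> sum ?z (insert 0 (J - {0}))"
      using fin z0 by (intro sum_mono2) auto
    also have "\<dots> = ?z 0 + sum ?z (J - {0})" using fin by (subst sum.insert) auto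
    also have "sum ?z (J - {0}) = (\<Sum>i\<in>J - {0}. ?z i * indicator {..u} (?z i))"
      using sm by (intro sum.cong) auto
    also have "\<dots> \<le> (\<Sum>i\<in>{1..<K m}. ?z i * indicator {..u} (?z i))"
      using J z0 by (intro sum_mono2) (auto simp: Suc_le_eq)
    finally show "sum ?z J \<le> \<epsilon>" using A1 A2 by linarith
  next
    fix j i i' assume j: "j < m" and i: "0 < i" "i < i'"
      and ij: "i \<in> {nat \<lfloor>real j * \<delta> / ?\<tau>\<rfloor>..<nat \<lfloor>real (Suc j) * \<delta> / ?\<tau>\<rfloor>}"
        "i' \<in> {nat \<lfloor>real j * \<delta> / ?\<tau>\<rfloor>..<nat \<lfloor>real (Suc j) * \<delta> / ?\<tau>\<rfloor>}"
      and large: "u < ?z i" "u < ?z i'"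
    have ij: "i \<in> {K j..<K (Suc j)}" "i' \<in> {K j..<K (Suc j)}" using ij by (simp_all only: K)
    have lp: "w \<in> large_pair u i i'" using large w by (simp add: large_pair_def)
    show False
    proof (cases "i' = Suc i")
      case True
      obtain a where a: "i = Suc a" using i(1) by (cases i) auto
      have "a < K m" using ij(1) Kmono[of "Suc j" m] j a by simp
      then show False using A3 lp unfolding True a by blast
    next
      case False
      then have "(i, i') \<in> distant_pairs K m" using ij i j unfolding distant_pairs_def by auto
      then show False using A4 lp by blast
    qed
  qed
qed

end

end

section \<open>Smallness of the exceptional events\<close>

context clock_sequence
begin

lemma tail_increment_tendsto:
  assumes \<delta>: "0 < \<delta>" and u: "0 < u"
  shows "(\<lambda>n. real (blocks n (real (Suc j) * \<delta>) - blocks n (real j * \<delta>)) * C.mean n (block_tail (X n) u))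
    \<longlonglongrightarrow> \<delta> * measure \<nu> {u<..}"
proof -
  have lim: "(\<lambda>n. real (blocks n (real i * \<delta>)) * C.mean n (block_tail (X n) u)) \<longlonglongrightarrow> real i * \<delta> * measure \<nu> {u<..}" for i
  proof (cases "i = 0")
    case True then show ?thesis by (simp add: C.nblocks_0)
  next
    case False
    then have "0 < real i * \<delta>" using \<delta> by simp
    then show ?thesis by (rule tail_intensity_tendsto[OF _ u])
  qed
  have le: "blocks n (real j * \<delta>) \<le> blocks n (real (Suc j) * \<delta>)" for n
    using \<delta> by (intro C.nblocks_mono mult_right_mono) auto
  have "real (Suc j) * \<delta> * measure \<nu> {u<..} - real j * \<delta> * measure \<nu> {u<..} = \<delta> * measure \<nu> {u<..}"
    by (simp add: algebra_simps)
  then show ?thesis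
    using tendsto_diff[OF lim[of "Suc j"] lim[of j]] by (simp only: of_nat_diff[OF le] left_diff_distrib)
qed

text \<open>\<open>u\<close> comes first, from (v), and fixes the limiting rate \<open>c\<close> of
  large blocks. Pairs further apart have probability of order
  \<open>\<delta> * (t * c\<^sup>2)\<close>, which is why the mesh must be small depending on
  \<open>u\<close>; neighbours are handled by (iii) and (iv) for any mesh. Each of the four events
  receives \<open>\<eta> / 4\<close>.\<close>

lemma eventually_single_jump_cells:
  assumes \<epsilon>: "0 < \<epsilon>" and \<eta>: "0 < \<eta>"
  shows "\<forall>\<^sub>F l in sequentially. \<forall>\<^sub>F n in sequentially. \<exists>B\<in>sets (law (X n) (init (X n))).
    measure (law (X n) (init (X n))) B \<le> \<eta> \<and> (\<forall>w\<in>space (law (X n) (init (X n))) - B.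
      single_jump_cells (1 / real (Suc l)) \<epsilon> (T * Suc l) (blocked_clock (X n) w))"
proof (cases "T = 0")
  case True
  have "{} \<in> sets (law (X n) (init (X n)))" for n by simp
  then show ?thesis using True \<eta> by (intro always_eventually allI bexI[of _ "{}"]) (auto simp: single_jump_cells_def)
next
  case False
  define t where "t = real T"
  have t: "0 < t" using False by (simp add: t_def)
  \<comment> \<open>The constant leaves room for the mixing factor 2 and for the threshold
    \<open>\<epsilon> / 2\<close> in Markov's inequality.\<close>
  obtain \<epsilon>0 where \<epsilon>0: "0 < \<epsilon>0" "\<And>u. 0 < u \<Longrightarrow> u < \<epsilon>0 \<Longrightarrow>
    \<forall>\<^sub>F n in sequentially. real (blocks n t) * C.block_intensity n (\<lambda>z. z * indicator {..u} z) < \<epsilon> * \<eta> / 32"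
    using small_intensity[OF t, of "\<epsilon> * \<eta> / 32"] \<epsilon> \<eta> by auto
  define u where "u = \<epsilon>0 / 2"
  have u: "0 < u" "u < \<epsilon>0" using \<epsilon>0(1) by (auto simp: u_def)
  define c where "c = measure \<nu> {u<..}"
  have c: "0 \<le> c" by (simp add: c_def)
  \<comment> \<open>The Young parameter for neighbouring large blocks: since
    \<open>1 + \<rho> n \<le> 2\<close> eventually, the limit \<open>h * (t * c)\<close> must stay
    below \<open>\<eta> / 8\<close>.\<close>
  define h where "h = \<eta> / (16 * (t * c + 1))"
  have tc: "0 < 16 * (t * c + 1)" "0 \<le> t * c" using t c by (auto simp: add_nonneg_pos)
  have twice: "x < 2 * (x + 1)" if "0 \<le> x" for x :: real using that by simp
  have h: "0 < h" "h * (t * c) < \<eta> / 8"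
  proof -
    show h0: "0 < h" using \<eta> tc by (simp add: h_def)
    have "h * (t * c) < h * (2 * (t * c + 1))" by (rule mult_strict_left_mono[OF twice[OF tc(2)] h0])
    also have "\<dots> = \<eta> / 8" using tc(1) by (simp add: h_def field_simps)
    finally show "h * (t * c) < \<eta> / 8" .
  qed
  \<comment> \<open>A bound on the mesh: the cells contribute
    \<open>\<delta> * (t * c\<^sup>2)\<close> in total, to be multiplied by
    \<open>(1 + \<rho> n)\<^sup>2 \<le> 4\<close>, whence \<open>\<eta> / 16\<close>.\<close>
  define d where "d = \<eta> / (32 * (t * c\<^sup>2 + 1))"
  have tc2: "0 < 32 * (t * c\<^sup>2 + 1)" "0 \<le> t * c\<^sup>2" using t by (auto simp: add_nonneg_pos)
  have d: "0 < d" "d * (t * c\<^sup>2) < \<eta> / 16"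
  proof -
    show d0: "0 < d" using \<eta> tc2 by (simp add: d_def)
    have "d * (t * c\<^sup>2) < d * (2 * (t * c\<^sup>2 + 1))" by (rule mult_strict_left_mono[OF twice[OF tc2(2)] d0])
    also have "\<dots> = \<eta> / 16" using tc2(1) by (simp add: d_def field_simps)
    finally show "d * (t * c\<^sup>2) < \<eta> / 16" .
  qed
  show ?thesis using eventually_inverse_Suc_le[OF d(1)]
  proof eventually_elim
    case (elim l)
    define \<delta> where "\<delta> = 1 / real (Suc l)"
    define m where "m = T * Suc l"
    have \<delta>: "0 < \<delta>" "\<delta> \<le> d" using elim by (auto simp: \<delta>_def)
    have md: "real m * \<delta> = t" by (simp add: m_def \<delta>_def t_def del: of_nat_Suc mult_Suc_right)
    define K where "K n = (\<lambda>j. blocks n (real j * \<delta>))" for n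
    have Km: "K n m = blocks n t" for n by (simp add: K_def md)
    let ?P = "\<lambda>n. law (X n) (init (X n))"
    have e1: "\<forall>\<^sub>F n in sequentially. measure (?P n) {w \<in> space (?P n). \<epsilon> / 2 < block (X n) (Suc 0) w} < \<eta> / 4"
    proof -
      have "(\<lambda>n. measure (?P n) {w \<in> space (?P n). \<epsilon> / 2 < block (X n) 1 w}) \<longlonglongrightarrow> 0"
        using first_block half_gt_zero[OF \<epsilon>] unfolding initial_block_negligible_def by blast
      then have "(\<lambda>n. measure (?P n) {w \<in> space (?P n). \<epsilon> / 2 < block (X n) (Suc 0) w}) \<longlonglongrightarrow> 0"
        by (simp only: One_nat_def)
      then show ?thesis by (rule order_tendstoD(2)) (use \<eta> in simp)
    qed
    have e2: "\<forall>\<^sub>F n in sequentially. real (blocks n t) * C.block_intensity n (\<lambda>z. z * indicator {..u} z) < \<epsilon> * \<eta> / 32"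
      by (rule \<epsilon>0(2)[OF u])
    have e3: "\<forall>\<^sub>F n in sequentially. h * (real (blocks n t) * C.mean n (block_tail (X n) u))
        + real (blocks n t) * C.mean n (\<lambda>y. (block_tail (X n) u y)\<^sup>2) / h < \<eta> / 8"
    proof -
      have "(\<lambda>n. h * (real (blocks n t) * C.mean n (block_tail (X n) u))
        + real (blocks n t) * C.mean n (\<lambda>y. (block_tail (X n) u y)\<^sup>2) / h) \<longlonglongrightarrow> h * (t * c) + 0 / h"
        unfolding c_def using h(1)
        by (intro tendsto_intros tail_intensity_tendsto squared_tail_intensity_tendsto t u) auto
      then show ?thesis using h(2) by (intro order_tendstoD(2)) auto
    qed
    have e4: "\<forall>\<^sub>F n in sequentially. (\<Sum>j<m. (real (K n (Suc j) - K n j) * C.mean n (block_tail (X n) u))\<^sup>2) < \<eta> / 16"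
    proof -
      have lim: "(\<lambda>n. \<Sum>j<m. (real (K n (Suc j) - K n j) * C.mean n (block_tail (X n) u))\<^sup>2) \<longlonglongrightarrow> (\<Sum>j<m. (\<delta> * c)\<^sup>2)"
        unfolding K_def c_def by (intro tendsto_sum tendsto_power tail_increment_tendsto \<delta>(1) u(1))
      have "(\<Sum>j<m. (\<delta> * c)\<^sup>2) = \<delta> * (t * c\<^sup>2)"
        unfolding md[symmetric] by (simp add: power2_eq_square mult_ac)
      also have "\<dots> \<le> d * (t * c\<^sup>2)" using \<delta>(2) tc2(2) by (rule mult_right_mono)
      also have "\<dots> < \<eta> / 16" by (rule d(2))
      finally show ?thesis by (rule order_tendstoD(2)[OF lim])
    qed
    have e5: "\<forall>\<^sub>F n in sequentially. \<rho> n < 1" using mix(3) by (intro order_tendstoD(2)) auto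
    show ?case using e1 e2 e3 e4 e5
    proof eventually_elim
      case (elim n)
      interpret P: prob_space "?P n" by (rule C.prob_space_law[OF C.init_verts])
      note mx = mix(1)[of n] mix(2)[of n] C.init_verts[of n]
      define A1 where "A1 = {w \<in> space (?P n). \<epsilon> / 2 < block (X n) (Suc 0) w}"
      define A2 where "A2 = {w \<in> space (?P n). \<epsilon> / 2 \<le> (\<Sum>i\<in>{1..<K n m}. block (X n) (Suc i) w * indicator {..u} (block (X n) (Suc i) w))}"
      define A3 where "A3 = (\<Union>i<K n m. C.large_pair n (init (X n)) u (Suc i) (Suc (Suc i)))"
      define A4 where "A4 = (\<Union>(i, i')\<in>distant_pairs (K n) m. C.large_pair n (init (X n)) u i i')"
      have sA1: "A1 \<in> sets (?P n)"
      proof -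
        have [measurable]: "(\<lambda>w. block (X n) (Suc 0) w) \<in> borel_measurable (?P n)" by (rule C.block_measurable[OF C.init_verts])
        show ?thesis unfolding A1_def by measurable
      qed
      note A2' = C.small_blocks_sum_prob[OF mx less_imp_le[OF u(1)], of "\<epsilon> / 2" "K n m", folded A2_def]
      have sA2: "A2 \<in> sets (?P n)" using A2'(1) \<epsilon> by simp
      have sA3: "A3 \<in> sets (?P n)" unfolding A3_def by (intro sets.finite_UN C.large_pair_sets[OF mx]) auto
      have fin: "finite (distant_pairs (K n) m)"
        by (rule finite_subset[of _ "\<Union>j<m. {K n j..<K n (Suc j)} \<times> {K n j..<K n (Suc j)}"]) (auto simp: distant_pairs_def)
      have sA4: "A4 \<in> sets (?P n)" unfolding A4_def using fin C.large_pair_sets[OF mx] by (intro sets.finite_UN) auto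
      have r: "1 + \<rho> n \<le> 2" "0 \<le> 1 + \<rho> n" using elim(5) mix(2)[of n] by auto
      have m1: "measure (?P n) A1 \<le> \<eta> / 4" using elim(1) by (simp add: A1_def)
      have m2: "measure (?P n) A2 \<le> \<eta> / 4"
      proof -
        have i0: "0 \<le> real (K n m) * C.block_intensity n (\<lambda>z. z * indicator {..u} z)"
          using u(1) by (intro mult_nonneg_nonneg C.block_intensity_nonneg bounded_baire_truncation) auto
        have "measure (?P n) A2 \<le> (1 + \<rho> n) * (real (K n m) * C.block_intensity n (\<lambda>z. z * indicator {..u} z)) / (\<epsilon> / 2)"
          using A2'(2) \<epsilon> by simp
        also have "\<dots> \<le> 2 * (\<epsilon> * \<eta> / 32) / (\<epsilon> / 2)"
          using \<epsilon> r i0 elim(2) unfolding Km by (intro divide_right_mono mult_mono) auto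
        also have "\<dots> \<le> \<eta> / 4" using \<epsilon> \<eta> by (simp add: field_simps)
        finally show ?thesis .
      qed
      have m3: "measure (?P n) A3 \<le> \<eta> / 4"
      proof -
        have "measure (?P n) A3 \<le> (1 + \<rho> n) * (h * (real (K n m) * C.mean n (block_tail (X n) u))
            + real (K n m) * C.mean n (\<lambda>y. (block_tail (X n) u y)\<^sup>2) / h)"
          unfolding A3_def by (rule C.adjacent_pairs_prob[OF mx h(1)])
        also have "\<dots> \<le> (1 + \<rho> n) * (\<eta> / 8)" unfolding Km using elim(3) r by (intro mult_left_mono) auto
        also have "\<dots> \<le> 2 * (\<eta> / 8)" using r \<eta> by (intro mult_right_mono) auto
        finally show ?thesis by simp
      qed
      have m4: "measure (?P n) A4 \<le> \<eta> / 4"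
      proof -
        have "measure (?P n) A4 \<le> (1 + \<rho> n)\<^sup>2 * (\<Sum>j<m. (real (K n (Suc j) - K n j) * C.mean n (block_tail (X n) u))\<^sup>2)"
          unfolding A4_def by (rule C.distant_pairs_prob[OF mx])
        also have "\<dots> \<le> (1 + \<rho> n)\<^sup>2 * (\<eta> / 16)" using elim(4) by (intro mult_left_mono) auto
        also have "\<dots> \<le> 2\<^sup>2 * (\<eta> / 16)" using r \<eta> by (intro mult_right_mono power_mono) auto
        finally show ?thesis by simp
      qed
      show ?case
      proof (intro bexI[of _ "A1 \<union> A2 \<union> (A3 \<union> A4)"] conjI ballI)
        show "A1 \<union> A2 \<union> (A3 \<union> A4) \<in> sets (?P n)" using sA1 sA2 sA3 sA4 by auto
        have "measure (?P n) (A1 \<union> A2 \<union> (A3 \<union> A4)) \<le> (measure (?P n) A1 + measure (?P n) A2) + (measure (?P n) A3 + measure (?P n) A4)"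
          using sA1 sA2 sA3 sA4
          by (intro order_trans[OF measure_Un_le] add_mono measure_Un_le sets.Un)
        then show "measure (?P n) (A1 \<union> A2 \<union> (A3 \<union> A4)) \<le> \<eta>" using m1 m2 m3 m4 by linarith
        fix w assume w: "w \<in> space (?P n) - (A1 \<union> A2 \<union> (A3 \<union> A4))"
        have "single_jump_cells \<delta> \<epsilon> m (blocked_clock (X n) w)"
          using w unfolding A1_def A2_def A3_def A4_def K_def
          by (intro C.blocked_clock_single_jump_cells[OF mx \<delta>(1) \<epsilon>, where u = u]) auto
        then show "single_jump_cells (1 / real (Suc l)) \<epsilon> (T * Suc l) (blocked_clock (X n) w)"
          by (simp only: \<delta>_def m_def)
      qed
    qed
  qed
qed

end

section \<open>The limit theorem\<close>

lemma levy_subordinator_increasing_process: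
  assumes "levy_subordinator N S \<nu>"
  shows "increasing_process N (\<lambda>w. restrict (\<lambda>t. S t w) {0..})"
  unfolding increasing_process_def
proof (intro conjI ballI allI impI)
  show "prob_space N" using assms by (simp add: levy_subordinator_def)
  show "(\<lambda>w. restrict (\<lambda>t. S t w) {0..} t) \<in> borel_measurable N" if "0 \<le> t" for t
    using assms that by (simp add: levy_subordinator_def)
  fix w assume w: "w \<in> space N"
  then have S: "S 0 w = 0" "mono_on {0..} (\<lambda>t. S t w)" "\<And>t. 0 \<le> t \<Longrightarrow> continuous (at_right t) (\<lambda>s. S s w)"
    using assms by (simp_all add: levy_subordinator_def)
  show "increasing_path (restrict (\<lambda>t. S t w) {0..})"
    unfolding increasing_path_def
  proof (intro conjI allI impI)
    show "mono_on {0..} (restrict (\<lambda>t. S t w) {0..})" using S(2) by (simp add: mono_on_def)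
    fix t :: real assume t: "0 \<le> t"
    have "((\<lambda>s. S s w) \<longlongrightarrow> S t w) (at_right t)" using S(3)[OF t] by (simp add: continuous_within)
    moreover have "\<forall>\<^sub>F s in at_right t. S s w = restrict (\<lambda>t. S t w) {0..} s"
      using eventually_at_right_less[of t] by eventually_elim (use t in simp)
    ultimately have "(restrict (\<lambda>t. S t w) {0..} \<longlongrightarrow> S t w) (at_right t)"
      by (rule Lim_transform_eventually)
    then show "continuous (at_right t) (restrict (\<lambda>t. S t w) {0..})" using t by (simp add: continuous_within)
  qed (simp_all add: S(1))
qed

text \<open>Independent stationary increments reduce the joint transform to a product of one-cell
  transforms, which matches the limit in \<open>blocked_clock_laplace_tendsto\<close> factor by
  factor.\<close>

lemma levy_subordinator_laplace:
  fixes q :: "nat \<Rightarrow> real"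
  assumes S: "levy_subordinator N S \<nu>" and \<delta>: "0 < \<delta>" and q: "\<And>j. 0 \<le> q j"
  shows "(\<integral>w. exp (- (\<Sum>j<m. q j * grid_increment \<delta> (restrict (\<lambda>t. S t w) {0..}) j)) \<partial>N)
    = (\<Prod>j<m. exp (- (\<delta> * (\<integral>x. laplace_weight (q j) x \<partial>\<nu>))))"
proof -
  interpret prob_space N using S by (simp add: levy_subordinator_def)
  define D where "D j w = S (real (Suc j) * \<delta>) w - S (real j * \<delta>) w" for j w
  have grid: "0 \<le> real j * \<delta>" "real j * \<delta> \<le> real (Suc j) * \<delta>" for j
    using \<delta> by (auto intro: mult_right_mono)
  have Sm: "S t \<in> borel_measurable N" if "0 \<le> t" for t using S that by (simp add: levy_subordinator_def)
  have Dm: "D j \<in> borel_measurable N" for j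
    unfolding D_def[abs_def] by (intro borel_measurable_diff Sm grid)
  have D0: "0 \<le> D j w" if "w \<in> space N" for j w
  proof -
    have "mono_on {0..} (\<lambda>t. S t w)" using S that by (simp add: levy_subordinator_def)
    then show ?thesis unfolding D_def using mono_onD[of "{0..}" "\<lambda>t. S t w" "real j * \<delta>" "real (Suc j) * \<delta>"]
        grid(1)[of j] grid(1)[of "Suc j"] grid(2)[of j] by (simp del: of_nat_Suc)
  qed
  have g: "grid_increment \<delta> (restrict (\<lambda>t. S t w) {0..}) j = D j w" for j w
    unfolding grid_increment_def D_def using grid(1)[of j] grid(1)[of "Suc j"] by (simp del: of_nat_Suc)
  have "indep_vars (\<lambda>_. borel) D {..<m}"
    unfolding D_def[abs_def]
    using S[unfolded levy_subordinator_def] grid by (elim conjE allE[of _ m] allE[of _ "\<lambda>j. real j * \<delta>"]) simp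
  then have ind: "indep_vars (\<lambda>_. borel) (\<lambda>j w. exp (- q j * D j w)) {..<m}"
    by (rule indep_vars_compose2) simp
  have int: "integrable N (\<lambda>w. exp (- q j * D j w))" for j
  proof (rule integrable_const_bound[where B = 1])
    show "AE w in N. norm (exp (- q j * D j w)) \<le> 1" using D0 q by (intro AE_I2) simp
    show "(\<lambda>w. exp (- q j * D j w)) \<in> borel_measurable N" using Dm[of j] by measurable
  qed
  have "(\<integral>w. exp (- (\<Sum>j<m. q j * grid_increment \<delta> (restrict (\<lambda>t. S t w) {0..}) j)) \<partial>N)
      = (\<integral>w. (\<Prod>j<m. exp (- q j * D j w)) \<partial>N)"
    unfolding g by (simp add: exp_sum flip: sum_negf)
  also have "\<dots> = (\<Prod>j<m. \<integral>w. exp (- q j * D j w) \<partial>N)"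
    by (rule indep_vars_lebesgue_integral[OF _ ind int]) simp
  also have "\<dots> = (\<Prod>j<m. exp (- (\<delta> * (\<integral>x. laplace_weight (q j) x \<partial>\<nu>))))"
  proof (intro prod.cong refl)
    fix j
    have "distr N borel (D j) = distr N borel (S (real (Suc j) * \<delta> - real j * \<delta>))"
      unfolding D_def[abs_def] using S grid[of j] by (simp add: levy_subordinator_def del: of_nat_Suc)
    also have "real (Suc j) * \<delta> - real j * \<delta> = \<delta>" by (simp add: algebra_simps)
    finally have d: "distr N borel (D j) = distr N borel (S \<delta>)" .
    have "(\<integral>w. exp (- q j * D j w) \<partial>N) = (\<integral>x. exp (- q j * x) \<partial>distr N borel (D j))"
      by (rule integral_distr[symmetric, OF Dm]) simp
    also have "\<dots> = (\<integral>w. exp (- q j * S \<delta> w) \<partial>N)"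
      unfolding d by (rule integral_distr[OF Sm]) (use \<delta> in simp_all)
    also have "\<dots> = exp (- \<delta> * (\<integral>x. (1 - exp (- q j * x)) \<partial>\<nu>))"
      using S \<delta> q by (simp add: levy_subordinator_def)
    finally show "(\<integral>w. exp (- q j * D j w) \<partial>N) = exp (- (\<delta> * (\<integral>x. laplace_weight (q j) x \<partial>\<nu>)))"
      by (simp add: laplace_weight_def)
  qed
  finally show ?thesis .
qed

lemma (in clock_sequence) blocked_clocks_converge:
  assumes S: "levy_subordinator N S \<nu>"
  shows "blocked_clocks_converge N S X"
  unfolding blocked_clocks_converge_def
proof (rule increasing_process_weak_conv)
  show "increasing_process (law (X n) (init (X n))) (blocked_clock (X n))" for n
    by (rule C.blocked_clock_increasing_process[OF C.init_verts])
  show "increasing_process N (\<lambda>w. restrict (\<lambda>t. S t w) {0..})"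
    by (rule levy_subordinator_increasing_process[OF S])
  fix l m and q :: "nat \<Rightarrow> nat"
  have \<delta>: "0 < 1 / real (Suc l)" by simp
  show "(\<lambda>n. \<integral>w. exp (- (\<Sum>j<m. real (q j) * grid_increment (1 / real (Suc l)) (blocked_clock (X n) w) j)) \<partial>law (X n) (init (X n)))
    \<longlonglongrightarrow> (\<integral>w. exp (- (\<Sum>j<m. real (q j) * grid_increment (1 / real (Suc l)) (restrict (\<lambda>t. S t w) {0..}) j)) \<partial>N)"
    using blocked_clock_laplace_tendsto[OF \<delta>, of "\<lambda>j. real (q j)" m]
    unfolding levy_subordinator_laplace[OF S \<delta> of_nat_0_le_iff] exponent_def by simp
qed (rule eventually_single_jump_cells)

section \<open>Subsequences and convergence in probability\<close>

lemma initial_block_negligible_subseq: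
  "initial_block_negligible X \<Longrightarrow> strict_mono r \<Longrightarrow> initial_block_negligible (\<lambda>n. X (r n))"
  unfolding initial_block_negligible_def
  using LIMSEQ_subseq_LIMSEQ[of _ 0 r] by (fastforce simp: comp_def)

lemma tails_converge_subseq:
  "tails_converge \<nu> X \<Longrightarrow> strict_mono r \<Longrightarrow> tails_converge \<nu> (\<lambda>n. X (r n))"
  unfolding tails_converge_def
  using LIMSEQ_subseq_LIMSEQ[of _ _ r] by (fastforce simp: comp_def)

lemma squared_tails_vanish_subseq:
  "squared_tails_vanish X \<Longrightarrow> strict_mono r \<Longrightarrow> squared_tails_vanish (\<lambda>n. X (r n))"
  unfolding squared_tails_vanish_def
  using LIMSEQ_subseq_LIMSEQ[of _ 0 r] by (fastforce simp: comp_def)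

lemma rapidly_mixing_subseq:
  assumes "rapidly_mixing X" "strict_mono r" shows "rapidly_mixing (\<lambda>n. X (r n))"
proof -
  obtain \<rho> where \<rho>: "\<And>n. 0 < \<rho> n" "decseq \<rho>" "\<rho> \<longlonglongrightarrow> 0"
    "\<And>n x y t. x \<in> verts (X n) \<Longrightarrow> y \<in> verts (X n) \<Longrightarrow> 0 \<le> t \<Longrightarrow>
      \<bar>measure (law_from (X n) x) {w \<in> space (law_from (X n) x). expl (X n) (t + real (mixtime (X n))) w = y}
        - pmf (invar (X n)) y\<bar> \<le> \<rho> n * pmf (invar (X n)) y"
    using assms(1) unfolding rapidly_mixing_def by blast
  show ?thesis unfolding rapidly_mixing_def
  proof (intro exI[of _ "\<lambda>n. \<rho> (r n)"] conjI allI ballI impI)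
    show "0 < \<rho> (r n)" for n by (rule \<rho>(1))
    show "decseq (\<lambda>n. \<rho> (r n))"
      using \<rho>(2) strict_mono_mono[OF assms(2)] by (simp add: decseq_def mono_def)
    show "(\<lambda>n. \<rho> (r n)) \<longlonglongrightarrow> 0" using LIMSEQ_subseq_LIMSEQ[OF \<rho>(3) assms(2)] by (simp add: comp_def)
  qed (rule \<rho>(4))
qed

text \<open>The subsequence found for \<open>H\<close> is thinned out once more for
  \<open>K\<close>, so \<open>H\<close> must be inherited by subsequences.\<close>

lemma holds_in_probability_conj:
  assumes H: "holds_in_probability M X H" and K: "holds_in_probability M X K"
    and her: "\<And>\<omega> s r. \<omega> \<in> space M \<Longrightarrow> strict_mono s \<Longrightarrow> strict_mono r \<Longrightarrow>
      H (\<lambda>n. X (s n) \<omega>) \<Longrightarrow> H (\<lambda>n. X (s (r n)) \<omega>)"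
  shows "holds_in_probability M X (\<lambda>Y. H Y \<and> K Y)"
  unfolding holds_in_probability_def
proof (intro allI impI)
  fix s :: "nat \<Rightarrow> nat" assume s: "strict_mono s"
  obtain r where r: "strict_mono r" "AE \<omega> in M. H (\<lambda>n. X (s (r n)) \<omega>)"
    using H s unfolding holds_in_probability_def by blast
  have sr: "strict_mono (\<lambda>n. s (r n))" using strict_mono_compose[OF s r(1)] .
  then obtain r' where r': "strict_mono r'" "AE \<omega> in M. K (\<lambda>n. X (s (r (r' n))) \<omega>)"
    using K unfolding holds_in_probability_def by blast
  have "AE \<omega> in M. H (\<lambda>n. X (s (r (r' n))) \<omega>) \<and> K (\<lambda>n. X (s (r (r' n))) \<omega>)"
    using r(2) r'(2) AE_space
  proof eventually_elim
    case (elim \<omega>)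
    then show ?case using her[of \<omega> "\<lambda>n. s (r n)" r'] sr r'(1) by simp
  qed
  then show "\<exists>r. strict_mono r \<and> (AE \<omega> in M. H (\<lambda>n. X (s (r n)) \<omega>) \<and> K (\<lambda>n. X (s (r n)) \<omega>))"
    using strict_mono_compose[OF r(1) r'(1)] by (intro exI[of _ "\<lambda>n. r (r' n)"]) simp
qed

lemma blocked_clocks_converge_of_hypotheses:
  assumes X: "\<And>n. exploration_clock (X n)" and scales: "(\<lambda>n. blocklen (X n) / tscale (X n)) \<longlonglongrightarrow> 0"
    and levy: "sets \<nu> = sets (restrict_space borel {0<..})" "(\<integral>\<^sup>+x. ennreal (min x 1) \<partial>\<nu>) < \<infinity>"
    and S: "levy_subordinator N S \<nu>"
    and hyps: "initial_block_negligible X" "rapidly_mixing X" "tails_converge \<nu> X"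
      "squared_tails_vanish X" "small_blocks_negligible X"
  shows "blocked_clocks_converge N S X"
proof -
  obtain \<rho> where \<rho>: "\<And>n. 0 < \<rho> n" "\<rho> \<longlonglongrightarrow> 0"
    "\<And>n x y t. x \<in> verts (X n) \<Longrightarrow> y \<in> verts (X n) \<Longrightarrow> 0 \<le> t \<Longrightarrow>
      \<bar>measure (law_from (X n) x) {w \<in> space (law_from (X n) x). expl (X n) (t + real (mixtime (X n))) w = y}
        - pmf (invar (X n)) y\<bar> \<le> \<rho> n * pmf (invar (X n)) y"
    using hyps(2) unfolding rapidly_mixing_def by blast
  interpret clock_sequence X \<nu> \<rho>
  proof (rule clock_sequence.intro)
    show "exploration_clock.mixing (X n) (\<rho> n)" for n
      unfolding exploration_clock.mixing_def[OF X] using \<rho>(3) by blast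
  qed (use X scales levy hyps \<rho>(2) less_imp_le[OF \<rho>(1)] in simp_all)
  show ?thesis by (rule blocked_clocks_converge[OF S])
qed

theorem theorem1p3:
  fixes M :: "'w measure"
    and V :: "nat \<Rightarrow> 'a set" and E :: "nat \<Rightarrow> ('a \<times> 'a) set"
    and \<tau> :: "nat \<Rightarrow> 'a \<Rightarrow> 'w \<Rightarrow> real"
    and lam lam' :: "nat \<Rightarrow> 'w \<Rightarrow> 'a \<Rightarrow> 'a \<Rightarrow> real"
    and Y :: "nat \<Rightarrow> 'w \<Rightarrow> real \<Rightarrow> 'p \<Rightarrow> 'a"
    and P :: "nat \<Rightarrow> 'w \<Rightarrow> 'a pmf \<Rightarrow> 'p measure"
    and \<mu> \<pi> :: "nat \<Rightarrow> 'w \<Rightarrow> 'a pmf"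
    and a c \<theta> :: "nat \<Rightarrow> real" and \<kappa> :: "nat \<Rightarrow> nat"
    and \<nu> :: "real measure"
    and N :: "'q measure" and S :: "real \<Rightarrow> 'q \<Rightarrow> real"
  assumes environment: "prob_space M"
      "\<And>n x. x \<in> V n \<Longrightarrow> \<tau> n x \<in> borel_measurable M"
      "\<And>n x \<omega>. x \<in> V n \<Longrightarrow> \<omega> \<in> space M \<Longrightarrow> 0 < \<tau> n x \<omega>"
    and graphs: "\<And>n. finite (V n)" "\<And>n. V n \<noteq> {}" "\<And>n. E n \<subseteq> V n \<times> V n"
      "\<And>n. sym (E n)" "\<And>n. irrefl (E n)"
    and rates: "\<And>n \<omega> x y. \<omega> \<in> space M \<Longrightarrow> 0 \<le> lam n \<omega> x y"
      "\<And>n \<omega> x y. \<omega> \<in> space M \<Longrightarrow> (x, y) \<notin> E n \<Longrightarrow> lam n \<omega> x y = 0"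
      "\<And>n \<omega> x. \<omega> \<in> space M \<Longrightarrow> x \<in> V n \<Longrightarrow> 0 < exit_rate (E n) (lam n \<omega>) x"
    and reversible: "\<And>n \<omega> x y. \<omega> \<in> space M \<Longrightarrow> (x, y) \<in> E n \<Longrightarrow>
        \<tau> n x \<omega> * lam n \<omega> x y = \<tau> n y \<omega> * lam n \<omega> y x"
    and exploration_rates: "\<And>n \<omega> x y. \<omega> \<in> space M \<Longrightarrow> 0 \<le> lam' n \<omega> x y"
      "\<And>n \<omega> x y. \<omega> \<in> space M \<Longrightarrow> (x, y) \<notin> E n \<Longrightarrow> lam' n \<omega> x y = 0"
      "\<And>n \<omega> x. \<omega> \<in> space M \<Longrightarrow> x \<in> V n \<Longrightarrow> 0 < exit_rate (E n) (lam' n \<omega>) x"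
      "\<And>n \<omega> x y. \<omega> \<in> space M \<Longrightarrow> (x, y) \<in> E n \<Longrightarrow>
        lam n \<omega> x y / exit_rate (E n) (lam n \<omega>) x
          = lam' n \<omega> x y / exit_rate (E n) (lam' n \<omega>) x"
    and exploration_process: "\<And>n \<omega> \<mu>'. \<omega> \<in> space M \<Longrightarrow> set_pmf \<mu>' \<subseteq> V n \<Longrightarrow>
        markov_jump_process (P n \<omega> \<mu>') (Y n \<omega>) (V n) (lam' n \<omega>) \<mu>'"
    and invariant: "\<And>n \<omega>. \<omega> \<in> space M \<Longrightarrow>
        invariant_distribution (V n) (lam' n \<omega>) (\<pi> n \<omega>)"
    and initial: "\<And>n \<omega>. \<omega> \<in> space M \<Longrightarrow> set_pmf (\<mu> n \<omega>) \<subseteq> V n"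
    and levy_measure: "sets \<nu> = sets (restrict_space borel {0<..})"
      "sigma_finite_measure \<nu>" "(\<integral>\<^sup>+x. ennreal (min x 1) \<partial>\<nu>) < \<infinity>"
    and limit_process: "levy_subordinator N S \<nu>"
    and scales: "\<And>n. 0 < a n" "\<And>n. 0 < c n" "\<And>n. 0 < \<theta> n"
      "\<And>n. real (\<kappa> n) \<le> \<theta> n" "(\<lambda>n. \<theta> n / a n) \<longlonglongrightarrow> 0"
  shows "let X = (\<lambda>n \<omega>.
      \<lparr>verts = V n, edges = E n, rate = lam n \<omega>, expl_rate = lam' n \<omega>,
       expl = Y n \<omega>, law = P n \<omega>, init = \<mu> n \<omega>, invar = \<pi> n \<omega>,
       tscale = a n, cscale = c n, blocklen = \<theta> n, mixtime = \<kappa> n\<rparr>)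
    in \<forall>holds \<in> {holds_almost_surely M X, holds_in_probability M X}.
         holds initial_block_negligible \<and> holds rapidly_mixing \<and> holds (tails_converge \<nu>) \<and>
         holds squared_tails_vanish \<and> holds small_blocks_negligible
         \<longrightarrow> holds (blocked_clocks_converge N S)"
proof -
  define X :: "nat \<Rightarrow> 'w \<Rightarrow> ('a, 'p) clock_model" where "X = (\<lambda>n \<omega>.
      \<lparr>verts = V n, edges = E n, rate = lam n \<omega>, expl_rate = lam' n \<omega>,
       expl = Y n \<omega>, law = P n \<omega>, init = \<mu> n \<omega>, invar = \<pi> n \<omega>,
       tscale = a n, cscale = c n, blocklen = \<theta> n, mixtime = \<kappa> n\<rparr>)"
  \<comment> \<open>The hypotheses are joined one at a time; at each stage those already joined have
    to pass to a further subsequence, and (v) is joined last.\<close>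
  define A where "A Z \<longleftrightarrow> initial_block_negligible Z \<and> rapidly_mixing Z" for Z :: "nat \<Rightarrow> ('a, 'p) clock_model"
  define B where "B Z \<longleftrightarrow> A Z \<and> tails_converge \<nu> Z" for Z :: "nat \<Rightarrow> ('a, 'p) clock_model"
  define C where "C Z \<longleftrightarrow> B Z \<and> squared_tails_vanish Z" for Z :: "nat \<Rightarrow> ('a, 'p) clock_model"
  define D where "D Z \<longleftrightarrow> C Z \<and> small_blocks_negligible Z" for Z :: "nat \<Rightarrow> ('a, 'p) clock_model"
  have clock: "exploration_clock (X n \<omega>)" if "\<omega> \<in> space M" for n \<omega>
  proof
    show "set_pmf (invar (X n \<omega>)) \<subseteq> verts (X n \<omega>)"
      using invariant[OF that] by (simp add: X_def invariant_distribution_def)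
  qed (use that in \<open>simp_all add: X_def graphs rates exploration_rates exploration_process initial scales\<close>)
  \<comment> \<open>The deterministic result for one realization, along a subsequence of the models,
    which is again a sequence of models of the same kind.\<close>
  have conv: "blocked_clocks_converge N S (\<lambda>n. X (s n) \<omega>)"
    if "\<omega> \<in> space M" "strict_mono s" "D (\<lambda>n. X (s n) \<omega>)" for \<omega> s
  proof (rule blocked_clocks_converge_of_hypotheses[OF clock[OF that(1)] _ levy_measure(1,3) limit_process])
    show "(\<lambda>n. blocklen (X (s n) \<omega>) / tscale (X (s n) \<omega>)) \<longlonglongrightarrow> 0"
      using LIMSEQ_subseq_LIMSEQ[OF scales(5) that(2)] by (simp add: X_def comp_def)
  qed (use that(3) in \<open>simp_all add: A_def B_def C_def D_def\<close>)
  have as: "holds_almost_surely M X (blocked_clocks_converge N S)"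
    if "holds_almost_surely M X initial_block_negligible" "holds_almost_surely M X rapidly_mixing"
      "holds_almost_surely M X (tails_converge \<nu>)" "holds_almost_surely M X squared_tails_vanish"
      "holds_almost_surely M X small_blocks_negligible"
    using that AE_space unfolding holds_almost_surely_def
  proof eventually_elim
    case (elim \<omega>)
    then show ?case using conv[of \<omega> "\<lambda>n. n"] by (simp add: A_def B_def C_def D_def strict_mono_def)
  qed
  have ip: "holds_in_probability M X (blocked_clocks_converge N S)"
    if h: "holds_in_probability M X initial_block_negligible" "holds_in_probability M X rapidly_mixing"
      "holds_in_probability M X (tails_converge \<nu>)" "holds_in_probability M X squared_tails_vanish"
      "holds_in_probability M X small_blocks_negligible"
  proof -
    have "holds_in_probability M X A" unfolding A_def
      by (rule holds_in_probability_conj[OF h(1,2)]) (rule initial_block_negligible_subseq)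
    then have "holds_in_probability M X B" unfolding B_def
      by (rule holds_in_probability_conj[OF _ h(3)])
        (auto simp: A_def intro: initial_block_negligible_subseq rapidly_mixing_subseq)
    then have "holds_in_probability M X C" unfolding C_def
      by (rule holds_in_probability_conj[OF _ h(4)])
        (auto simp: A_def B_def intro: initial_block_negligible_subseq rapidly_mixing_subseq tails_converge_subseq)
    then have "holds_in_probability M X D" unfolding D_def
      by (rule holds_in_probability_conj[OF _ h(5)])
        (auto simp: A_def B_def C_def intro: initial_block_negligible_subseq rapidly_mixing_subseq
          tails_converge_subseq squared_tails_vanish_subseq)
    show ?thesis unfolding holds_in_probability_def
    proof (intro allI impI)
      fix s :: "nat \<Rightarrow> nat" assume s: "strict_mono s"
      obtain r where r: "strict_mono r" "AE \<omega> in M. D (\<lambda>n. X (s (r n)) \<omega>)"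
        using \<open>holds_in_probability M X D\<close> s unfolding holds_in_probability_def by blast
      have "AE \<omega> in M. blocked_clocks_converge N S (\<lambda>n. X (s (r n)) \<omega>)"
        using r(2) AE_space
        by eventually_elim (rule conv[OF _ strict_mono_compose[OF s r(1)]])
      then show "\<exists>r. strict_mono r \<and> (AE \<omega> in M. blocked_clocks_converge N S (\<lambda>n. X (s (r n)) \<omega>))"
        using r(1) by blast
    qed
  qed
  show ?thesis using as ip unfolding Let_def X_def by simp
qed

end
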